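(* Let $G$ be a $PI$-group. Then the set of all nil-elements of $G$ coincides with the locally nilpotent radical $\mathrm{HP}(G)$.
   Context: The words $e_n(x,y)$ in the free group on $x,y$ are defined by $e_1(x,y)=[x,y]$ and $e_n(x,y)=[e_{n-1}(x,y),y]$ for $n\ge 2$, where $[x,y]$ denotes the group commutator (with one fixed standard convention, say $[x,y]=x^{-1}y^{-1}xy$). An element $g$ of a group $G$ is a nil-element if for every $a\in G$ there is $n=n(a,g)\ge 1$ with $e_n(a,g)=1$. A group $G$ is a $PI$-group if there exist a field $P$ and an associative algebra $A$ with $1$ over $P$ satisfying a nontrivial polynomial identity (a $PI$-algebra) such that $G$ is isomorphic to a subgroup of the group of invertible elements of $A$. A group is locally nilpotent if each of its finitely generated subgroups is nilpotent. The locally nilpotent (Hirsch–Plotkin) radical $\mathrm{HP}(G)$ is the largest locally nilpotent normal subgroup of $G$, i.e. the subgroup generated by all locally nilpotent normal subgroups of $G$. *)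

theory Defs
  imports "HOL-Algebra.Algebra"
begin

definition commutator :: "('g, 'm) monoid_scheme \<Rightarrow> 'g \<Rightarrow> 'g \<Rightarrow> 'g" where
  "commutator G x y = inv\<^bsub>G\<^esub> x \<otimes>\<^bsub>G\<^esub> inv\<^bsub>G\<^esub> y \<otimes>\<^bsub>G\<^esub> x \<otimes>\<^bsub>G\<^esub> y"

(* engel G n x y is the value e_n(x,y) in G of the Engel word.  The recursion is started at
   e_0(x,y) = x, so that e_1(x,y) = [x,y]; only indices n \<ge> 1 are used below. *)
primrec engel :: "('g, 'm) monoid_scheme \<Rightarrow> nat \<Rightarrow> 'g \<Rightarrow> 'g \<Rightarrow> 'g" where
  "engel G 0 x y = x"
| "engel G (Suc n) x y = commutator G (engel G n x y) y"

lemma engel_1: "engel G 1 x y = commutator G x y"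
  by simp

lemma engel_rec: "n \<ge> 2 \<Longrightarrow> engel G n x y = commutator G (engel G (n - 1) x y) y"
  by (cases n) auto

definition nil_elements :: "('g, 'm) monoid_scheme \<Rightarrow> 'g set" where
  "nil_elements G =
     {g \<in> carrier G. \<forall>a \<in> carrier G. \<exists>n\<ge>1. engel G n a g = \<one>\<^bsub>G\<^esub>}"

primrec lower_central :: "('g, 'm) monoid_scheme \<Rightarrow> nat \<Rightarrow> 'g set" where
  "lower_central G 0 = carrier G"
| "lower_central G (Suc n) =
     generate G {commutator G x y | x y. x \<in> lower_central G n \<and> y \<in> carrier G}"

definition nilpotent_group :: "('g, 'm) monoid_scheme \<Rightarrow> bool" where
  "nilpotent_group G \<longleftrightarrow> group G \<and> (\<exists>n. lower_central G n = {\<one>\<^bsub>G\<^esub>})"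

definition locally_nilpotent :: "('g, 'm) monoid_scheme \<Rightarrow> bool" where
  "locally_nilpotent G \<longleftrightarrow> group G \<and>
     (\<forall>S. finite S \<and> S \<subseteq> carrier G \<longrightarrow> nilpotent_group (G\<lparr>carrier := generate G S\<rparr>))"

definition HP :: "('g, 'm) monoid_scheme \<Rightarrow> 'g set" where
  "HP G = generate G (\<Union>{N. N \<lhd> G \<and> locally_nilpotent (G\<lparr>carrier := N\<rparr>)})"

(* The library locale algebra requires the multiplication to be commutative,
   so it cannot be used here. *)
locale assoc_algebra = module P A + ring A for P (structure) and A (structure) +
  assumes smult_mult_left:
      "\<lbrakk>c \<in> carrier P; x \<in> carrier A; y \<in> carrier A\<rbrakk> \<Longrightarrow>
        (c \<odot>\<^bsub>A\<^esub> x) \<otimes>\<^bsub>A\<^esub> y = c \<odot>\<^bsub>A\<^esub> (x \<otimes>\<^bsub>A\<^esub> y)"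
    and smult_mult_right:
      "\<lbrakk>c \<in> carrier P; x \<in> carrier A; y \<in> carrier A\<rbrakk> \<Longrightarrow>
        x \<otimes>\<^bsub>A\<^esub> (c \<odot>\<^bsub>A\<^esub> y) = c \<odot>\<^bsub>A\<^esub> (x \<otimes>\<^bsub>A\<^esub> y)"

(* Elements of the free associative algebra with 1 over P on variables x_0, x_1, ...: a
   noncommutative monomial is the list of the indices of its factors, and a polynomial is the
   finitely supported function giving the coefficient of each monomial. *)
definition nc_poly :: "('k, 'm) ring_scheme \<Rightarrow> (nat list \<Rightarrow> 'k) set" where
  "nc_poly P = {f. (\<forall>w. f w \<in> carrier P) \<and> finite {w. f w \<noteq> \<zero>\<^bsub>P\<^esub>}}"

definition nc_monom_eval :: "('a, 'm) monoid_scheme \<Rightarrow> (nat \<Rightarrow> 'a) \<Rightarrow> nat list \<Rightarrow> 'a" where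
  "nc_monom_eval A s w = foldr (\<lambda>i a. s i \<otimes>\<^bsub>A\<^esub> a) w \<one>\<^bsub>A\<^esub>"

definition nc_eval ::
  "('k, 'm) ring_scheme \<Rightarrow> ('k, 'a, 'n) module_scheme \<Rightarrow> (nat \<Rightarrow> 'a) \<Rightarrow> (nat list \<Rightarrow> 'k) \<Rightarrow> 'a" where
  "nc_eval P A s f =
     (\<Oplus>\<^bsub>A\<^esub>w \<in> {w. f w \<noteq> \<zero>\<^bsub>P\<^esub>}. f w \<odot>\<^bsub>A\<^esub> nc_monom_eval A s w)"

definition PI_algebra :: "('k, 'm) ring_scheme \<Rightarrow> ('k, 'a, 'n) module_scheme \<Rightarrow> bool" where
  "PI_algebra P A \<longleftrightarrow> assoc_algebra P A \<and>
     (\<exists>f \<in> nc_poly P. (\<exists>w. f w \<noteq> \<zero>\<^bsub>P\<^esub>) \<and>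
        (\<forall>s. range s \<subseteq> carrier A \<longrightarrow> nc_eval P A s f = \<zero>\<^bsub>A\<^esub>))"

(* HOL cannot quantify over types inside a formula, so the types carrying the field and the
   algebra are parameters.  "G is a PI-group" means that this holds for some choice of 'k and 'a;
   as a hypothesis with 'k and 'a type variables it therefore expresses exactly that. *)
definition PI_group :: "'k itself \<Rightarrow> 'a itself \<Rightarrow> ('g, 'm) monoid_scheme \<Rightarrow> bool" where
  "PI_group TYPE('k) TYPE('a) G \<longleftrightarrow> group G \<and>
     (\<exists>(P :: 'k ring) (A :: ('k, 'a) module) U.
        field P \<and> PI_algebra P A \<and> subgroup U (units_of A) \<and>
        G \<cong> (units_of A)\<lparr>carrier := U\<rparr>)"

end

theory Submission imports Defs begin

text \<open>Suppose first that the group acts faithfully on a finite-dimensional vector space. Word equations in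
  one variable of bounded length are then polynomial equations of bounded degree, so lists of points
  and words forming a triangular vanishing pattern have bounded length. This noetherian property
  replaces the maximal condition in Baer's proof that nil-elements lie in the locally nilpotent
  radical, and it bounds the derived length of locally nilpotent subgroups by a number \<open>k\<close> depending
  only on the dimension.

  In general let \<open>E\<close> be the subgroup generated by the nil-elements. If \<open>a\<close> is a
  non-nilpotent element of the algebra \<open>A\<close>, then \<open>A[X] / A[X](1 - a X)\<close> is nonzero and has a
  simple quotient not annihilated by \<open>a\<close>. By the polynomial identity (as in Kaplansky's theorem)
  it has dimension bounded in terms of the degree over a maximal commutative ring of endomorphisms. So the
  values on \<open>E\<close> of the \<open>k\<close>-th derived word act trivially, that is, they lie in
  \<open>1 + N\<close> for a nil ideal \<open>N\<close>. Nil ideals of PI-algebras are locally nilpotent, hence so is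
  \<open>1 + N\<close>, and Gruenberg's theorem (nil-elements of a group that is soluble modulo a locally
  nilpotent normal subgroup lie in the radical) applies to \<open>E\<close>.\<close>

section \<open>Relative subgroups and the locally nilpotent radical\<close>

text \<open>The Jacobson radical of a PI-algebra need not be nil, so simple modules over
  \<open>A\<close> alone do not detect all non-nilpotent elements. The variable repairs this:
  \<open>a X\<close> fixes the class of 1 in \<open>A[X] / A[X](1 - a X)\<close>, so
  \<open>a\<close> survives in a simple quotient. Multiplication by \<open>X\<close> commutes with
  \<open>A\<close> and is put into the commutative ring \<open>K\<close>, which is why simplicity is
  only asked for \<open>A\<close> and \<open>K\<close> together.

  The second obstacle is uniformity. One level \<open>k\<close> of the derived word must serve all
  simple modules at once, because all its values enter a single ideal. Hence the explicit level
  \<open>(1 + 2 * d^2)^2\<close>, with \<open>d\<close> the degree of the multilinear identity: the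
  variable \<open>y\<close> occurs twice in \<open>[x, y]\<close>, and each occurrence multiplies
  the number of coefficient functions needed by \<open>1 + 2 * d^2\<close>.

  The noetherian property is used for two word lengths: length 2, for centralisers, determines
  \<open>k\<close>; length \<open>4 ^ k\<close>, for the derived word itself, requires only some
  finite bound.\<close>

context group begin

section \<open>Commutator calculus and relative normality\<close>

abbreviation comm :: "'a \<Rightarrow> 'a \<Rightarrow> 'a" where "comm x y \<equiv> commutator G x y"

definition cj :: "'a \<Rightarrow> 'a \<Rightarrow> 'a" where "cj x g = inv g \<otimes> x \<otimes> g"

lemma inv_cancel [simp]:
  "x \<in> carrier G \<Longrightarrow> y \<in> carrier G \<Longrightarrow> inv x \<otimes> (x \<otimes> y) = y"
  "x \<in> carrier G \<Longrightarrow> y \<in> carrier G \<Longrightarrow> x \<otimes> (inv x \<otimes> y) = y"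
  by (simp_all add: m_assoc[symmetric])

lemmas word = m_assoc inv_mult_group cj_def commutator_def

lemma cj_closed [simp]: "x \<in> carrier G \<Longrightarrow> g \<in> carrier G \<Longrightarrow> cj x g \<in> carrier G"
  by (simp add: cj_def)

lemma comm_closed [simp]: "x \<in> carrier G \<Longrightarrow> y \<in> carrier G \<Longrightarrow> comm x y \<in> carrier G"
  by (simp add: commutator_def)

lemma cj_one [simp]: "g \<in> carrier G \<Longrightarrow> cj \<one> g = \<one>"
  "x \<in> carrier G \<Longrightarrow> cj x \<one> = x"
  by (simp_all add: cj_def)

lemma comm_one [simp]: "x \<in> carrier G \<Longrightarrow> comm x \<one> = \<one>"
  "x \<in> carrier G \<Longrightarrow> comm \<one> x = \<one>" "x \<in> carrier G \<Longrightarrow> comm x x = \<one>"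
  by (simp_all add: word)

lemma cj_cj: "\<lbrakk>x \<in> carrier G; g \<in> carrier G; h \<in> carrier G\<rbrakk> \<Longrightarrow> cj (cj x g) h = cj x (g \<otimes> h)"
  by (simp add: word)

lemma cj_inv_cancel [simp]: "\<lbrakk>x \<in> carrier G; g \<in> carrier G\<rbrakk> \<Longrightarrow> cj (cj x g) (inv g) = x"
  "\<lbrakk>x \<in> carrier G; g \<in> carrier G\<rbrakk> \<Longrightarrow> cj (cj x (inv g)) g = x"
  by (simp_all add: word)

lemma cj_mult: "\<lbrakk>x \<in> carrier G; y \<in> carrier G; g \<in> carrier G\<rbrakk> \<Longrightarrow> cj (x \<otimes> y) g = cj x g \<otimes> cj y g"
  by (simp add: word)

lemma cj_inv: "\<lbrakk>x \<in> carrier G; g \<in> carrier G\<rbrakk> \<Longrightarrow> cj (inv x) g = inv (cj x g)"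
  by (simp add: word)

lemma cj_comm: "\<lbrakk>x \<in> carrier G; y \<in> carrier G; g \<in> carrier G\<rbrakk> \<Longrightarrow> cj (comm x y) g = comm (cj x g) (cj y g)"
  by (simp add: word)

lemma cj_eq_comm: "\<lbrakk>x \<in> carrier G; g \<in> carrier G\<rbrakk> \<Longrightarrow> cj x g = x \<otimes> comm x g"
  by (simp add: word)

lemma comm_eq_cj: "\<lbrakk>x \<in> carrier G; g \<in> carrier G\<rbrakk> \<Longrightarrow> comm x g = inv x \<otimes> cj x g"
  by (simp add: word)

lemma comm_swap: "\<lbrakk>x \<in> carrier G; y \<in> carrier G\<rbrakk> \<Longrightarrow> comm x y = inv (comm y x)"
  by (simp add: word)

lemma comm_mult_right: "\<lbrakk>x \<in> carrier G; y \<in> carrier G; z \<in> carrier G\<rbrakk>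
    \<Longrightarrow> comm x (y \<otimes> z) = comm x z \<otimes> cj (comm x y) z"
  by (simp add: word)

lemma comm_inv_right: "\<lbrakk>x \<in> carrier G; y \<in> carrier G\<rbrakk>
    \<Longrightarrow> comm x (inv y) = cj (inv (comm x y)) (inv y)"
  by (simp add: word)

lemma comm_mult_left: "\<lbrakk>x \<in> carrier G; y \<in> carrier G; z \<in> carrier G\<rbrakk>
    \<Longrightarrow> comm (x \<otimes> z) y = cj (comm x y) z \<otimes> comm z y"
  by (simp add: word)

lemma comm_inv_left: "\<lbrakk>x \<in> carrier G; y \<in> carrier G\<rbrakk>
    \<Longrightarrow> comm (inv x) y = cj (inv (comm x y)) (inv x)"
  by (simp add: word)

text \<open>All subgroups stay subsets of one ambient group \<open>G\<close>, and normality of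
  \<open>N\<close> in \<open>B\<close> is a relation between sets. Long chains of subgroups, each
  normal in the next, then need no change of the group record.\<close>

definition normal_in :: "'a set \<Rightarrow> 'a set \<Rightarrow> bool" where
  "normal_in N B \<longleftrightarrow> subgroup N G \<and> subgroup B G \<and> N \<subseteq> B \<and> (\<forall>b\<in>B. \<forall>x\<in>N. cj x b \<in> N)"

lemma normal_inD:
  assumes "normal_in N B"
  shows "subgroup N G" "subgroup B G" "N \<subseteq> B" "\<And>b x. b \<in> B \<Longrightarrow> x \<in> N \<Longrightarrow> cj x b \<in> N"
    "N \<subseteq> carrier G" "B \<subseteq> carrier G"
  using assms subgroup.subset unfolding normal_in_def by auto

lemma normal_inI: "\<lbrakk>subgroup N G; subgroup B G; N \<subseteq> B; \<And>b x. b \<in> B \<Longrightarrow> x \<in> N \<Longrightarrow> cj x b \<in> N\<rbrakk> \<Longrightarrow> normal_in N B"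
  unfolding normal_in_def by auto

lemma sub_closed:
  assumes "subgroup H G" "x \<in> H"
  shows "y \<in> H \<Longrightarrow> x \<otimes> y \<in> H" "inv x \<in> H" "y \<in> H \<Longrightarrow> cj x y \<in> H" "y \<in> H \<Longrightarrow> comm x y \<in> H"
  using assms subgroup.m_closed[OF assms(1)] subgroup.m_inv_closed[OF assms(1)]
  by (auto simp: cj_def commutator_def)

lemma normal_in_self: "subgroup B G \<Longrightarrow> normal_in B B"
  by (auto intro: normal_inI sub_closed)

lemma normal_in_comm:
  assumes "normal_in N B" "x \<in> N" "b \<in> B"
  shows "comm x b \<in> N" "comm b x \<in> N"
proof -
  note n = normal_inD[OF assms(1)]
  have c: "x \<in> carrier G" "b \<in> carrier G" using n assms by auto
  show "comm x b \<in> N" using comm_eq_cj[OF c] n assms sub_closed by metis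
  then show "comm b x \<in> N" using comm_swap[OF c(2,1)] n assms sub_closed by metis
qed

lemma gen_sub: "S \<subseteq> carrier G \<Longrightarrow> subgroup (generate G S) G"
  by (rule generate_is_subgroup)

lemma gen_least: "subgroup H G \<Longrightarrow> S \<subseteq> H \<Longrightarrow> generate G S \<subseteq> H"
  using generate_subgroup_incl by blast

lemma gen_in: "x \<in> S \<Longrightarrow> x \<in> generate G S" by (rule generate.incl)

lemma gen_self: "subgroup H G \<Longrightarrow> generate G H = H"
  using gen_least[of H H] gen_in[of _ H] by auto

lemma gen_carrier: "S \<subseteq> carrier G \<Longrightarrow> generate G S \<subseteq> carrier G"
  by (rule generate_incl)

lemma gen_cj:
  assumes S: "S \<subseteq> carrier G" and b: "b \<in> carrier G" and K: "subgroup K G"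
    and h: "\<And>s. s \<in> S \<Longrightarrow> cj s b \<in> K" and x: "x \<in> generate G S"
  shows "cj x b \<in> K"
  using x
proof induction
  case one then show ?case using b subgroup.one_closed[OF K] by simp
next
  case (incl s) then show ?case by (rule h)
next
  case (inv s) then show ?case using cj_inv[of s b] h[of s] S b sub_closed[OF K] by auto
next
  case (eng x y)
  then have "x \<in> carrier G" "y \<in> carrier G" using gen_carrier[OF S] by auto
  then show ?case using cj_mult[of x y b] eng b sub_closed[OF K] by auto
qed

text \<open>Conjugation by \<open>b\<close> may map an infinite \<open>N\<close> onto a proper part
  of itself, so both \<open>b\<close> and its inverse are required to preserve \<open>N\<close>. In
  \<open>baer\<close> this is also applied to mere sets of nil-elements that are not
  subgroups.\<close>

definition normalizer_in :: "'a set \<Rightarrow> 'a set" where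
  "normalizer_in N = {b \<in> carrier G. \<forall>x\<in>N. cj x b \<in> N \<and> cj x (inv b) \<in> N}"

lemma normalizer_in_subgroup: "N \<subseteq> carrier G \<Longrightarrow> subgroup (normalizer_in N) G"
proof (rule subgroupI)
  fix a b assume N: "N \<subseteq> carrier G" and "a \<in> normalizer_in N" "b \<in> normalizer_in N"
  then show "a \<otimes> b \<in> normalizer_in N" unfolding normalizer_in_def
    by (auto simp: inv_mult_group cj_cj[symmetric] subsetD[OF N])
next
  assume "N \<subseteq> carrier G" then have "\<one> \<in> normalizer_in N" unfolding normalizer_in_def by (auto simp: subset_iff)
  then show "normalizer_in N \<noteq> {}" by blast
qed (auto simp: normalizer_in_def)

lemma normal_in_iff_normalizer_in:
  assumes N: "subgroup N G" and B: "subgroup B G" and NB: "N \<subseteq> B"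
  shows "normal_in N B \<longleftrightarrow> B \<subseteq> normalizer_in N"
proof
  assume n: "normal_in N B"
  show "B \<subseteq> normalizer_in N"
    unfolding normalizer_in_def using normal_inD(4,6)[OF n] sub_closed(2)[OF B] by auto
next
  assume "B \<subseteq> normalizer_in N"
  then show "normal_in N B" unfolding normalizer_in_def using N B NB by (intro normal_inI) auto
qed

lemma normal_in_genI:
  assumes S: "S \<subseteq> carrier G" and T: "T \<subseteq> carrier G" and ST: "generate G S \<subseteq> generate G T"
    and h: "\<And>s t. s \<in> S \<Longrightarrow> t \<in> T \<Longrightarrow> cj s t \<in> generate G S \<and> cj s (inv t) \<in> generate G S"
  shows "normal_in (generate G S) (generate G T)"
proof -
  have "t \<in> normalizer_in (generate G S)" if "t \<in> T" for t
    unfolding normalizer_in_def using that gen_cj[OF S _ gen_sub[OF S]] h T by blast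
  then show ?thesis
    using normal_in_iff_normalizer_in[OF gen_sub[OF S] gen_sub[OF T] ST] gen_least[OF normalizer_in_subgroup[OF gen_carrier[OF S]]]
    by blast
qed

lemma normal_in_gen_invariant:
  assumes B: "subgroup B G" and S: "S \<subseteq> B" and h: "\<And>s b. s \<in> S \<Longrightarrow> b \<in> B \<Longrightarrow> cj s b \<in> generate G S"
  shows "normal_in (generate G S) B"
proof -
  have SG: "S \<subseteq> carrier G" using S subgroup.subset[OF B] by blast
  show ?thesis
    using gen_cj[OF SG _ gen_sub[OF SG]] h subgroup.subset[OF B] B S
    by (intro normal_inI gen_sub[OF SG] gen_least) auto
qed

text \<open>The set is the preimage in \<open>B\<close> of the centraliser of the coset of
  \<open>x\<close> in \<open>B / N\<close>.\<close>

lemma centmod_subgroup: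
  assumes N: "normal_in N B" and x: "x \<in> B"
  shows "subgroup {y \<in> B. comm x y \<in> N} G"
proof (rule subgroupI)
  note n = normal_inD[OF N]
  have xc: "x \<in> carrier G" using x n by auto
  show "{y \<in> B. comm x y \<in> N} \<subseteq> carrier G" using n by auto
  show "{y \<in> B. comm x y \<in> N} \<noteq> {}"
    using subgroup.one_closed[OF n(1)] subgroup.one_closed[OF n(2)] xc by force
  fix a assume a: "a \<in> {y \<in> B. comm x y \<in> N}"
  then have ac: "a \<in> carrier G" using n by auto
  show "inv a \<in> {y \<in> B. comm x y \<in> N}"
    using a comm_inv_right[OF xc ac] n sub_closed[OF n(1)] sub_closed[OF n(2)] by auto
  fix b assume b: "b \<in> {y \<in> B. comm x y \<in> N}"
  then have bc: "b \<in> carrier G" using n by auto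
  show "a \<otimes> b \<in> {y \<in> B. comm x y \<in> N}"
    using a b comm_mult_right[OF xc ac bc] n sub_closed[OF n(1)] sub_closed[OF n(2)] by auto
qed

lemma centmod_subgroup':
  assumes N: "normal_in N B" and x: "x \<in> B"
  shows "subgroup {y \<in> B. comm y x \<in> N} G"
proof -
  note n = normal_inD[OF N]
  have "comm y x \<in> N \<longleftrightarrow> comm x y \<in> N" if "y \<in> B" for y
    using comm_swap[of x y] comm_swap[of y x] n that x sub_closed[OF n(1)] by (metis subsetD)
  then have "{y \<in> B. comm y x \<in> N} = {y \<in> B. comm x y \<in> N}" by blast
  then show ?thesis using centmod_subgroup[OF assms] by simp
qed

text \<open>Two passes through centralisers modulo \<open>N\<close>, one for each argument, carry
  the condition from the generators to the generated subgroups.\<close>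

lemma comm_gen:
  assumes N: "normal_in N B" and S: "S \<subseteq> B" and T: "T \<subseteq> B"
    and h: "\<And>s t. s \<in> S \<Longrightarrow> t \<in> T \<Longrightarrow> comm s t \<in> N"
    and x: "x \<in> generate G S" and y: "y \<in> generate G T"
  shows "comm x y \<in> N"
proof -
  have 1: "comm s y \<in> N" if "s \<in> S" for s
  proof -
    have "generate G T \<subseteq> {y \<in> B. comm s y \<in> N}"
      using gen_least[OF centmod_subgroup[OF N]] that S T h by blast
    then show ?thesis using y by blast
  qed
  have yB: "y \<in> B" using gen_least[OF normal_inD(2)[OF N] T] y by blast
  have "generate G S \<subseteq> {x \<in> B. comm x y \<in> N}"
    using gen_least[OF centmod_subgroup'[OF N yB]] S 1 by blast
  then show ?thesis using x by blast
qed

section \<open>Lower central series and left-normed commutators\<close>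

primrec lcs :: "'a set \<Rightarrow> nat \<Rightarrow> 'a set" where
  "lcs B 0 = B"
| "lcs B (Suc n) = generate G {comm x y | x y. x \<in> lcs B n \<and> y \<in> B}"

text \<open>Lower central terms are characteristic in \<open>Y\<close>: conjugation by an element of
  \<open>B\<close> maps generating commutators to generating commutators. So they inherit normality
  in \<open>B\<close> from \<open>Y\<close>.\<close>

lemma normal_in_lcs_gen:
  assumes "normal_in Y B"
  shows "normal_in (lcs Y n) B \<and> lcs Y n \<subseteq> Y"
proof (induction n)
  case 0 then show ?case using assms by auto
next
  case (Suc n)
  note b = normal_inD[OF assms]
  note i = normal_inD[OF Suc[THEN conjunct1]]
  let ?S = "{comm x y | x y. x \<in> lcs Y n \<and> y \<in> Y}"
  have S: "?S \<subseteq> lcs Y n"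
    using normal_in_comm(1)[OF Suc[THEN conjunct1]] b(3) by auto
  then have SB: "?S \<subseteq> B" "?S \<subseteq> Y" using i(3) Suc[THEN conjunct2] by (meson subset_trans)+
  have "normal_in (generate G ?S) B"
  proof (rule normal_in_gen_invariant[OF b(2) SB(1)])
    fix s c assume "s \<in> ?S" and c: "c \<in> B"
    then obtain x y where s: "s = comm x y" "x \<in> lcs Y n" "y \<in> Y" by blast
    have "x \<in> carrier G" "y \<in> carrier G" "c \<in> carrier G" using s c i(5) b(5,6) by auto
    then have "cj s c = comm (cj x c) (cj y c)" unfolding s(1) by (rule cj_comm)
    moreover have "cj x c \<in> lcs Y n" "cj y c \<in> Y" using i(4)[OF c s(2)] b(4)[OF c s(3)] by auto
    ultimately show "cj s c \<in> generate G ?S" by (intro gen_in) auto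
  qed
  then show ?case using gen_least[OF b(1) SB(2)] by simp
qed

lemma normal_in_lcs: "subgroup B G \<Longrightarrow> normal_in (lcs B n) B"
  using normal_in_lcs_gen[OF normal_in_self] by blast

lemma comm_lcs: "x \<in> lcs B n \<Longrightarrow> y \<in> B \<Longrightarrow> comm x y \<in> lcs B (Suc n)"
  unfolding lcs.simps by (rule gen_in) blast

lemma lcs_Suc_subset: "subgroup B G \<Longrightarrow> lcs B (Suc n) \<subseteq> lcs B n"
  unfolding lcs.simps using normal_in_comm(1)[OF normal_in_lcs] by (intro gen_least normal_inD(1)[OF normal_in_lcs]) auto

lemma lcs_mono: "C \<subseteq> B \<Longrightarrow> lcs C n \<subseteq> lcs B n"
proof (induction n)
  case (Suc n) then show ?case unfolding lcs.simps by (intro mono_generate) blast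
qed auto

text \<open>All entries come from \<open>S\<close> itself, without inverses, so a finite
  \<open>S\<close> gives finitely many commutators of each length. This finiteness later allows one
  Engel exponent for all of them.\<close>

primrec lnc :: "'a set \<Rightarrow> nat \<Rightarrow> 'a set" where
  "lnc S 0 = S"
| "lnc S (Suc n) = {comm x s | x s. x \<in> lnc S n \<and> s \<in> S}"

lemma lnc_finite: "finite S \<Longrightarrow> finite (lnc S n)"
proof (induction n)
  case (Suc n)
  have "lnc S (Suc n) = (\<lambda>(x,s). comm x s) ` (lnc S n \<times> S)" by auto
  then show ?case using Suc by simp
qed simp

lemma lnc_subset: "S \<subseteq> B \<Longrightarrow> lnc S n \<subseteq> lcs B n"
proof (induction n)
  case (Suc n) then show ?case using comm_lcs[of _ B n] by auto
qed auto

text \<open>Nilpotency modulo \<open>N\<close> can be tested on the generators. The induction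
  replaces \<open>N\<close> by the preimage \<open>?Z\<close> of the centre of the quotient by
  \<open>N\<close>: if \<open>lnc S (Suc n)\<close> lies in \<open>N\<close>, then
  \<open>lnc S n\<close> is central modulo \<open>N\<close>, because commuting modulo
  \<open>N\<close> with the generators suffices.\<close>

lemma lcs_gen_subset:
  assumes S: "S \<subseteq> carrier G"
  shows "normal_in N (generate G S) \<Longrightarrow> lnc S n \<subseteq> N \<Longrightarrow> lcs (generate G S) n \<subseteq> N"
proof (induction n arbitrary: N)
  case 0
  then show ?case using gen_least normal_inD(1) by simp
next
  case (Suc n)
  let ?B = "generate G S"
  let ?Z = "{x \<in> ?B. \<forall>y\<in>?B. comm x y \<in> N}"
  note b = normal_inD[OF Suc.prems(1)]
  have Zs: "subgroup ?Z G"
  proof -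
    have "?Z = \<Inter> (insert ?B ((\<lambda>y. {x \<in> ?B. comm x y \<in> N}) ` ?B))" by auto
    also have "subgroup \<dots> G"
      by (rule subgroups_Inter) (use centmod_subgroup'[OF Suc.prems(1)] b in auto)
    finally show ?thesis .
  qed
  have "normal_in ?Z ?B"
  proof (rule normal_inI[OF Zs b(2)], blast)
    fix c x assume c: "c \<in> ?B" and x: "x \<in> ?Z"
    have cc: "c \<in> carrier G" "x \<in> carrier G" using c x b by auto
    have "comm (cj x c) y \<in> N" if y: "y \<in> ?B" for y
    proof -
      have yc: "y \<in> carrier G" using y b by auto
      have "comm (cj x c) y = cj (comm x (cj y (inv c))) c" using cj_comm cc yc by simp
      moreover have "cj y (inv c) \<in> ?B" using y c sub_closed[OF b(2)] by blast
      ultimately show ?thesis using x c b by auto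
    qed
    then show "cj x c \<in> ?Z" using x c sub_closed[OF b(2)] by auto
  qed
  moreover have "lnc S n \<subseteq> ?Z"
  proof
    fix x assume x: "x \<in> lnc S n"
    have xB: "x \<in> ?B" using lnc_subset[of S ?B n] x normal_inD(3)[OF normal_in_lcs[OF b(2)], of n] gen_in by blast
    have "?B \<subseteq> {y \<in> ?B. comm x y \<in> N}"
    proof (rule gen_least[OF centmod_subgroup[OF Suc.prems(1) xB]])
      show "S \<subseteq> {y \<in> ?B. comm x y \<in> N}" using x Suc.prems(2) gen_in by auto
    qed
    then show "x \<in> ?Z" using xB by blast
  qed
  ultimately have "lcs ?B n \<subseteq> ?Z" by (rule Suc.IH)
  then show ?case unfolding lcs.simps using b(1) by (intro gen_least) auto
qed

section \<open>Nilpotent and locally nilpotent subgroups of the ambient group\<close>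

definition nilp :: "'a set \<Rightarrow> bool" where
  "nilp B \<longleftrightarrow> subgroup B G \<and> (\<exists>n. lcs B n = {\<one>})"

definition lnilp :: "'a set \<Rightarrow> bool" where
  "lnilp B \<longleftrightarrow> subgroup B G \<and> (\<forall>S. finite S \<and> S \<subseteq> B \<longrightarrow> nilp (generate G S))"

lemma nilpI: "subgroup B G \<Longrightarrow> lcs B n \<subseteq> {\<one>} \<Longrightarrow> nilp B"
  unfolding nilp_def using normal_inD(1)[OF normal_in_lcs] subgroup.one_closed by blast

lemma nilp_mono: "nilp B \<Longrightarrow> C \<subseteq> B \<Longrightarrow> subgroup C G \<Longrightarrow> nilp C"
  using lcs_mono nilpI unfolding nilp_def by metis

lemma lnilp_mono: "lnilp B \<Longrightarrow> C \<subseteq> B \<Longrightarrow> subgroup C G \<Longrightarrow> lnilp C"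
  unfolding lnilp_def by blast

lemma lnilp_sub: "lnilp B \<Longrightarrow> subgroup B G" "lnilp B \<Longrightarrow> B \<subseteq> carrier G"
  unfolding lnilp_def using subgroup.subset by auto

lemma commutator_consistent:
  assumes H: "subgroup H G" and "x \<in> H" "y \<in> H"
  shows "commutator (G\<lparr>carrier := H\<rparr>) x y = comm x y"
  using m_inv_consistent[OF H] assms(2,3) by (simp add: commutator_def)

lemma lower_central_eq_lcs:
  assumes H: "subgroup H G"
  shows "lower_central (G\<lparr>carrier := H\<rparr>) n = lcs H n"
proof (induction n)
  case (Suc n)
  have L: "lcs H n \<subseteq> H" using normal_inD(3)[OF normal_in_lcs[OF H]] .
  let ?c = "\<lambda>f. {f x y | x y. x \<in> lcs H n \<and> y \<in> H}"
  have im: "?c f = case_prod f ` (lcs H n \<times> H)" for f :: "'a \<Rightarrow> 'a \<Rightarrow> 'a"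
    by (simp add: set_eq_iff image_iff Bex_def) (metis)
  have "?c (commutator (G\<lparr>carrier := H\<rparr>)) = ?c comm"
    unfolding im by (rule image_cong) (use L commutator_consistent[OF H] in auto)
  moreover have "?c comm \<subseteq> H" using sub_closed(4)[OF H] L by auto
  ultimately show ?case using Suc generate_consistent[OF _ H] by simp
qed simp

lemma nilpotent_group_iff: "subgroup H G \<Longrightarrow> nilpotent_group (G\<lparr>carrier := H\<rparr>) \<longleftrightarrow> nilp H"
  unfolding nilpotent_group_def nilp_def
  using lower_central_eq_lcs subgroup.subgroup_is_group[OF _ is_group] by simp

lemma locally_nilpotent_iff:
  assumes H: "subgroup H G"
  shows "locally_nilpotent (G\<lparr>carrier := H\<rparr>) \<longleftrightarrow> lnilp H"
proof -
  have "nilpotent_group ((G\<lparr>carrier := H\<rparr>)\<lparr>carrier := generate (G\<lparr>carrier := H\<rparr>) S\<rparr>) \<longleftrightarrow> nilp (generate G S)"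
    if "S \<subseteq> H" for S
    using that generate_consistent[OF that H] nilpotent_group_iff[OF gen_sub] subgroup.subset[OF H]
    by auto
  then show ?thesis
    unfolding locally_nilpotent_def lnilp_def
    using subgroup.subgroup_is_group[OF H is_group] H by auto
qed

lemma gen_finite_support: "x \<in> generate G T \<Longrightarrow> \<exists>F. finite F \<and> F \<subseteq> T \<and> x \<in> generate G F"
proof (induction rule: generate.induct)
  case one then show ?case by (intro exI[of _ "{}"]) (auto intro: generate.one)
next
  case (incl h) then show ?case by (intro exI[of _ "{h}"]) (auto intro: generate.incl)
next
  case (inv h) then show ?case by (intro exI[of _ "{h}"]) (auto intro: generate.inv)
next
  case (eng a b)
  then obtain F F' where F: "finite F" "F \<subseteq> T" "a \<in> generate G F" "finite F'" "F' \<subseteq> T" "b \<in> generate G F'"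
    by blast
  have "a \<in> generate G (F \<union> F')" "b \<in> generate G (F \<union> F')"
    using F(3,6) mono_generate[of F "F \<union> F'"] mono_generate[of F' "F \<union> F'"] by auto
  then have "a \<otimes> b \<in> generate G (F \<union> F')" by (rule generate.eng)
  then show ?case using F by (intro exI[of _ "F \<union> F'"]) auto
qed

lemma gen_finite_support_set:
  assumes "finite S" "S \<subseteq> generate G T"
  shows "\<exists>F. finite F \<and> F \<subseteq> T \<and> S \<subseteq> generate G F"
proof -
  have "\<forall>x\<in>S. \<exists>F. finite F \<and> F \<subseteq> T \<and> x \<in> generate G F"
    using gen_finite_support assms(2) by auto
  then obtain f where f: "\<And>x. x \<in> S \<Longrightarrow> finite (f x) \<and> f x \<subseteq> T \<and> x \<in> generate G (f x)" by metis
  have "x \<in> generate G (\<Union>(f ` S))" if "x \<in> S" for x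
    using f[OF that] mono_generate[of "f x" "\<Union>(f ` S)"] that by auto
  then show ?thesis using f assms(1) by (intro exI[of _ "\<Union>(f ` S)"]) auto
qed

section \<open>Engel elements and their adjunction to locally nilpotent subgroups\<close>

lemma engel_closed [simp]: "x \<in> carrier G \<Longrightarrow> g \<in> carrier G \<Longrightarrow> engel G n x g \<in> carrier G"
  by (induction n) auto

lemma engel_mono: "g \<in> carrier G \<Longrightarrow> engel G m x g = \<one> \<Longrightarrow> m \<le> n \<Longrightarrow> engel G n x g = \<one>"
  by (induction n) (auto simp: le_Suc_eq)

lemma engel_shift: "engel G (Suc n) x g = engel G n (comm x g) g"
  by (induction n) auto

lemma engel_in_lcs: "x \<in> B \<Longrightarrow> g \<in> B \<Longrightarrow> engel G n x g \<in> lcs B n"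
  by (induction n) (auto intro!: comm_lcs simp del: lcs.simps(2))

lemma engel_in: "normal_in N B \<Longrightarrow> x \<in> N \<Longrightarrow> g \<in> B \<Longrightarrow> engel G n x g \<in> N"
  by (induction n) (auto intro: normal_in_comm)

definition nil_in :: "'a set \<Rightarrow> 'a set" where
  "nil_in B = {g \<in> B. \<forall>a\<in>B. \<exists>n. engel G n a g = \<one>}"

lemma nil_in_mono: "C \<subseteq> B \<Longrightarrow> nil_in B \<inter> C \<subseteq> nil_in C"
  unfolding nil_in_def by auto

lemma nil_in_sub: "nil_in B \<subseteq> B" unfolding nil_in_def by auto

lemma engel_cj: "\<lbrakk>x \<in> carrier G; g \<in> carrier G; h \<in> carrier G\<rbrakk> \<Longrightarrow> cj (engel G n x g) h = engel G n (cj x h) (cj g h)"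
  by (induction n) (auto simp: cj_comm)

lemma nil_in_cj:
  assumes B: "subgroup B G" and g: "g \<in> nil_in B" and h: "h \<in> B"
  shows "cj g h \<in> nil_in B"
proof -
  have c: "B \<subseteq> carrier G" using subgroup.subset[OF B] .
  have gB: "g \<in> B" using g nil_in_def by auto
  have "\<exists>n. engel G n a (cj g h) = \<one>" if a: "a \<in> B" for a
  proof -
    have "cj a (inv h) \<in> B" using a h sub_closed[OF B] by blast
    then obtain n where "engel G n (cj a (inv h)) g = \<one>" using g nil_in_def by auto
    then have "engel G n a (cj g h) = \<one>"
      using engel_cj[of "cj a (inv h)" g h n] a h gB c by (auto simp: subset_iff)
    then show ?thesis ..
  qed
  then show ?thesis unfolding nil_in_def using gB h sub_closed(3)[OF B] by auto
qed

text \<open>The element \<open>a\<close> need not lie in \<open>M\<close>, but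
  \<open>comm a g\<close> does, and from there on the Engel word lives in the nilpotent subgroup
  generated by \<open>comm a g\<close> and \<open>g\<close>.\<close>

lemma nil_in_of_lnilp:
  assumes M: "normal_in M B" "lnilp M" and g: "g \<in> M"
  shows "g \<in> nil_in B"
proof -
  note m = normal_inD[OF M(1)]
  have "\<exists>n. engel G n a g = \<one>" if a: "a \<in> B" for a
  proof -
    have c: "comm a g \<in> M" using normal_in_comm(2)[OF M(1) g a] .
    let ?C = "generate G {comm a g, g}"
    have "nilp ?C" using M(2) c g unfolding lnilp_def by simp
    then obtain n where n: "lcs ?C n = {\<one>}" unfolding nilp_def by auto
    have "engel G n (comm a g) g \<in> lcs ?C n" by (intro engel_in_lcs gen_in) auto
    then have "engel G (Suc n) a g = \<one>" unfolding engel_shift n by simp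
    then show ?thesis ..
  qed
  then show ?thesis unfolding nil_in_def using g m(3) by auto
qed

text \<open>Conjugation by \<open>inv u\<close> is expressed through the next Engel commutator
  \<open>comm b u\<close>. Run downwards from a trivial Engel commutator, the identity keeps
  conjugates by \<open>inv u\<close> inside the subgroup generated by finitely many Engel
  commutators.\<close>

lemma cj_inv_recursion:
  "\<lbrakk>b \<in> carrier G; u \<in> carrier G\<rbrakk> \<Longrightarrow> cj b (inv u) = b \<otimes> inv (cj (comm b u) (inv u))"
  by (simp add: word)

text \<open>Modulo \<open>lcs Y (i + 1)\<close> a left-normed commutator of length \<open>e + n\<close> survives only if its last
  \<open>n\<close> entries are all \<open>u\<close>, and then the Engel condition kills it.\<close>

lemma nilp_adjoin_engel:
  assumes A: "finite A" "Y = generate G A" "A \<subseteq> carrier G" and Y: "nilp Y" and u: "u \<in> carrier G"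
    and norm: "\<And>a. a \<in> A \<Longrightarrow> cj a u \<in> Y" "\<And>a. a \<in> A \<Longrightarrow> cj a (inv u) \<in> Y"
    and eng: "\<And>y. y \<in> Y \<Longrightarrow> \<exists>n. engel G n y u = \<one>"
  shows "nilp (generate G (insert u A))"
proof -
  let ?S = "insert u A"
  let ?B = "generate G ?S"
  have SG: "?S \<subseteq> carrier G" using A u by auto
  have B: "subgroup ?B G" by (rule gen_sub[OF SG])
  have Ys: "subgroup Y G" using gen_sub A by simp
  have YB: "normal_in Y ?B"
    unfolding A(2)
  proof (rule normal_in_genI[OF A(3) SG mono_generate])
    fix s t assume s: "s \<in> A" and t: "t \<in> insert u A"
    show "cj s t \<in> generate G A \<and> cj s (inv t) \<in> generate G A"
    proof (cases "t = u")
      case True then show ?thesis using norm[OF s] A by simp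
    next
      case False
      then have "t \<in> Y" "s \<in> Y" using s t A gen_in by auto
      then show ?thesis using sub_closed[OF Ys] A by simp
    qed
  qed auto
  have nl: "normal_in (lcs Y i) ?B" for i using normal_in_lcs_gen[OF YB] by blast
  \<comment> \<open>Induction along the lower central series of \<open>Y\<close>, one term at a
    time; since \<open>Y\<close> is nilpotent, some term is trivial.\<close>
  have "\<exists>e. lcs ?B e \<subseteq> lcs Y i" for i
  proof (induction i)
    case 0
    have "lnc ?S 1 \<subseteq> Y"
    proof -
      have "comm s t \<in> Y" if "s \<in> ?S" "t \<in> ?S" for s t
      proof (cases "s = u \<and> t = u")
        case True then show ?thesis using u subgroup.one_closed[OF Ys] by simp
      next
        case False
        then have "s \<in> Y \<or> t \<in> Y" using that A gen_in by auto
        then show ?thesis using normal_in_comm[OF YB] that gen_in by blast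
      qed
      then show ?thesis by auto
    qed
    then have "lcs ?B 1 \<subseteq> Y" using lcs_gen_subset[OF SG YB] by blast
    then show ?case by (metis lcs.simps(1))
  next
    case (Suc i)
    then obtain e where e: "lcs ?B e \<subseteq> lcs Y i" by blast
    have Ze: "lnc ?S e \<subseteq> lcs Y i" using lnc_subset[of ?S ?B e] e gen_in by blast
    have ZY: "lnc ?S e \<subseteq> Y" using Ze normal_inD(3)[OF normal_in_lcs[OF Ys]] by blast
    have ZG: "lnc ?S e \<subseteq> carrier G" using ZY subgroup.subset[OF Ys] by blast
    obtain f where f: "\<And>z. z \<in> lnc ?S e \<Longrightarrow> engel G (f z) z u = \<one>" using eng ZY by (metis subsetD)
    \<comment> \<open>One exponent for all left-normed commutators of stage \<open>e\<close>: there
      are finitely many of them because \<open>A\<close> is finite.\<close>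
    obtain n where n: "\<And>z. z \<in> lnc ?S e \<Longrightarrow> f z \<le> n"
      using finite_nat_set_iff_bounded_le[of "f ` lnc ?S e"] lnc_finite[of ?S e] A(1) by auto
    have "lnc ?S (e + j) \<subseteq> lcs Y (Suc i) \<union> {engel G j z u | z. z \<in> lnc ?S e}" for j
    proof (induction j)
      case 0 then show ?case by auto
    next
      case (Suc j)
      have "comm x s \<in> lcs Y (Suc i) \<union> {engel G (Suc j) z u | z. z \<in> lnc ?S e}"
        if x: "x \<in> lnc ?S (e + j)" and s: "s \<in> ?S" for x s
      proof (cases "x \<in> lcs Y (Suc i)")
        case True
        then show ?thesis using normal_in_comm(1)[OF nl _ gen_in[OF s]] by blast
      next
        case False
        then obtain z where z: "x = engel G j z u" "z \<in> lnc ?S e" using Suc x by blast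
        show ?thesis
        proof (cases "s = u")
          case True then show ?thesis using z by auto
        next
          case False
          then have "s \<in> Y" using s A gen_in by auto
          moreover have "x \<in> lcs Y i" unfolding z(1) using z(2) Ze gen_in by (intro engel_in[OF nl]) auto
          ultimately show ?thesis using comm_lcs by blast
        qed
      qed
      then show ?case by auto
    qed
    moreover have "engel G n z u = \<one>" if "z \<in> lnc ?S e" for z
      using engel_mono[OF u f[OF that] n[OF that]] .
    ultimately have "lnc ?S (e + n) \<subseteq> lcs Y (Suc i)"
      using subgroup.one_closed[OF normal_inD(1)[OF nl[of "Suc i"]]] by fastforce
    then show ?case using lcs_gen_subset[OF SG nl[of "Suc i"]] by blast
  qed
  moreover obtain c where "lcs Y c = {\<one>}" using Y unfolding nilp_def by blast
  ultimately obtain e where "lcs ?B e \<subseteq> {\<one>}" by metis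
  then show ?thesis by (rule nilpI[OF B])
qed

text \<open>A finite part of \<open>H\<close> need not generate a subgroup normalised by
  \<open>u\<close>. Adding the Engel commutators of its elements with \<open>u\<close>, up to an
  exponent where all are trivial, gives a finite subset of \<open>H\<close>. The subgroup
  \<open>?Y\<close> generated by it is nilpotent and stable under \<open>u\<close> and
  \<open>inv u\<close>, and \<open>nilp_adjoin_engel\<close> applies.\<close>

lemma lnilp_adjoin_engel:
  assumes H: "lnilp H" and u: "u \<in> normalizer_in H" and eng: "\<And>a. a \<in> H \<Longrightarrow> \<exists>n. engel G n a u = \<one>"
  shows "lnilp (generate G (insert u H))"
proof -
  have Hs: "subgroup H G" and HG: "H \<subseteq> carrier G" using lnilp_sub[OF H] by auto
  have uG: "u \<in> carrier G" using u normalizer_in_def by auto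
  have uH: "comm a u \<in> H" if "a \<in> H" for a
    using u that comm_eq_cj[of a u] HG uG sub_closed[OF Hs] unfolding normalizer_in_def by auto
  have engH: "engel G i a u \<in> H" if "a \<in> H" for i a
    using that by (induction i) (auto intro: uH)
  have IG: "insert u H \<subseteq> carrier G" using uG HG by auto
  show ?thesis
    unfolding lnilp_def
  proof (intro conjI allI impI gen_sub[OF IG])
    fix S assume "finite S \<and> S \<subseteq> generate G (insert u H)"
    then obtain F where F: "finite F" "F \<subseteq> insert u H" "S \<subseteq> generate G F"
      using gen_finite_support_set by meson
    let ?A = "F - {u}"
    have AH: "?A \<subseteq> H" using F by auto
    obtain f where f: "\<And>a. a \<in> H \<Longrightarrow> engel G (f a) a u = \<one>" using eng by metis
    obtain n where n: "\<And>a. a \<in> ?A \<Longrightarrow> f a \<le> n"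
      using finite_nat_set_iff_bounded_le[of "f ` ?A"] F(1) by auto
    have vanish: "engel G (Suc n) a u = \<one>" if "a \<in> ?A" for a
      using engel_mono[OF uG f, of a "Suc n"] n[OF that] that AH by (auto simp: subset_iff)
    let ?A' = "(\<lambda>(a,i). engel G i a u) ` (?A \<times> {..Suc n})"
    have A'H: "?A' \<subseteq> H" using engH AH by auto
    have fin: "finite ?A'" using F(1) by auto
    let ?Y = "generate G ?A'"
    have A'G: "?A' \<subseteq> carrier G" using A'H HG by blast
    have Ys: "subgroup ?Y G" using gen_sub A'G by blast
    have YH: "?Y \<subseteq> H" using gen_least[OF Hs A'H] .
    have inY: "engel G i a u \<in> ?Y" if "a \<in> ?A" "i \<le> Suc n" for a i
      using that by (intro gen_in) force
    have 1: "cj s u \<in> ?Y" if "s \<in> ?A'" for s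
    proof -
      obtain a i where a: "a \<in> ?A" "i \<le> Suc n" "s = engel G i a u" using \<open>s \<in> ?A'\<close> by auto
      have "comm s u \<in> ?Y"
      proof (cases "i = Suc n")
        case True
        then show ?thesis using a(3) vanish[OF a(1)] uG subgroup.one_closed[OF Ys] by simp
      next
        case False
        then show ?thesis using inY[of a "Suc i"] a by simp
      qed
      moreover have "s \<in> ?Y" using inY a by simp
      moreover have "cj s u = s \<otimes> comm s u" using that A'G uG by (intro cj_eq_comm) auto
      ultimately show ?thesis using sub_closed(1)[OF Ys] by simp
    qed
    \<comment> \<open>Downward induction on \<open>i\<close>: at \<open>Suc n\<close> the Engel
      commutator is trivial, and \<open>cj_inv_recursion\<close> leads from \<open>Suc i\<close> to
      \<open>i\<close>.\<close>
    have 2: "cj (engel G i a u) (inv u) \<in> ?Y" if a: "a \<in> ?A" and i: "i \<le> Suc n" for a i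
      using i
    proof (induction i rule: inc_induct)
      case base
      show ?case using vanish[OF a] uG subgroup.one_closed[OF Ys] by simp
    next
      case (step i)
      have aG: "a \<in> carrier G" using a AH HG by auto
      have "cj (engel G i a u) (inv u) = engel G i a u \<otimes> inv (cj (engel G (Suc i) a u) (inv u))"
        using cj_inv_recursion[OF engel_closed[OF aG uG] uG] by simp
      then show ?case using step inY[OF a, of i] sub_closed(1,2)[OF Ys] by simp
    qed
    have "nilp ?Y" using H fin A'H unfolding lnilp_def by blast
    then have N: "nilp (generate G (insert u ?A'))"
    proof (rule nilp_adjoin_engel[OF fin refl A'G _ uG 1])
      fix s assume "s \<in> ?A'"
      then obtain a i where a: "a \<in> ?A" "i \<le> Suc n" "s = engel G i a u" by auto
      show "cj s (inv u) \<in> ?Y" unfolding a(3) by (rule 2[OF a(1,2)])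
    qed (use eng YH in auto)
    have "F \<subseteq> insert u ?A'"
    proof
      fix x assume "x \<in> F"
      show "x \<in> insert u ?A'"
      proof (cases "x = u")
        case False
        then have "(x, 0) \<in> ?A \<times> {..Suc n}" using \<open>x \<in> F\<close> by auto
        then have "(case (x, 0::nat) of (a, i) \<Rightarrow> engel G i a u) \<in> ?A'" by (rule imageI)
        then show ?thesis by simp
      qed simp
    qed
    then have "S \<subseteq> generate G (insert u ?A')" using F(3) mono_generate by blast
    moreover have "subgroup (generate G (insert u ?A')) G" using uG A'G by (intro gen_sub) auto
    ultimately have "generate G S \<subseteq> generate G (insert u ?A')" by (intro gen_least)
    moreover have "S \<subseteq> carrier G" using F(3) gen_carrier[of F] F(2) IG by blast
    ultimately show "nilp (generate G S)" using nilp_mono[OF N] gen_sub by blast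
  qed
qed

lemma normal_in_of_comm:
  assumes K: "subgroup K G" and T: "subgroup T G" and KT: "K \<subseteq> T" and h: "\<And>x y. x \<in> T \<Longrightarrow> y \<in> T \<Longrightarrow> comm x y \<in> K"
  shows "normal_in K T"
proof (rule normal_inI[OF K T KT])
  fix b x assume "b \<in> T" "x \<in> K"
  moreover have "x \<in> carrier G" "b \<in> carrier G" using calculation KT subgroup.subset[OF T] by auto
  ultimately show "cj x b \<in> K" using cj_eq_comm[of x b] h[of x b] KT sub_closed(1)[OF K] by auto
qed

text \<open>A finite set of elements of \<open>T\<close> involves only finitely many elements of
  \<open>E\<close>, which are adjoined to \<open>H\<close> one by one. Each intermediate subgroup
  contains all commutators of \<open>T\<close>, so it is normal in \<open>T\<close> and the next
  element normalises it.\<close>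

lemma lnilp_abelian_extension:
  assumes H: "lnilp H" and T: "T = generate G (H \<union> E)" and E: "E \<subseteq> nil_in T" "E \<subseteq> carrier G"
    and c: "\<And>x y. x \<in> T \<Longrightarrow> y \<in> T \<Longrightarrow> comm x y \<in> H"
  shows "lnilp T"
proof -
  have HG: "H \<subseteq> carrier G" and Hs: "subgroup H G" using lnilp_sub[OF H] by auto
  have UG: "H \<union> E \<subseteq> carrier G" using HG E by auto
  have Ts: "subgroup T G" using T gen_sub[OF UG] by simp
  have HT: "H \<subseteq> T" unfolding T using gen_in[of _ "H \<union> E"] by auto
  have ET: "E \<subseteq> T" using E(1) nil_in_sub by blast
  have fin: "lnilp (generate G (H \<union> E0))" if "finite E0" "E0 \<subseteq> E" for E0
    using that
  proof (induction E0)
    case empty then show ?case using H gen_self[OF Hs] by simp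
  next
    case (insert u E0)
    let ?K = "generate G (H \<union> E0)"
    have lK: "lnilp ?K" using insert by auto
    have Ks: "subgroup ?K G" by (rule lnilp_sub[OF lK])
    have KT: "?K \<subseteq> T" using HT ET insert.prems by (intro gen_least[OF Ts]) auto
    have HK: "H \<subseteq> ?K" using gen_in[of _ "H \<union> E0"] by auto
    have "normal_in ?K T" using c HK by (intro normal_in_of_comm[OF Ks Ts KT]) auto
    then have "T \<subseteq> normalizer_in ?K" using normal_in_iff_normalizer_in[OF Ks Ts KT] by simp
    moreover have uE: "u \<in> nil_in T" using insert.prems E(1) by auto
    ultimately have "lnilp (generate G (insert u ?K))"
      using KT by (intro lnilp_adjoin_engel[OF lK]) (auto simp: nil_in_def)
    moreover have "generate G (H \<union> insert u E0) \<subseteq> generate G (insert u ?K)"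
      by (intro mono_generate) (auto intro: gen_in)
    moreover have "subgroup (generate G (H \<union> insert u E0)) G"
      using UG insert.prems by (intro gen_sub) auto
    ultimately show ?case using lnilp_mono by blast
  qed
  show ?thesis
    unfolding lnilp_def
  proof (intro conjI allI impI Ts)
    fix S assume S: "finite S \<and> S \<subseteq> T"
    then obtain F where F: "finite F" "F \<subseteq> H \<union> E" "S \<subseteq> generate G F"
      using gen_finite_support_set T by meson
    have "generate G F \<subseteq> generate G (H \<union> (F \<inter> E))" using F(2) by (intro mono_generate) auto
    moreover have "lnilp (generate G (H \<union> (F \<inter> E)))" using fin[of "F \<inter> E"] F(1) by auto
    ultimately show "nilp (generate G S)" using F(3) S unfolding lnilp_def by (meson subset_trans)
  qed
qed

section \<open>The Hirsch-Plotkin theorem and the relative radical\<close>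

declare lcs.simps(2) [simp del]

text \<open>Only a finitely generated subgroup \<open>Y\<close> of \<open>M\<close> has to be
  considered at a time, and it is nilpotent. The subgroups generated by \<open>N\<close> and
  \<open>lcs Y i\<close> grow, as \<open>i\<close> falls from \<open>c\<close> to 0, from
  \<open>N\<close> to the subgroup generated by \<open>N\<close> and \<open>Y\<close>. Successive
  factors are abelian, and elements of \<open>Y\<close> are nil in \<open>B\<close> because
  \<open>M\<close> is normal and locally nilpotent, so \<open>lnilp_abelian_extension\<close> climbs
  the series.\<close>

lemma lnilp_join:
  assumes N: "normal_in N B" "lnilp N" and M: "normal_in M B" "lnilp M"
  shows "lnilp (generate G (N \<union> M))"
proof -
  note n = normal_inD[OF N(1)] and m = normal_inD[OF M(1)]
  have NMG: "N \<union> M \<subseteq> carrier G" using n m by auto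
  have main: "lnilp (generate G (N \<union> generate G F))" if F: "finite F" "F \<subseteq> M" for F
  proof -
    let ?Y = "generate G F"
    have FG: "F \<subseteq> carrier G" using F(2) m(5) by auto
    have YM: "?Y \<subseteq> M" using gen_least[OF m(1) F(2)] .
    have Ys: "subgroup ?Y G" using gen_sub[OF FG] .
    have "nilp ?Y" using M(2) F unfolding lnilp_def by auto
    then obtain c where c: "lcs ?Y c = {\<one>}" unfolding nilp_def by auto
    have lY: "lcs ?Y i \<subseteq> ?Y" for i using normal_inD(3)[OF normal_in_lcs[OF Ys]] .
    let ?T = "\<lambda>i. generate G (N \<union> lcs ?Y i)"
    have subB: "N \<union> lcs ?Y i \<subseteq> B" for i using n(3) lY[of i] YM m(3) by auto
    then have subG: "N \<union> lcs ?Y i \<subseteq> carrier G" for i using n(6) by (meson subset_trans)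
    have Ts: "subgroup (?T i) G" for i using gen_sub[OF subG] .
    have tri_bounded: "?T i \<subseteq> B" for i using gen_least[OF n(2) subB] .
    have step: "lnilp (?T i)" if IH: "lnilp (?T (Suc i))" for i
    proof -
      have gT: "x \<in> ?T i" if "x \<in> N \<or> x \<in> lcs ?Y i" for x i using that by (intro gen_in) auto
      have comm1: "comm s t \<in> ?T (Suc i)" if "s \<in> N \<union> lcs ?Y i" "t \<in> N \<union> lcs ?Y i" for s t
      proof (cases "s \<in> N \<or> t \<in> N")
        case True
        then have "comm s t \<in> N" using normal_in_comm[OF N(1)] that subB[of i] by auto
        then show ?thesis using gT by blast
      next
        case False
        then have "comm s t \<in> lcs ?Y (Suc i)" using that lY[of i] by (intro comm_lcs) auto
        then show ?thesis using gT by blast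
      qed
      have le: "lcs ?Y (Suc i) \<subseteq> lcs ?Y i" using lcs_Suc_subset[OF Ys] .
      have T1T: "?T (Suc i) \<subseteq> ?T i" using le by (intro mono_generate) auto
      have nT: "normal_in (?T (Suc i)) (?T i)"
      proof (rule normal_in_genI[OF subG subG T1T])
        fix s t assume s: "s \<in> N \<union> lcs ?Y (Suc i)" and t: "t \<in> N \<union> lcs ?Y i"
        have cj: "cj s t' \<in> ?T (Suc i)" if t': "t' \<in> N \<union> lcs ?Y i" for t'
        proof -
          have "s \<in> N \<union> lcs ?Y i" using s le by auto
          then have "comm s t' \<in> ?T (Suc i)" using comm1 t' by blast
          moreover have "s \<in> ?T (Suc i)" using s by (intro gen_in)
          moreover have "cj s t' = s \<otimes> comm s t'" using s t' subG by (intro cj_eq_comm) auto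
          ultimately show ?thesis using sub_closed(1)[OF Ts] by simp
        qed
        have "inv t \<in> N \<union> lcs ?Y i"
          using t sub_closed(2)[OF n(1)] sub_closed(2)[OF normal_inD(1)[OF normal_in_lcs[OF Ys]]] by auto
        then show "cj s t \<in> ?T (Suc i) \<and> cj s (inv t) \<in> ?T (Suc i)" using cj t by blast
      qed
      have cT: "comm x y \<in> ?T (Suc i)" if "x \<in> ?T i" "y \<in> ?T i" for x y
        by (rule comm_gen[OF nT _ _ comm1 that]) (auto intro: gT)
      have "?T i = generate G (?T (Suc i) \<union> lcs ?Y i)"
      proof
        show "?T i \<subseteq> generate G (?T (Suc i) \<union> lcs ?Y i)"
          by (intro mono_generate) (auto intro: gT)
        show "generate G (?T (Suc i) \<union> lcs ?Y i) \<subseteq> ?T i"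
          using T1T by (intro gen_least[OF Ts]) (auto intro: gT)
      qed
      moreover have "lcs ?Y i \<subseteq> nil_in (?T i)"
      proof
        fix x assume x: "x \<in> lcs ?Y i"
        then have "x \<in> nil_in B" using nil_in_of_lnilp[OF M] lY[of i] YM by auto
        then show "x \<in> nil_in (?T i)" using nil_in_mono[OF tri_bounded[of i]] gT x by auto
      qed
      ultimately show ?thesis using cT lY[of i] YM m(5)
        by (intro lnilp_abelian_extension[OF IH, of _ "lcs ?Y i"]) auto
    qed
    have "N \<union> {\<one>} = N" using subgroup.one_closed[OF n(1)] by auto
    then have "lnilp (?T c)" using c N(2) gen_self[OF n(1)] by simp
    then have "lnilp (?T 0)" by (induction c) (auto intro: step simp del: lcs.simps)
    then show ?thesis by simp
  qed
  show ?thesis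
    unfolding lnilp_def
  proof (intro conjI allI impI gen_sub[OF NMG])
    fix S assume S: "finite S \<and> S \<subseteq> generate G (N \<union> M)"
    then obtain F where F: "finite F" "F \<subseteq> N \<union> M" "S \<subseteq> generate G F"
      using gen_finite_support_set by meson
    have "F \<subseteq> N \<union> generate G (F \<inter> M)" using F(2) gen_in[of _ "F \<inter> M"] by auto
    then have "S \<subseteq> generate G (N \<union> generate G (F \<inter> M))" using F(3) mono_generate by (meson subset_trans)
    then show "nilp (generate G S)" using main[of "F \<inter> M"] F(1) S unfolding lnilp_def by auto
  qed
qed

text \<open>A plain union, since \<open>lnilp_join\<close> makes the family of normal locally
  nilpotent subgroups directed.\<close>

definition HP_in :: "'a set \<Rightarrow> 'a set" where
  "HP_in B = \<Union>{N. normal_in N B \<and> lnilp N}"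

lemma HP_in_sub: "HP_in B \<subseteq> B" unfolding HP_in_def using normal_inD(3) by auto

lemma normal_in_trivial:
  assumes B: "subgroup B G"
  shows "normal_in {\<one>} B" "lnilp {\<one>}"
proof -
  have t: "subgroup {\<one>} G" by (rule triv_subgroup)
  have "\<one> \<in> B" using subgroup.one_closed[OF B] .
  moreover have "cj x b \<in> {\<one>}" if "b \<in> B" "x \<in> {\<one>}" for b x
    using that subgroup.subset[OF B] by auto
  ultimately show "normal_in {\<one>} B" by (intro normal_inI t B) auto
  have "nilp (generate G S)" if "S \<subseteq> {\<one>}" for S
    using gen_least[OF t that] gen_sub[of S] that by (intro nilpI[of _ 0]) auto
  then show "lnilp {\<one>}" unfolding lnilp_def using t by auto
qed

lemma normal_in_gen_Un:
  assumes "normal_in N B" "normal_in M B"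
  shows "normal_in (generate G (N \<union> M)) B"
proof (rule normal_in_gen_invariant[OF normal_inD(2)[OF assms(1)]])
  show "N \<union> M \<subseteq> B" using normal_inD(3) assms by auto
  fix s b assume "s \<in> N \<union> M" "b \<in> B"
  then have "cj s b \<in> N \<union> M" using normal_inD(4)[OF assms(1)] normal_inD(4)[OF assms(2)] by auto
  then show "cj s b \<in> generate G (N \<union> M)" by (rule gen_in)
qed

lemma HP_in_finite:
  assumes B: "subgroup B G" and "finite S" "S \<subseteq> HP_in B"
  shows "\<exists>N. normal_in N B \<and> lnilp N \<and> S \<subseteq> N"
  using assms(2,3)
proof (induction S)
  case empty then show ?case using normal_in_trivial[OF B] by auto
next
  case (insert x S)
  then obtain N M where N: "normal_in N B" "lnilp N" "S \<subseteq> N" and M: "normal_in M B" "lnilp M" "x \<in> M"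
    unfolding HP_in_def by auto
  have "insert x S \<subseteq> generate G (N \<union> M)" using N(3) M(3) by (auto intro!: gen_in)
  then show ?case using lnilp_join[OF N(1,2) M(1,2)] normal_in_gen_Un[OF N(1) M(1)] by auto
qed

lemma HP_in_props:
  assumes B: "subgroup B G"
  shows "normal_in (HP_in B) B" "lnilp (HP_in B)"
proof -
  have BG: "B \<subseteq> carrier G" using subgroup.subset[OF B] .
  have two: "\<exists>N. normal_in N B \<and> lnilp N \<and> x \<in> N \<and> y \<in> N" if "x \<in> HP_in B" "y \<in> HP_in B" for x y
    using HP_in_finite[OF B, of "{x,y}"] that by auto
  have inH: "N \<subseteq> HP_in B" if "normal_in N B" "lnilp N" for N using that unfolding HP_in_def by auto
  have sub: "subgroup (HP_in B) G"
  proof (rule subgroupI)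
    show "HP_in B \<subseteq> carrier G" using HP_in_sub BG by (meson subset_trans)
    show "HP_in B \<noteq> {}" using inH[OF normal_in_trivial[OF B]] by auto
    fix a assume a: "a \<in> HP_in B"
    then obtain N where "normal_in N B \<and> lnilp N \<and> a \<in> N" using two by blast
    then show "inv a \<in> HP_in B" using inH[of N] sub_closed(2)[OF normal_inD(1)] by auto
    fix b assume b: "b \<in> HP_in B"
    obtain M where "normal_in M B \<and> lnilp M \<and> a \<in> M \<and> b \<in> M" using two[OF a b] by blast
    then show "a \<otimes> b \<in> HP_in B" using inH[of M] sub_closed(1)[OF normal_inD(1)] by auto
  qed
  show "normal_in (HP_in B) B"
  proof (rule normal_inI[OF sub B HP_in_sub])
    fix b x assume "b \<in> B" "x \<in> HP_in B"
    moreover then obtain N where "normal_in N B \<and> lnilp N \<and> x \<in> N" using two by blast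
    ultimately show "cj x b \<in> HP_in B" using inH[of N] normal_inD(4)[of N B b x] by auto
  qed
  show "lnilp (HP_in B)"
    unfolding lnilp_def
  proof (intro conjI sub allI impI)
    fix S assume S: "finite S \<and> S \<subseteq> HP_in B"
    then obtain N where "normal_in N B" "lnilp N" "S \<subseteq> N" using HP_in_finite[OF B] by blast
    then show "nilp (generate G S)" using S unfolding lnilp_def by auto
  qed
qed

lemma HP_in_greatest: "normal_in N B \<Longrightarrow> lnilp N \<Longrightarrow> N \<subseteq> HP_in B"
  unfolding HP_in_def by auto

lemma lnilp_cj:
  assumes N: "lnilp N" and b: "b \<in> carrier G"
  shows "lnilp ((\<lambda>x. cj x b) ` N)"
proof -
  note s = lnilp_sub[OF N]
  let ?c = "\<lambda>x. cj x b"
  have im: "subgroup (?c ` K) G" if K: "subgroup K G" for K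
  proof -
    have KG: "K \<subseteq> carrier G" using subgroup.subset[OF K] .
    show ?thesis
    proof (rule subgroupI)
      show "?c ` K \<subseteq> carrier G" using KG b by auto
      show "?c ` K \<noteq> {}" using subgroup.one_closed[OF K] by auto
      fix x assume x: "x \<in> ?c ` K"
      then obtain x' where x': "x = cj x' b" "x' \<in> K" by auto
      then show "inv x \<in> ?c ` K" using sub_closed(2)[OF K] cj_inv[of x' b] KG b by (auto intro!: image_eqI[of _ _ "inv x'"])
      fix y assume y: "y \<in> ?c ` K"
      then obtain y' where y': "y = cj y' b" "y' \<in> K" by auto
      have "x \<otimes> y = cj (x' \<otimes> y') b"
        unfolding x'(1) y'(1) using KG b x'(2) y'(2) by (intro cj_mult[symmetric]) auto
      then show "x \<otimes> y \<in> ?c ` K" using sub_closed(1)[OF K x'(2) y'(2)] by auto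
    qed
  qed
  have lc: "lcs (?c ` K) n \<subseteq> ?c ` lcs K n" if K: "subgroup K G" for K n
  proof (induction n)
    case (Suc n)
    have LG: "lcs K n \<subseteq> carrier G" "K \<subseteq> carrier G" using normal_inD(5,6)[OF normal_in_lcs[OF K]] by auto
    have "comm x y \<in> ?c ` lcs K (Suc n)" if x: "x \<in> lcs (?c ` K) n" and y: "y \<in> ?c ` K" for x y
    proof -
      obtain x' y' where *: "x = cj x' b" "x' \<in> lcs K n" "y = cj y' b" "y' \<in> K"
        using Suc.IH x y by auto
      have "comm x y = cj (comm x' y') b"
        unfolding *(1,3) using LG b *(2,4) by (intro cj_comm[symmetric]) auto
      then show ?thesis using comm_lcs[of x' K n y'] * by (auto simp del: lcs.simps)
    qed
    then show ?case using im[OF normal_inD(1)[OF normal_in_lcs[OF K], of "Suc n"]]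
      unfolding lcs.simps(2)[of "?c ` K"] by (intro gen_least) auto
  qed simp
  show ?thesis
    unfolding lnilp_def
  proof (intro conjI im s allI impI)
    fix S assume S: "finite S \<and> S \<subseteq> ?c ` N"
    then obtain F where F: "finite F" "F \<subseteq> N" "S = ?c ` F" by (meson finite_subset_image)
    have FG: "F \<subseteq> carrier G" using F s by auto
    have "nilp (generate G F)" using N F unfolding lnilp_def by auto
    then obtain n where n: "lcs (generate G F) n = {\<one>}" unfolding nilp_def by auto
    have Fs: "subgroup (generate G F) G" using gen_sub[OF FG] .
    have "lcs (?c ` generate G F) n \<subseteq> {\<one>}" using lc[OF Fs, of n] n b by auto
    then have "nilp (?c ` generate G F)" by (rule nilpI[OF im[OF Fs]])
    moreover have "S \<subseteq> ?c ` generate G F" unfolding F(3) by (intro image_mono subsetI gen_in)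
    moreover have "S \<subseteq> carrier G" unfolding F(3) using FG b by auto
    ultimately show "nilp (generate G S)"
      using nilp_mono[of "?c ` generate G F" "generate G S"] gen_least[OF im[OF Fs]] gen_sub by auto
  qed
qed

text \<open>The radical of \<open>B\<close> is preserved by automorphisms of \<open>B\<close>, in
  particular by conjugation with elements of \<open>C\<close>; so it is a normal locally nilpotent
  subgroup of \<open>C\<close>.\<close>

lemma HP_in_mono:
  assumes BC: "normal_in B C"
  shows "HP_in B \<subseteq> HP_in C"
proof -
  note b = normal_inD[OF BC]
  note p = HP_in_props[OF b(1)]
  have HB: "HP_in B \<subseteq> B" by (rule HP_in_sub)
  have "normal_in (HP_in B) C"
  proof (rule normal_inI[OF normal_inD(1)[OF p(1)] b(2)])
    show "HP_in B \<subseteq> C" using HB b(3) by auto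
    fix c x assume c: "c \<in> C" and x: "x \<in> HP_in B"
    let ?N = "(\<lambda>x. cj x c) ` HP_in B"
    have cG: "c \<in> carrier G" using c b by auto
    have l: "lnilp ?N" using lnilp_cj[OF p(2) cG] .
    have "normal_in ?N B"
    proof (rule normal_inI[OF lnilp_sub(1)[OF l] b(1)])
      show "?N \<subseteq> B" using HB b(4)[OF c] by auto
      fix d y assume d: "d \<in> B" and "y \<in> ?N"
      then obtain z where z: "y = cj z c" "z \<in> HP_in B" by auto
      have G: "z \<in> carrier G" "d \<in> carrier G" using z d HB b(5) by auto
      have ci: "inv c \<in> C" using sub_closed(2)[OF b(2) c] .
      have "cj z (cj d (inv c)) \<in> HP_in B" using normal_inD(4)[OF p(1) b(4)[OF ci d] z(2)] .
      moreover have "cj y d = cj (cj z (cj d (inv c))) c"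
        unfolding z(1) using G cG by (simp add: word)
      ultimately show "cj y d \<in> ?N" by auto
    qed
    then show "cj x c \<in> HP_in B" using HP_in_greatest[OF _ l] x by auto
  qed
  then show ?thesis using HP_in_greatest p(2) by auto
qed

lemma HP_eq_HP_in: "HP G = HP_in (carrier G)"
proof -
  have "N \<lhd> G \<and> locally_nilpotent (G\<lparr>carrier := N\<rparr>) \<longleftrightarrow> normal_in N (carrier G) \<and> lnilp N" for N
  proof (cases "subgroup N G")
    case N: True
    have "N \<lhd> G \<longleftrightarrow> normal_in N (carrier G)"
    proof
      assume "N \<lhd> G"
      then have *: "x \<otimes> h \<otimes> inv x \<in> N" if "x \<in> carrier G" "h \<in> N" for x h
        using that unfolding normal_inv_iff by auto
      have "cj h x \<in> N" if "x \<in> carrier G" "h \<in> N" for x h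
        using *[of "inv x" h] that by (simp add: cj_def)
      then show "normal_in N (carrier G)" using N subgroup.subset[OF N] subgroup_self
        by (intro normal_inI) auto
    next
      assume n: "normal_in N (carrier G)"
      have "x \<otimes> h \<otimes> inv x \<in> N" if "x \<in> carrier G" "h \<in> N" for x h
        using normal_inD(4)[OF n, of "inv x" h] that by (auto simp: cj_def)
      then show "N \<lhd> G" unfolding normal_inv_iff using N by auto
    qed
    then show ?thesis using locally_nilpotent_iff[OF N] by simp
  next
    case False
    then show ?thesis using normal_imp_subgroup normal_inD(1) by auto
  qed
  then have "HP G = generate G (HP_in (carrier G))" unfolding HP_def HP_in_def by simp
  then show ?thesis using gen_self[OF normal_inD(1)[OF HP_in_props(1)[OF subgroup_self]]] by simp
qed

lemma nil_elements_eq_nil_in: "nil_elements G = nil_in (carrier G)"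
proof -
  have "(\<exists>n\<ge>1. engel G n a g = \<one>) \<longleftrightarrow> (\<exists>n. engel G n a g = \<one>)" if "g \<in> carrier G" for a g
    using engel_mono[OF that, of _ a] by (metis le_add1 le_add2)
  then show ?thesis unfolding nil_elements_def nil_in_def by auto
qed

lemma HP_subset_nil: "HP G \<subseteq> nil_elements G"
  unfolding HP_eq_HP_in nil_elements_eq_nil_in
  using nil_in_of_lnilp[OF HP_in_props[OF subgroup_self]] by auto

text \<open>The radicals increase along the chain by \<open>HP_in_mono\<close>, and their union is a
  normal locally nilpotent subgroup of the union. An infinite chain is what
  \<open>HP_in_ascend\<close> produces, where the Engel exponents may have no common bound.\<close>

lemma HP_in_chain:
  assumes P: "\<And>j. normal_in (P j) (P (Suc j))" and B: "B = (\<Union>j. P j)" and g: "g \<in> HP_in (P (0::nat))"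
  shows "g \<in> HP_in B"
proof -
  have mono: "P i \<subseteq> P j" if "i \<le> j" for i j
    using that by (rule lift_Suc_antimono_le[of "\<lambda>i. - P i", simplified, rotated]) (use normal_inD(3)[OF P] in auto)
  have Hmono: "HP_in (P i) \<subseteq> HP_in (P j)" if "i \<le> j" for i j
    using that by (rule lift_Suc_mono_le[of "\<lambda>i. HP_in (P i)", rotated]) (use HP_in_mono[OF P] in auto)
  have Ps: "subgroup (P j) G" for j using normal_inD(1)[OF P] .
  note h = HP_in_props[OF Ps]
  let ?R = "\<Union>j. HP_in (P j)"
  have Un: "subgroup (\<Union>j. Q j) G" if Q: "\<And>j. subgroup (Q j) G" and m: "\<And>i j. i \<le> j \<Longrightarrow> Q i \<subseteq> Q j"
    for Q :: "nat \<Rightarrow> 'a set"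
  proof (rule subgroupI)
    show "(\<Union>j. Q j) \<subseteq> carrier G" using subgroup.subset[OF Q] by auto
    show "(\<Union>j. Q j) \<noteq> {}" using subgroup.one_closed[OF Q] by auto
    fix a assume "a \<in> (\<Union>j. Q j)"
    then obtain i where i: "a \<in> Q i" by auto
    then show "inv a \<in> (\<Union>j. Q j)" using sub_closed(2)[OF Q] by auto
    fix b assume "b \<in> (\<Union>j. Q j)"
    then obtain j where "b \<in> Q j" by auto
    then have "a \<in> Q (max i j)" "b \<in> Q (max i j)" using i m[of i "max i j"] m[of j "max i j"] by auto
    then show "a \<otimes> b \<in> (\<Union>j. Q j)" using sub_closed(1)[OF Q] by auto
  qed
  have Rs: "subgroup ?R G" using Un[of "\<lambda>j. HP_in (P j)"] normal_inD(1)[OF h(1)] Hmono by auto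
  have Bs: "subgroup B G" unfolding B using Un[of P] Ps mono by auto
  have "normal_in ?R B"
  proof (rule normal_inI[OF Rs Bs])
    show "?R \<subseteq> B" unfolding B using HP_in_sub by auto
    fix b x assume "b \<in> B" "x \<in> ?R"
    then obtain i j where "b \<in> P i" "x \<in> HP_in (P j)" unfolding B by auto
    then have "b \<in> P (max i j)" "x \<in> HP_in (P (max i j))"
      using mono[of i "max i j"] Hmono[of j "max i j"] by auto
    then show "cj x b \<in> ?R" using normal_inD(4)[OF h(1)] by auto
  qed
  moreover have "lnilp ?R"
    unfolding lnilp_def
  proof (intro conjI Rs allI impI)
    fix S assume "finite S \<and> S \<subseteq> ?R"
    then have S: "finite S" "S \<subseteq> ?R" by auto
    then have "\<exists>j. S \<subseteq> HP_in (P j)"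
    proof (induction S)
      case (insert x S)
      then obtain i j where "S \<subseteq> HP_in (P i)" "x \<in> HP_in (P j)" by auto
      then have "insert x S \<subseteq> HP_in (P (max i j))" using Hmono[of i "max i j"] Hmono[of j "max i j"] by auto
      then show ?case ..
    qed auto
    then show "nilp (generate G S)" using h(2) S(1) unfolding lnilp_def by auto
  qed
  ultimately have "?R \<subseteq> HP_in B" by (rule HP_in_greatest)
  then show ?thesis using g by auto
qed

end

section \<open>Derived words and triangular lists\<close>

text \<open>The matrix of truth values of points against conditions is false on the diagonal and
  true above it. With \<open>P\<close> the vanishing of an equation at a point, each new equation
  vanishes at all earlier points but not at its own.\<close>

fun tri :: "('y \<Rightarrow> 'f \<Rightarrow> bool) \<Rightarrow> ('y \<times> 'f) list \<Rightarrow> bool" where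
  "tri P [] \<longleftrightarrow> True"
| "tri P ((y, f) # zs) \<longleftrightarrow> \<not> P y f \<and> (\<forall>(y', f') \<in> set zs. P y f') \<and> tri P zs"

lemma tri_append:
  "tri P (zs @ [(y, f)]) \<longleftrightarrow> tri P zs \<and> (\<forall>(y', f') \<in> set zs. P y' f) \<and> \<not> P y f"
  by (induction P zs rule: tri.induct) auto

context group begin

text \<open>Even and odd variables feed the two entries of the commutator, so each variable occurs
  in one entry only and the values of the two entries can be chosen independently. Only the first
  \<open>2 ^ k\<close> variables are read.\<close>

primrec delta :: "nat \<Rightarrow> (nat \<Rightarrow> 'a) \<Rightarrow> 'a" where
  "delta 0 y = y 0"
| "delta (Suc k) y = comm (delta k (\<lambda>i. y (2 * i))) (delta k (\<lambda>i. y (2 * i + 1)))"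

text \<open>Values of a single word instead of the derived subgroup: a value depends on each
  variable through a word of bounded length, so its vanishing is a word equation.\<close>

definition derived_values :: "nat \<Rightarrow> 'a set \<Rightarrow> 'a set" where
  "derived_values k B = {delta k y | y. range y \<subseteq> B}"

lemma derived_values_0 [simp]: "derived_values 0 B = B"
proof -
  have "b \<in> derived_values 0 B" if "b \<in> B" for b
    unfolding derived_values_def using that by (auto intro!: exI[of _ "\<lambda>_. b"])
  then show ?thesis unfolding derived_values_def by auto
qed

lemma derived_values_Suc: "derived_values (Suc k) B = {comm a b | a b. a \<in> derived_values k B \<and> b \<in> derived_values k B}"
proof
  show "{comm a b | a b. a \<in> derived_values k B \<and> b \<in> derived_values k B} \<subseteq> derived_values (Suc k) B"
  proof
    fix v assume "v \<in> {comm a b | a b. a \<in> derived_values k B \<and> b \<in> derived_values k B}"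
    then obtain y z where yz: "v = comm (delta k y) (delta k z)" "range y \<subseteq> B" "range z \<subseteq> B"
      by (auto simp: derived_values_def)
    let ?w = "\<lambda>i. if even i then y (i div 2) else z (i div 2)"
    have "v = delta (Suc k) ?w" unfolding yz(1) by simp
    moreover have "range ?w \<subseteq> B" using yz(2,3) by auto
    ultimately show "v \<in> derived_values (Suc k) B" unfolding derived_values_def by (intro CollectI exI conjI)
  qed
  show "derived_values (Suc k) B \<subseteq> {comm a b | a b. a \<in> derived_values k B \<and> b \<in> derived_values k B}"
  proof
    fix v assume "v \<in> derived_values (Suc k) B"
    then obtain y where y: "range y \<subseteq> B" "v = delta (Suc k) y" unfolding derived_values_def by auto
    have "delta k (\<lambda>i. y (2 * i)) \<in> derived_values k B" "delta k (\<lambda>i. y (2 * i + 1)) \<in> derived_values k B"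
      unfolding derived_values_def using y(1) by auto
    then show "v \<in> {comm a b | a b. a \<in> derived_values k B \<and> b \<in> derived_values k B}" unfolding y(2) delta.simps by blast
  qed
qed

lemma derived_values_sub: "subgroup B G \<Longrightarrow> derived_values k B \<subseteq> B"
  by (induction k) (auto simp: derived_values_Suc dest: sub_closed)

lemma derived_values_mono: "B \<subseteq> C \<Longrightarrow> derived_values k B \<subseteq> derived_values k C"
  by (induction k) (auto simp: derived_values_Suc)

lemma derived_values_shift:
  assumes "\<And>a b. a \<in> U \<Longrightarrow> b \<in> U \<Longrightarrow> comm a b \<in> C"
  shows "derived_values (Suc k) U \<subseteq> derived_values k C"
proof (induction k)
  case 0 then show ?case using assms by (auto simp: derived_values_Suc)
next
  case (Suc k)
  show ?case
  proof
    fix v assume "v \<in> derived_values (Suc (Suc k)) U"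
    then obtain a b where "v = comm a b" "a \<in> derived_values (Suc k) U" "b \<in> derived_values (Suc k) U"
      unfolding derived_values_Suc[of "Suc k"] by auto
    then show "v \<in> derived_values (Suc k) C" using Suc unfolding derived_values_Suc[of k C] by auto
  qed
qed

lemma derived_values_cj:
  assumes B: "subgroup B G" and v: "v \<in> derived_values k B" and b: "b \<in> B"
  shows "cj v b \<in> derived_values k B"
  using v
proof (induction k arbitrary: v)
  case 0 then show ?case using sub_closed(3)[OF B] b by simp
next
  case (Suc k)
  then obtain x y where v: "v = comm x y" "x \<in> derived_values k B" "y \<in> derived_values k B" unfolding derived_values_Suc by auto
  have "cj v b = comm (cj x b) (cj y b)"
    unfolding v(1) using v(2,3) b derived_values_sub[OF B] subgroup.subset[OF B] by (intro cj_comm) auto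
  then show ?case using Suc.IH v(2,3) unfolding derived_values_Suc by auto
qed

text \<open>Let \<open>C j\<close> consist of the elements of \<open>D\<close> that \<open>j\<close>
  commutations with \<open>g\<close> bring into \<open>D'\<close>. As \<open>D / D'\<close> is
  abelian, \<open>C j\<close> is a subgroup. The subgroups generated by \<open>g\<close> and
  \<open>C j\<close> form a chain with each normal in the next, and the Engel condition on
  \<open>g\<close> makes the union of all \<open>C j\<close> equal to \<open>D\<close>. Then
  \<open>HP_in_chain\<close> carries \<open>g\<close> upwards.\<close>

lemma HP_in_ascend:
  assumes D': "normal_in D' B" and D: "normal_in D B" and DD: "D' \<subseteq> D"
    and c: "\<And>x y. x \<in> D \<Longrightarrow> y \<in> D \<Longrightarrow> comm x y \<in> D'"
    and g: "g \<in> nil_in B" and gH: "g \<in> HP_in (generate G (insert g D'))"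
  shows "g \<in> HP_in (generate G (insert g D))"
proof -
  define C where "C = rec_nat D' (\<lambda>n Y. {d \<in> D. comm d g \<in> Y})"
  have C0: "C 0 = D'" and CS: "C (Suc j) = {d \<in> D. comm d g \<in> C j}" for j
    unfolding C_def by simp_all
  note d = normal_inD[OF D] and d' = normal_inD[OF D']
  have gB: "g \<in> B" using g nil_in_sub by auto
  have gG: "g \<in> carrier G" using gB d by auto
  have igB: "inv g \<in> B" using sub_closed(2)[OF d(2) gB] .
  have props: "subgroup (C j) G \<and> D' \<subseteq> C j \<and> C j \<subseteq> D \<and> (\<forall>s\<in>C j. cj s (inv g) \<in> C j) \<and> C j \<subseteq> C (Suc j)" for j
  proof (induction j)
    case 0
    then show ?case unfolding CS unfolding C0 using d'(1) DD d'(4)[OF igB] normal_in_comm(1)[OF D' _ gB] by auto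
  next
    case (Suc j)
    then have Cs: "subgroup (C j) G" "D' \<subseteq> C j" "C j \<subseteq> D" "\<And>s. s \<in> C j \<Longrightarrow> cj s (inv g) \<in> C j" "C j \<subseteq> C (Suc j)"
      by auto
    have CD: "x \<in> carrier G" if "x \<in> D" for x using that d(5) by auto
    have cjC: "cj x y \<in> C j" if x: "x \<in> C j" and y: "y \<in> D" for x y
    proof -
      have "x \<in> D" using x Cs(3) by auto
      then have "comm x y \<in> C j" using c y Cs(2) by auto
      then show ?thesis using cj_eq_comm[OF CD CD] \<open>x \<in> D\<close> y sub_closed(1)[OF Cs(1) x] by simp
    qed
    have "subgroup (C (Suc j)) G"
      unfolding CS
    proof (rule subgroupI)
      show "{d \<in> D. comm d g \<in> C j} \<subseteq> carrier G" using CD by auto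
      show "{d \<in> D. comm d g \<in> C j} \<noteq> {}"
        using subgroup.one_closed[OF d(1)] subgroup.one_closed[OF Cs(1)] gG by force
      fix a assume "a \<in> {d \<in> D. comm d g \<in> C j}"
      then have a: "a \<in> D" "comm a g \<in> C j" by auto
      show "inv a \<in> {d \<in> D. comm d g \<in> C j}"
        using comm_inv_left[OF CD[OF a(1)] gG] cjC[OF sub_closed(2)[OF Cs(1) a(2)] sub_closed(2)[OF d(1) a(1)]]
          sub_closed(2)[OF d(1) a(1)] by simp
      fix b assume "b \<in> {d \<in> D. comm d g \<in> C j}"
      then have b: "b \<in> D" "comm b g \<in> C j" by auto
      show "a \<otimes> b \<in> {d \<in> D. comm d g \<in> C j}"
        using comm_mult_left[OF CD[OF a(1)] gG CD[OF b(1)]] sub_closed(1)[OF d(1) a(1) b(1)]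
          sub_closed(1)[OF Cs(1) cjC[OF a(2) b(1)] b(2)] by simp
    qed
    moreover have "cj s (inv g) \<in> C (Suc j)" if s: "s \<in> C (Suc j)" for s
    proof -
      have s': "s \<in> D" "comm s g \<in> C j" using s unfolding CS by auto
      have "comm (cj s (inv g)) g = cj (comm s g) (inv g)"
        using CD[OF s'(1)] gG by (simp add: word)
      then show ?thesis unfolding CS using Cs(4)[OF s'(2)] d(4)[OF igB s'(1)] by simp
    qed
    moreover have "C (Suc j) \<subseteq> C (Suc (Suc j))" using Cs(5) unfolding CS[of "Suc j"] by (auto simp: CS)
    moreover have "D' \<subseteq> C (Suc j)" using Cs(2,5) by auto
    moreover have "C (Suc j) \<subseteq> D" unfolding CS by auto
    ultimately show ?case by blast
  qed
  have Cs: "subgroup (C j) G" "D' \<subseteq> C j" "C j \<subseteq> D" "C j \<subseteq> C (Suc j)" for j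
    using props[of j] by auto
  have Cinv: "cj s (inv g) \<in> C j" if "s \<in> C j" for s j using props[of j] that by auto
  have Cg: "comm s g \<in> C j" if "s \<in> C (Suc j)" for s j using that unfolding CS by auto
  have CG: "C j \<subseteq> carrier G" for j using subgroup.subset[OF Cs(1)] .
  let ?P = "\<lambda>j. generate G (insert g (C j))"
  have IG: "insert g (C j) \<subseteq> carrier G" for j using CG gG by auto
  have Ps: "subgroup (?P j) G" for j using gen_sub[OF IG] .
  have inP: "x \<in> ?P j" if "x \<in> C j" for x j using that by (intro gen_in) auto
  have gP: "g \<in> ?P j" for j by (intro gen_in) auto
  \<comment> \<open>An element of \<open>C (Suc j)\<close> changes \<open>g\<close> by a commutator
    in \<open>C j\<close> and changes elements of \<open>C j\<close> by elements of
    \<open>D'\<close>; this is the purpose of the shift in the recursion for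
    \<open>C\<close>.\<close>
  have nP: "normal_in (?P j) (?P (Suc j))" for j
  proof (rule normal_in_genI[OF IG IG mono_generate])
    show "insert g (C j) \<subseteq> insert g (C (Suc j))" using Cs(4) by auto
    fix s t assume s: "s \<in> insert g (C j)" and t: "t \<in> insert g (C (Suc j))"
    have 1: "cj s t' \<in> ?P j" if t': "t' \<in> C (Suc j)" for t'
    proof -
      have tD: "t' \<in> D" using t' Cs(3) by auto
      have "comm s t' \<in> ?P j"
      proof (cases "s = g")
        case True
        have "comm g t' = inv (comm t' g)" using comm_swap[OF gG] tD d(5) by auto
        then show ?thesis using True sub_closed(2)[OF Ps inP[OF Cg[OF t']]] by simp
      next
        case False
        then have "s \<in> D" using s Cs(3)[of j] by auto
        then show ?thesis using c[OF _ tD] Cs(2)[of j] by (intro inP) auto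
      qed
      moreover have "s \<in> ?P j" using s by (rule gen_in)
      moreover have "cj s t' = s \<otimes> comm s t'" using s t' IG[of j] CG[of "Suc j"] by (intro cj_eq_comm) auto
      ultimately show ?thesis using sub_closed(1)[OF Ps] by simp
    qed
    show "cj s t \<in> ?P j \<and> cj s (inv t) \<in> ?P j"
    proof (cases "t = g")
      case False
      then have "t \<in> C (Suc j)" using t by auto
      then show ?thesis using 1 sub_closed(2)[OF Cs(1)] by auto
    next
      case t: True
      show ?thesis
      proof (cases "s = g")
        case True
        then have "cj s t = g" "cj s (inv t) = g" using t gG by (simp_all add: word)
        then show ?thesis using gP by simp
      next
        case False
        then have sC: "s \<in> C j" using s by auto
        then have "cj s g = s \<otimes> comm s g" using CG gG by (intro cj_eq_comm) auto
        moreover have "comm s g \<in> C j" using Cg Cs(4) sC by auto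
        ultimately have "cj s g \<in> C j" using sub_closed(1)[OF Cs(1) sC] by simp
        then show ?thesis using t inP Cinv[OF sC] by simp
      qed
    qed
  qed
  have eng: "a \<in> D \<Longrightarrow> engel G n a g \<in> C 0 \<Longrightarrow> a \<in> C n" for n a
  proof (induction n arbitrary: a)
    case (Suc n)
    then have "comm a g \<in> C n" using normal_in_comm(1)[OF D Suc.prems(1) gB] by (auto simp: engel_shift simp del: engel.simps)
    then show ?case unfolding CS using Suc.prems(1) by auto
  qed simp
  have DC: "D = (\<Union>j. C j)"
  proof
    show "D \<subseteq> (\<Union>j. C j)"
    proof
      fix a assume a: "a \<in> D"
      then obtain n where "engel G n a g = \<one>" using g d(3) unfolding nil_in_def by auto
      then show "a \<in> (\<Union>j. C j)" using eng[OF a, of n] C0 subgroup.one_closed[OF d'(1)] by auto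
    qed
  qed (use Cs(3) in auto)
  have Cmono: "C i \<subseteq> C j" if "i \<le> j" for i j
    using that by (rule lift_Suc_mono_le[of C, rotated]) (use Cs(4) in auto)
  have "generate G (insert g D) = (\<Union>j. ?P j)"
  proof
    show "(\<Union>j. ?P j) \<subseteq> generate G (insert g D)" using Cs(3) by (intro UN_least mono_generate) auto
    show "generate G (insert g D) \<subseteq> (\<Union>j. ?P j)"
    proof
      fix x assume "x \<in> generate G (insert g D)"
      then obtain F where F: "finite F" "F \<subseteq> insert g D" "x \<in> generate G F" using gen_finite_support by blast
      from F(1,2) have "\<exists>j. F \<subseteq> insert g (C j)"
      proof (induction F)
        case (insert y F)
        then obtain i where i: "F \<subseteq> insert g (C i)" by auto
        obtain j where j: "y \<in> insert g (C j)" using insert.prems DC by auto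
        have "insert y F \<subseteq> insert g (C (max i j))" using i j Cmono[of i "max i j"] Cmono[of j "max i j"] by auto
        then show ?case ..
      qed auto
      then obtain j where "F \<subseteq> insert g (C j)" ..
      then have "x \<in> ?P j" using F(3) mono_generate by blast
      then show "x \<in> (\<Union>j. ?P j)" by auto
    qed
  qed
  moreover have "g \<in> HP_in (\<Union>j. ?P j)"
  proof (rule HP_in_chain[where P = ?P, OF _ refl])
    show "normal_in (?P j) (?P (Suc j))" for j by (rule nP)
    show "g \<in> HP_in (?P 0)" using gH unfolding C0 .
  qed
  ultimately show ?thesis by simp
qed

text \<open>The subgroups \<open>?D i\<close> generated by \<open>H\<close> and the derived values
  of level \<open>i\<close> descend from \<open>B\<close> to \<open>H\<close> with abelian factors.
  At the bottom, \<open>g\<close> and \<open>H\<close> generate a locally nilpotent subgroup;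
  \<open>HP_in_ascend\<close> carries membership in the radical up the series.\<close>

theorem gruenberg:
  assumes H: "normal_in H B" "lnilp H" and s: "derived_values k B \<subseteq> H" and g: "g \<in> nil_in B"
  shows "g \<in> HP_in B"
proof -
  note h = normal_inD[OF H(1)]
  let ?D = "\<lambda>i. generate G (H \<union> derived_values i B)"
  have gB: "g \<in> B" using g nil_in_sub by auto
  have gG: "g \<in> carrier G" using gB h by auto
  have UB: "H \<union> derived_values i B \<subseteq> B" for i using h(3) derived_values_sub[OF h(2)] by auto
  have nD: "normal_in (?D i) B" for i
    using h(4) derived_values_cj[OF h(2)] by (intro normal_in_gen_invariant[OF h(2) UB] gen_in) auto
  have inD: "x \<in> ?D i" if "x \<in> H \<or> x \<in> derived_values i B" for x i using that by (intro gen_in) auto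
  have cD: "comm x y \<in> ?D (Suc i)" if "x \<in> ?D i" "y \<in> ?D i" for x y i
  proof (rule comm_gen[OF nD UB UB _ that])
    fix s t assume st: "s \<in> H \<union> derived_values i B" "t \<in> H \<union> derived_values i B"
    then have B: "s \<in> B" "t \<in> B" using UB[of i] by auto
    show "comm s t \<in> ?D (Suc i)"
    proof (cases "s \<in> H \<or> t \<in> H")
      case True then show ?thesis using normal_in_comm[OF H(1)] B inD by auto
    next
      case False then show ?thesis using st by (intro inD) (auto simp: derived_values_Suc)
    qed
  qed
  have dec: "?D (Suc i) \<subseteq> ?D i" for i
  proof (rule gen_least[OF normal_inD(1)[OF nD]])
    show "H \<union> derived_values (Suc i) B \<subseteq> ?D i"
      using inD[of _ i] sub_closed(4)[OF normal_inD(1)[OF nD[of i]]] by (auto simp: derived_values_Suc)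
  qed
  have "H \<union> derived_values k B = H" using s by auto
  then have Dk: "?D k = H" using gen_self[OF h(1)] by simp
  have IHG: "insert g H \<subseteq> carrier G" using h gG by auto
  have "g \<in> normalizer_in H" using gB normal_in_iff_normalizer_in[OF h(1,2,3)] H(1) by auto
  then have "lnilp (generate G (insert g H))"
    using g h(3) by (intro lnilp_adjoin_engel[OF H(2)]) (auto simp: nil_in_def)
  then have "generate G (insert g H) \<subseteq> HP_in (generate G (insert g H))"
    by (intro HP_in_greatest normal_in_self gen_sub[OF IHG])
  then have start: "g \<in> HP_in (generate G (insert g (?D k)))" unfolding Dk using gen_in[of g "insert g H"] by auto
  have "g \<in> HP_in (generate G (insert g (?D i)))" if "i \<le> k" for i
    using that
  proof (induction i rule: inc_induct)
    case base show ?case by (rule start)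
  next
    case (step i)
    show ?case by (rule HP_in_ascend[OF nD nD dec cD g step.IH])
  qed
  then have "g \<in> HP_in (generate G (insert g (?D 0)))" by blast
  moreover have "insert g (?D 0) = B"
  proof -
    have "?D 0 = B" using gen_self[OF h(2)] h(3) by (simp add: Un_absorb1)
    then show ?thesis using gB by auto
  qed
  ultimately show ?thesis using gen_self[OF h(2)] by simp
qed

section \<open>Word equations and their closed sets\<close>

text \<open>Functions given by words in one variable with constants from \<open>B\<close>; the number bounds the
  occurrences of the variable.\<close>

inductive word_fun :: "'a set \<Rightarrow> nat \<Rightarrow> ('a \<Rightarrow> 'a) \<Rightarrow> bool" for B where
  const: "c \<in> B \<Longrightarrow> word_fun B 0 (\<lambda>y. c)"
| var: "word_fun B 1 (\<lambda>y. y)"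
| var_inv: "word_fun B 1 (\<lambda>y. inv y)"
| mult: "word_fun B m f \<Longrightarrow> word_fun B n h \<Longrightarrow> word_fun B (m + n) (\<lambda>y. f y \<otimes> h y)"
| weaken: "word_fun B m f \<Longrightarrow> m \<le> n \<Longrightarrow> word_fun B n f"
| agree: "word_fun B m f \<Longrightarrow> (\<And>y. y \<in> carrier G \<Longrightarrow> f y = h y) \<Longrightarrow> word_fun B m h"

lemma word_fun_closed: "word_fun B m f \<Longrightarrow> B \<subseteq> carrier G \<Longrightarrow> y \<in> carrier G \<Longrightarrow> f y \<in> carrier G"
  by (induction rule: word_fun.induct) auto

lemma word_fun_mono: "word_fun B m f \<Longrightarrow> B \<subseteq> C \<Longrightarrow> word_fun C m f"
  by (induction rule: word_fun.induct) (auto intro: word_fun.intros)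

lemma word_fun_inv:
  assumes "word_fun B m f" and B: "subgroup B G"
  shows "word_fun B m (\<lambda>y. inv (f y))"
  using assms(1)
proof induction
  case (const c) then show ?case using word_fun.const sub_closed(2)[OF B] by auto
next
  case var then show ?case by (rule word_fun.var_inv)
next
  case var_inv then show ?case by (rule word_fun.agree[OF word_fun.var]) simp
next
  case (mult m f n h)
  have "word_fun B (n + m) (\<lambda>y. inv (h y) \<otimes> inv (f y))" by (rule word_fun.mult[OF mult.IH(2,1)])
  then show ?case
    using word_fun_closed[OF mult.hyps(1)] word_fun_closed[OF mult.hyps(2)] subgroup.subset[OF B]
    by (subst add.commute, elim word_fun.agree) (simp add: inv_mult_group)
next
  case (weaken m f n) then show ?case using word_fun.weaken by blast
next
  case (agree m f h) then show ?case by (intro word_fun.agree[OF agree.IH]) simp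
qed

text \<open>Translations do not increase the number of occurrences of the variable, so they are
  homeomorphisms for the topology given by word equations of fixed length. Together with
  \<open>word_fun_subst_inv\<close> this makes the closure of a subgroup a subgroup.\<close>

lemma word_fun_subst:
  assumes "word_fun B m f" and B: "B \<subseteq> carrier G" and a: "a \<in> B" and b: "b \<in> B" and ia: "inv a \<in> B" "inv b \<in> B"
  shows "word_fun B m (\<lambda>y. f (a \<otimes> y \<otimes> b))"
  using assms(1)
proof induction
  case (const c) then show ?case by (rule word_fun.const)
next
  case var then show ?case using word_fun.mult[OF word_fun.mult[OF word_fun.const[OF a] word_fun.var] word_fun.const[OF b]] by simp
next
  case var_inv
  have "word_fun B (0 + 1 + 0) (\<lambda>y. inv b \<otimes> inv y \<otimes> inv a)"
    by (intro word_fun.mult word_fun.const word_fun.var_inv ia)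
  then have "word_fun B 1 (\<lambda>y. inv b \<otimes> inv y \<otimes> inv a)" by simp
  then show ?case using a b B by (elim word_fun.agree) (auto simp: inv_mult_group m_assoc subset_iff)
next
  case (mult m f n h) then show ?case by (intro word_fun.mult)
next
  case (weaken m f n) then show ?case using word_fun.weaken by blast
next
  case (agree m f h) then show ?case using subsetD[OF B a] subsetD[OF B b] by (intro word_fun.agree[OF agree.IH]) auto
qed

lemma word_fun_subst_inv: "word_fun B m f \<Longrightarrow> word_fun B m (\<lambda>y. f (inv y))"
proof (induction rule: word_fun.induct)
  case var_inv then show ?case by (rule word_fun.agree[OF word_fun.var]) simp
next
  case (weaken m f n) then show ?case using word_fun.weaken by blast
next
  case (agree m f h) then show ?case by (intro word_fun.agree[OF agree.IH]) auto
qed (auto intro: word_fun.intros)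

lemma word_fun_comm:
  assumes "word_fun B m f" "word_fun B m h" and B: "subgroup B G"
  shows "word_fun B (4 * m) (\<lambda>z. comm (f z) (h z))"
proof -
  have "word_fun B (m + m + m + m) (\<lambda>z. inv (f z) \<otimes> inv (h z) \<otimes> f z \<otimes> h z)"
    by (intro word_fun.mult word_fun_inv assms)
  moreover have "m + m + m + m = 4 * m" by simp
  ultimately show ?thesis unfolding commutator_def by metis
qed

lemma word_fun_comm_var:
  assumes B: "subgroup B G" and x: "x \<in> B"
  shows "word_fun B 2 (\<lambda>y. comm x y)"
proof -
  have "word_fun B (0 + 1 + 0 + 1) (\<lambda>y. inv x \<otimes> inv y \<otimes> x \<otimes> y)"
    by (intro word_fun.intros x sub_closed(2)[OF B])
  then show ?thesis by (simp add: commutator_def numeral_2_eq_2)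
qed

text \<open>A strictly descending chain of solution sets of word equations yields a triangular list, so this
  is a bounded form of the noetherian property of the topology defined by such equations.\<close>

definition tri_bounded :: "'a set \<Rightarrow> nat \<Rightarrow> nat \<Rightarrow> bool" where
  "tri_bounded B m n \<longleftrightarrow> (\<forall>zs. (\<forall>(y, f) \<in> set zs. y \<in> B \<and> word_fun B m f) \<and> tri (\<lambda>y f. f y = \<one>) zs \<longrightarrow> length zs \<le> n)"

lemma tri_bounded_mono: "tri_bounded B m n \<Longrightarrow> C \<subseteq> B \<Longrightarrow> tri_bounded C m n"
  unfolding tri_bounded_def
proof (intro allI impI)
  fix zs assume a: "\<forall>zs. (\<forall>(y, f) \<in> set zs. y \<in> B \<and> word_fun B m f) \<and> tri (\<lambda>y f. f y = \<one>) zs \<longrightarrow> length zs \<le> n"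
    and C: "C \<subseteq> B" and z: "(\<forall>(y, f) \<in> set zs. y \<in> C \<and> word_fun C m f) \<and> tri (\<lambda>y f. f y = \<one>) zs"
  have "\<forall>(y, f) \<in> set zs. y \<in> B \<and> word_fun B m f" using z C word_fun_mono[OF _ C] by auto
  then show "length zs \<le> n" using a z by blast
qed

text \<open>A triangular list in \<open>C\<close> can be prolonged by \<open>(z, f)\<close>, since
  \<open>f\<close> vanishes on all of \<open>C\<close>. So passing to a proper closed subset lowers
  the bound by one, which drives the inductions in \<open>nilp_derived_values_trivial\<close> and
  \<open>baer\<close>.\<close>

lemma tri_bounded_proper:
  assumes tri_bounded: "tri_bounded B m n" and CB: "C \<subseteq> B" and f: "word_fun B m f" "\<And>c. c \<in> C \<Longrightarrow> f c = \<one>" and z: "z \<in> B" "f z \<noteq> \<one>"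
  shows "n > 0" "tri_bounded C m (n - 1)"
proof -
  have "Suc (length zs) \<le> n" if "\<forall>(y, f) \<in> set zs. y \<in> C \<and> word_fun C m f" "tri (\<lambda>y f. f y = \<one>) zs" for zs
  proof -
    have "\<forall>(y, f) \<in> set (zs @ [(z, f)]). y \<in> B \<and> word_fun B m f" using that(1) CB word_fun_mono[OF _ CB] f(1) z(1) by auto
    moreover have "tri (\<lambda>y f. f y = \<one>) (zs @ [(z, f)])"
      unfolding tri_append using that f(2) z(2) by auto
    ultimately have "length (zs @ [(z, f)]) \<le> n" using tri_bounded unfolding tri_bounded_def by blast
    then show ?thesis by simp
  qed
  note * = this
  show "n > 0" using *[of "[]"] by simp
  show "tri_bounded C m (n - 1)" unfolding tri_bounded_def using * by force
qed

lemma tri_bounded_0_trivial: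
  assumes "tri_bounded B m 0" "1 \<le> m" "B \<subseteq> carrier G"
  shows "B \<subseteq> {\<one>}"
proof
  fix y assume y: "y \<in> B"
  show "y \<in> {\<one>}"
  proof (rule ccontr)
    assume n: "y \<notin> {\<one>}"
    have "word_fun B m (\<lambda>y. y)" using word_fun.weaken[OF word_fun.var assms(2)] .
    then have "length [(y, \<lambda>y. y)] \<le> 0"
      using assms(1)[unfolded tri_bounded_def, rule_format, of "[(y, \<lambda>y. y)]"] y n by simp
    then show False by simp
  qed
qed

text \<open>An element \<open>x\<close> of the second centre gives a homomorphism \<open>y \<mapsto> [x, y]\<close> into the
  (abelian) centre, so the derived subgroup lies in the proper centraliser of \<open>x\<close>.\<close>

lemma nilp_derived_values_trivial:
  assumes "nilp U" "tri_bounded U 2 k"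
  shows "derived_values k U \<subseteq> {\<one>}"
  using assms
proof (induction k arbitrary: U)
  case 0
  then have "U \<subseteq> carrier G" using subgroup.subset unfolding nilp_def by auto
  then show ?case using tri_bounded_0_trivial[OF 0(2)] by simp
next
  case (Suc k)
  have U: "subgroup U G" using Suc.prems unfolding nilp_def by auto
  have UG: "U \<subseteq> carrier G" using subgroup.subset[OF U] .
  show ?case
  proof (cases "\<forall>x\<in>U. \<forall>y\<in>U. comm x y = \<one>")
    case True
    show ?thesis
    proof
      fix v assume "v \<in> derived_values (Suc k) U"
      then obtain a b where v: "v = comm a b" "a \<in> derived_values k U" "b \<in> derived_values k U" unfolding derived_values_Suc by blast
      then have "a \<in> U" "b \<in> U" using derived_values_sub[OF U] by auto
      then show "v \<in> {\<one>}" using True v(1) by simp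
    qed
  next
    case False
    define n where "n = (LEAST n. lcs U n = {\<one>})"
    have "\<exists>n. lcs U n = {\<one>}" using Suc.prems(1) unfolding nilp_def by simp
    then have n: "lcs U n = {\<one>}" unfolding n_def by (rule LeastI_ex)
    have least: "lcs U i \<noteq> {\<one>}" if "i < n" for i using not_less_Least[OF that[unfolded n_def]] .
    have "n \<noteq> 0"
    proof
      assume "n = 0"
      then have "U = {\<one>}" using n by simp
      then show False using False by simp
    qed
    moreover have "n \<noteq> 1"
    proof
      assume "n = 1"
      have "comm x y = \<one>" if "x \<in> U" "y \<in> U" for x y
      proof -
        have "comm x y \<in> lcs U (Suc 0)" using that by (intro comm_lcs) simp_all
        then show ?thesis using n \<open>n = 1\<close> by simp
      qed
      then show False using False by simp
    qed
    \<comment> \<open>\<open>U\<close> is not abelian, so its class is at least 2, and commutators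
      of elements of \<open>lcs U p\<close> with elements of \<open>U\<close> are central.\<close>
    ultimately obtain p where p: "n = Suc (Suc p)" by (metis One_nat_def not0_implies_Suc)
    have "\<exists>x\<in>lcs U p. \<exists>y\<in>U. comm x y \<noteq> \<one>"
    proof (rule ccontr)
      assume "\<not> (\<exists>x\<in>lcs U p. \<exists>y\<in>U. comm x y \<noteq> \<one>)"
      then have "lcs U (Suc p) \<subseteq> {\<one>}" unfolding lcs.simps
        by (intro gen_least triv_subgroup) auto
      then have "lcs U (Suc p) = {\<one>}" using subgroup.one_closed[OF normal_inD(1)[OF normal_in_lcs[OF U], of "Suc p"]] by auto
      then show False using least[of "Suc p"] p by simp
    qed
    then obtain x y0 where x: "x \<in> lcs U p" "y0 \<in> U" "comm x y0 \<noteq> \<one>" by auto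
    have xU: "x \<in> U" using x(1) normal_inD(3)[OF normal_in_lcs[OF U]] by auto
    have xG: "x \<in> carrier G" using xU UG by auto
    have central: "comm (comm x y) z = \<one>" if "y \<in> U" "z \<in> U" for y z
      using comm_lcs[OF comm_lcs[OF x(1) that(1)] that(2)] n p by simp
    let ?C = "{y \<in> U. comm x y \<in> {\<one>}}"
    have C: "subgroup ?C G" using centmod_subgroup[OF normal_in_trivial(1)[OF U] xU] .
    have cm: "comm x (y \<otimes> z) = comm x z \<otimes> comm x y" if "y \<in> U" "z \<in> U" for y z
    proof -
      have yz: "y \<in> carrier G" "z \<in> carrier G" using that UG by auto
      have "cj (comm x y) z = comm x y" using cj_eq_comm[of "comm x y" z] central[OF that] xG yz by simp
      then show ?thesis using comm_mult_right[OF xG yz] by simp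
    qed
    have derived: "comm a b \<in> ?C" if a: "a \<in> U" and b: "b \<in> U" for a b
    proof -
      have ab: "a \<in> carrier G" "b \<in> carrier G" using that UG by auto
      have t: "comm a b \<in> U" using sub_closed(4)[OF U a b] .
      have xa: "comm x a \<in> U" "comm x b \<in> U" using sub_closed(4)[OF U xU] a b by auto
      have "comm x b \<otimes> comm x a = comm x a \<otimes> comm x b"
      proof -
        have "comm (comm x a) (comm x b) = \<one>" using central[OF a xa(2)] .
        then have "cj (comm x a) (comm x b) = comm x a" using cj_eq_comm[of "comm x a" "comm x b"] xG ab by simp
        then show ?thesis using xG ab by (simp add: cj_def m_assoc) (metis comm_closed inv_cancel(2) m_closed)
      qed
      then have "comm x (a \<otimes> b) = comm x (b \<otimes> a)" using cm a b by simp
      also have "a \<otimes> b = b \<otimes> a \<otimes> comm a b" using ab by (simp add: word)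
      also have "comm x (b \<otimes> a \<otimes> comm a b) = comm x (comm a b) \<otimes> comm x (b \<otimes> a)"
        using cm[OF sub_closed(1)[OF U b a] t] .
      finally have "comm x (comm a b) \<otimes> comm x (b \<otimes> a) = \<one> \<otimes> comm x (b \<otimes> a)" using xG ab by simp
      then have "comm x (comm a b) = \<one>" using xG ab by (metis comm_closed m_closed one_closed r_cancel)
      then show ?thesis using t by simp
    qed
    \<comment> \<open>The centraliser of \<open>x\<close> is cut out by the word
      \<open>comm x y\<close>, in which \<open>y\<close> occurs twice, and \<open>y0\<close> lies
      outside it.\<close>
    have "tri_bounded ?C 2 (Suc k - 1)"
      by (rule tri_bounded_proper(2)[OF Suc.prems(2) _ word_fun_comm_var[OF U xU] _ x(2,3)]) auto
    moreover have "nilp ?C" using nilp_mono[OF Suc.prems(1) _ C] by auto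
    ultimately have "derived_values k ?C \<subseteq> {\<one>}" using Suc.IH by simp
    then show ?thesis using derived_values_shift[of U ?C k] derived by auto
  qed
qed

lemma delta_cong: "(\<And>i. i < 2 ^ k \<Longrightarrow> y i = z i) \<Longrightarrow> delta k y = delta k z"
proof (induction k arbitrary: y z)
  case (Suc k)
  have "delta k (\<lambda>i. y (2 * i)) = delta k (\<lambda>i. z (2 * i))" by (rule Suc.IH) (use Suc.prems in auto)
  moreover have "delta k (\<lambda>i. y (2 * i + 1)) = delta k (\<lambda>i. z (2 * i + 1))" by (rule Suc.IH) (use Suc.prems in auto)
  ultimately show ?case by simp
qed simp

text \<open>A single value involves \<open>2 ^ k\<close> arguments and hence takes place in a
  finitely generated nilpotent subgroup; \<open>k\<close> does not depend on the class of that
  subgroup.\<close>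

lemma lnilp_derived_values_trivial:
  assumes U: "lnilp U" and tri_bounded: "tri_bounded U 2 k"
  shows "derived_values k U \<subseteq> {\<one>}"
proof
  fix v assume "v \<in> derived_values k U"
  then obtain y where y: "v = delta k y" "range y \<subseteq> U" unfolding derived_values_def by auto
  let ?S = "y ` {..<2 ^ k}"
  let ?z = "\<lambda>i. if i < 2 ^ k then y i else \<one>"
  have SU: "?S \<subseteq> U" using y by auto
  have "nilp (generate G ?S)" using U SU unfolding lnilp_def by blast
  moreover have "generate G ?S \<subseteq> U" using gen_least[OF lnilp_sub(1)[OF U] SU] .
  ultimately have d: "derived_values k (generate G ?S) \<subseteq> {\<one>}" using nilp_derived_values_trivial tri_bounded_mono[OF tri_bounded] by auto
  have "range ?z \<subseteq> generate G ?S" by (auto intro: generate.one generate.incl)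
  moreover have "v = delta k ?z" unfolding y(1) by (rule delta_cong) simp
  ultimately have "v \<in> derived_values k (generate G ?S)" unfolding derived_values_def by blast
  then show "v \<in> {\<one>}" using d by auto
qed

text \<open>\<open>word_fun_comm\<close> allows the variable in both entries of a commutator, each
  of which is written twice, hence the factor 4 per level. The index \<open>j\<close> belongs to the
  half given by its parity and reappears there as \<open>j div 2\<close>; the other half is
  constant.\<close>

lemma word_fun_delta:
  assumes B: "subgroup B G"
  shows "range y \<subseteq> B \<Longrightarrow> word_fun B (4 ^ k) (\<lambda>z. delta k (y(j := z)))"
proof (induction k arbitrary: y j)
  case 0
  show ?case
  proof (cases "j = 0")
    case True then show ?thesis using word_fun.var by simp
  next
    case False then show ?thesis using 0 by (auto intro!: word_fun.weaken[OF word_fun.const])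
  qed
next
  case (Suc k)
  have half: "word_fun B (4 ^ k) (\<lambda>z. delta k (\<lambda>i. (y(j := z)) (2 * i + e)))" if e: "e < 2" for e
  proof (cases "j mod 2 = e")
    case True
    then have eq: "(\<lambda>i. (y(j := z)) (2 * i + e)) = (\<lambda>i. y (2 * i + e))(j div 2 := z)" for z
      using e by (auto simp: fun_eq_iff)
    have "range (\<lambda>i. y (2 * i + e)) \<subseteq> B" using Suc.prems by auto
    show ?thesis unfolding eq by (rule Suc.IH) fact
  next
    case False
    then have "(\<lambda>i. (y(j := z)) (2 * i + e)) = (\<lambda>i. y (2 * i + e))" for z
      using e by (auto simp: fun_eq_iff)
    moreover have "delta k (\<lambda>i. y (2 * i + e)) \<in> B"
    proof -
      have "delta k (\<lambda>i. y (2 * i + e)) \<in> derived_values k B" unfolding derived_values_def using Suc.prems by auto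
      then show ?thesis using derived_values_sub[OF B] by auto
    qed
    ultimately show ?thesis by (auto intro!: word_fun.weaken[OF word_fun.const])
  qed
  have "word_fun B (4 * 4 ^ k) (\<lambda>z. comm (delta k (\<lambda>i. (y(j := z)) (2 * i + 0)))
      (delta k (\<lambda>i. (y(j := z)) (2 * i + 1))))"
    by (rule word_fun_comm[OF half half B]) simp_all
  then show ?case by (simp only: delta.simps power_Suc add_0_right)
qed

text \<open>The closure of \<open>W\<close> in that topology.\<close>

definition word_closure :: "nat \<Rightarrow> 'a set \<Rightarrow> 'a set \<Rightarrow> 'a set" where
  "word_closure m B W = {y \<in> B. \<forall>f. word_fun B m f \<longrightarrow> (\<forall>w\<in>W. f w = \<one>) \<longrightarrow> f y = \<one>}"

lemma word_closure_mono: "W \<subseteq> W' \<Longrightarrow> word_closure m B W \<subseteq> word_closure m B W'"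
  unfolding word_closure_def by auto

lemma word_closure_ext: "W \<subseteq> B \<Longrightarrow> W \<subseteq> word_closure m B W" unfolding word_closure_def by auto

text \<open>Multiplication is used only as a separately continuous map, so products are treated in
  two rounds: \<open>w \<otimes> b\<close> with \<open>w\<close> in \<open>U\<close> and
  \<open>b\<close> in the closure, by density in the second factor, then
  \<open>a \<otimes> b\<close> by density in the first.\<close>

lemma word_closure_subgroup:
  assumes B: "subgroup B G" and U: "subgroup U G" and UB: "U \<subseteq> B"
  shows "subgroup (word_closure m B U) G"
proof (rule subgroupI)
  have BG: "B \<subseteq> carrier G" using subgroup.subset[OF B] .
  have sub: "word_fun B m (\<lambda>y. f (a \<otimes> y))" "word_fun B m (\<lambda>y. f (y \<otimes> a))" if f: "word_fun B m f" and a: "a \<in> B" for f a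
  proof -
    have 1: "\<one> \<in> B" "inv a \<in> B" using subgroup.one_closed[OF B] sub_closed(2)[OF B a] by auto
    have aG: "a \<in> carrier G" using a BG by auto
    show "word_fun B m (\<lambda>y. f (a \<otimes> y))"
      using word_fun.agree[OF word_fun_subst[OF f BG a 1(1) 1(2)], of "\<lambda>y. f (a \<otimes> y)"] 1 aG by simp
    show "word_fun B m (\<lambda>y. f (y \<otimes> a))"
      using word_fun.agree[OF word_fun_subst[OF f BG 1(1) a _ 1(2)], of "\<lambda>y. f (y \<otimes> a)"] 1 aG by simp
  qed
  show "word_closure m B U \<subseteq> carrier G" unfolding word_closure_def using BG by auto
  show "word_closure m B U \<noteq> {}" using word_closure_ext[OF UB] subgroup.one_closed[OF U] by auto
  fix a assume a: "a \<in> word_closure m B U"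
  then have aB: "a \<in> B" unfolding word_closure_def by auto
  have "f (inv a) = \<one>" if "word_fun B m f" "\<forall>w\<in>U. f w = \<one>" for f
    using a word_fun_subst_inv[OF that(1)] that(2) sub_closed(2)[OF U] unfolding word_closure_def by auto
  then show "inv a \<in> word_closure m B U" unfolding word_closure_def using sub_closed(2)[OF B aB] by auto
  fix b assume b: "b \<in> word_closure m B U"
  then have bB: "b \<in> B" unfolding word_closure_def by auto
  have "f (a \<otimes> b) = \<one>" if f: "word_fun B m f" "\<forall>w\<in>U. f w = \<one>" for f
  proof -
    have "f (w \<otimes> b) = \<one>" if w: "w \<in> U" for w
    proof -
      have "\<forall>w'\<in>U. f (w \<otimes> w') = \<one>" using f(2) sub_closed(1)[OF U w] by auto
      moreover have "word_fun B m (\<lambda>y. f (w \<otimes> y))" using sub(1)[OF f(1)] w UB by auto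
      ultimately show ?thesis using b unfolding word_closure_def by auto
    qed
    then show ?thesis using a sub(2)[OF f(1) bB] unfolding word_closure_def by auto
  qed
  then show "a \<otimes> b \<in> word_closure m B U" unfolding word_closure_def using sub_closed(1)[OF B aB bB] by auto
qed

lemma word_closure_cj:
  assumes B: "subgroup B G" and b: "b \<in> B" and W: "W \<subseteq> B" and x: "x \<in> word_closure m B W"
  shows "cj x b \<in> word_closure m B ((\<lambda>w. cj w b) ` W)"
proof -
  have BG: "B \<subseteq> carrier G" using subgroup.subset[OF B] .
  have ib: "inv b \<in> B" "inv (inv b) \<in> B" using sub_closed(2)[OF B b] b BG by auto
  have "f (cj x b) = \<one>" if f: "word_fun B m f" "\<forall>w\<in>(\<lambda>w. cj w b) ` W. f w = \<one>" for f
  proof -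
    have "word_fun B m (\<lambda>y. f (cj y b))" unfolding cj_def by (rule word_fun_subst[OF f(1) BG ib(1) b ib(2,1)])
    then show ?thesis using x f(2) unfolding word_closure_def by auto
  qed
  moreover have "cj x b \<in> B" using x b sub_closed(3)[OF B] unfolding word_closure_def by auto
  ultimately show ?thesis unfolding word_closure_def by auto
qed

text \<open>Variables of the word \<open>delta k\<close> are moved from \<open>U\<close> to the closure of \<open>U\<close> one at a time.\<close>

lemma dense_derived_values_trivial:
  assumes B: "subgroup B G" and UB: "U \<subseteq> B" and dense: "B \<subseteq> word_closure (4 ^ k) B U" and d: "derived_values k U \<subseteq> {\<one>}"
    and one: "\<one> \<in> U"
  shows "derived_values k B \<subseteq> {\<one>}"
proof
  have P: "delta k y = \<one>" if "range y \<subseteq> B" "\<And>i. i \<ge> j \<Longrightarrow> y i \<in> U" for j y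
    using that
  proof (induction j arbitrary: y)
    case 0
    then have "delta k y \<in> derived_values k U" unfolding derived_values_def by auto
    then show ?case using d by auto
  next
    case (Suc j)
    have 1: "delta k (y(j := z)) = \<one>" if "z \<in> U" for z
    proof (rule Suc.IH)
      show "range (y(j := z)) \<subseteq> B" using Suc.prems(1) that UB by auto
      show "(y(j := z)) i \<in> U" if "i \<ge> j" for i using that \<open>z \<in> U\<close> Suc.prems(2)[of i] by auto
    qed
    have "y j \<in> word_closure (4 ^ k) B U" using Suc.prems(1) dense by auto
    then have *: "word_fun B (4 ^ k) f \<Longrightarrow> \<forall>w\<in>U. f w = \<one> \<Longrightarrow> f (y j) = \<one>" for f unfolding word_closure_def by blast
    have "(\<lambda>z. delta k (y(j := z))) (y j) = \<one>" by (rule *[OF word_fun_delta[OF B Suc.prems(1)]]) (use 1 in blast)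
    then show ?case by simp
  qed
  fix v assume "v \<in> derived_values k B"
  then obtain y where y: "range y \<subseteq> B" "v = delta k y" unfolding derived_values_def by auto
  let ?z = "\<lambda>i. if i < 2 ^ k then y i else \<one>"
  have "v = delta k ?z" unfolding y(2) by (rule delta_cong) simp
  also have "\<dots> = \<one>" by (rule P[of _ "2 ^ k"]) (use y(1) one UB in auto)
  finally show "v \<in> {\<one>}" by simp
qed

text \<open>The normaliser condition of nilpotent groups, for an invariant set \<open>Y\<close> in
  place of the whole group. The subgroups \<open>?K j\<close> generated by
  \<open>W \<inter> F\<close> and \<open>lcs F j\<close> descend from \<open>F\<close> to
  \<open>W \<inter> F\<close>, each normal in the preceding one. If \<open>Y \<inter> ?K j\<close>
  leaves \<open>W\<close> but \<open>Y \<inter> ?K (Suc j)\<close> does not, any element of the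
  former outside \<open>W\<close> will do.\<close>

lemma nilp_normalizer_condition:
  assumes F: "nilp F" and Y: "Y \<subseteq> F" "\<And>y b. y \<in> Y \<Longrightarrow> b \<in> F \<Longrightarrow> cj y b \<in> Y"
    and W: "subgroup W G" and YW: "\<not> Y \<subseteq> W"
  shows "\<exists>u\<in>Y - W. \<forall>t\<in>Y \<inter> W. cj t u \<in> W \<and> cj t (inv u) \<in> W"
proof -
  have Fs: "subgroup F G" using F unfolding nilp_def by auto
  have FG: "F \<subseteq> carrier G" using subgroup.subset[OF Fs] .
  obtain c where c: "lcs F c = {\<one>}" using F unfolding nilp_def by auto
  have WF: "subgroup (W \<inter> F) G" using subgroups_Inter_pair[OF W Fs] .
  let ?K = "\<lambda>j. generate G (W \<inter> F \<union> lcs F j)"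
  have l: "normal_in (lcs F j) F" for j using normal_in_lcs[OF Fs] .
  have UF: "W \<inter> F \<union> lcs F j \<subseteq> F" for j using normal_inD(3)[OF l] by auto
  have UG: "W \<inter> F \<union> lcs F j \<subseteq> carrier G" for j using UF FG by (meson subset_trans)
  have inK: "x \<in> ?K j" if "x \<in> W \<inter> F \<or> x \<in> lcs F j" for x j using that by (intro gen_in) auto
  have Ks: "subgroup (?K j) G" for j using gen_sub[OF UG] .
  have nK: "normal_in (?K (Suc j)) (?K j)" for j
  proof (rule normal_in_genI[OF UG UG mono_generate])
    show "W \<inter> F \<union> lcs F (Suc j) \<subseteq> W \<inter> F \<union> lcs F j" using lcs_Suc_subset[OF Fs] by auto
    fix s t assume s: "s \<in> W \<inter> F \<union> lcs F (Suc j)" and t: "t \<in> W \<inter> F \<union> lcs F j"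
    have 1: "cj s t' \<in> ?K (Suc j)" if t': "t' \<in> W \<inter> F \<union> lcs F j" for t'
    proof -
      have tF: "t' \<in> F" "t' \<in> carrier G" using t' UF[of j] UG[of j] by auto
      consider "s \<in> lcs F (Suc j)" | "s \<in> W \<inter> F" "t' \<in> W \<inter> F" | "s \<in> W \<inter> F" "t' \<in> lcs F j"
        using s t' by auto
      then show ?thesis
      proof cases
        case 1 then show ?thesis using normal_inD(4)[OF l tF(1)] inK by auto
      next
        case 2 then show ?thesis using sub_closed(3)[OF WF] inK by auto
      next
        case 3
        then have sG: "s \<in> carrier G" using FG by auto
        have "comm t' s \<in> lcs F (Suc j)" using 3 by (intro comm_lcs) auto
        then have "comm s t' \<in> ?K (Suc j)"
          using comm_swap[OF sG tF(2)] sub_closed(2)[OF normal_inD(1)[OF l]] inK by auto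
        then show ?thesis
          using cj_eq_comm[OF sG tF(2)] sub_closed(1)[OF Ks inK] 3(1) by auto
      qed
    qed
    have "inv t \<in> W \<inter> F \<union> lcs F j"
      using t sub_closed(2)[OF WF] sub_closed(2)[OF normal_inD(1)[OF l]] by auto
    then show "cj s t \<in> ?K (Suc j) \<and> cj s (inv t) \<in> ?K (Suc j)" using 1 t by blast
  qed
  have "?K 0 = F" using gen_self[OF Fs] by (simp add: Un_absorb1)
  then have K0: "\<not> Y \<inter> ?K 0 \<subseteq> W" using Y(1) YW by auto
  have "W \<inter> F \<union> {\<one>} = W \<inter> F" using subgroup.one_closed[OF WF] by auto
  then have "?K c = W \<inter> F" using c gen_self[OF WF] by simp
  then have Kc: "Y \<inter> ?K c \<subseteq> W" by auto
  have "\<exists>j. \<not> Y \<inter> ?K j \<subseteq> W \<and> Y \<inter> ?K (Suc j) \<subseteq> W"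
  proof (rule ccontr)
    assume *: "\<not> ?thesis"
    have "\<not> Y \<inter> ?K j \<subseteq> W" for j by (induction j) (use K0 * in blast)+
    then show False using Kc by blast
  qed
  then obtain j where j: "\<not> Y \<inter> ?K j \<subseteq> W" "Y \<inter> ?K (Suc j) \<subseteq> W" by auto
  then obtain u where u: "u \<in> Y" "u \<in> ?K j" "u \<notin> W" by auto
  have "cj t u' \<in> W" if t: "t \<in> Y \<inter> W" and u': "u' \<in> ?K j" "u' \<in> F" for t u'
  proof -
    have "t \<in> ?K (Suc j)" using t Y(1) inK by auto
    then have "cj t u' \<in> ?K (Suc j)" using normal_inD(4)[OF nK u'(1)] by auto
    then show ?thesis using j(2) Y(2) t u'(2) by auto
  qed
  moreover have "inv u \<in> ?K j" "inv u \<in> F" using sub_closed(2)[OF Ks u(2)] sub_closed(2)[OF Fs] u Y(1) by auto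
  ultimately show ?thesis using u Y(1) by (intro bexI[of _ u]) auto
qed

text \<open>Local nilpotency speaks only about finite sets, while \<open>T\<close> may be infinite.
  So the normaliser condition is applied in the nilpotent subgroup generated by \<open>v\<close> and
  the finite set \<open>S\<close>, which is dense in \<open>T\<close>: an element of
  \<open>B\<close> conjugating \<open>S\<close> into \<open>T\<close> conjugates the closure of
  \<open>S\<close> into the closure of \<open>T\<close>, and \<open>T\<close> is closed in
  \<open>Xs\<close>.\<close>

lemma normalizing_element:
  assumes B: "subgroup B G" and Xs: "Xs \<subseteq> B" "\<And>x b. x \<in> Xs \<Longrightarrow> b \<in> B \<Longrightarrow> cj x b \<in> Xs"
    and T1: "T1 \<subseteq> Xs" "lnilp (generate G T1)" "Xs \<inter> generate G T1 \<subseteq> T1"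
    and T: "T \<subseteq> T1" "T \<noteq> T1" "Xs \<inter> generate G T \<subseteq> T" "Xs \<inter> word_closure m B T \<subseteq> T"
    and S: "finite S" "S \<subseteq> T" "T \<subseteq> word_closure m B S"
  shows "\<exists>u\<in>T1 - T. u \<in> normalizer_in T"
proof -
  have BG: "B \<subseteq> carrier G" using subgroup.subset[OF B] .
  obtain v where v: "v \<in> T1" "v \<notin> T" using T by auto
  let ?F = "generate G (insert v S)"
  have I: "insert v S \<subseteq> T1" using v S T by auto
  have F1: "?F \<subseteq> generate G T1" using mono_generate[OF I] .
  have FB: "?F \<subseteq> B" using I T1(1) Xs(1) by (intro gen_least[OF B]) auto
  have "insert v S \<subseteq> generate G T1" using I gen_in by auto
  then have F: "nilp ?F" using T1(2) S(1) unfolding lnilp_def by simp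
  have Fs: "subgroup ?F G" using F unfolding nilp_def by auto
  have TG: "T \<subseteq> carrier G" using T(1) T1(1) Xs(1) BG by auto
  have W: "subgroup (generate G T) G" using gen_sub[OF TG] .
  have "\<exists>u\<in>Xs \<inter> ?F - generate G T. \<forall>t\<in>Xs \<inter> ?F \<inter> generate G T. cj t u \<in> generate G T \<and> cj t (inv u) \<in> generate G T"
  proof (rule nilp_normalizer_condition[OF F _ _ W])
    show "cj y b \<in> Xs \<inter> ?F" if "y \<in> Xs \<inter> ?F" "b \<in> ?F" for y b
      using that Xs(2) FB sub_closed(3)[OF Fs] by auto
    have "v \<in> Xs \<inter> ?F" using v T1(1) gen_in[of v "insert v S"] by auto
    moreover have "v \<notin> generate G T" using v T1(1) T(3) by auto
    ultimately show "\<not> Xs \<inter> ?F \<subseteq> generate G T" by auto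
  qed auto
  then obtain u where u: "u \<in> Xs" "u \<in> ?F" "u \<notin> generate G T"
    "\<And>t. t \<in> Xs \<inter> ?F \<inter> generate G T \<Longrightarrow> cj t u \<in> generate G T \<and> cj t (inv u) \<in> generate G T" by auto
  have uT: "u \<in> T1 - T" using u F1 T1(3) gen_in[of u T] by auto
  have uB: "u \<in> B" using u Xs by auto
  have conj: "cj t w \<in> T" if t: "t \<in> T" and w: "w \<in> B" and ws: "\<And>s. s \<in> S \<Longrightarrow> cj s w \<in> generate G T" for t w
  proof -
    have SX: "S \<subseteq> Xs" using S T T1 by auto
    have "cj s w \<in> T" if "s \<in> S" for s
    proof -
      have "cj s w \<in> Xs \<inter> generate G T" using ws[OF that] Xs(2)[OF _ w] SX that by auto
      then show ?thesis using T(3) by auto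
    qed
    then have "(\<lambda>s. cj s w) ` S \<subseteq> T" by auto
    then have "word_closure m B ((\<lambda>s. cj s w) ` S) \<subseteq> word_closure m B T" by (rule word_closure_mono)
    moreover have "cj t w \<in> word_closure m B ((\<lambda>s. cj s w) ` S)" using word_closure_cj[OF B w _ subsetD[OF S(3) t]] SX Xs(1) by auto
    ultimately show ?thesis using T(4) Xs(2)[OF _ w, of t] t T(1) T1(1) by auto
  qed
  have "s \<in> Xs \<inter> ?F \<inter> generate G T" if "s \<in> S" for s
    using that S(2) T(1) T1(1) gen_in[of s "insert v S"] gen_in[of s T] by auto
  then have "cj t u \<in> T \<and> cj t (inv u) \<in> T" if "t \<in> T" for t
    using conj[OF that uB] conj[OF that sub_closed(2)[OF B uB]] u(4) by auto
  then have "u \<in> normalizer_in T" unfolding normalizer_in_def using uB BG by auto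
  then show ?thesis using uT by auto
qed

text \<open>Baer's argument: two maximal locally nilpotent subgroups generated by Engel elements and
  conjugate to each other are chosen with an intersection supporting a triangular list of maximal
  length; this replaces the maximal condition on subgroups.\<close>

theorem baer:
  assumes "subgroup B G" "tri_bounded B 2 k" "tri_bounded B (4 ^ k) n"
  shows "nil_in B \<subseteq> HP_in B"
  using assms
proof (induction n arbitrary: B rule: less_induct)
  case (less n)
  note B = less.prems(1)
  have BG: "B \<subseteq> carrier G" using subgroup.subset[OF B] .
  define Xs where "Xs = nil_in B"
  let ?m = "4 ^ k :: nat"
  have XB: "Xs \<subseteq> B" unfolding Xs_def by (rule nil_in_sub)
  have Xcj: "cj x b \<in> Xs" if "x \<in> Xs" "b \<in> B" for x b using nil_in_cj[OF B] that unfolding Xs_def by auto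
  have XG: "Xs \<subseteq> carrier G" using XB BG by auto
  define TT where "TT = {T. T \<subseteq> Xs \<and> lnilp (generate G T)}"
  have TT: "T \<subseteq> Xs" "lnilp (generate G T)" if "T \<in> TT" for T using that unfolding TT_def by auto
  show ?case
  proof (rule ccontr)
    assume not: "\<not> nil_in B \<subseteq> HP_in B"
    have "\<exists>M\<in>TT. \<forall>T\<in>TT. M \<subseteq> T \<longrightarrow> T = M"
    proof (rule subset_Zorn_nonempty)
      have "generate G {} \<subseteq> {\<one>}" by (intro gen_least triv_subgroup) simp
      then have "lnilp (generate G {})" using lnilp_mono[OF normal_in_trivial(2)[OF B]] gen_sub[of "{}"] by auto
      then show "TT \<noteq> {}" unfolding TT_def by auto
      fix C assume C: "C \<noteq> {}" "subset.chain TT C"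
      then have CT: "T \<in> TT" if "T \<in> C" for T using that unfolding subset.chain_def by auto
      have UX: "\<Union>C \<subseteq> Xs" using CT TT(1) by auto
      moreover have "lnilp (generate G (\<Union>C))"
        unfolding lnilp_def
      proof (intro conjI allI impI gen_sub)
        show "\<Union>C \<subseteq> carrier G" using UX XG by auto
        fix S assume S: "finite S \<and> S \<subseteq> generate G (\<Union>C)"
        then obtain F where F: "finite F" "F \<subseteq> \<Union>C" "S \<subseteq> generate G F" using gen_finite_support_set[of S "\<Union>C"] S by auto
        obtain T where T: "T \<in> C" "F \<subseteq> T" using finite_subset_Union_chain[OF F(1,2) C] by auto
        have "S \<subseteq> generate G T" using F(3) mono_generate[OF T(2)] by auto
        then show "nilp (generate G S)" using TT(2)[OF CT[OF T(1)]] S unfolding lnilp_def by auto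
      qed
      ultimately show "\<Union>C \<in> TT" unfolding TT_def by auto
    qed
    \<comment> \<open>A maximal set of nil-elements generating a locally nilpotent subgroup. Working
      with sets of nil-elements rather than with subgroups ensures that every new element to be
      adjoined is an Engel element.\<close>
    then obtain T0 where T0: "T0 \<in> TT" and max: "\<And>T. T \<in> TT \<Longrightarrow> T0 \<subseteq> T \<Longrightarrow> T = T0" by auto
    let ?U = "generate G T0"
    have T0X: "T0 \<subseteq> Xs" and lU: "lnilp ?U" using TT[OF T0] by auto
    have Us: "subgroup ?U G" and UG: "?U \<subseteq> carrier G" using lnilp_sub[OF lU] by auto
    have UB: "?U \<subseteq> B" using T0X XB by (intro gen_least[OF B]) auto
    have T0U: "T0 \<subseteq> ?U" using gen_in by auto
    have TT_intro: "T \<in> TT" if "T \<subseteq> Xs" "T \<subseteq> H" "lnilp H" for T H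
    proof -
      have "generate G T \<subseteq> H" using gen_least[OF lnilp_sub(1)[OF that(3)] that(2)] .
      then have "lnilp (generate G T)" using lnilp_mono[OF that(3)] gen_sub[of T] that(1) XG by auto
      then show ?thesis using that(1) unfolding TT_def by auto
    qed
    have XU: "Xs \<inter> ?U = T0"
      using max[OF TT_intro[of "Xs \<inter> ?U" ?U]] lU T0X T0U by auto
    \<comment> \<open>A nil-element normalising \<open>?U\<close> can be adjoined to it by
      \<open>lnilp_adjoin_engel\<close>, so by maximality it already belongs to
      \<open>T0\<close>.\<close>
    have nzU: "v \<in> T0" if v: "v \<in> Xs" "v \<in> normalizer_in ?U" for v
    proof -
      have "\<exists>n. engel G n a v = \<one>" if "a \<in> ?U" for a using v(1) that UB unfolding Xs_def nil_in_def by auto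
      then have l: "lnilp (generate G (insert v ?U))" using lnilp_adjoin_engel[OF lU v(2)] by auto
      have "insert v T0 \<subseteq> generate G (insert v ?U)" using T0U gen_in[of _ "insert v ?U"] by auto
      then have "insert v T0 \<in> TT" using TT_intro[OF _ _ l] v(1) T0X by auto
      then show ?thesis using max by auto
    qed
    let ?D = "word_closure ?m B ?U"
    have Ds: "subgroup ?D G" using word_closure_subgroup[OF B Us UB] .
    have UD: "?U \<subseteq> ?D" using word_closure_ext[OF UB] .
    have DB: "?D \<subseteq> B" unfolding word_closure_def by auto
    \<comment> \<open>If \<open>?U\<close> were dense in \<open>B\<close>, the derived word of level
      \<open>k\<close> would vanish on \<open>B\<close> as it does on \<open>?U\<close>, and
      \<open>gruenberg\<close> with trivial \<open>H\<close> would give the claim. So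
      \<open>?D\<close> is proper and the induction hypothesis applies to it with a smaller
      \<open>n\<close>.\<close>
    have "\<not> B \<subseteq> ?D"
    proof
      assume BD: "B \<subseteq> ?D"
      have "derived_values k ?U \<subseteq> {\<one>}" using lnilp_derived_values_trivial[OF lU tri_bounded_mono[OF less.prems(2) UB]] .
      then have "derived_values k B \<subseteq> {\<one>}" using dense_derived_values_trivial[OF B UB BD] subgroup.one_closed[OF Us] by auto
      then have "nil_in B \<subseteq> HP_in B" using gruenberg[OF normal_in_trivial[OF B]] by auto
      then show False using not by simp
    qed
    then obtain z f where z: "z \<in> B" and f: "word_fun B ?m f" "\<forall>w\<in>?U. f w = \<one>" "f z \<noteq> \<one>" unfolding word_closure_def by auto
    have fD: "f d = \<one>" if "d \<in> ?D" for d using that f unfolding word_closure_def by auto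
    have n: "n > 0" "tri_bounded ?D ?m (n - 1)" using tri_bounded_proper[OF less.prems(3) DB f(1) fD z f(3)] by auto
    have XDn: "Xs \<inter> ?D \<subseteq> nil_in ?D" using nil_in_mono[OF DB] unfolding Xs_def .
    have "nil_in ?D \<subseteq> HP_in ?D" using less.IH[of "n - 1" ?D] n Ds tri_bounded_mono[OF less.prems(2) DB] by auto
    then have "Xs \<inter> ?D \<in> TT" using TT_intro[OF _ _ HP_in_props(2)[OF Ds], of "Xs \<inter> ?D"] XDn by auto
    \<comment> \<open>\<open>T0\<close> is thus closed in \<open>Xs\<close>: by induction the
      nil-elements in the closure of \<open>?U\<close> generate a locally nilpotent subgroup, and
      \<open>T0\<close> is maximal.\<close>
    then have XD: "Xs \<inter> ?D = T0" using max[of "Xs \<inter> ?D"] T0X T0U UD by auto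
    have TTcj: "(\<lambda>t. cj t b) ` T \<in> TT" if T: "T \<in> TT" and b: "b \<in> B" for T b
    proof (rule TT_intro)
      show "lnilp ((\<lambda>t. cj t b) ` generate G T)" using lnilp_cj[OF TT(2)[OF T]] b BG by auto
      show "(\<lambda>t. cj t b) ` T \<subseteq> (\<lambda>t. cj t b) ` generate G T" using gen_in by auto
      show "(\<lambda>t. cj t b) ` T \<subseteq> Xs" using TT(1)[OF T] Xcj b by auto
    qed
    let ?T = "\<lambda>y. (\<lambda>t. cj t y) ` T0"
    have iB: "inv y \<in> B" "y \<in> carrier G" if "y \<in> B" for y using sub_closed(2)[OF B that] that BG by auto
    have preim: "x \<in> ?T y" if "y \<in> B" "x \<in> carrier G" "cj x (inv y) \<in> T0" for x y
    proof -
      have "x = cj (cj x (inv y)) y" using that iB by simp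
      then show ?thesis using that(3) by blast
    qed
    have T_gen: "Xs \<inter> generate G (?T y) \<subseteq> ?T y" if y: "y \<in> B" for y
    proof
      fix x assume x: "x \<in> Xs \<inter> generate G (?T y)"
      have "subgroup ((\<lambda>t. cj t y) ` ?U) G" using lnilp_sub(1)[OF lnilp_cj[OF lU]] iB y by auto
      moreover have "?T y \<subseteq> (\<lambda>t. cj t y) ` ?U" using T0U by auto
      ultimately have "x \<in> (\<lambda>t. cj t y) ` ?U" using gen_least x by blast
      then obtain x' where x': "x = cj x' y" "x' \<in> ?U" by auto
      then have "x' = cj x (inv y)" using UG iB y by auto
      moreover have "cj x (inv y) \<in> Xs" using x Xcj iB y by auto
      ultimately have "x' \<in> T0" using XU x'(2) by auto
      then show "x \<in> ?T y" using x'(1) by auto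
    qed
    have T_max: "T = ?T y" if y: "y \<in> B" and T: "T \<in> TT" "?T y \<subseteq> T" for y T
    proof -
      have "t \<in> (\<lambda>t. cj t (inv y)) ` T" if "t \<in> T0" for t
      proof -
        have "cj (cj t y) (inv y) = t" using that T0X XG iB y by auto
        moreover have "cj t y \<in> T" using that T(2) by auto
        ultimately show ?thesis by (metis imageI)
      qed
      then have "(\<lambda>t. cj t (inv y)) ` T = T0" using max[OF TTcj[OF T(1)], of "inv y"] iB y by auto
      then have "T \<subseteq> ?T y" using preim[OF y] TT(1)[OF T(1)] XG by auto
      then show ?thesis using T(2) by auto
    qed
    have T_word_closure: "Xs \<inter> word_closure ?m B (?T y) \<subseteq> ?T y" if y: "y \<in> B" for y
    proof
      fix x assume x: "x \<in> Xs \<inter> word_closure ?m B (?T y)"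
      have TyB: "?T y \<subseteq> B" using TT(1)[OF TTcj[OF T0 y]] XB by auto
      have im: "(\<lambda>t. cj t (inv y)) ` ?T y = T0" using T0X XG iB[OF y] by (force simp: image_image)
      have "cj x (inv y) \<in> word_closure ?m B ((\<lambda>t. cj t (inv y)) ` ?T y)"
        using word_closure_cj[OF B iB(1)[OF y] TyB] x by auto
      then have "cj x (inv y) \<in> ?D" unfolding im using word_closure_mono[OF T0U] by auto
      moreover have "cj x (inv y) \<in> Xs" using x Xcj iB y by auto
      ultimately have "cj x (inv y) \<in> T0" using XD by auto
      then show "x \<in> ?T y" using preim[OF y] x XG by auto
    qed
    have T_normalizer_in: "y \<in> normalizer_in ?U" if y: "y \<in> B" and eq: "?T y = T0" for y
    proof -
      have T0G: "T0 \<subseteq> carrier G" using T0X XG by auto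
      have 1: "cj t y \<in> ?U" if "t \<in> T0" for t using that eq T0U by auto
      have 2: "cj t (inv y) \<in> ?U" if t: "t \<in> T0" for t
      proof -
        have "t \<in> ?T y" using t eq by simp
        then obtain t' where t': "t = cj t' y" "t' \<in> T0" by auto
        then have "cj t (inv y) = t'" using subsetD[OF T0G t'(2)] iB[OF y] by simp
        then show ?thesis using t' T0U by auto
      qed
      show ?thesis
        unfolding normalizer_in_def using gen_cj[OF T0G _ Us 1] gen_cj[OF T0G _ Us 2] iB[OF y] by auto
    qed
    \<comment> \<open>A conjugate \<open>?T y\<close> of \<open>T0\<close> different from
      \<open>T0\<close>, with a triangular list whose points lie in the intersection of the two.
      Such lists have length at most \<open>n\<close>, so there is a longest one; its finitely many
      points are then dense in the intersection.\<close>
    define Q where "Q = (\<lambda>(y, zs). y \<in> B \<and> ?T y \<noteq> T0 \<and> fst ` set zs \<subseteq> T0 \<inter> ?T y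
        \<and> (\<forall>(y, f) \<in> set zs. y \<in> B \<and> word_fun B ?m f) \<and> tri (\<lambda>y f. f y = \<one>) zs)"
    have "\<not> Xs \<subseteq> T0"
    proof
      assume "Xs \<subseteq> T0"
      then have XT: "Xs = T0" using T0X by auto
      have "normal_in ?U B"
        by (rule normal_in_gen_invariant[OF B]) (use XT XB Xcj gen_in in auto)
      then have "?U \<subseteq> HP_in B" using HP_in_greatest lU by auto
      then show False using not T0U XT unfolding Xs_def by auto
    qed
    then obtain v where v: "v \<in> Xs" "v \<notin> T0" by auto
    then have "?T v \<noteq> T0" using T_normalizer_in nzU XB by auto
    then have "Q (v, [])" unfolding Q_def using v XB by auto
    moreover have "\<forall>p. Q p \<longrightarrow> length (snd p) < Suc n"
      using less.prems(3) unfolding Q_def tri_bounded_def by (auto simp: less_Suc_eq_le)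
    ultimately have "\<exists>p. Q p \<and> (\<forall>q. Q q \<longrightarrow> length (snd q) \<le> length (snd p))" 
    by (rule ex_has_greatest_nat[of Q "(v, [])" "\<lambda>p. length (snd p)" "Suc n"])
    then obtain y zs where Qy: "Q (y, zs)" and longest: "\<And>y' zs'. Q (y', zs') \<Longrightarrow> length zs' \<le> length zs" by auto
    have y: "y \<in> B" "?T y \<noteq> T0" and zs: "fst ` set zs \<subseteq> T0 \<inter> ?T y" "\<forall>(y, f) \<in> set zs. y \<in> B \<and> word_fun B ?m f"
      "tri (\<lambda>y f. f y = \<one>) zs" using Qy unfolding Q_def by auto
    let ?R = "T0 \<inter> ?T y"
    let ?S = "fst ` set zs"
    \<comment> \<open>By maximality of the list this holds for every conjugate other than
      \<open>T0\<close> that contains the same points, not only for \<open>?T y\<close>. The final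
      contradiction uses it for another conjugate \<open>?T x\<close>.\<close>
    have extend: "t \<in> word_closure ?m B ?S"
      if y': "y' \<in> B" "?T y' \<noteq> T0" "?S \<subseteq> T0 \<inter> ?T y'" and t: "t \<in> T0 \<inter> ?T y'" for t y'
    proof (rule ccontr)
      assume "t \<notin> word_closure ?m B ?S"
      moreover have tB: "t \<in> B" using t T0X XB by auto
      ultimately obtain f where f: "word_fun B ?m f" "\<forall>w\<in>?S. f w = \<one>" "f t \<noteq> \<one>" unfolding word_closure_def by auto
      have "tri (\<lambda>y f. f y = \<one>) (zs @ [(t, f)])" unfolding tri_append using zs(3) f(2,3) by auto
      then have "Q (y', zs @ [(t, f)])" unfolding Q_def using y' t tB f(1) zs(2) by auto
      then show False using longest by fastforce
    qed
    have S: "finite ?S" "?S \<subseteq> ?R" "?R \<subseteq> word_closure ?m B ?S" using zs(1) extend[OF y zs(1)] by auto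
    have RT: "?R \<subseteq> T0" "?R \<subseteq> ?T y" by auto
    have Rgen: "Xs \<inter> generate G ?R \<subseteq> ?R"
      using T_gen[OF y(1)] XU mono_generate[OF RT(1)] mono_generate[OF RT(2)] by auto
    have Rcl: "Xs \<inter> word_closure ?m B ?R \<subseteq> ?R"
      using T_word_closure[OF y(1)] XD word_closure_mono[OF RT(2), of ?m B] word_closure_mono[OF order_trans[OF RT(1) T0U], of ?m B] by auto
    have "?R \<noteq> T0" using max[OF TTcj[OF T0 y(1)]] y(2) by auto
    \<comment> \<open>\<open>?R\<close> is a proper part of \<open>T0\<close> and of
      \<open>?T y\<close>, so each of these two sets has an element outside \<open>?R\<close> that
      normalises \<open>?R\<close>.\<close>
    then have "\<exists>u\<in>T0 - ?R. u \<in> normalizer_in ?R"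
      using normalizing_element[OF B XB Xcj T0X lU _ RT(1) _ Rgen Rcl S] XU by auto
    then obtain u where u: "u \<in> T0" "u \<notin> ?R" "u \<in> normalizer_in ?R" by auto
    have "?R \<noteq> ?T y" using T_max[OF y(1) T0] y(2) by auto
    then have "\<exists>u\<in>?T y - ?R. u \<in> normalizer_in ?R"
      using normalizing_element[OF B XB Xcj TT[OF TTcj[OF T0 y(1)]] T_gen[OF y(1)] RT(2) _ Rgen Rcl S] by auto
    then obtain v where v: "v \<in> ?T y" "v \<notin> ?R" "v \<in> normalizer_in ?R" by auto
    have RG: "?R \<subseteq> carrier G" using T0X XG by auto
    have NR: "subgroup (normalizer_in ?R) G" using normalizer_in_subgroup[OF RG] .
    have NU: "subgroup (normalizer_in ?U) G" using normalizer_in_subgroup[OF UG] .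
    have uX: "u \<in> Xs" and uB: "u \<in> B" and uG: "u \<in> carrier G" using u T0X XB BG by auto
    have vX: "v \<in> Xs" using v TT(1)[OF TTcj[OF T0 y(1)]] by auto
    then have vB: "v \<in> B" using XB by auto
    have xR: "engel G i v u \<in> normalizer_in ?R" for i
      by (induction i) (use v(3) u(3) sub_closed(4)[OF NR] in auto)
    have xB: "engel G i v u \<in> B" for i by (induction i) (use vB uB sub_closed(4)[OF B] in auto)
    obtain l where "engel G l v u = \<one>" using uX vB unfolding Xs_def nil_in_def by auto
    then have Pl: "engel G l v u \<in> normalizer_in ?U" using subgroup.one_closed[OF NU] by simp
    have P0: "engel G 0 v u \<notin> normalizer_in ?U"
    proof
      assume "engel G 0 v u \<in> normalizer_in ?U"
      then have "v \<in> T0" using nzU[OF vX] by simp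
      then show False using v by auto
    qed
    have "\<exists>i. engel G i v u \<notin> normalizer_in ?U \<and> engel G (Suc i) v u \<in> normalizer_in ?U"
    proof (rule ccontr)
      assume *: "\<not> ?thesis"
      have "engel G i v u \<notin> normalizer_in ?U" for i by (induction i) (use P0 * in blast)+
      then show False using Pl by blast
    qed
    \<comment> \<open>The Engel sequence of \<open>v\<close> and \<open>u\<close> starts outside the
      normaliser of \<open>?U\<close> and reaches it; \<open>x\<close> below is a member outside
      whose successor is inside. Then \<open>?T x\<close> differs from \<open>T0\<close> but
      contains \<open>?R\<close>, and \<open>cj u x\<close> is a nil-element normalising
      \<open>?U\<close>, hence in \<open>T0\<close>. By \<open>extend\<close> and the closedness of
      \<open>?R\<close> it lies in \<open>?R\<close>. But \<open>x\<close> normalises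
      \<open>?R\<close> and \<open>u\<close> is outside \<open>?R\<close>, a contradiction.\<close>
    then obtain i where i: "engel G i v u \<notin> normalizer_in ?U" "engel G (Suc i) v u \<in> normalizer_in ?U" by auto
    define x where "x = engel G i v u"
    have xB': "x \<in> B" and xG: "x \<in> carrier G" and xN: "x \<in> normalizer_in ?R" using xB xR BG unfolding x_def by auto
    have uU: "u \<in> normalizer_in ?U"
      using normal_in_iff_normalizer_in[OF Us Us order_refl] normal_in_self[OF Us] T0U u(1) by auto
    have "cj u x = u \<otimes> inv (comm x u)" using uG xG by (simp add: word)
    moreover have "comm x u \<in> normalizer_in ?U" using i(2) unfolding x_def by simp
    ultimately have "cj u x \<in> normalizer_in ?U" using sub_closed(1)[OF NU uU] sub_closed(2)[OF NU] by auto
    then have u': "cj u x \<in> T0" using nzU[OF Xcj[OF uX xB']] by auto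
    have Tx: "?T x \<noteq> T0" using T_normalizer_in[OF xB'] i(1) unfolding x_def by auto
    have RTx: "?R \<subseteq> ?T x"
    proof
      fix t assume t: "t \<in> ?R"
      then have "cj t (inv x) \<in> ?R" using xN unfolding normalizer_in_def by auto
      then show "t \<in> ?T x" using preim[OF xB'] t RG by auto
    qed
    have "?S \<subseteq> T0 \<inter> ?T x" using S(2) RTx RT(1) by (meson Int_greatest order_trans)
    moreover have "cj u x \<in> T0 \<inter> ?T x" using u' u(1) by auto
    ultimately have "cj u x \<in> word_closure ?m B ?S" by (rule extend[OF xB' Tx])
    then have "cj u x \<in> word_closure ?m B ?R" using word_closure_mono[OF S(2)] by auto
    then have "cj u x \<in> ?R" using Rcl Xcj[OF uX xB'] by auto
    then have "cj (cj u x) (inv x) \<in> ?R" using xN unfolding normalizer_in_def by auto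
    then show False using u(2) uG xG by simp
  qed
qed

end

section \<open>Nil ideals of rings with a multilinear identity\<close>

definition perms_on :: "nat set \<Rightarrow> nat list set" where
  "perms_on V = {u. distinct u \<and> set u = V}"

lemma finite_perms_on: "finite V \<Longrightarrow> finite (perms_on V)"
proof -
  assume V: "finite V"
  have "perms_on V \<subseteq> {u. set u \<subseteq> V \<and> length u = card V}" unfolding perms_on_def using distinct_card by fastforce
  then show ?thesis using finite_lists_length_eq[OF V] finite_subset by blast
qed

lemma perms_on_empty: "perms_on {} = {[]}"
  unfolding perms_on_def by auto

lemma perms_on_hd:
  assumes "i \<in> V"
  shows "{u \<in> perms_on V. hd u = i} = (#) i ` perms_on (V - {i})"
proof
  show "{u \<in> perms_on V. hd u = i} \<subseteq> (#) i ` perms_on (V - {i})"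
  proof
    fix u assume u: "u \<in> {u \<in> perms_on V. hd u = i}"
    then have "u \<noteq> []" using assms unfolding perms_on_def by auto
    then obtain w where w: "u = i # w" using u by (cases u) auto
    then have "w \<in> perms_on (V - {i})" using u unfolding perms_on_def by auto
    then show "u \<in> (#) i ` perms_on (V - {i})" using w by auto
  qed
  show "(#) i ` perms_on (V - {i}) \<subseteq> {u \<in> perms_on V. hd u = i}"
  proof
    fix u assume "u \<in> (#) i ` perms_on (V - {i})"
    then obtain w where w: "u = i # w" "distinct w" "set w = V - {i}" unfolding perms_on_def by blast
    have "set u = V" using w assms by (simp add: insert_absorb)
    then show "u \<in> {u \<in> perms_on V. hd u = i}" using w unfolding perms_on_def by simp
  qed
qed

context ring begin

abbreviation mon :: "(nat \<Rightarrow> 'a) \<Rightarrow> nat list \<Rightarrow> 'a" where "mon s w \<equiv> nc_monom_eval R s w"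

lemma mon_Nil [simp]: "mon s [] = \<one>" and mon_Cons [simp]: "mon s (i # w) = s i \<otimes> mon s w"
  by (simp_all add: nc_monom_eval_def)

lemma mon_closed [simp]: "(\<And>i. i \<in> set w \<Longrightarrow> s i \<in> carrier R) \<Longrightarrow> mon s w \<in> carrier R"
  by (induction w) auto

lemma mon_cong: "(\<And>i. i \<in> set w \<Longrightarrow> s i = t i) \<Longrightarrow> mon s w = mon t w"
  by (induction w) auto

definition central :: "'a \<Rightarrow> bool" where
  "central c \<longleftrightarrow> c \<in> carrier R \<and> (\<forall>x\<in>carrier R. c \<otimes> x = x \<otimes> c)"

text \<open>Coefficients are central elements of the ring itself, so no base field is mentioned from
  here on. The monomial with the variables in increasing order is normalised to coefficient
  one.\<close>

definition multilinear_identity :: "nat \<Rightarrow> (nat list \<Rightarrow> 'a) \<Rightarrow> bool" where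
  "multilinear_identity d \<alpha> \<longleftrightarrow> (\<forall>u. central (\<alpha> u)) \<and> \<alpha> [0..<d] = \<one> \<and>
     (\<forall>s. range s \<subseteq> carrier R \<longrightarrow> (\<Oplus>u\<in>perms_on {..<d}. \<alpha> u \<otimes> mon s u) = \<zero>)"

lemma additive_subgroup_facts:
  assumes "additive_subgroup I R"
  shows "I \<subseteq> carrier R" "\<zero> \<in> I" "x \<in> I \<Longrightarrow> y \<in> I \<Longrightarrow> x \<oplus> y \<in> I" "x \<in> I \<Longrightarrow> \<ominus> x \<in> I"
    "x \<in> I \<Longrightarrow> y \<in> I \<Longrightarrow> x \<ominus> y \<in> I"
proof -
  interpret I: additive_subgroup I R by fact
  show 1: "I \<subseteq> carrier R" "\<zero> \<in> I" "x \<in> I \<Longrightarrow> y \<in> I \<Longrightarrow> x \<oplus> y \<in> I" "x \<in> I \<Longrightarrow> \<ominus> x \<in> I"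
    using I.a_subset I.zero_closed I.a_closed I.a_inv_closed by auto
  then show "x \<in> I \<Longrightarrow> y \<in> I \<Longrightarrow> x \<ominus> y \<in> I" using I.a_closed I.a_inv_closed unfolding a_minus_def by auto
qed

lemma additive_subgroupI':
  assumes "I \<subseteq> carrier R" "\<zero> \<in> I" "\<And>x y. x \<in> I \<Longrightarrow> y \<in> I \<Longrightarrow> x \<oplus> y \<in> I" "\<And>x. x \<in> I \<Longrightarrow> \<ominus> x \<in> I"
  shows "additive_subgroup I R"
proof (rule additive_subgroup.intro, rule add.subgroupI)
  show "I \<noteq> {}" using assms(2) by auto
qed (use assms in \<open>auto simp: a_inv_def\<close>)

lemma ideal_facts:
  assumes "ideal I R"
  shows "additive_subgroup I R" "x \<in> I \<Longrightarrow> a \<in> carrier R \<Longrightarrow> a \<otimes> x \<in> I" "x \<in> I \<Longrightarrow> a \<in> carrier R \<Longrightarrow> x \<otimes> a \<in> I"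
  using ideal.I_l_closed[OF assms] ideal.I_r_closed[OF assms] ideal.axioms(1)[OF assms] by auto

lemma idealI':
  assumes "I \<subseteq> carrier R" "\<zero> \<in> I" "\<And>x y. x \<in> I \<Longrightarrow> y \<in> I \<Longrightarrow> x \<oplus> y \<in> I"
    "\<And>x a. x \<in> I \<Longrightarrow> a \<in> carrier R \<Longrightarrow> a \<otimes> x \<in> I" "\<And>x a. x \<in> I \<Longrightarrow> a \<in> carrier R \<Longrightarrow> x \<otimes> a \<in> I"
  shows "ideal I R"
proof -
  have "\<ominus> x \<in> I" if "x \<in> I" for x
  proof -
    have xc: "x \<in> carrier R" using that assms(1) by auto
    then have "\<ominus> \<one> \<otimes> x = \<ominus> x" by (simp add: l_minus)
    then show ?thesis using assms(4)[OF that, of "\<ominus> \<one>"] by simp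
  qed
  then have "additive_subgroup I R" using assms by (intro additive_subgroupI') auto
  then show ?thesis using assms ring_axioms by (intro idealI additive_subgroup.a_subgroup) auto
qed

lemma finsum_mem:
  assumes I: "additive_subgroup I R" and "finite P" "\<And>u. u \<in> P \<Longrightarrow> g u \<in> I"
  shows "(\<Oplus>u\<in>P. g u) \<in> I"
  using assms(2,3)
proof (induction P)
  case empty then show ?case using additive_subgroup_facts(2)[OF I] by simp
next
  case (insert u P)
  have "g u \<in> carrier R" "g \<in> P \<rightarrow> carrier R" using insert.prems additive_subgroup_facts(1)[OF I] by auto
  then show ?case using insert additive_subgroup_facts(3)[OF I] by (simp add: finsum_insert)
qed

definition right_ideal :: "'a set \<Rightarrow> bool" where
  "right_ideal \<rho> \<longleftrightarrow> additive_subgroup \<rho> R \<and> (\<forall>x\<in>\<rho>. \<forall>a\<in>carrier R. x \<otimes> a \<in> \<rho>)"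

text \<open>The induction peels off the first letter \<open>i\<close> of the distinguished monomial: after multiplying by
  \<open>c\<close> with \<open>c\<^sup>2 \<rho> \<subseteq> L\<close> and substituting multiples of \<open>c\<close> for the other variables, only
  the monomials starting with \<open>i\<close> survive modulo \<open>L\<close>.\<close>

lemma nil_right_ideal_subset:
  assumes L: "ideal L R" and N: "ideal N R" and nil: "\<And>x. x \<in> N \<Longrightarrow> \<exists>m::nat. x [^] m \<in> L"
    and semiprime: "\<And>v. v \<in> N \<Longrightarrow> (\<And>a. a \<in> carrier R \<Longrightarrow> v \<otimes> a \<otimes> v \<in> L) \<Longrightarrow> v \<in> L"
  shows "distinct u0 \<Longrightarrow> right_ideal \<rho> \<Longrightarrow> \<rho> \<subseteq> N \<Longrightarrow> (\<And>u. central (\<alpha> u)) \<Longrightarrow> \<alpha> u0 = \<one> \<Longrightarrow>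
    (\<And>s y. range s \<subseteq> \<rho> \<Longrightarrow> y \<in> \<rho> \<Longrightarrow> (\<Oplus>u\<in>perms_on (set u0). \<alpha> u \<otimes> mon s u) \<otimes> y \<in> L) \<Longrightarrow> \<rho> \<subseteq> L"
proof (induction u0 arbitrary: \<rho> \<alpha>)
  case Nil
  have \<rho>: "\<rho> \<subseteq> carrier R" "\<zero> \<in> \<rho>" using Nil(2) additive_subgroup_facts unfolding right_ideal_def by auto
  show ?case
  proof
    fix y assume y: "y \<in> \<rho>"
    have "(\<Oplus>u\<in>perms_on (set []). \<alpha> u \<otimes> mon (\<lambda>_. \<zero>) u) \<otimes> y \<in> L" by (rule Nil(6)) (use y \<rho> in auto)
    then show "y \<in> L" using Nil(5) y \<rho> by (auto simp: perms_on_empty)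
  qed
next
  case (Cons i u1)
  note l = additive_subgroup_facts[OF ideal_facts(1)[OF L]] ideal_facts(2,3)[OF L]
  note nn = additive_subgroup_facts[OF ideal_facts(1)[OF N]] ideal_facts(2,3)[OF N]
  have \<rho>s: "additive_subgroup \<rho> R" using Cons.prems(2) unfolding right_ideal_def by auto
  note r = additive_subgroup_facts[OF \<rho>s]
  have rm: "x \<otimes> a \<in> \<rho>" if "x \<in> \<rho>" "a \<in> carrier R" for x a using that Cons.prems(2) unfolding right_ideal_def by auto
  have rc: "x \<in> carrier R" if "x \<in> \<rho>" for x using that r(1) by auto
  have \<alpha>c: "\<alpha> u \<in> carrier R" "x \<in> carrier R \<Longrightarrow> \<alpha> u \<otimes> x = x \<otimes> \<alpha> u" for u x
    using Cons.prems(4) unfolding central_def by auto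
  show ?case
  proof (rule ccontr)
    assume not: "\<not> \<rho> \<subseteq> L"
    then obtain v where v: "v \<in> \<rho>" "v \<notin> L" by auto
    then obtain a where a: "a \<in> carrier R" "v \<otimes> a \<otimes> v \<notin> L" using semiprime Cons.prems(3) by blast
    let ?x = "v \<otimes> a"
    have x\<rho>: "?x \<in> \<rho>" and xc: "?x \<in> carrier R" using v a rm rc by auto
    let ?P = "\<lambda>m::nat. \<forall>t\<in>\<rho>. ?x [^] m \<otimes> t \<in> L"
    obtain m0 where "?x [^] (m0::nat) \<in> L" using nil x\<rho> Cons.prems(3) by blast
    then have Pm0: "?P m0" using l(7) rc by auto
    have P0: "\<not> ?P 0" using v rc by auto
    have "\<exists>m. \<not> ?P m \<and> ?P (Suc m)"
    proof (rule ccontr)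
      assume *: "\<not> ?thesis"
      have "\<not> ?P m" for m by (induction m) (use P0 * in blast)+
      then show False using Pm0 by blast
    qed
    \<comment> \<open>\<open>?x\<close> is nilpotent modulo \<open>L\<close>, so high powers
      annihilate \<open>\<rho>\<close> modulo \<open>L\<close>. For \<open>c\<close>, the power just
      before one that does, \<open>c\<close> squared annihilates \<open>\<rho>\<close> modulo
      \<open>L\<close> provided \<open>m > 0\<close>; this holds because
      \<open>?x \<otimes> v\<close> is outside \<open>L\<close>.\<close>
    then obtain m where m: "\<not> ?P m" "?P (Suc m)" by auto
    have pow\<rho>: "?x [^] (Suc j) \<in> \<rho>" for j 
      unfolding nat_pow_Suc2[OF xc] using xc by (intro rm[OF x\<rho>]) simp
    have "m \<noteq> 0" 
    proof
      assume "m = 0"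
      then have "?x [^] (1::nat) \<otimes> v \<in> L" using m(2) v(1) by auto
      then show False using a(2) xc by simp
    qed
    then obtain m' where m': "m = Suc m'" by (cases m) auto
    define c where "c = ?x [^] m"
    have c\<rho>: "c \<in> \<rho>" unfolding c_def m' by (rule pow\<rho>)
    have cc: "c \<in> carrier R" using rc c\<rho> by auto
    have cL: "\<exists>t\<in>\<rho>. c \<otimes> t \<notin> L" using m(1) unfolding c_def by auto
    have c2: "c \<otimes> (c \<otimes> t) \<in> L" if t: "t \<in> \<rho>" for t
    proof -
      have "?x [^] m' \<otimes> t \<in> \<rho>"
      proof (cases m')
        case 0 then show ?thesis using t rc by simp
      next
        case (Suc j) then show ?thesis using rm[OF pow\<rho>] t rc by auto
      qed
      then have "?x [^] Suc m \<otimes> (?x [^] m' \<otimes> t) \<in> L" using m(2) by auto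
      moreover have "?x [^] Suc m \<otimes> (?x [^] m' \<otimes> t) = ?x [^] (Suc m + m') \<otimes> t"
        using xc rc[OF t] by (simp only: m_assoc[symmetric] nat_pow_closed nat_pow_mult)
      moreover have "c \<otimes> (c \<otimes> t) = ?x [^] (m + m) \<otimes> t"
        unfolding c_def using xc rc[OF t] by (simp only: m_assoc[symmetric] nat_pow_closed nat_pow_mult)
      moreover have "Suc m + m' = m + m" using m' by simp
      ultimately show ?thesis by metis
    qed
    let ?\<rho> = "(\<lambda>t. c \<otimes> t) ` \<rho>"
    have \<rho>': "?\<rho> \<subseteq> \<rho>" using rm c\<rho> rc by auto
    have \<rho>'s: "additive_subgroup ?\<rho> R"
    proof (rule additive_subgroupI')
      show "?\<rho> \<subseteq> carrier R" using \<rho>' r(1) by auto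
      show "\<zero> \<in> ?\<rho>" using r(2) cc by (auto intro!: image_eqI[of _ _ \<zero>])
      fix x assume "x \<in> ?\<rho>"
      then obtain x' where x': "x = c \<otimes> x'" "x' \<in> \<rho>" by auto
      have "\<ominus> x = c \<otimes> (\<ominus> x')" using x' cc rc by (simp add: r_minus)
      then show "\<ominus> x \<in> ?\<rho>" using x' r(4) by auto
      fix y assume "y \<in> ?\<rho>"
      then obtain y' where y': "y = c \<otimes> y'" "y' \<in> \<rho>" by auto
      have "x \<oplus> y = c \<otimes> (x' \<oplus> y')" using x' y' cc rc by (simp add: r_distr)
      then show "x \<oplus> y \<in> ?\<rho>" using x' y' r(3) by auto
    qed
    have \<rho>'m: "x \<otimes> b \<in> ?\<rho>" if "x \<in> ?\<rho>" "b \<in> carrier R" for x b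
    proof -
      obtain x' where x': "x = c \<otimes> x'" "x' \<in> \<rho>" using \<open>x \<in> ?\<rho>\<close> by auto
      have "x \<otimes> b = c \<otimes> (x' \<otimes> b)" using x' cc rc that by (simp add: m_assoc)
      then show ?thesis using rm x' that by auto
    qed
    have \<rho>'c: "x \<in> carrier R" if "x \<in> ?\<rho>" for x using that \<rho>' rc by auto
    let ?V = "set u1"
    let ?\<alpha> = "\<lambda>u. \<alpha> (i # u)"
    let ?G = "\<lambda>s. \<Oplus>u\<in>perms_on ?V. ?\<alpha> u \<otimes> mon s u"
    have V: "set (i # u1) - {i} = ?V" using Cons.prems(1) by auto
    have finV: "finite (perms_on ?V)" by (simp add: finite_perms_on)
    have Gc: "?G s \<in> carrier R" if "range s \<subseteq> ?\<rho>" for s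
      using that \<rho>'c \<alpha>c(1) by (intro finsum_closed Pi_I m_closed mon_closed) auto
    have key: "c \<otimes> t \<otimes> ?G s \<otimes> y \<in> L" if s: "range s \<subseteq> ?\<rho>" and t: "t \<in> \<rho>" and y: "y \<in> \<rho>" for s t y
    proof -
      let ?s = "s(i := t)"
      let ?P = "perms_on (set (i # u1))"
      let ?P1 = "{u \<in> ?P. hd u = i}" and ?P2 = "{u \<in> ?P. hd u \<noteq> i}"
      let ?f = "\<lambda>u. \<alpha> u \<otimes> mon ?s u"
      have s\<rho>: "range ?s \<subseteq> \<rho>" using s t \<rho>' by auto
      then have fc: "?f u \<in> carrier R" for u using rc \<alpha>c(1) by (intro m_closed mon_closed) auto
      have fin: "finite ?P" "finite ?P1" "finite ?P2" by (simp_all add: finite_perms_on)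
      have "(\<Oplus>u\<in>?P. ?f u) = (\<Oplus>u\<in>?P1 \<union> ?P2. ?f u)" by (rule arg_cong[where f = "finsum R ?f"]) auto
      also have "\<dots> = (\<Oplus>u\<in>?P1. ?f u) \<oplus> (\<Oplus>u\<in>?P2. ?f u)"
        using fin fc by (intro finsum_Un_disjoint) auto
      finally have split: "(\<Oplus>u\<in>?P. ?f u) = (\<Oplus>u\<in>?P1. ?f u) \<oplus> (\<Oplus>u\<in>?P2. ?f u)" .
      have "(\<Oplus>u\<in>?P1. ?f u) = (\<Oplus>u\<in>(#) i ` perms_on ?V. ?f u)" using perms_on_hd[of i "set (i # u1)"] V by simp
      also have "\<dots> = (\<Oplus>u\<in>perms_on ?V. ?f (i # u))" using fc by (intro finsum_reindex) auto
      also have "\<dots> = (\<Oplus>u\<in>perms_on ?V. t \<otimes> (?\<alpha> u \<otimes> mon s u))"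
      proof (rule finsum_cong')
        show "(\<lambda>u. t \<otimes> (?\<alpha> u \<otimes> mon s u)) \<in> perms_on ?V \<rightarrow> carrier R"
          using s \<rho>'c rc[OF t] \<alpha>c(1) by (intro Pi_I m_closed mon_closed) auto
        fix u assume u: "u \<in> perms_on ?V"
        have iu: "i \<notin> set u" using u Cons.prems(1) unfolding perms_on_def by auto
        have "mon ?s u = mon s u" using iu by (intro mon_cong) auto
        then have "?f (i # u) = ?\<alpha> u \<otimes> (t \<otimes> mon s u)" by simp
        also have "\<dots> = ?\<alpha> u \<otimes> t \<otimes> mon s u"
          using \<alpha>c(1) rc[OF t] s \<rho>'c by (intro m_assoc[symmetric] mon_closed) auto
        also have "?\<alpha> u \<otimes> t = t \<otimes> ?\<alpha> u" by (rule \<alpha>c(2)[OF rc[OF t]])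
        also have "t \<otimes> ?\<alpha> u \<otimes> mon s u = t \<otimes> (?\<alpha> u \<otimes> mon s u)"
          using \<alpha>c(1) rc[OF t] s \<rho>'c by (intro m_assoc mon_closed) auto
        finally show "?f (i # u) = t \<otimes> (?\<alpha> u \<otimes> mon s u)" .
      qed simp
      also have "\<dots> = t \<otimes> ?G s"
        using finV rc[OF t] s \<rho>'c \<alpha>c(1)
        by (intro finsum_rdistr[symmetric] Pi_I m_closed mon_closed) auto
      finally have P1: "(\<Oplus>u\<in>?P1. ?f u) = t \<otimes> ?G s" .
      have yc: "y \<in> carrier R" using rc y by auto
      have "c \<otimes> (\<Oplus>u\<in>?P2. ?f u) \<otimes> y = (\<Oplus>u\<in>?P2. c \<otimes> ?f u \<otimes> y)"
        using fin(3) cc yc fc by (simp add: finsum_rdistr finsum_ldistr)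
      also have "\<dots> \<in> L"
      proof (rule finsum_mem[OF ideal_facts(1)[OF L] fin(3)])
        fix u assume u: "u \<in> ?P2"
        then have "u \<noteq> []" unfolding perms_on_def by auto
        then obtain j w where u': "u = j # w" by (cases u) auto
        then have "j \<noteq> i" using u by auto
        then have "?s j \<in> ?\<rho>" using s by auto
        then obtain \<sigma> where \<sigma>: "?s j = c \<otimes> \<sigma>" "\<sigma> \<in> \<rho>" by auto
        have wc: "mon ?s w \<in> carrier R" using s\<rho> rc by (intro mon_closed) auto
        have "c \<otimes> ?f u \<otimes> y = c \<otimes> (?s j \<otimes> mon ?s w \<otimes> \<alpha> u) \<otimes> y"
          unfolding u' using \<alpha>c(1) \<alpha>c(2)[of "?s j \<otimes> mon ?s w"] \<sigma> cc rc wc by simp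
        also have "\<dots> = c \<otimes> (c \<otimes> (\<sigma> \<otimes> mon ?s w \<otimes> \<alpha> u \<otimes> y))"
          unfolding \<sigma>(1) using \<alpha>c(1) \<sigma>(2) cc rc wc yc by (simp add: m_assoc)
        also have "\<dots> \<in> L" using \<sigma>(2) rm wc \<alpha>c(1) yc by (intro c2) auto
        finally show "c \<otimes> ?f u \<otimes> y \<in> L" .
      qed
      finally have 2: "c \<otimes> (\<Oplus>u\<in>?P2. ?f u) \<otimes> y \<in> L" .
      have S2c: "(\<Oplus>u\<in>?P2. ?f u) \<in> carrier R" using fc by (intro finsum_closed) auto
      have tG: "t \<otimes> ?G s \<in> carrier R" using rc[OF t] Gc[OF s] by auto
      have "(t \<otimes> ?G s \<oplus> (\<Oplus>u\<in>?P2. ?f u)) \<otimes> y \<in> L"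
        using Cons.prems(6)[OF s\<rho> y] unfolding split P1 .
      then have "c \<otimes> ((t \<otimes> ?G s \<oplus> (\<Oplus>u\<in>?P2. ?f u)) \<otimes> y) \<ominus> c \<otimes> (\<Oplus>u\<in>?P2. ?f u) \<otimes> y \<in> L"
        using l(5,6) 2 cc by auto
      moreover have "c \<otimes> ((t \<otimes> ?G s \<oplus> (\<Oplus>u\<in>?P2. ?f u)) \<otimes> y) \<ominus> c \<otimes> (\<Oplus>u\<in>?P2. ?f u) \<otimes> y = c \<otimes> t \<otimes> ?G s \<otimes> y"
      proof -
        have "p \<oplus> q \<ominus> q = p" if "p \<in> carrier R" "q \<in> carrier R" for p q
          using that by (simp add: a_minus_def a_assoc r_neg)
        then show ?thesis using S2c tG cc yc rc[OF t] Gc[OF s] by (simp add: l_distr r_distr m_assoc)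
      qed
      ultimately show ?thesis by simp
    qed
    have "?\<rho> \<subseteq> L"
    proof (rule Cons.IH)
      show "distinct u1" using Cons.prems(1) by simp
      show "right_ideal ?\<rho>" unfolding right_ideal_def using \<rho>'s \<rho>'m by auto
      show "?\<rho> \<subseteq> N" using \<rho>' Cons.prems(3) by auto
      show "central (?\<alpha> u)" for u using Cons.prems(4) .
      show "?\<alpha> u1 = \<one>" using Cons.prems(5) .
      fix s :: "nat \<Rightarrow> 'a" and y assume s: "range s \<subseteq> ?\<rho>" and y: "y \<in> ?\<rho>"
      have yc: "y \<in> carrier R" using y \<rho>'c by auto
      have "(\<Oplus>u\<in>perms_on ?V. ?\<alpha> u \<otimes> mon s u) \<otimes> y = (\<Oplus>u\<in>perms_on ?V. ?\<alpha> u \<otimes> mon s u \<otimes> y)"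
        using finV yc s \<rho>'c \<alpha>c(1) by (intro finsum_ldistr Pi_I m_closed mon_closed) auto
      also have "\<dots> \<in> ?\<rho>"
      proof (rule finsum_mem[OF \<rho>'s finV])
        fix u
        have mc: "mon s u \<in> carrier R" using s \<rho>'c by (intro mon_closed) auto
        have "mon s u \<otimes> y \<in> ?\<rho>"
        proof (cases u)
          case Nil then show ?thesis using y yc by simp
        next
          case (Cons j w)
          have "s j \<in> ?\<rho>" using s by auto
          moreover have "mon s w \<in> carrier R" using s \<rho>'c by (intro mon_closed) auto
          ultimately show ?thesis using Cons \<rho>'m yc by (auto simp del: image_iff)
        qed
        then have "mon s u \<otimes> y \<otimes> ?\<alpha> u \<in> ?\<rho>" using \<rho>'m \<alpha>c(1) by blast
        moreover have "?\<alpha> u \<otimes> mon s u \<otimes> y = mon s u \<otimes> y \<otimes> ?\<alpha> u"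
          using \<alpha>c(1) \<alpha>c(2)[of "mon s u \<otimes> y"] mc yc by (simp add: m_assoc)
        ultimately show "?\<alpha> u \<otimes> mon s u \<otimes> y \<in> ?\<rho>" by simp
      qed
      finally have z: "?G s \<otimes> y \<in> ?\<rho>" .
      then obtain w where w: "?G s \<otimes> y = c \<otimes> w" "w \<in> \<rho>" by auto
      \<comment> \<open>By \<open>key\<close> the shorter identity vanishes modulo \<open>L\<close>
        only after multiplication by \<open>c \<otimes> t\<close> on the left. The element itself
        lies in \<open>?\<rho>\<close> and so starts with \<open>c\<close>; putting \<open>b\<close>
        between two copies of it produces such a product, and semiprimeness removes the extra
        factor.\<close>
      show "?G s \<otimes> y \<in> L"
      proof (rule semiprime)
        show "?G s \<otimes> y \<in> N" using z \<rho>' Cons.prems(3) by blast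
        fix b assume b: "b \<in> carrier R"
        have "c \<otimes> (w \<otimes> b) \<otimes> ?G s \<otimes> y \<in> L" using rm[OF w(2) b] y \<rho>' by (intro key[OF s]) auto
        moreover have "?G s \<otimes> y \<otimes> b \<otimes> (?G s \<otimes> y) = c \<otimes> (w \<otimes> b) \<otimes> ?G s \<otimes> y"
        proof -
          have "?G s \<otimes> y \<otimes> b \<otimes> (?G s \<otimes> y) = c \<otimes> w \<otimes> b \<otimes> (?G s \<otimes> y)" unfolding w(1) ..
          then show ?thesis using cc rc[OF w(2)] b Gc[OF s] yc by (simp add: m_assoc)
        qed
        ultimately show "?G s \<otimes> y \<otimes> b \<otimes> (?G s \<otimes> y) \<in> L" by simp
      qed
    qed
    then show False using cL by auto
  qed
qed

end

context ring begin

definition lprod :: "'a list \<Rightarrow> 'a" where "lprod w = foldr (\<otimes>) w \<one>"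

lemma lprod_Nil [simp]: "lprod [] = \<one>" and lprod_Cons [simp]: "lprod (x # w) = x \<otimes> lprod w"
  by (simp_all add: lprod_def)

lemma lprod_closed [simp]: "set w \<subseteq> carrier R \<Longrightarrow> lprod w \<in> carrier R"
  by (induction w) auto

lemma lprod_append: "set v \<subseteq> carrier R \<Longrightarrow> set w \<subseteq> carrier R \<Longrightarrow> lprod (v @ w) = lprod v \<otimes> lprod w"
  by (induction v) (auto simp: m_assoc)

definition locnil :: "'a set \<Rightarrow> bool" where
  "locnil I \<longleftrightarrow> (\<forall>F. finite F \<and> F \<subseteq> I \<longrightarrow> (\<exists>m. \<forall>w. set w \<subseteq> F \<and> length w = m \<longrightarrow> lprod w = \<zero>))"

lemma locnilD:
  assumes "locnil I" "finite F" "F \<subseteq> I"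
  obtains m where "\<And>w. set w \<subseteq> F \<Longrightarrow> length w = m \<Longrightarrow> lprod w = \<zero>"
proof -
  have "\<exists>m. \<forall>w. set w \<subseteq> F \<and> length w = m \<longrightarrow> lprod w = \<zero>"
    using assms(1)[unfolded locnil_def, rule_format, of F] assms(2,3) by simp
  then obtain m where m: "\<forall>w. set w \<subseteq> F \<and> length w = m \<longrightarrow> lprod w = \<zero>" ..
  show thesis by (rule that[of m]) (use m in simp)
qed

text \<open>Bracketing a word of even length in pairs transfers local nilpotency from an ideal
  containing all products of two letters to the letters themselves.\<close>

lemma lprod_pairs:
  assumes F: "F \<subseteq> carrier R"
  shows "set w \<subseteq> F \<Longrightarrow> length w = 2 * m \<Longrightarrow>
    \<exists>v. set v \<subseteq> (\<lambda>(x, y). x \<otimes> y) ` (F \<times> F) \<and> length v = m \<and> lprod v = lprod w"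
proof (induction m arbitrary: w)
  case 0 then show ?case by (intro exI[of _ "[]"]) simp
next
  case (Suc m)
  then obtain x y w' where w: "w = x # y # w'" by (cases w; cases "tl w") auto
  then obtain v where v: "set v \<subseteq> (\<lambda>(x, y). x \<otimes> y) ` (F \<times> F)" "length v = m" "lprod v = lprod w'"
    using Suc.IH[of w'] Suc.prems by auto
  have c: "x \<in> carrier R" "y \<in> carrier R" "set w' \<subseteq> carrier R" using w Suc.prems F by auto
  have "lprod ((x \<otimes> y) # v) = lprod w" unfolding w using v(3) c by (simp add: m_assoc)
  moreover have "x \<otimes> y \<in> (\<lambda>(x, y). x \<otimes> y) ` (F \<times> F)" using w Suc.prems by auto
  ultimately show ?case using v by (intro exI[of _ "(x \<otimes> y) # v"]) simp
qed

text \<open>Let \<open>L\<close> be a maximal locally nilpotent ideal inside \<open>N\<close>. If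
  \<open>v\<close> in \<open>N\<close> satisfies \<open>v R v \<subseteq> L\<close>, the ideal
  generated by \<open>v\<close> and \<open>L\<close> has its square in \<open>L\<close>, so it is
  locally nilpotent and equals \<open>L\<close>. This is the semiprimeness that
  \<open>nil_right_ideal_subset\<close> demands, and with \<open>N\<close> as the right ideal that
  lemma gives \<open>N \<subseteq> L\<close>.\<close>

theorem nil_ideal_locnil:
  assumes pi: "multilinear_identity d \<alpha>" and N: "ideal N R" and nil: "\<And>x. x \<in> N \<Longrightarrow> \<exists>m::nat. x [^] m = \<zero>"
  shows "locnil N"
proof -
  note nn = additive_subgroup_facts[OF ideal_facts(1)[OF N]] ideal_facts(2,3)[OF N]
  define LL where "LL = {I. ideal I R \<and> I \<subseteq> N \<and> locnil I}"
  have "\<exists>M\<in>LL. \<forall>I\<in>LL. M \<subseteq> I \<longrightarrow> I = M"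
  proof (rule subset_Zorn_nonempty)
    have "locnil {\<zero>}"
      unfolding locnil_def
    proof (intro allI impI)
      fix F :: "'a set" assume F: "finite F \<and> F \<subseteq> {\<zero>}"
      have "lprod w = \<zero>" if "set w \<subseteq> F \<and> length w = 1" for w
        using that F by (cases w) auto
      then show "\<exists>m. \<forall>w. set w \<subseteq> F \<and> length w = m \<longrightarrow> lprod w = \<zero>" by blast
    qed
    then show "LL \<noteq> {}" unfolding LL_def using zeroideal nn(2) by auto
    fix C assume C: "C \<noteq> {}" "subset.chain LL C"
    then have CL: "I \<in> LL" if "I \<in> C" for I using that unfolding subset.chain_def by auto
    have "subset.chain {I. ideal I R} C" using C(2) unfolding subset.chain_def LL_def by auto
    from chain_Union_is_ideal[OF this] have "ideal (\<Union>C) R" using C(1) by simp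
    moreover have "\<Union>C \<subseteq> N" using CL unfolding LL_def by auto
    moreover have "locnil (\<Union>C)"
      unfolding locnil_def
    proof (intro allI impI)
      fix F assume F: "finite F \<and> F \<subseteq> \<Union>C"
      then obtain I where I: "I \<in> C" "F \<subseteq> I" using finite_subset_Union_chain[of F C LL] C by auto
      have "locnil I" using CL[OF I(1)] unfolding LL_def by auto
      then show "\<exists>m. \<forall>w. set w \<subseteq> F \<and> length w = m \<longrightarrow> lprod w = \<zero>" using F I(2) unfolding locnil_def by auto
    qed
    ultimately show "\<Union>C \<in> LL" unfolding LL_def by auto
  qed
  then obtain L where L: "L \<in> LL" and max: "\<And>I. I \<in> LL \<Longrightarrow> L \<subseteq> I \<Longrightarrow> I = L" by auto
  have Li: "ideal L R" and LN: "L \<subseteq> N" and Ln: "locnil L" using L unfolding LL_def by auto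
  note l = additive_subgroup_facts[OF ideal_facts(1)[OF Li]] ideal_facts(2,3)[OF Li]
  have semiprime: "v \<in> L" if v: "v \<in> N" and vav: "\<And>a. a \<in> carrier R \<Longrightarrow> v \<otimes> a \<otimes> v \<in> L" for v
  proof -
    have vc: "v \<in> carrier R" using v nn(1) by auto
    let ?I = "Idl (insert v L)"
    have IG: "insert v L \<subseteq> carrier R" using vc l(1) by auto
    have Ii: "ideal ?I R" by (rule genideal_ideal[OF IG])
    have sub: "insert v L \<subseteq> ?I" by (rule genideal_self[OF IG])
    have IN: "?I \<subseteq> N" by (rule genideal_minimal[OF N]) (use v LN in auto)
    note ii = additive_subgroup_facts[OF ideal_facts(1)[OF Ii]] ideal_facts(2,3)[OF Ii]
    \<comment> \<open>\<open>?J\<close> and later \<open>?K\<close> are annihilator ideals modulo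
      \<open>L\<close>. An ideal containing \<open>v\<close> and \<open>L\<close> contains the ideal
      generated by them, so no explicit description of that ideal is called for; \<open>?J\<close>
      treats the right factor and \<open>?K\<close> the left one.\<close>
    let ?J = "{y \<in> carrier R. \<forall>a\<in>carrier R. v \<otimes> a \<otimes> y \<in> L}"
    have "ideal ?J R"
    proof (rule idealI')
      show "\<zero> \<in> ?J" using vc l(2) by simp
      fix x y assume xy: "x \<in> ?J" "y \<in> ?J"
      then show "x \<oplus> y \<in> ?J" using vc l(3) by (simp add: r_distr)
    next
      fix x b assume x: "x \<in> ?J" and b: "b \<in> carrier R"
      have "v \<otimes> a \<otimes> (b \<otimes> x) \<in> L" if a: "a \<in> carrier R" for a
      proof -
        have "v \<otimes> (a \<otimes> b) \<otimes> x \<in> L" using x a b by auto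
        then show ?thesis using vc a b x by (simp add: m_assoc)
      qed
      then show "b \<otimes> x \<in> ?J" using b x by simp
      have "v \<otimes> a \<otimes> (x \<otimes> b) \<in> L" if a: "a \<in> carrier R" for a
      proof -
        have "v \<otimes> a \<otimes> x \<otimes> b \<in> L" using x a b l(7) by auto
        then show ?thesis using vc a b x by (simp add: m_assoc)
      qed
      then show "x \<otimes> b \<in> ?J" using b x by simp
    qed auto
    moreover have "insert v L \<subseteq> ?J" using vav vc l(1,6) by auto
    ultimately have 1: "?I \<subseteq> ?J" by (rule genideal_minimal)
    let ?K = "{x \<in> carrier R. \<forall>a\<in>carrier R. \<forall>y\<in>?I. x \<otimes> a \<otimes> y \<in> L}"
    have "ideal ?K R"
    proof (rule idealI')
      show "\<zero> \<in> ?K" using l(2) ii(1) by (auto simp: subset_iff)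
      fix x y assume xy: "x \<in> ?K" "y \<in> ?K"
      have "(x \<oplus> y) \<otimes> a \<otimes> z \<in> L" if a: "a \<in> carrier R" and z: "z \<in> ?I" for a z
      proof -
        have "x \<otimes> a \<otimes> z \<oplus> y \<otimes> a \<otimes> z \<in> L" using xy a z l(3) by auto
        then show ?thesis using xy a subsetD[OF ii(1) z] by (simp add: l_distr)
      qed
      then show "x \<oplus> y \<in> ?K" using xy by simp
    next
      fix x b assume x: "x \<in> ?K" and b: "b \<in> carrier R"
      have "b \<otimes> x \<otimes> a \<otimes> z \<in> L" if a: "a \<in> carrier R" and z: "z \<in> ?I" for a z
      proof -
        have "b \<otimes> (x \<otimes> a \<otimes> z) \<in> L" using x a z b l(6) by auto
        then show ?thesis using x b a subsetD[OF ii(1) z] by (simp add: m_assoc)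
      qed
      then show "b \<otimes> x \<in> ?K" using b x by simp
      have "x \<otimes> b \<otimes> a \<otimes> z \<in> L" if a: "a \<in> carrier R" and z: "z \<in> ?I" for a z
      proof -
        have "x \<otimes> (b \<otimes> a) \<otimes> z \<in> L" using x a z b by auto
        then show ?thesis using x b a subsetD[OF ii(1) z] by (simp add: m_assoc)
      qed
      then show "x \<otimes> b \<in> ?K" using b x by simp
    qed auto
    moreover have "insert v L \<subseteq> ?K" using 1 vc l(1,7) ii(1) by (auto simp: subset_iff m_assoc)
    ultimately have "?I \<subseteq> ?K" by (rule genideal_minimal)
    then have II: "x \<otimes> y \<in> L" if "x \<in> ?I" "y \<in> ?I" for x y
    proof -
      have "x \<otimes> \<one> \<otimes> y \<in> L" using that \<open>?I \<subseteq> ?K\<close> by auto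
      then show ?thesis using that ii(1) by (auto simp: subset_iff)
    qed
    have "locnil ?I"
      unfolding locnil_def
    proof (intro allI impI)
      fix F assume F: "finite F \<and> F \<subseteq> ?I"
      let ?F = "(\<lambda>(x, y). x \<otimes> y) ` (F \<times> F)"
      have "finite ?F" "?F \<subseteq> L" using F II by auto
      from locnilD[OF Ln this]
      obtain m where m: "\<And>w. set w \<subseteq> ?F \<Longrightarrow> length w = m \<Longrightarrow> lprod w = \<zero>" by metis
      have Fc: "F \<subseteq> carrier R" using F ii(1) by auto
      have "lprod w = \<zero>" if w: "set w \<subseteq> F \<and> length w = 2 * m" for w
      proof -
        obtain v where "set v \<subseteq> ?F \<and> length v = m \<and> lprod v = lprod w"
          using lprod_pairs[OF Fc, of w m] w by auto
        then show ?thesis using m by auto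
      qed
      then show "\<exists>m. \<forall>w. set w \<subseteq> F \<and> length w = m \<longrightarrow> lprod w = \<zero>" by blast
    qed
    then have "?I = L" using max[of ?I] Ii IN sub unfolding LL_def by auto
    then show ?thesis using sub by auto
  qed
  have "N \<subseteq> L"
  proof (rule nil_right_ideal_subset[OF Li N _ semiprime, of "[0..<d]" N \<alpha>])
    show "\<exists>m::nat. x [^] m \<in> L" if "x \<in> N" for x using nil[OF that] l(2) by metis
    show "right_ideal N" unfolding right_ideal_def using ideal_facts[OF N] by auto
    show "central (\<alpha> u)" for u using pi unfolding multilinear_identity_def by auto
    show "\<alpha> [0..<d] = \<one>" using pi unfolding multilinear_identity_def by auto
    fix s :: "nat \<Rightarrow> 'a" and y assume s: "range s \<subseteq> N" and y: "y \<in> N"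
    have "(\<Oplus>u\<in>perms_on {..<d}. \<alpha> u \<otimes> mon s u) = \<zero>"
      using pi s nn(1) unfolding multilinear_identity_def by blast
    moreover have "set [0..<d] = {..<d}" by auto
    ultimately show "(\<Oplus>u\<in>perms_on (set [0..<d]). \<alpha> u \<otimes> mon s u) \<otimes> y \<in> L" using l(2) y nn(1) by auto
  qed auto
  then show ?thesis using LN Ln by auto
qed

end

section \<open>Group elements congruent to one modulo an ideal\<close>

locale unit_rep = G: group G + R: ring R for G (structure) and R (structure) +
  fixes \<phi> :: "'a \<Rightarrow> 'c"
  assumes \<phi>_closed: "x \<in> carrier G \<Longrightarrow> \<phi> x \<in> carrier R"
    and \<phi>_mult: "x \<in> carrier G \<Longrightarrow> y \<in> carrier G \<Longrightarrow> \<phi> (x \<otimes>\<^bsub>G\<^esub> y) = \<phi> x \<otimes>\<^bsub>R\<^esub> \<phi> y"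
    and \<phi>_one: "\<phi> \<one>\<^bsub>G\<^esub> = \<one>\<^bsub>R\<^esub>"
    and \<phi>_inj: "x \<in> carrier G \<Longrightarrow> \<phi> x = \<one>\<^bsub>R\<^esub> \<Longrightarrow> x = \<one>\<^bsub>G\<^esub>"
begin

definition df :: "'a \<Rightarrow> 'c" where "df x = \<phi> x \<ominus>\<^bsub>R\<^esub> \<one>\<^bsub>R\<^esub>"

lemma df_closed [simp]: "x \<in> carrier G \<Longrightarrow> df x \<in> carrier R"
  by (simp add: df_def \<phi>_closed)

lemma \<phi>_df: "x \<in> carrier G \<Longrightarrow> \<phi> x = df x \<oplus>\<^bsub>R\<^esub> \<one>\<^bsub>R\<^esub>"
  using \<phi>_closed[of x] by (simp add: df_def R.minus_eq R.a_assoc R.l_neg)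

lemma \<phi>_inv: "x \<in> carrier G \<Longrightarrow> \<phi> (inv\<^bsub>G\<^esub> x) \<otimes>\<^bsub>R\<^esub> \<phi> x = \<one>\<^bsub>R\<^esub>"
  using \<phi>_mult[of "inv\<^bsub>G\<^esub> x" x] \<phi>_one by simp

lemma df_mult:
  assumes "x \<in> carrier G" "y \<in> carrier G"
  shows "df (x \<otimes>\<^bsub>G\<^esub> y) = df x \<otimes>\<^bsub>R\<^esub> \<phi> y \<oplus>\<^bsub>R\<^esub> df y"
  using assms \<phi>_closed[of x] \<phi>_closed[of y]
  by (simp add: df_def \<phi>_mult R.minus_eq R.l_distr R.l_minus R.a_assoc R.r_neg1)

lemma df_inv:
  assumes x: "x \<in> carrier G"
  shows "df (inv\<^bsub>G\<^esub> x) = \<ominus>\<^bsub>R\<^esub> (\<phi> (inv\<^bsub>G\<^esub> x) \<otimes>\<^bsub>R\<^esub> df x)"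
proof -
  have c: "\<phi> x \<in> carrier R" "\<phi> (inv\<^bsub>G\<^esub> x) \<in> carrier R" using x \<phi>_closed by auto
  have "\<phi> (inv\<^bsub>G\<^esub> x) \<otimes>\<^bsub>R\<^esub> df x = \<one>\<^bsub>R\<^esub> \<ominus>\<^bsub>R\<^esub> \<phi> (inv\<^bsub>G\<^esub> x)"
    using c \<phi>_inv[OF x] by (simp add: df_def R.minus_eq R.r_distr R.r_minus)
  then show ?thesis using c by (simp add: df_def R.minus_eq R.minus_add R.a_comm)
qed

lemma df_conj:
  assumes x: "x \<in> carrier G" and g: "g \<in> carrier G"
  shows "df (G.cj x g) = \<phi> (inv\<^bsub>G\<^esub> g) \<otimes>\<^bsub>R\<^esub> df x \<otimes>\<^bsub>R\<^esub> \<phi> g"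
proof -
  have c: "\<phi> x \<in> carrier R" "\<phi> (inv\<^bsub>G\<^esub> g) \<in> carrier R" "\<phi> g \<in> carrier R" using x g \<phi>_closed by auto
  show ?thesis
    using c \<phi>_inv[OF g] x g by (simp add: df_def G.cj_def \<phi>_mult R.minus_eq R.r_distr R.l_distr R.r_minus R.l_minus)
qed

text \<open>The ones cancel in \<open>\<phi> x \<phi> y - \<phi> y \<phi> x\<close>, leaving the
  additive commutator of \<open>df x\<close> and \<open>df y\<close>. As both terms contain both
  factors, a group commutator moves down a filtration by the sum of the two steps.\<close>

lemma df_comm:
  assumes x: "x \<in> carrier G" and y: "y \<in> carrier G"
  shows "df (G.comm x y) = \<phi> (inv\<^bsub>G\<^esub> x) \<otimes>\<^bsub>R\<^esub> \<phi> (inv\<^bsub>G\<^esub> y) \<otimes>\<^bsub>R\<^esub>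
    (df x \<otimes>\<^bsub>R\<^esub> df y \<ominus>\<^bsub>R\<^esub> df y \<otimes>\<^bsub>R\<^esub> df x)"
proof -
  have c: "\<phi> x \<in> carrier R" "\<phi> y \<in> carrier R" "\<phi> (inv\<^bsub>G\<^esub> x) \<in> carrier R" "\<phi> (inv\<^bsub>G\<^esub> y) \<in> carrier R"
    using x y \<phi>_closed by auto
  have 1: "df x \<otimes>\<^bsub>R\<^esub> df y \<ominus>\<^bsub>R\<^esub> df y \<otimes>\<^bsub>R\<^esub> df x = \<phi> x \<otimes>\<^bsub>R\<^esub> \<phi> y \<ominus>\<^bsub>R\<^esub> \<phi> y \<otimes>\<^bsub>R\<^esub> \<phi> x"
  proof -
    have e: "df a \<otimes>\<^bsub>R\<^esub> df b = \<phi> a \<otimes>\<^bsub>R\<^esub> \<phi> b \<oplus>\<^bsub>R\<^esub> (\<one>\<^bsub>R\<^esub> \<ominus>\<^bsub>R\<^esub> \<phi> a \<ominus>\<^bsub>R\<^esub> \<phi> b)"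
      if "a \<in> carrier G" "b \<in> carrier G" for a b
      using \<phi>_closed[OF that(1)] \<phi>_closed[OF that(2)]
      by (simp add: df_def R.minus_eq R.r_distr R.l_distr R.r_minus R.l_minus R.minus_add R.a_ac)
    have s: "(p \<oplus>\<^bsub>R\<^esub> (\<one>\<^bsub>R\<^esub> \<ominus>\<^bsub>R\<^esub> a \<ominus>\<^bsub>R\<^esub> b)) \<ominus>\<^bsub>R\<^esub> (q \<oplus>\<^bsub>R\<^esub> (\<one>\<^bsub>R\<^esub> \<ominus>\<^bsub>R\<^esub> b \<ominus>\<^bsub>R\<^esub> a)) = p \<ominus>\<^bsub>R\<^esub> q"
      if "p \<in> carrier R" "q \<in> carrier R" "a \<in> carrier R" "b \<in> carrier R" for p q a b
    proof -
      have c: "p \<oplus>\<^bsub>R\<^esub> r \<ominus>\<^bsub>R\<^esub> (q \<oplus>\<^bsub>R\<^esub> r) = p \<ominus>\<^bsub>R\<^esub> q" if "r \<in> carrier R" for r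
      proof -
        have "p \<oplus>\<^bsub>R\<^esub> r \<ominus>\<^bsub>R\<^esub> (q \<oplus>\<^bsub>R\<^esub> r) = p \<ominus>\<^bsub>R\<^esub> q \<oplus>\<^bsub>R\<^esub> (r \<ominus>\<^bsub>R\<^esub> r)"
          using that \<open>p \<in> carrier R\<close> \<open>q \<in> carrier R\<close> by (simp add: R.minus_eq R.minus_add R.a_ac)
        then show ?thesis
          using that \<open>p \<in> carrier R\<close> \<open>q \<in> carrier R\<close> by (simp add: R.minus_eq R.r_neg)
      qed
      have "\<one>\<^bsub>R\<^esub> \<ominus>\<^bsub>R\<^esub> b \<ominus>\<^bsub>R\<^esub> a = \<one>\<^bsub>R\<^esub> \<ominus>\<^bsub>R\<^esub> a \<ominus>\<^bsub>R\<^esub> b" using that by (simp add: R.minus_eq R.a_ac)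
      then show ?thesis using c[of "\<one>\<^bsub>R\<^esub> \<ominus>\<^bsub>R\<^esub> a \<ominus>\<^bsub>R\<^esub> b"] that by simp
    qed
    show ?thesis unfolding e[OF x y] e[OF y x] by (rule s) (use c in auto)
  qed
  have "\<phi> (inv\<^bsub>G\<^esub> x) \<otimes>\<^bsub>R\<^esub> \<phi> (inv\<^bsub>G\<^esub> y) \<otimes>\<^bsub>R\<^esub> (\<phi> y \<otimes>\<^bsub>R\<^esub> \<phi> x) = \<one>\<^bsub>R\<^esub>"
  proof -
    have "\<phi> (inv\<^bsub>G\<^esub> x \<otimes>\<^bsub>G\<^esub> inv\<^bsub>G\<^esub> y \<otimes>\<^bsub>G\<^esub> (y \<otimes>\<^bsub>G\<^esub> x)) = \<one>\<^bsub>R\<^esub>"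
      using x y \<phi>_one by (simp add: G.m_assoc)
    then show ?thesis using x y by (simp add: \<phi>_mult)
  qed
  moreover have "\<phi> (G.comm x y) = \<phi> (inv\<^bsub>G\<^esub> x) \<otimes>\<^bsub>R\<^esub> \<phi> (inv\<^bsub>G\<^esub> y) \<otimes>\<^bsub>R\<^esub> (\<phi> x \<otimes>\<^bsub>R\<^esub> \<phi> y)"
    using x y c by (simp add: commutator_def \<phi>_mult R.m_assoc)
  ultimately show ?thesis unfolding 1 using c by (simp add: df_def R.minus_eq R.r_distr R.r_minus)
qed

lemma one_plus_normal:
  assumes N: "ideal N R"
  shows "G.normal_in {x \<in> carrier G. df x \<in> N} (carrier G)"
proof (rule G.normal_inI[OF _ G.subgroup_self])
  note n = R.additive_subgroup_facts[OF R.ideal_facts(1)[OF N]] R.ideal_facts(2,3)[OF N]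
  have one: "df \<one>\<^bsub>G\<^esub> = \<zero>\<^bsub>R\<^esub>" using \<phi>_one by (simp add: df_def R.minus_eq R.r_neg)
  show "subgroup {x \<in> carrier G. df x \<in> N} G"
  proof (rule G.subgroupI)
    show "{x \<in> carrier G. df x \<in> N} \<noteq> {}" using one n(2) G.one_closed by force
    fix x assume x: "x \<in> {x \<in> carrier G. df x \<in> N}"
    then show "inv\<^bsub>G\<^esub> x \<in> {x \<in> carrier G. df x \<in> N}" using df_inv[of x] n(4,6) \<phi>_closed by simp
    fix y assume y: "y \<in> {x \<in> carrier G. df x \<in> N}"
    then show "x \<otimes>\<^bsub>G\<^esub> y \<in> {x \<in> carrier G. df x \<in> N}" using x df_mult[of x y] n(3,7) \<phi>_closed by simp
  qed auto
  fix g x assume "g \<in> carrier G" "x \<in> {x \<in> carrier G. df x \<in> N}"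
  then show "G.cj x g \<in> {x \<in> carrier G. df x \<in> N}" using df_conj[of x g] n(6,7) \<phi>_closed by simp
qed auto

text \<open>A finitely generated subgroup of \<open>1 + N\<close> stabilises the chain \<open>V j\<close> of annihilators of
  products of length \<open>j\<close>.\<close>

lemma one_plus_lnilp:
  assumes N: "ideal N R" and nil: "R.locnil N"
  shows "G.lnilp {x \<in> carrier G. df x \<in> N}"
  unfolding G.lnilp_def
proof (intro conjI allI impI)
  note H = G.normal_inD[OF one_plus_normal[OF N]]
  show "subgroup {x \<in> carrier G. df x \<in> N} G" by (rule H(1))
  fix S assume S: "finite S \<and> S \<subseteq> {x \<in> carrier G. df x \<in> N}"
  then have SG: "S \<subseteq> carrier G" by auto
  let ?B = "generate G S"
  have B: "subgroup ?B G" by (rule G.gen_sub[OF SG])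
  have BG: "x \<in> carrier G" if "x \<in> ?B" for x using G.gen_carrier[OF SG] that by auto
  let ?F = "df ` S \<union> (\<lambda>s. df (inv\<^bsub>G\<^esub> s)) ` S"
  have FN: "?F \<subseteq> N" using S G.sub_closed(2)[OF H(1)] by auto
  have Fc: "?F \<subseteq> carrier R" using SG by auto
  have "finite ?F" using S by simp
  from R.locnilD[OF nil this FN]
  obtain m where m: "\<And>w. set w \<subseteq> ?F \<Longrightarrow> length w = m \<Longrightarrow> R.lprod w = \<zero>\<^bsub>R\<^esub>" by metis
  define V where "V j = {z \<in> carrier R. \<forall>w. set w \<subseteq> ?F \<longrightarrow> length w = j \<longrightarrow> z \<otimes>\<^bsub>R\<^esub> R.lprod w = \<zero>\<^bsub>R\<^esub>}" for j
  have Vc: "z \<in> carrier R" if "z \<in> V j" for z j using that unfolding V_def by auto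
  have lc: "R.lprod w \<in> carrier R" if "set w \<subseteq> ?F" for w using that Fc by (intro R.lprod_closed) auto
  have Vadd: "y \<oplus>\<^bsub>R\<^esub> z \<in> V j" if "y \<in> V j" "z \<in> V j" for y z j
    using that lc unfolding V_def by (simp add: R.l_distr)
  have Vneg: "\<ominus>\<^bsub>R\<^esub> z \<in> V j" if "z \<in> V j" for z j
    using that lc unfolding V_def by (simp add: R.l_minus)
  have V0: "V 0 = {\<zero>\<^bsub>R\<^esub>}" unfolding V_def by auto
  have VS: "V j \<subseteq> V (Suc j)" for j
  proof
    fix z assume z: "z \<in> V j"
    have "z \<otimes>\<^bsub>R\<^esub> R.lprod w = \<zero>\<^bsub>R\<^esub>" if w: "set w \<subseteq> ?F" "length w = Suc j" for w
    proof -
      obtain w' f where w': "w = w' @ [f]" using w(2) by (cases w rule: rev_cases) auto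
      have c: "set w' \<subseteq> carrier R" "f \<in> carrier R" using w(1) w' Fc by auto
      have "z \<otimes>\<^bsub>R\<^esub> R.lprod w' = \<zero>\<^bsub>R\<^esub>" using z w w' unfolding V_def by auto
      moreover have "z \<otimes>\<^bsub>R\<^esub> R.lprod w = z \<otimes>\<^bsub>R\<^esub> R.lprod w' \<otimes>\<^bsub>R\<^esub> f"
        unfolding w' using c Vc[OF z] by (simp add: R.lprod_append R.m_assoc)
      ultimately show ?thesis using c by simp
    qed
    then show "z \<in> V (Suc j)" unfolding V_def using Vc[OF z] by auto
  qed
  have Vmono: "V i \<subseteq> V j" if "i \<le> j" for i j using that by (rule lift_Suc_mono_le[of V, rotated]) (rule VS)
  \<comment> \<open>Elements whose \<open>df\<close>, multiplied from the right, lowers the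
    filtration \<open>V\<close> by \<open>k\<close> levels. The truncated subtraction is harmless,
    since \<open>V 0\<close> is zero.\<close>
  define \<Gamma> where "\<Gamma> k = {x \<in> ?B. \<forall>j. \<forall>z\<in>V j. z \<otimes>\<^bsub>R\<^esub> df x \<in> V (j - k)}" for k
  have act: "z \<otimes>\<^bsub>R\<^esub> \<phi> x \<in> V j" if x: "x \<in> \<Gamma> k" and z: "z \<in> V j" for x z j k
  proof -
    have xG: "x \<in> carrier G" using x BG unfolding \<Gamma>_def by auto
    have "z \<otimes>\<^bsub>R\<^esub> df x \<in> V j" using x z Vmono[of "j - k" j] unfolding \<Gamma>_def by auto
    then show ?thesis using \<phi>_df[OF xG] Vc[OF z] xG Vadd[OF _ z] by (simp add: R.r_distr)
  qed
  have gen\<Gamma>: "f \<in> ?F \<Longrightarrow> z \<in> V j \<Longrightarrow> z \<otimes>\<^bsub>R\<^esub> f \<in> V (j - 1)" for f z j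
  proof -
    assume f: "f \<in> ?F" and z: "z \<in> V j"
    have fc: "f \<in> carrier R" using f Fc by auto
    show "z \<otimes>\<^bsub>R\<^esub> f \<in> V (j - 1)"
    proof (cases j)
      case 0 then show ?thesis using z V0 fc by simp
    next
      case (Suc i)
      have "z \<otimes>\<^bsub>R\<^esub> f \<otimes>\<^bsub>R\<^esub> R.lprod w = \<zero>\<^bsub>R\<^esub>" if w: "set w \<subseteq> ?F" "length w = i" for w
      proof -
        have "set (f # w) \<subseteq> ?F" using f w(1) by simp
        moreover have "length (f # w) = j" using w(2) Suc by simp
        ultimately have "z \<otimes>\<^bsub>R\<^esub> R.lprod (f # w) = \<zero>\<^bsub>R\<^esub>" using z unfolding V_def by blast
        then show ?thesis using fc Vc[OF z] lc[OF w(1)] by (simp add: R.m_assoc)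
      qed
      then show ?thesis using Suc fc Vc[OF z] unfolding V_def by simp
    qed
  qed
  have \<Gamma>mult: "x \<otimes>\<^bsub>G\<^esub> y \<in> \<Gamma> k" if x: "x \<in> \<Gamma> k" and y: "y \<in> \<Gamma> k" for x y k
  proof -
    have G: "x \<in> carrier G" "y \<in> carrier G" "x \<in> ?B" "y \<in> ?B" using x y BG unfolding \<Gamma>_def by auto
    have "z \<otimes>\<^bsub>R\<^esub> df (x \<otimes>\<^bsub>G\<^esub> y) \<in> V (j - k)" if z: "z \<in> V j" for j z
    proof -
      have "z \<otimes>\<^bsub>R\<^esub> df x \<in> V (j - k)" "z \<otimes>\<^bsub>R\<^esub> df y \<in> V (j - k)" using x y z unfolding \<Gamma>_def by auto
      then have "z \<otimes>\<^bsub>R\<^esub> df x \<otimes>\<^bsub>R\<^esub> \<phi> y \<oplus>\<^bsub>R\<^esub> z \<otimes>\<^bsub>R\<^esub> df y \<in> V (j - k)" using act[OF y] Vadd by auto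
      then show ?thesis using df_mult[OF G(1,2)] Vc[OF z] G \<phi>_closed by (simp add: R.r_distr R.m_assoc)
    qed
    then show ?thesis unfolding \<Gamma>_def using G.sub_closed(1)[OF B G(3,4)] by auto
  qed
  have S1: "s \<in> \<Gamma> 1" "inv\<^bsub>G\<^esub> s \<in> \<Gamma> 1" if s: "s \<in> S" for s
  proof -
    have "s \<in> ?B" "inv\<^bsub>G\<^esub> s \<in> ?B" using s by (auto intro: generate.incl generate.inv)
    then show "s \<in> \<Gamma> 1" "inv\<^bsub>G\<^esub> s \<in> \<Gamma> 1" unfolding \<Gamma>_def using gen\<Gamma> s by auto
  qed
  have one: "\<one>\<^bsub>G\<^esub> \<in> \<Gamma> k" for k
  proof -
    have "df \<one>\<^bsub>G\<^esub> = \<zero>\<^bsub>R\<^esub>" using \<phi>_one by (simp add: df_def R.minus_eq R.r_neg)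
    moreover have "\<zero>\<^bsub>R\<^esub> \<in> V j" for j using Vmono[of 0 j] V0 by auto
    ultimately show ?thesis unfolding \<Gamma>_def using generate.one Vc by simp
  qed
  have B1: "x \<in> \<Gamma> 1" if "x \<in> ?B" for x
    using that
  proof induction
    case one then show ?case by (rule \<open>\<And>k. \<one>\<^bsub>G\<^esub> \<in> \<Gamma> k\<close>)
  qed (use S1 \<Gamma>mult in auto)
  have \<Gamma>inv: "inv\<^bsub>G\<^esub> x \<in> \<Gamma> k" if x: "x \<in> \<Gamma> k" for x k
  proof -
    have xB: "x \<in> ?B" and xG: "x \<in> carrier G" using x BG unfolding \<Gamma>_def by auto
    have iB: "inv\<^bsub>G\<^esub> x \<in> ?B" using G.sub_closed(2)[OF B xB] .
    have "z \<otimes>\<^bsub>R\<^esub> df (inv\<^bsub>G\<^esub> x) \<in> V (j - k)" if z: "z \<in> V j" for j z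
    proof -
      have "z \<otimes>\<^bsub>R\<^esub> \<phi> (inv\<^bsub>G\<^esub> x) \<in> V j" using act[OF B1[OF iB] z] .
      then have "z \<otimes>\<^bsub>R\<^esub> \<phi> (inv\<^bsub>G\<^esub> x) \<otimes>\<^bsub>R\<^esub> df x \<in> V (j - k)" using x unfolding \<Gamma>_def by auto
      then have "\<ominus>\<^bsub>R\<^esub> (z \<otimes>\<^bsub>R\<^esub> \<phi> (inv\<^bsub>G\<^esub> x) \<otimes>\<^bsub>R\<^esub> df x) \<in> V (j - k)" by (rule Vneg)
      then show ?thesis using df_inv[OF xG] Vc[OF z] xG \<phi>_closed by (simp add: R.r_minus R.m_assoc)
    qed
    then show ?thesis unfolding \<Gamma>_def using iB by auto
  qed
  have \<Gamma>gen: "generate G T \<subseteq> \<Gamma> k" if "T \<subseteq> \<Gamma> k" for T k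
  proof
    fix x assume "x \<in> generate G T"
    then show "x \<in> \<Gamma> k" by induction (use one that \<Gamma>inv \<Gamma>mult in auto)
  qed
  have comm: "G.comm x y \<in> \<Gamma> (Suc k)" if x: "x \<in> \<Gamma> k" and y: "y \<in> ?B" for x y k
  proof -
    have xB: "x \<in> ?B" using x unfolding \<Gamma>_def by auto
    have G: "x \<in> carrier G" "y \<in> carrier G" using xB y BG by auto
    have iB: "inv\<^bsub>G\<^esub> x \<in> ?B" "inv\<^bsub>G\<^esub> y \<in> ?B" using G.sub_closed(2)[OF B] xB y by auto
    have y1: "y \<in> \<Gamma> 1" using B1[OF y] .
    have "z \<otimes>\<^bsub>R\<^esub> df (G.comm x y) \<in> V (j - Suc k)" if z: "z \<in> V j" for j z
    proof -
      define z' where "z' = z \<otimes>\<^bsub>R\<^esub> \<phi> (inv\<^bsub>G\<^esub> x) \<otimes>\<^bsub>R\<^esub> \<phi> (inv\<^bsub>G\<^esub> y)"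
      have z': "z' \<in> V j" unfolding z'_def using act[OF B1] iB z by auto
      have z'c: "z' \<in> carrier R" using Vc[OF z'] .
      have "z' \<otimes>\<^bsub>R\<^esub> df x \<otimes>\<^bsub>R\<^esub> df y \<in> V (j - k - 1)" using x y1 z' unfolding \<Gamma>_def by blast
      moreover have "z' \<otimes>\<^bsub>R\<^esub> df y \<otimes>\<^bsub>R\<^esub> df x \<in> V (j - 1 - k)" using x y1 z' unfolding \<Gamma>_def by blast
      ultimately have "z' \<otimes>\<^bsub>R\<^esub> df x \<otimes>\<^bsub>R\<^esub> df y \<oplus>\<^bsub>R\<^esub> (\<ominus>\<^bsub>R\<^esub> (z' \<otimes>\<^bsub>R\<^esub> df y \<otimes>\<^bsub>R\<^esub> df x)) \<in> V (j - Suc k)"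
        using Vadd Vneg by (simp add: diff_diff_add)
      moreover have "z \<otimes>\<^bsub>R\<^esub> df (G.comm x y) = z' \<otimes>\<^bsub>R\<^esub> (df x \<otimes>\<^bsub>R\<^esub> df y \<ominus>\<^bsub>R\<^esub> df y \<otimes>\<^bsub>R\<^esub> df x)"
        unfolding z'_def df_comm[OF G] using Vc[OF z] G \<phi>_closed by (simp add: R.m_assoc)
      ultimately show ?thesis using z'c G by (simp add: R.minus_eq R.r_distr R.r_minus R.m_assoc)
    qed
    then show ?thesis unfolding \<Gamma>_def using G.sub_closed(4)[OF B xB y] by auto
  qed
  \<comment> \<open>The index is shifted by one because \<open>lcs\<close> starts with the whole
    subgroup, which lies in \<open>\<Gamma> 1\<close>.\<close>
  have "G.lcs ?B n \<subseteq> \<Gamma> (Suc n)" for n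
  proof (induction n)
    case 0 then show ?case using B1 by auto
  next
    case (Suc n)
    show ?case unfolding G.lcs.simps(2)
      by (rule \<Gamma>gen) (use Suc comm in auto)
  qed
  \<comment> \<open>All products of length \<open>m\<close> vanish, so the one of the ring lies in
    \<open>V m\<close>, and lowering it by more than \<open>m\<close> levels gives zero.\<close>
  moreover have "\<Gamma> (Suc m) \<subseteq> {\<one>\<^bsub>G\<^esub>}"
  proof
    fix x assume x: "x \<in> \<Gamma> (Suc m)"
    have xG: "x \<in> carrier G" using x BG unfolding \<Gamma>_def by auto
    have "\<one>\<^bsub>R\<^esub> \<in> V m" unfolding V_def using m lc by auto
    then have "\<one>\<^bsub>R\<^esub> \<otimes>\<^bsub>R\<^esub> df x \<in> V (m - Suc m)" using x unfolding \<Gamma>_def by blast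
    then have "df x = \<zero>\<^bsub>R\<^esub>" using V0 xG by simp
    then have "\<phi> x = \<one>\<^bsub>R\<^esub>" using \<phi>_df[OF xG] by simp
    then show "x \<in> {\<one>\<^bsub>G\<^esub>}" using \<phi>_inj[OF xG] by simp
  qed
  ultimately have "G.lcs ?B m \<subseteq> {\<one>\<^bsub>G\<^esub>}" by blast
  then show "G.nilp ?B" by (rule G.nilpI[OF B])
qed

end

section \<open>Multilinearisation of a polynomial identity\<close>

context ring begin

text \<open>Letters of \<open>u\<close> are read as positions in \<open>w\<close>: these are the
  monomials in position variables from \<open>T\<close> that turn into \<open>v\<close> when each
  position is replaced by the letter of \<open>w\<close> standing there. They arise when a variable
  is replaced by a sum of position variables.\<close>

definition fib :: "nat set \<Rightarrow> nat list \<Rightarrow> nat list \<Rightarrow> nat list set" where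
  "fib T w v = {u. set u \<subseteq> T \<and> map ((!) w) u = v}"

lemma finite_fib: "finite T \<Longrightarrow> finite (fib T w v)"
  by (rule finite_subset[of _ "{u. set u \<subseteq> T \<and> length u = length v}"])
    (auto simp: fib_def finite_lists_length_eq)

lemma fib_Cons: "fib T w (i # v) = (\<Union>j\<in>{j \<in> T. w ! j = i}. (#) j ` fib T w v)"
proof
  show "fib T w (i # v) \<subseteq> (\<Union>j\<in>{j \<in> T. w ! j = i}. (#) j ` fib T w v)"
  proof
    fix u assume u: "u \<in> fib T w (i # v)"
    then obtain j u' where "u = j # u'" unfolding fib_def by (cases u) auto
    then show "u \<in> (\<Union>j\<in>{j \<in> T. w ! j = i}. (#) j ` fib T w v)" using u unfolding fib_def by auto
  qed
qed (auto simp: fib_def)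

lemma mon_subst_sum:
  assumes T: "finite T" and y: "range y \<subseteq> carrier R"
  shows "mon (\<lambda>i. \<Oplus>j\<in>{j \<in> T. w ! j = i}. y j) v = (\<Oplus>u\<in>fib T w v. mon y u)"
proof (induction v)
  case Nil
  have "fib T w [] = {[]}" unfolding fib_def by auto
  then show ?case by simp
next
  case (Cons i v)
  let ?J = "{j \<in> T. w ! j = i}"
  have yc: "y j \<in> carrier R" for j using y by auto
  have mc: "mon y u \<in> carrier R" for u using yc by simp
  have fin: "finite ?J" "finite (fib T w v)" using T finite_fib by auto
  have "mon (\<lambda>i. \<Oplus>j\<in>{j \<in> T. w ! j = i}. y j) (i # v) = (\<Oplus>j\<in>?J. y j) \<otimes> (\<Oplus>u\<in>fib T w v. mon y u)"
    using Cons by simp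
  also have "\<dots> = (\<Oplus>j\<in>?J. y j \<otimes> (\<Oplus>u\<in>fib T w v. mon y u))"
    using fin yc mc by (intro finsum_ldistr finsum_closed) auto
  also have "\<dots> = (\<Oplus>j\<in>?J. \<Oplus>u\<in>(#) j ` fib T w v. mon y u)"
  proof (rule finsum_cong')
    fix j
    have "(\<Oplus>u\<in>(#) j ` fib T w v. mon y u) = (\<Oplus>u\<in>fib T w v. mon y (j # u))"
      using mc by (intro finsum_reindex) auto
    also have "\<dots> = (\<Oplus>u\<in>fib T w v. y j \<otimes> mon y u)" by simp
    also have "\<dots> = y j \<otimes> (\<Oplus>u\<in>fib T w v. mon y u)"
      using fin yc mc by (intro finsum_rdistr[symmetric]) auto
    finally show "y j \<otimes> (\<Oplus>u\<in>fib T w v. mon y u) = (\<Oplus>u\<in>(#) j ` fib T w v. mon y u)" by simp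
  qed (use mc in \<open>auto intro!: finsum_closed\<close>)
  also have "\<dots> = (\<Oplus>u\<in>(\<Union>j\<in>?J. (#) j ` fib T w v). mon y u)"
  proof (rule add.finprod_UN_disjoint[symmetric])
    show "pairwise (\<lambda>i j. disjnt ((#) i ` fib T w v) ((#) j ` fib T w v)) ?J"
      by (auto simp: pairwise_def disjnt_def)
  qed (use fin mc in auto)
  finally show ?case unfolding fib_Cons .
qed

text \<open>Setting the variable \<open>j\<close> to zero and subtracting isolates the monomials that contain \<open>j\<close>.\<close>

lemma finsum_isolate_letters:
  assumes Q: "finite Q" and F: "\<And>u. F u \<in> carrier R"
    and zero: "\<And>T. T \<subseteq> V \<Longrightarrow> (\<Oplus>u\<in>{u \<in> Q. set u \<subseteq> T}. F u) = \<zero>" and K: "finite K"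
  shows "T \<subseteq> V \<Longrightarrow> (\<Oplus>u\<in>{u \<in> Q. K \<subseteq> set u \<and> set u \<subseteq> T}. F u) = \<zero>"
  using K
proof (induction K arbitrary: T)
  case empty then show ?case using zero by simp
next
  case (insert j K)
  let ?A = "{u \<in> Q. insert j K \<subseteq> set u \<and> set u \<subseteq> T}" and ?B = "{u \<in> Q. K \<subseteq> set u \<and> set u \<subseteq> T - {j}}"
  have "{u \<in> Q. K \<subseteq> set u \<and> set u \<subseteq> T} = ?A \<union> ?B" by auto
  then have "(\<Oplus>u\<in>?A \<union> ?B. F u) = \<zero>" using insert.IH[OF insert.prems] by simp
  moreover have "(\<Oplus>u\<in>?A \<union> ?B. F u) = (\<Oplus>u\<in>?A. F u) \<oplus> (\<Oplus>u\<in>?B. F u)"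
    using Q F by (intro finsum_Un_disjoint) auto
  moreover have "(\<Oplus>u\<in>?B. F u) = \<zero>" using insert.IH[of "T - {j}"] insert.prems by auto
  ultimately show ?case using F by (simp add: finsum_closed)
qed

end

context assoc_algebra begin

text \<open>Take a longest monomial \<open>w\<close> of \<open>f\<close>, of length
  \<open>n\<close>, and replace each variable by the sum of new variables, one for every position of
  \<open>w\<close> at which it occurs. A monomial of the result that contains all \<open>n\<close>
  new variables has length at most \<open>n\<close> and is therefore a permutation of them. The
  identity permutation has coefficient \<open>f w\<close>, which division turns into one.\<close>

theorem multilinear_identity_exists:
  assumes P: "field P" and f: "f \<in> nc_poly P" and w1: "f w1 \<noteq> \<zero>\<^bsub>P\<^esub>"
    and pi: "\<And>s. range s \<subseteq> carrier A \<Longrightarrow> nc_eval P A s f = \<zero>\<^bsub>A\<^esub>"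
  shows "\<exists>d \<alpha>. multilinear_identity d \<alpha>"
proof -
  let ?W = "{w. f w \<noteq> \<zero>\<^bsub>P\<^esub>}"
  have finW: "finite ?W" and fc: "f w \<in> carrier P" for w using f unfolding nc_poly_def by auto
  define n where "n = Max (length ` ?W)"
  have "n \<in> length ` ?W" unfolding n_def using finW w1 by (intro Max_in) auto
  then obtain w where w: "f w \<noteq> \<zero>\<^bsub>P\<^esub>" "length w = n" by auto
  have le: "length v \<le> n" if "f v \<noteq> \<zero>\<^bsub>P\<^esub>" for v unfolding n_def using finW that by (intro Max_ge) auto
  let ?g = "\<lambda>u. f (map ((!) w) u)"
  let ?Q = "{u. set u \<subseteq> {..<n} \<and> ?g u \<noteq> \<zero>\<^bsub>P\<^esub>}"
  have "?Q \<subseteq> {u. set u \<subseteq> {..<n} \<and> length u \<le> n}" using le by fastforce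
  then have finQ: "finite ?Q" using finite_lists_length_le[of "{..<n}" n] finite_subset by blast
  have key: "(\<Oplus>\<^bsub>A\<^esub>u\<in>perms_on {..<n}. ?g u \<odot>\<^bsub>A\<^esub> mon y u) = \<zero>\<^bsub>A\<^esub>" if y: "range y \<subseteq> carrier A" for y
  proof -
    have mc: "mon y u \<in> carrier A" for u using y by (intro mon_closed) auto
    let ?F = "\<lambda>u. ?g u \<odot>\<^bsub>A\<^esub> mon y u"
    have Fc: "?F u \<in> carrier A" for u using mc fc by simp
    have zero: "(\<Oplus>\<^bsub>A\<^esub>u\<in>{u \<in> ?Q. set u \<subseteq> T}. ?F u) = \<zero>\<^bsub>A\<^esub>" if T: "T \<subseteq> {..<n}" for T
    proof -
      let ?s = "\<lambda>i. \<Oplus>\<^bsub>A\<^esub>j\<in>{j \<in> T. w ! j = i}. y j"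
      have finT: "finite T" using T finite_subset by blast
      have sc: "range ?s \<subseteq> carrier A" using y by (auto intro!: finsum_closed)
      have "\<zero>\<^bsub>A\<^esub> = (\<Oplus>\<^bsub>A\<^esub>v\<in>?W. f v \<odot>\<^bsub>A\<^esub> mon ?s v)" using pi[OF sc] unfolding nc_eval_def by simp
      also have "\<dots> = (\<Oplus>\<^bsub>A\<^esub>v\<in>?W. \<Oplus>\<^bsub>A\<^esub>u\<in>fib T w v. ?F u)"
      proof (rule finsum_cong')
        fix v
        have "f v \<odot>\<^bsub>A\<^esub> mon ?s v = f v \<odot>\<^bsub>A\<^esub> (\<Oplus>\<^bsub>A\<^esub>u\<in>fib T w v. mon y u)" using mon_subst_sum[OF finT y] by simp
        also have "\<dots> = (\<Oplus>\<^bsub>A\<^esub>u\<in>fib T w v. f v \<odot>\<^bsub>A\<^esub> mon y u)"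
          using mc fc finite_fib[OF finT] by (intro finsum_smult_ldistr) auto
        also have "\<dots> = (\<Oplus>\<^bsub>A\<^esub>u\<in>fib T w v. ?F u)"
          using Fc by (intro finsum_cong') (auto simp: fib_def)
        finally show "f v \<odot>\<^bsub>A\<^esub> mon ?s v = (\<Oplus>\<^bsub>A\<^esub>u\<in>fib T w v. ?F u)" .
      qed (use Fc in \<open>auto intro!: finsum_closed\<close>)
      also have "\<dots> = (\<Oplus>\<^bsub>A\<^esub>u\<in>(\<Union>v\<in>?W. fib T w v). ?F u)"
        using finW finite_fib[OF finT] Fc
        by (intro add.finprod_UN_disjoint[symmetric]) (auto simp: pairwise_def disjnt_def fib_def)
      also have "(\<Union>v\<in>?W. fib T w v) = {u \<in> ?Q. set u \<subseteq> T}" using T unfolding fib_def by auto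
      finally show ?thesis by simp
    qed
    have 1: "(\<Oplus>\<^bsub>A\<^esub>u\<in>{u \<in> ?Q. {..<n} \<subseteq> set u \<and> set u \<subseteq> {..<n}}. ?F u) = \<zero>\<^bsub>A\<^esub>"
      by (rule finsum_isolate_letters[OF finQ Fc zero]) auto
    \<comment> \<open>Permutations whose monomial has coefficient zero in \<open>f\<close> are
      missing from \<open>?Q\<close>; they form \<open>?B\<close> and contribute nothing.\<close>
    let ?A = "{u \<in> ?Q. {..<n} \<subseteq> set u \<and> set u \<subseteq> {..<n}}" and ?B = "{u \<in> perms_on {..<n}. ?g u = \<zero>\<^bsub>P\<^esub>}"
    have AB: "perms_on {..<n} = ?A \<union> ?B"
    proof
      show "?A \<union> ?B \<subseteq> perms_on {..<n}"
      proof
        fix u assume "u \<in> ?A \<union> ?B"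
        then show "u \<in> perms_on {..<n}"
        proof
          assume u: "u \<in> ?A"
          then have s: "set u = {..<n}" by auto
          have "length u \<le> n" using le[of "map ((!) w) u"] u by simp
          then have "card (set u) = length u" using card_length[of u] s by simp
          then have "distinct u" by (rule card_distinct)
          then show ?thesis unfolding perms_on_def using s by simp
        qed auto
      qed
    qed (auto simp: perms_on_def)
    have finA: "finite ?A" by (rule finite_subset[OF _ finQ]) auto
    have finB: "finite ?B" by (simp add: finite_perms_on)
    have "(\<Oplus>\<^bsub>A\<^esub>u\<in>perms_on {..<n}. ?F u) = (\<Oplus>\<^bsub>A\<^esub>u\<in>?A \<union> ?B. ?F u)"
      by (rule arg_cong[OF AB])
    also have "\<dots> = (\<Oplus>\<^bsub>A\<^esub>u\<in>?A. ?F u) \<oplus>\<^bsub>A\<^esub> (\<Oplus>\<^bsub>A\<^esub>u\<in>?B. ?F u)"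
      using Fc by (intro finsum_Un_disjoint finA finB) auto
    also have "(\<Oplus>\<^bsub>A\<^esub>u\<in>?B. ?F u) = (\<Oplus>\<^bsub>A\<^esub>u\<in>?B. \<zero>\<^bsub>A\<^esub>)"
      using mc by (intro finsum_cong') auto
    finally show ?thesis using 1 by simp
  qed
  interpret P: field P by fact
  have inv: "inv\<^bsub>P\<^esub> (f w) \<in> carrier P" "inv\<^bsub>P\<^esub> (f w) \<otimes>\<^bsub>P\<^esub> f w = \<one>\<^bsub>P\<^esub>"
    using P.field_Units fc[of w] w(1) by auto
  define \<alpha> where "\<alpha> u = (inv\<^bsub>P\<^esub> (f w) \<otimes>\<^bsub>P\<^esub> ?g u) \<odot>\<^bsub>A\<^esub> \<one>\<^bsub>A\<^esub>" for u
  have cc: "inv\<^bsub>P\<^esub> (f w) \<otimes>\<^bsub>P\<^esub> ?g u \<in> carrier P" for u using inv(1) fc by auto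
  have \<alpha>m: "\<alpha> u \<otimes>\<^bsub>A\<^esub> x = (inv\<^bsub>P\<^esub> (f w) \<otimes>\<^bsub>P\<^esub> ?g u) \<odot>\<^bsub>A\<^esub> x" "x \<otimes>\<^bsub>A\<^esub> \<alpha> u = (inv\<^bsub>P\<^esub> (f w) \<otimes>\<^bsub>P\<^esub> ?g u) \<odot>\<^bsub>A\<^esub> x"
    if "x \<in> carrier A" for u x
    unfolding \<alpha>_def using that cc by (simp_all add: smult_mult_left smult_mult_right)
  have "multilinear_identity n \<alpha>"
    unfolding multilinear_identity_def
  proof (intro conjI allI impI)
    show "central (\<alpha> u)" for u unfolding central_def using \<alpha>m cc by (auto simp: \<alpha>_def)
    have "map ((!) w) [0..<n] = w" using w(2) map_nth by blast
    then show "\<alpha> [0..<n] = \<one>\<^bsub>A\<^esub>" unfolding \<alpha>_def using inv(2) by simp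
    fix s :: "nat \<Rightarrow> 'c" assume s: "range s \<subseteq> carrier A"
    have mc: "mon s u \<in> carrier A" for u using s by (intro mon_closed) auto
    have "(\<Oplus>\<^bsub>A\<^esub>u\<in>perms_on {..<n}. \<alpha> u \<otimes>\<^bsub>A\<^esub> mon s u)
        = (\<Oplus>\<^bsub>A\<^esub>u\<in>perms_on {..<n}. inv\<^bsub>P\<^esub> (f w) \<odot>\<^bsub>A\<^esub> (?g u \<odot>\<^bsub>A\<^esub> mon s u))"
      using mc inv(1) fc \<alpha>m(1) by (intro finsum_cong') (auto simp: smult_assoc1)
    also have "\<dots> = inv\<^bsub>P\<^esub> (f w) \<odot>\<^bsub>A\<^esub> (\<Oplus>\<^bsub>A\<^esub>u\<in>perms_on {..<n}. ?g u \<odot>\<^bsub>A\<^esub> mon s u)"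
      using mc inv(1) fc by (intro finsum_smult_ldistr[symmetric]) (auto simp: finite_perms_on)
    also have "\<dots> = \<zero>\<^bsub>A\<^esub>" using key[OF s] inv(1) by simp
    finally show "(\<Oplus>\<^bsub>A\<^esub>u\<in>perms_on {..<n}. \<alpha> u \<otimes>\<^bsub>A\<^esub> mon s u) = \<zero>\<^bsub>A\<^esub>" .
  qed
  then show ?thesis by blast
qed

end

section \<open>Simple modules over rings with a multilinear identity\<close>

context abelian_group begin

text \<open>Functions live on the whole type, but only their values on the carrier are constrained,
  here and in \<open>commutes\<close>. Sets of endomorphisms are therefore kept closed under changes
  off the carrier.\<close>

definition endo :: "('a \<Rightarrow> 'a) \<Rightarrow> bool" where
  "endo f \<longleftrightarrow> (\<forall>x\<in>carrier G. f x \<in> carrier G) \<and>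
     (\<forall>x\<in>carrier G. \<forall>y\<in>carrier G. f (x \<oplus> y) = f x \<oplus> f y)"

definition commutes :: "('a \<Rightarrow> 'a) \<Rightarrow> ('a \<Rightarrow> 'a) \<Rightarrow> bool" where
  "commutes f g \<longleftrightarrow> (\<forall>x\<in>carrier G. f (g x) = g (f x))"

lemma endo_closed [simp]: "endo f \<Longrightarrow> x \<in> carrier G \<Longrightarrow> f x \<in> carrier G"
  and endo_add: "endo f \<Longrightarrow> x \<in> carrier G \<Longrightarrow> y \<in> carrier G \<Longrightarrow> f (x \<oplus> y) = f x \<oplus> f y"
  by (auto simp: endo_def)

lemma endo_zero [simp]: "endo f \<Longrightarrow> f \<zero> = \<zero>"
  using endo_add[of f \<zero> \<zero>] endo_closed[of f \<zero>] by (simp add: add.r_cancel_one')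

lemma endo_neg: "endo f \<Longrightarrow> x \<in> carrier G \<Longrightarrow> f (\<ominus> x) = \<ominus> f x"
proof -
  assume f: "endo f" and x: "x \<in> carrier G"
  have "f (\<ominus> x) \<oplus> f x = \<zero>" using endo_add[OF f, of "\<ominus> x" x] x f by (simp add: l_neg)
  then show ?thesis using x f by (intro minus_equality[symmetric]) auto
qed

lemma minus_eq_zero_iff: "x \<in> carrier G \<Longrightarrow> y \<in> carrier G \<Longrightarrow> x \<ominus> y = \<zero> \<longleftrightarrow> x = y"
proof
  assume c: "x \<in> carrier G" "y \<in> carrier G" and "x \<ominus> y = \<zero>"
  then have "x \<ominus> y \<oplus> y = y" by simp
  then show "x = y" using c by (simp add: minus_eq a_assoc l_neg)
qed (simp add: minus_eq r_neg)

lemma endo_finsum: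
  assumes f: "endo f" and "finite P" "\<And>u. u \<in> P \<Longrightarrow> g u \<in> carrier G"
  shows "f (finsum G g P) = (\<Oplus>u\<in>P. f (g u))"
  using assms(2,3)
proof (induction P)
  case (insert u P)
  then have "g \<in> P \<rightarrow> carrier G" "(\<lambda>u. f (g u)) \<in> P \<rightarrow> carrier G" using f by auto
  then show ?case using insert f by (simp add: finsum_insert endo_add[OF f] finsum_closed)
qed (use f in simp)

end

text \<open>\<open>K\<close> is a maximal commutative ring of endomorphisms commuting with \<open>R\<close>; by Schur's lemma
  it is a field, and \<open>M\<close> is a \<open>K\<close>-vector space on which \<open>R\<close> acts \<open>K\<close>-linearly.\<close>

locale ring_rep = R: ring R + M: abelian_group M for R (structure) and M (structure) +
  fixes \<rho> :: "'a \<Rightarrow> 'c \<Rightarrow> 'c"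
  assumes \<rho>_endo: "a \<in> carrier R \<Longrightarrow> M.endo (\<rho> a)"
    and \<rho>_add: "a \<in> carrier R \<Longrightarrow> b \<in> carrier R \<Longrightarrow> x \<in> carrier M \<Longrightarrow> \<rho> (a \<oplus>\<^bsub>R\<^esub> b) x = \<rho> a x \<oplus>\<^bsub>M\<^esub> \<rho> b x"
    and \<rho>_mult: "a \<in> carrier R \<Longrightarrow> b \<in> carrier R \<Longrightarrow> x \<in> carrier M \<Longrightarrow> \<rho> (a \<otimes>\<^bsub>R\<^esub> b) x = \<rho> a (\<rho> b x)"
    and \<rho>_one: "x \<in> carrier M \<Longrightarrow> \<rho> \<one>\<^bsub>R\<^esub> x = x"

text \<open>The condition \<open>simple\<close> concerns submodules stable under both
  \<open>R\<close> and \<open>K\<close>, so \<open>M\<close> may fail to be simple over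
  \<open>R\<close> alone. In the application the variable of a polynomial ring acts through
  \<open>K\<close>.\<close>

locale linear_rep = ring_rep +
  fixes K :: "('c \<Rightarrow> 'c) set"
  assumes K_endo: "k \<in> K \<Longrightarrow> M.endo k"
    and K_\<rho>: "k \<in> K \<Longrightarrow> a \<in> carrier R \<Longrightarrow> M.commutes k (\<rho> a)"
    and K_comm: "k \<in> K \<Longrightarrow> l \<in> K \<Longrightarrow> M.commutes k l"
    and K_max: "M.endo f \<Longrightarrow> (\<And>a. a \<in> carrier R \<Longrightarrow> M.commutes f (\<rho> a)) \<Longrightarrow> (\<And>k. k \<in> K \<Longrightarrow> M.commutes f k) \<Longrightarrow> f \<in> K"
    and nontrivial: "\<exists>x\<in>carrier M. x \<noteq> \<zero>\<^bsub>M\<^esub>"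
    and simple: "Q \<subseteq> carrier M \<Longrightarrow> \<zero>\<^bsub>M\<^esub> \<in> Q \<Longrightarrow> (\<And>x y. x \<in> Q \<Longrightarrow> y \<in> Q \<Longrightarrow> x \<oplus>\<^bsub>M\<^esub> y \<in> Q) \<Longrightarrow>
      (\<And>a x. a \<in> carrier R \<Longrightarrow> x \<in> Q \<Longrightarrow> \<rho> a x \<in> Q) \<Longrightarrow> (\<And>k x. k \<in> K \<Longrightarrow> x \<in> Q \<Longrightarrow> k x \<in> Q) \<Longrightarrow>
      x \<in> Q \<Longrightarrow> x \<noteq> \<zero>\<^bsub>M\<^esub> \<Longrightarrow> Q = carrier M"

context ring_rep begin

lemma \<rho>_closed [simp]: "a \<in> carrier R \<Longrightarrow> x \<in> carrier M \<Longrightarrow> \<rho> a x \<in> carrier M"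
  using M.endo_closed[OF \<rho>_endo] .

lemma \<rho>_zero: "x \<in> carrier M \<Longrightarrow> \<rho> \<zero>\<^bsub>R\<^esub> x = \<zero>\<^bsub>M\<^esub>"
  using \<rho>_add[of "\<zero>\<^bsub>R\<^esub>" "\<zero>\<^bsub>R\<^esub>" x] M.add.r_cancel_one'[of "\<rho> \<zero>\<^bsub>R\<^esub> x" "\<rho> \<zero>\<^bsub>R\<^esub> x"] by simp

lemma \<rho>_finsum:
  assumes "finite P" "\<And>u. u \<in> P \<Longrightarrow> g u \<in> carrier R" and x: "x \<in> carrier M"
  shows "\<rho> (finsum R g P) x = (\<Oplus>\<^bsub>M\<^esub>u\<in>P. \<rho> (g u) x)"
  using assms(1,2)
proof (induction P)
  case empty then show ?case using x by (simp add: \<rho>_zero)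
next
  case (insert u P)
  then have "g \<in> P \<rightarrow> carrier R" "(\<lambda>u. \<rho> (g u) x) \<in> P \<rightarrow> carrier M" using x by auto
  then show ?case using insert x by (simp add: R.finsum_insert M.finsum_insert \<rho>_add R.finsum_closed)
qed

end

context linear_rep begin

lemma K_closed [simp]: "k \<in> K \<Longrightarrow> x \<in> carrier M \<Longrightarrow> k x \<in> carrier M"
  using M.endo_closed[OF K_endo] .

lemma K_swap: "k \<in> K \<Longrightarrow> a \<in> carrier R \<Longrightarrow> x \<in> carrier M \<Longrightarrow> k (\<rho> a x) = \<rho> a (k x)"
  "k \<in> K \<Longrightarrow> l \<in> K \<Longrightarrow> x \<in> carrier M \<Longrightarrow> k (l x) = l (k x)"
  using K_\<rho> K_comm unfolding M.commutes_def by auto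

lemma K_zero: "(\<lambda>x. \<zero>\<^bsub>M\<^esub>) \<in> K"
proof (rule K_max)
  show "M.commutes (\<lambda>x. \<zero>\<^bsub>M\<^esub>) (\<rho> a)" if "a \<in> carrier R" for a
    using M.endo_zero[OF \<rho>_endo[OF that]] unfolding M.commutes_def by simp
  show "M.commutes (\<lambda>x. \<zero>\<^bsub>M\<^esub>) k" if "k \<in> K" for k
    using M.endo_zero[OF K_endo[OF that]] unfolding M.commutes_def by simp
qed (simp add: M.endo_def)

lemma K_id: "(\<lambda>x. x) \<in> K"
  by (rule K_max) (simp_all add: M.endo_def M.commutes_def)

lemma K_comp:
  assumes "k \<in> K" "l \<in> K"
  shows "(\<lambda>x. k (l x)) \<in> K"
proof (rule K_max)
  show "M.endo (\<lambda>x. k (l x))"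
    using assms K_endo[OF assms(1)] K_endo[OF assms(2)] by (simp add: M.endo_def)
  show "M.commutes (\<lambda>x. k (l x)) (\<rho> a)" if "a \<in> carrier R" for a
    unfolding M.commutes_def using that assms by (simp add: K_swap(1))
  show "M.commutes (\<lambda>x. k (l x)) j" if "j \<in> K" for j
    unfolding M.commutes_def using that assms by (simp add: K_swap(2)[of k j] K_swap(2)[of l j])
qed

lemma K_diff:
  assumes "k \<in> K" "l \<in> K"
  shows "(\<lambda>x. k x \<ominus>\<^bsub>M\<^esub> l x) \<in> K"
proof (rule K_max)
  note e = K_endo[OF assms(1)] K_endo[OF assms(2)]
  show "M.endo (\<lambda>x. k x \<ominus>\<^bsub>M\<^esub> l x)"
    unfolding M.endo_def using assms by (auto simp: M.endo_add[OF e(1)] M.endo_add[OF e(2)] M.minus_eq M.minus_add M.a_ac)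
  fix a assume a: "a \<in> carrier R"
  show "M.commutes (\<lambda>x. k x \<ominus>\<^bsub>M\<^esub> l x) (\<rho> a)"
    unfolding M.commutes_def using a assms
    by (auto simp: K_swap(1) M.minus_eq M.endo_add[OF \<rho>_endo[OF a]] M.endo_neg[OF \<rho>_endo[OF a]])
next
  fix j assume j: "j \<in> K"
  show "M.commutes (\<lambda>x. k x \<ominus>\<^bsub>M\<^esub> l x) j"
    unfolding M.commutes_def using j assms
    by (auto simp: K_swap(2)[of k j] K_swap(2)[of l j] M.minus_eq M.endo_add[OF K_endo[OF j]] M.endo_neg[OF K_endo[OF j]])
qed

text \<open>Schur's lemma: kernel and image of \<open>k\<close> are stable under \<open>R\<close>
  and, since \<open>K\<close> is commutative, under \<open>K\<close>. The inverse again commutes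
  with \<open>R\<close> and \<open>K\<close> and belongs to \<open>K\<close> by maximality.\<close>

lemma K_inverse:
  assumes k: "k \<in> K" and x0: "x0 \<in> carrier M" "k x0 \<noteq> \<zero>\<^bsub>M\<^esub>"
  shows "\<exists>l\<in>K. \<forall>x\<in>carrier M. l (k x) = x \<and> k (l x) = x"
proof -
  note e = K_endo[OF k]
  have ker: "x = \<zero>\<^bsub>M\<^esub>" if x: "x \<in> carrier M" "k x = \<zero>\<^bsub>M\<^esub>" for x
  proof (rule ccontr)
    assume nz: "x \<noteq> \<zero>\<^bsub>M\<^esub>"
    let ?Q = "{x \<in> carrier M. k x = \<zero>\<^bsub>M\<^esub>}"
    have "?Q = carrier M"
    proof (rule simple[of ?Q x])
      fix l x assume l: "l \<in> K" and x: "x \<in> ?Q"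
      have "k (l x) = l (k x)" using K_swap(2)[OF k l] x by auto
      then show "l x \<in> ?Q" using l x M.endo_zero[OF K_endo[OF l]] by auto
    next
      fix a x assume a: "a \<in> carrier R" and x: "x \<in> ?Q"
      have "k (\<rho> a x) = \<rho> a (k x)" using K_swap(1)[OF k a] x by auto
      then show "\<rho> a x \<in> ?Q" using a x M.endo_zero[OF \<rho>_endo[OF a]] by auto
    qed (use x nz e in \<open>auto simp: M.endo_add\<close>)
    then show False using x0 by auto
  qed
  have im: "\<exists>x\<in>carrier M. k x = y" if y: "y \<in> carrier M" for y
  proof -
    have "k ` carrier M = carrier M"
    proof (rule simple[of "k ` carrier M" "k x0"])
      show "\<zero>\<^bsub>M\<^esub> \<in> k ` carrier M" by (rule image_eqI[of _ _ "\<zero>\<^bsub>M\<^esub>"]) (simp_all add: e)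
      fix x y assume "x \<in> k ` carrier M" "y \<in> k ` carrier M"
      then obtain x' y' where xy: "x = k x'" "x' \<in> carrier M" "y = k y'" "y' \<in> carrier M" by auto
      have "x \<oplus>\<^bsub>M\<^esub> y = k (x' \<oplus>\<^bsub>M\<^esub> y')" unfolding xy using xy by (simp add: M.endo_add[OF e])
      then show "x \<oplus>\<^bsub>M\<^esub> y \<in> k ` carrier M" using xy by auto
    next
      fix a x assume a: "a \<in> carrier R" and "x \<in> k ` carrier M"
      then obtain x' where x: "x = k x'" "x' \<in> carrier M" by auto
      have "\<rho> a x = k (\<rho> a x')" unfolding x using K_swap(1)[OF k a] x by simp
      then show "\<rho> a x \<in> k ` carrier M" using a x by auto
    next
      fix l x assume l: "l \<in> K" and "x \<in> k ` carrier M"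
      then obtain x' where x: "x = k x'" "x' \<in> carrier M" by auto
      have "l x = k (l x')" unfolding x using K_swap(2)[OF l k] x by simp
      then show "l x \<in> k ` carrier M" using l x by auto
    qed (use k x0 in auto)
    then have "y \<in> k ` carrier M" using y by simp
    then show ?thesis by auto
  qed
  have inj: "x = y" if "x \<in> carrier M" "y \<in> carrier M" "k x = k y" for x y
  proof -
    have "k (x \<ominus>\<^bsub>M\<^esub> y) = \<zero>\<^bsub>M\<^esub>"
      using that k by (simp add: M.minus_eq M.endo_add[OF e] M.endo_neg[OF e] M.r_neg)
    then have "x \<ominus>\<^bsub>M\<^esub> y = \<zero>\<^bsub>M\<^esub>" using ker that by simp
    then show ?thesis using that by (simp add: M.minus_eq_zero_iff)
  qed
  define l where "l y = (SOME x. x \<in> carrier M \<and> k x = y)" for y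
  have l: "l y \<in> carrier M" "k (l y) = y" if "y \<in> carrier M" for y
    using someI_ex[of "\<lambda>x. x \<in> carrier M \<and> k x = y"] im[OF that] unfolding l_def by auto
  have lk: "l (k x) = x" if "x \<in> carrier M" for x
    by (rule inj) (use l k that in auto)
  have "l \<in> K"
  proof (rule K_max)
    show "M.endo l" unfolding M.endo_def
    proof (intro conjI ballI)
      fix x y assume xy: "x \<in> carrier M" "y \<in> carrier M"
      show "l (x \<oplus>\<^bsub>M\<^esub> y) = l x \<oplus>\<^bsub>M\<^esub> l y"
        by (rule inj) (use l xy in \<open>auto simp: M.endo_add[OF e]\<close>)
    qed (use l in auto)
    show "M.commutes l (\<rho> a)" if a: "a \<in> carrier R" for a unfolding M.commutes_def
    proof
      fix x assume x: "x \<in> carrier M"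
      show "l (\<rho> a x) = \<rho> a (l x)" by (rule inj) (use l a x K_swap(1)[OF k a] in auto)
    qed
    show "M.commutes l j" if j: "j \<in> K" for j unfolding M.commutes_def
    proof
      fix x assume x: "x \<in> carrier M"
      show "l (j x) = j (l x)" by (rule inj) (use l j x K_swap(2)[OF k j] in auto)
    qed
  qed
  then show ?thesis using lk l by auto
qed

text \<open>The \<open>K\<close>-linear combinations of operators from \<open>\<rho>\<close>, a ring
  of \<open>K\<close>-linear maps. It acts irreducibly on \<open>M\<close>, even where
  \<open>R\<close> alone does not.\<close>

inductive_set B :: "('c \<Rightarrow> 'c) set" where
  base: "a \<in> carrier R \<Longrightarrow> \<rho> a \<in> B"
| smult: "k \<in> K \<Longrightarrow> b \<in> B \<Longrightarrow> (\<lambda>x. k (b x)) \<in> B"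
| sum: "b \<in> B \<Longrightarrow> c \<in> B \<Longrightarrow> (\<lambda>x. b x \<oplus>\<^bsub>M\<^esub> c x) \<in> B"
| agree: "b \<in> B \<Longrightarrow> (\<And>x. x \<in> carrier M \<Longrightarrow> b x = c x) \<Longrightarrow> c \<in> B"

lemma B_endo: "b \<in> B \<Longrightarrow> M.endo b"
proof (induction rule: B.induct)
  case (smult k b) then show ?case using K_endo[OF smult(1)] by (simp add: M.endo_def)
next
  case (sum b c)
  note e = sum.IH
  show ?case unfolding M.endo_def
  proof (intro conjI ballI)
    fix x y assume "x \<in> carrier M" "y \<in> carrier M"
    then show "b (x \<oplus>\<^bsub>M\<^esub> y) \<oplus>\<^bsub>M\<^esub> c (x \<oplus>\<^bsub>M\<^esub> y) = b x \<oplus>\<^bsub>M\<^esub> c x \<oplus>\<^bsub>M\<^esub> (b y \<oplus>\<^bsub>M\<^esub> c y)"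
      using M.endo_closed[OF e(1)] M.endo_closed[OF e(2)]
      by (simp add: M.endo_add[OF e(1)] M.endo_add[OF e(2)] M.a_ac)
  qed (use e in auto)
next
  case (agree b c)
  show ?case unfolding M.endo_def
  proof (intro conjI ballI)
    fix x y assume xy: "x \<in> carrier M" "y \<in> carrier M"
    then show "c (x \<oplus>\<^bsub>M\<^esub> y) = c x \<oplus>\<^bsub>M\<^esub> c y"
      using M.endo_add[OF agree.IH xy] by (simp add: agree(2)[symmetric])
    show "c x \<in> carrier M" using agree(2)[OF xy(1)] M.endo_closed[OF agree.IH xy(1)] by simp
  qed
qed (rule \<rho>_endo)

lemma B_closed [simp]: "b \<in> B \<Longrightarrow> x \<in> carrier M \<Longrightarrow> b x \<in> carrier M"
  using M.endo_closed[OF B_endo] .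

lemma B_K: "b \<in> B \<Longrightarrow> k \<in> K \<Longrightarrow> x \<in> carrier M \<Longrightarrow> k (b x) = b (k x)"
proof (induction arbitrary: x rule: B.induct)
  case (smult l b)
  then show ?case using K_swap(2)[of k l "b x"] by simp
next
  case (sum b c) then show ?case using M.endo_add[OF K_endo[OF sum.prems(1)]] by simp
qed (auto simp: K_swap)

lemma B_mult: "b \<in> B \<Longrightarrow> a \<in> carrier R \<Longrightarrow> (\<lambda>x. \<rho> a (b x)) \<in> B"
proof (induction rule: B.induct)
  case (base c)
  then show ?case by (intro B.agree[OF B.base[of "a \<otimes>\<^bsub>R\<^esub> c"]]) (auto simp: \<rho>_mult)
next
  case (smult k b)
  then show ?case by (intro B.agree[OF B.smult[OF smult(1) smult.IH]]) (auto simp: K_swap)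
next
  case (sum b c)
  then show ?case by (intro B.agree[OF B.sum[OF sum.IH]]) (auto simp: M.endo_add[OF \<rho>_endo])
next
  case (agree b c)
  then show ?case by (intro B.agree[OF agree.IH]) auto
qed

primrec kspan :: "'c list \<Rightarrow> 'c set" where
  "kspan [] = {\<zero>\<^bsub>M\<^esub>}"
| "kspan (x # xs) = {k x \<oplus>\<^bsub>M\<^esub> z | k z. k \<in> K \<and> z \<in> kspan xs}"

lemma kspan_sub: "set xs \<subseteq> carrier M \<Longrightarrow> kspan xs \<subseteq> carrier M"
  by (induction xs) auto

lemma kspan_ConsI: "k \<in> K \<Longrightarrow> z \<in> kspan xs \<Longrightarrow> k x \<oplus>\<^bsub>M\<^esub> z \<in> kspan (x # xs)"
  by auto

lemma kspan_zero_in: "set xs \<subseteq> carrier M \<Longrightarrow> \<zero>\<^bsub>M\<^esub> \<in> kspan xs"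
proof (induction xs)
  case (Cons x xs)
  then show ?case using kspan_ConsI[OF K_zero, of "\<zero>\<^bsub>M\<^esub>" xs x] by simp
qed simp

text \<open>The vectors \<open>b x\<close>, with \<open>b\<close> in the left ideal of
  \<open>B\<close> annihilating \<open>xs\<close>, form a set stable under \<open>R\<close> and
  \<open>K\<close>; it is all of \<open>M\<close> once it contains a nonzero vector.\<close>

lemma orbit:
  assumes xs: "set xs \<subseteq> carrier M" and x: "x \<in> carrier M" and b: "b \<in> B" "\<forall>y\<in>set xs. b y = \<zero>\<^bsub>M\<^esub>" "b x \<noteq> \<zero>\<^bsub>M\<^esub>"
    and z: "z \<in> carrier M"
  shows "\<exists>b\<in>B. (\<forall>y\<in>set xs. b y = \<zero>\<^bsub>M\<^esub>) \<and> b x = z"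
proof -
  let ?J = "{b \<in> B. \<forall>y\<in>set xs. b y = \<zero>\<^bsub>M\<^esub>}"
  have "(\<lambda>b. b x) ` ?J = carrier M"
  proof (rule simple[of "(\<lambda>b. b x) ` ?J" "b x"])
    show "(\<lambda>b. b x) ` ?J \<subseteq> carrier M" using x by auto
    have "\<rho> \<zero>\<^bsub>R\<^esub> \<in> ?J" using B.base \<rho>_zero xs by auto
    then show "\<zero>\<^bsub>M\<^esub> \<in> (\<lambda>b. b x) ` ?J" by (rule rev_image_eqI) (simp add: \<rho>_zero x)
    fix p q assume "p \<in> (\<lambda>b. b x) ` ?J" "q \<in> (\<lambda>b. b x) ` ?J"
    then obtain c d where cd: "p = c x" "c \<in> ?J" "q = d x" "d \<in> ?J" by auto
    have "(\<lambda>x. c x \<oplus>\<^bsub>M\<^esub> d x) \<in> ?J" using cd B.sum by auto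
    then show "p \<oplus>\<^bsub>M\<^esub> q \<in> (\<lambda>b. b x) ` ?J" unfolding cd(1,3) by (rule rev_image_eqI) simp
  next
    fix a p assume a: "a \<in> carrier R" and "p \<in> (\<lambda>b. b x) ` ?J"
    then obtain c where c: "p = c x" "c \<in> ?J" by auto
    have "(\<lambda>x. \<rho> a (c x)) \<in> ?J" using c a B_mult M.endo_zero[OF \<rho>_endo[OF a]] by auto
    then show "\<rho> a p \<in> (\<lambda>b. b x) ` ?J" unfolding c(1) by (rule rev_image_eqI) simp
  next
    fix k p assume k: "k \<in> K" and "p \<in> (\<lambda>b. b x) ` ?J"
    then obtain c where c: "p = c x" "c \<in> ?J" by auto
    have "(\<lambda>x. k (c x)) \<in> ?J" using c k B.smult M.endo_zero[OF K_endo[OF k]] by auto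
    then show "k p \<in> (\<lambda>b. b x) ` ?J" unfolding c(1) by (rule rev_image_eqI) simp
  qed (use b in auto)
  then have "z \<in> (\<lambda>b. b x) ` ?J" using z by simp
  then show ?thesis by auto
qed

text \<open>Jacobson density: if the annihilator of \<open>ys\<close> moves \<open>y\<close>, then \<open>b y \<mapsto> b x\<close> (\<open>b\<close> in that
  annihilator) is a well-defined endomorphism of \<open>M\<close> lying in \<open>K\<close>.\<close>

lemma density:
  "set xs \<subseteq> carrier M \<Longrightarrow> x \<in> carrier M \<Longrightarrow> (\<And>b. b \<in> B \<Longrightarrow> \<forall>y\<in>set xs. b y = \<zero>\<^bsub>M\<^esub> \<Longrightarrow> b x = \<zero>\<^bsub>M\<^esub>) \<Longrightarrow> x \<in> kspan xs"
proof (induction xs arbitrary: x)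
  case Nil
  then show ?case using Nil(3)[OF B.base[of "\<one>\<^bsub>R\<^esub>"]] \<rho>_one by simp
next
  case (Cons y ys)
  have ys: "set ys \<subseteq> carrier M" and y: "y \<in> carrier M" using Cons.prems(1) by auto
  let ?J = "{b \<in> B. \<forall>y\<in>set ys. b y = \<zero>\<^bsub>M\<^esub>}"
  show ?case
  proof (cases "\<forall>b\<in>?J. b y = \<zero>\<^bsub>M\<^esub>")
    case True
    then have "x \<in> kspan ys" using Cons.prems(3) by (intro Cons.IH[OF ys Cons.prems(2)]) auto
    from kspan_ConsI[OF K_zero this, of y] show ?thesis using Cons.prems(2) by simp
  next
    case False
    then obtain b0 where b0: "b0 \<in> B" "\<forall>y\<in>set ys. b0 y = \<zero>\<^bsub>M\<^esub>" "b0 y \<noteq> \<zero>\<^bsub>M\<^esub>" by auto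
    have ex: "\<exists>b\<in>?J. b y = z" if "z \<in> carrier M" for z using orbit[OF ys y b0 that] by auto
    have wd: "b x = c x" if b: "b \<in> ?J" and c: "c \<in> ?J" and eq: "b y = c y" for b c
    proof -
      let ?d = "\<lambda>x. b x \<oplus>\<^bsub>M\<^esub> \<rho> (\<ominus>\<^bsub>R\<^esub> \<one>\<^bsub>R\<^esub>) (c x)"
      have neg: "\<rho> (\<ominus>\<^bsub>R\<^esub> \<one>\<^bsub>R\<^esub>) v = \<ominus>\<^bsub>M\<^esub> v" if v: "v \<in> carrier M" for v
      proof -
        have "\<rho> (\<one>\<^bsub>R\<^esub> \<oplus>\<^bsub>R\<^esub> \<ominus>\<^bsub>R\<^esub> \<one>\<^bsub>R\<^esub>) v = \<zero>\<^bsub>M\<^esub>" using \<rho>_zero[OF v] by (simp add: R.r_neg)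
        then have "v \<oplus>\<^bsub>M\<^esub> \<rho> (\<ominus>\<^bsub>R\<^esub> \<one>\<^bsub>R\<^esub>) v = \<zero>\<^bsub>M\<^esub>" using \<rho>_add[of "\<one>\<^bsub>R\<^esub>" "\<ominus>\<^bsub>R\<^esub> \<one>\<^bsub>R\<^esub>" v] v \<rho>_one by simp
        then show ?thesis using v by (intro M.minus_equality[symmetric]) (simp_all add: M.a_comm)
      qed
      have "?d \<in> B" using b c by (auto intro!: B.sum B_mult)
      moreover have "\<forall>v\<in>set (y # ys). ?d v = \<zero>\<^bsub>M\<^esub>"
        using b c eq y ys by (auto simp: neg M.r_neg)
      ultimately have "b x \<oplus>\<^bsub>M\<^esub> \<ominus>\<^bsub>M\<^esub> c x = \<zero>\<^bsub>M\<^esub>" using Cons.prems(2) Cons.prems(3)[of ?d] c by (simp add: neg)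
      moreover have "b x \<in> carrier M" "c x \<in> carrier M" using b c Cons.prems(2) by auto
      ultimately show ?thesis using M.minus_eq_zero_iff[of "b x" "c x"] by (simp add: M.minus_eq)
    qed
    define \<beta> where "\<beta> z = (SOME b. b \<in> ?J \<and> b y = z)" for z
    have \<beta>: "\<beta> z \<in> ?J" "\<beta> z y = z" if "z \<in> carrier M" for z
      using someI_ex[of "\<lambda>b. b \<in> ?J \<and> b y = z"] ex[OF that] unfolding \<beta>_def by auto
    define \<phi> where "\<phi> z = \<beta> z x" for z
    have \<phi>: "\<phi> (b y) = b x" if b: "b \<in> ?J" for b
    proof -
      have byM: "b y \<in> carrier M" using b y by auto
      show ?thesis unfolding \<phi>_def by (rule wd[OF \<beta>(1)[OF byM] b \<beta>(2)[OF byM]])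
    qed
    have \<phi>c: "\<phi> z \<in> carrier M" if "z \<in> carrier M" for z unfolding \<phi>_def using \<beta>(1)[OF that] Cons.prems(2) by auto
    have \<phi>K: "\<phi> \<in> K"
    proof (rule K_max)
      show "M.endo \<phi>" unfolding M.endo_def
      proof (intro conjI ballI \<phi>c)
        fix p q assume p: "p \<in> carrier M" and q: "q \<in> carrier M"
        let ?b = "\<lambda>x. \<beta> p x \<oplus>\<^bsub>M\<^esub> \<beta> q x"
        have "?b \<in> ?J" using \<beta>(1)[OF p] \<beta>(1)[OF q] B.sum by auto
        from \<phi>[OF this] show "\<phi> (p \<oplus>\<^bsub>M\<^esub> q) = \<phi> p \<oplus>\<^bsub>M\<^esub> \<phi> q" using \<beta>(2)[OF p] \<beta>(2)[OF q] unfolding \<phi>_def by simp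
      qed
      show "M.commutes \<phi> (\<rho> a)" if a: "a \<in> carrier R" for a unfolding M.commutes_def
      proof
        fix p assume p: "p \<in> carrier M"
        let ?b = "\<lambda>x. \<rho> a (\<beta> p x)"
        have "?b \<in> ?J" using \<beta>(1)[OF p] B_mult a M.endo_zero[OF \<rho>_endo[OF a]] by auto
        from \<phi>[OF this] show "\<phi> (\<rho> a p) = \<rho> a (\<phi> p)" using \<beta>(2)[OF p] unfolding \<phi>_def by simp
      qed
      show "M.commutes \<phi> k" if k: "k \<in> K" for k unfolding M.commutes_def
      proof
        fix p assume p: "p \<in> carrier M"
        let ?b = "\<lambda>x. k (\<beta> p x)"
        have "?b \<in> ?J" using \<beta>(1)[OF p] B.smult k M.endo_zero[OF K_endo[OF k]] by auto
        from \<phi>[OF this] show "\<phi> (k p) = k (\<phi> p)" using \<beta>(2)[OF p] unfolding \<phi>_def by simp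
      qed
    qed
    have \<phi>y: "\<phi> y \<in> carrier M" using \<phi>c y by simp
    \<comment> \<open>Every \<open>b\<close> annihilating \<open>ys\<close> commutes with
      \<open>\<phi>\<close>, so it sends \<open>\<phi> y\<close> to \<open>\<phi> (b y)\<close>,
      which is \<open>b x\<close>. Hence it kills the difference and the induction hypothesis
      applies.\<close>
    have "x \<ominus>\<^bsub>M\<^esub> \<phi> y \<in> kspan ys"
    proof (rule Cons.IH[OF ys])
      show "x \<ominus>\<^bsub>M\<^esub> \<phi> y \<in> carrier M" using Cons.prems(2) \<phi>y by simp
      fix b assume b: "b \<in> B" "\<forall>y\<in>set ys. b y = \<zero>\<^bsub>M\<^esub>"
      have "b (\<phi> y) = b x" using B_K[OF b(1) \<phi>K y] \<phi>[of b] b by simp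
      then show "b (x \<ominus>\<^bsub>M\<^esub> \<phi> y) = \<zero>\<^bsub>M\<^esub>"
        using Cons.prems(2) \<phi>y b(1) M.endo_add[OF B_endo[OF b(1)]] M.endo_neg[OF B_endo[OF b(1)]]
        by (simp add: M.minus_eq M.r_neg)
    qed
    from kspan_ConsI[OF \<phi>K this, of y] have "\<phi> y \<oplus>\<^bsub>M\<^esub> (x \<ominus>\<^bsub>M\<^esub> \<phi> y) \<in> kspan (y # ys)" .
    moreover have "x = \<phi> y \<oplus>\<^bsub>M\<^esub> (x \<ominus>\<^bsub>M\<^esub> \<phi> y)"
      using Cons.prems(2) \<phi>y by (simp add: M.minus_eq M.a_lcomm[of "\<phi> y"] M.r_neg)
    ultimately show ?thesis by simp
  qed
qed

end

section \<open>Transfer of the identity to linear operators and the dimension bound\<close>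

context linear_rep begin

definition ev :: "(nat \<Rightarrow> 'c \<Rightarrow> 'c) \<Rightarrow> nat list \<Rightarrow> 'c \<Rightarrow> 'c" where
  "ev b u x = foldr (\<lambda>i z. b i z) u x"

lemma ev_simps [simp]: "ev b [] x = x" "ev b (i # u) x = b i (ev b u x)"
  by (simp_all add: ev_def)

lemma ev_cong: "(\<And>i. i \<in> set u \<Longrightarrow> b i = c i) \<Longrightarrow> ev b u x = ev c u x"
  by (induction u) auto

lemma ev_closed: "(\<And>i. i \<in> set u \<Longrightarrow> b i \<in> B) \<Longrightarrow> x \<in> carrier M \<Longrightarrow> ev b u x \<in> carrier M"
  by (induction u) auto

lemma ev_linear:
  assumes b: "\<And>i. b i \<in> B" and f: "f \<in> B" "g \<in> B" and k: "k \<in> K" and x: "x \<in> carrier M"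
  shows "distinct u \<Longrightarrow> j \<in> set u \<Longrightarrow>
    ev (b(j := \<lambda>x. f x \<oplus>\<^bsub>M\<^esub> g x)) u x = ev (b(j := f)) u x \<oplus>\<^bsub>M\<^esub> ev (b(j := g)) u x \<and>
    ev (b(j := \<lambda>x. k (f x))) u x = k (ev (b(j := f)) u x)"
proof (induction u)
  case (Cons i u)
  have c: "ev (b(j := h)) u x \<in> carrier M" if "h \<in> B" for h
    using that b x by (intro ev_closed) auto
  show ?case
  proof (cases "i = j")
    case True
    then have "j \<notin> set u" using Cons.prems by simp
    then have e: "ev (b(j := h)) u x = ev b u x" for h by (intro ev_cong) auto
    show ?thesis by (simp only: ev_simps True fun_upd_same e)
  next
    case False
    then have "distinct u" "j \<in> set u" using Cons.prems by auto
    note IH = Cons.IH[OF this]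
    show ?thesis
      unfolding ev_simps fun_upd_other[OF False] IH[THEN conjunct1] IH[THEN conjunct2]
        M.endo_add[OF B_endo[OF b[of i]] c[OF f(1)] c[OF f(2)]] B_K[OF b[of i] k c[OF f(1)]]
      by simp
  qed
qed simp

text \<open>The identity passes from \<open>R\<close> to \<open>B\<close> by multilinearity, one variable at a time.\<close>

lemma identity_on_B:
  assumes pi: "R.multilinear_identity d \<alpha>" and b: "\<And>i. b i \<in> B" and x: "x \<in> carrier M"
  shows "(\<Oplus>\<^bsub>M\<^esub>u\<in>perms_on {..<d}. \<rho> (\<alpha> u) (ev b u x)) = \<zero>\<^bsub>M\<^esub>"
proof -
  have \<alpha>c: "\<alpha> u \<in> carrier R" for u using pi unfolding R.multilinear_identity_def R.central_def by auto
  let ?S = "\<lambda>b. \<Oplus>\<^bsub>M\<^esub>u\<in>perms_on {..<d}. \<rho> (\<alpha> u) (ev b u x)"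
  let ?P = "perms_on {..<d}"
  have term_closed: "\<rho> (\<alpha> u) (ev c u x) \<in> carrier M" if "\<And>i. c i \<in> B" for c u
    using \<alpha>c x that by (intro \<rho>_closed ev_closed)
  \<comment> \<open>Variables of index below \<open>j\<close> may already carry arbitrary operators
    of \<open>B\<close>; from \<open>j\<close> on they still come from \<open>R\<close>.\<close>
  have main: "j \<le> d \<Longrightarrow> (\<And>i. b i \<in> B) \<Longrightarrow> (\<And>i. i \<ge> j \<Longrightarrow> \<exists>a\<in>carrier R. b i = \<rho> a) \<Longrightarrow> ?S b = \<zero>\<^bsub>M\<^esub>" for j b
  proof (induction j arbitrary: b)
    case 0
    then obtain s where s: "\<And>i. s i \<in> carrier R" "\<And>i. b i = \<rho> (s i)" by (metis le0)
    have mc: "R.mon s u \<in> carrier R" for u using s(1) by simp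
    have ev: "ev b u x = \<rho> (R.mon s u) x" for u
      using x s mc by (induction u) (simp_all add: \<rho>_one \<rho>_mult)
    have "?S b = (\<Oplus>\<^bsub>M\<^esub>u\<in>?P. \<rho> (\<alpha> u \<otimes>\<^bsub>R\<^esub> R.mon s u) x)"
      using x mc \<alpha>c by (intro M.finsum_cong') (auto simp: ev \<rho>_mult)
    also have "\<dots> = \<rho> (\<Oplus>\<^bsub>R\<^esub>u\<in>?P. \<alpha> u \<otimes>\<^bsub>R\<^esub> R.mon s u) x"
      using x mc \<alpha>c by (intro \<rho>_finsum[symmetric]) (auto simp: finite_perms_on)
    also have "(\<Oplus>\<^bsub>R\<^esub>u\<in>?P. \<alpha> u \<otimes>\<^bsub>R\<^esub> R.mon s u) = \<zero>\<^bsub>R\<^esub>"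
      using pi s(1) unfolding R.multilinear_identity_def by blast
    finally show ?case using \<rho>_zero[OF x] by simp
  next
    case (Suc j)
    have bB: "b i \<in> B" for i by (rule Suc.prems(2))
    have upd: "(b(j := c)) i \<in> B" if "c \<in> B" for c i using that bB by simp
    have "?S (b(j := c)) = \<zero>\<^bsub>M\<^esub>" if "c \<in> B" for c
      using that
    proof (induction rule: B.induct)
      case (base a)
      show ?case
      proof (rule Suc.IH)
        fix i assume i: "i \<ge> j"
        show "\<exists>a'\<in>carrier R. (b(j := \<rho> a)) i = \<rho> a'"
          using base Suc.prems(3)[of i] i by (cases "i = j") auto
      qed (use Suc.prems upd[OF B.base[OF base]] in auto)
    next
      case (smult k c)
      have tc: "\<rho> (\<alpha> u) (ev (b(j := c)) u x) \<in> carrier M" for u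
        by (rule term_closed, rule upd[OF smult(2)])
      have "?S (b(j := \<lambda>x. k (c x))) = (\<Oplus>\<^bsub>M\<^esub>u\<in>?P. k (\<rho> (\<alpha> u) (ev (b(j := c)) u x)))"
      proof (rule M.finsum_cong')
        fix u assume u: "u \<in> ?P"
        then have "ev (b(j := \<lambda>x. k (c x))) u x = k (ev (b(j := c)) u x)"
          using ev_linear[OF bB smult(2) smult(2) smult(1) x, of u j] Suc.prems(1) unfolding perms_on_def by auto
        then show "\<rho> (\<alpha> u) (ev (b(j := \<lambda>x. k (c x))) u x) = k (\<rho> (\<alpha> u) (ev (b(j := c)) u x))"
          using K_swap(1)[OF smult(1) \<alpha>c, of "ev (b(j := c)) u x"] ev_closed[OF upd[OF smult(2)] x] by simp
      qed (use K_closed[OF smult(1) tc] in auto)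
      also have "\<dots> = k (?S (b(j := c)))"
        by (rule M.endo_finsum[OF K_endo[OF smult(1)] _ tc, symmetric]) (simp add: finite_perms_on)
      also have "\<dots> = \<zero>\<^bsub>M\<^esub>" by (simp only: smult.IH M.endo_zero[OF K_endo[OF smult(1)]])
      finally show ?case .
    next
      case (sum f g)
      have tc: "\<rho> (\<alpha> u) (ev (b(j := f)) u x) \<in> carrier M" "\<rho> (\<alpha> u) (ev (b(j := g)) u x) \<in> carrier M" for u
        by (rule term_closed, rule upd[OF sum(1)], rule term_closed, rule upd[OF sum(2)])
      have "?S (b(j := \<lambda>x. f x \<oplus>\<^bsub>M\<^esub> g x))
          = (\<Oplus>\<^bsub>M\<^esub>u\<in>?P. \<rho> (\<alpha> u) (ev (b(j := f)) u x) \<oplus>\<^bsub>M\<^esub> \<rho> (\<alpha> u) (ev (b(j := g)) u x))"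
      proof (rule M.finsum_cong')
        fix u assume u: "u \<in> ?P"
        then have "ev (b(j := \<lambda>x. f x \<oplus>\<^bsub>M\<^esub> g x)) u x = ev (b(j := f)) u x \<oplus>\<^bsub>M\<^esub> ev (b(j := g)) u x"
          using ev_linear[OF bB sum(1,2) K_id x, of u j] Suc.prems(1) unfolding perms_on_def by auto
        moreover have "ev (b(j := f)) u x \<in> carrier M" "ev (b(j := g)) u x \<in> carrier M"
          by (rule ev_closed[OF _ x], rule upd[OF sum(1)], rule ev_closed[OF _ x], rule upd[OF sum(2)])
        ultimately show "\<rho> (\<alpha> u) (ev (b(j := \<lambda>x. f x \<oplus>\<^bsub>M\<^esub> g x)) u x)
            = \<rho> (\<alpha> u) (ev (b(j := f)) u x) \<oplus>\<^bsub>M\<^esub> \<rho> (\<alpha> u) (ev (b(j := g)) u x)"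
          by (simp only: M.endo_add[OF \<rho>_endo[OF \<alpha>c]])
      qed (use M.a_closed[OF tc] in auto)
      also have "\<dots> = ?S (b(j := f)) \<oplus>\<^bsub>M\<^esub> ?S (b(j := g))"
        using tc by (intro M.finsum_addf Pi_I)
      also have "\<dots> = \<zero>\<^bsub>M\<^esub>" by (simp only: sum.IH M.l_zero M.zero_closed)
      finally show ?case .
    next
      case (agree f g)
      have gB: "g \<in> B" using B.agree[OF agree(1,2)] .
      have "ev (b(j := f)) u x = ev (b(j := g)) u x" for u
      proof (induction u)
        case (Cons i u)
        have "ev (b(j := g)) u x \<in> carrier M" by (rule ev_closed[OF _ x], rule upd[OF gB])
        from agree(2)[OF this] Cons show ?case
          by (cases "i = j") (simp_all only: ev_simps fun_upd_same fun_upd_other not_False_eq_True)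
      qed simp
      then show ?case using agree.IH by (simp only:)
    qed
    from this[OF bB[of j]] show ?case by simp
  qed
  \<comment> \<open>Variables of index \<open>d\<close> and beyond do not occur in the identity, so
    they may be set to an operator coming from \<open>R\<close>.\<close>
  let ?b = "\<lambda>i. if i < d then b i else \<rho> \<one>\<^bsub>R\<^esub>"
  have "?S ?b = \<zero>\<^bsub>M\<^esub>" by (rule main[of d]) (use b B.base in auto)
  moreover have "ev ?b u x = ev b u x" if "u \<in> ?P" for u using that unfolding perms_on_def by (intro ev_cong) auto
  then have "?S ?b = ?S b" using term_closed b by (intro M.finsum_cong') auto
  ultimately show ?thesis by simp
qed

primrec indep :: "'c list \<Rightarrow> bool" where
  "indep [] \<longleftrightarrow> True"
| "indep (x # xs) \<longleftrightarrow> x \<in> carrier M \<and> x \<notin> kspan xs \<and> indep xs"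

lemma indep_nth: "indep zs \<Longrightarrow> i < length zs \<Longrightarrow> zs ! i \<notin> kspan (drop (Suc i) zs) \<and> zs ! i \<in> carrier M"
proof (induction zs arbitrary: i)
  case (Cons z zs) then show ?case by (cases i) auto
qed simp

lemma indep_sub: "indep zs \<Longrightarrow> set zs \<subseteq> carrier M"
  by (induction zs) auto

text \<open>Operators shifting \<open>zs ! (i + 1)\<close> to \<open>zs ! i\<close> and killing the later vectors make
  the monomial of the identity permutation the only one that does not vanish on the last vector.\<close>

theorem dimension_bound:
  assumes pi: "R.multilinear_identity d \<alpha>"
  shows "\<exists>xs. set xs \<subseteq> carrier M \<and> length xs = d \<and> kspan xs = carrier M"
proof -
  have "\<exists>xs. set xs \<subseteq> carrier M \<and> length xs \<le> d \<and> kspan xs = carrier M"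
  proof (rule ccontr)
    assume not: "\<not> ?thesis"
    have "\<exists>zs. indep zs \<and> length zs = n" if "n \<le> Suc d" for n
      using that
    proof (induction n)
      case 0 then show ?case by (intro exI[of _ "[]"]) simp
    next
      case (Suc n)
      then obtain zs where zs: "indep zs" "length zs = n" by auto
      then have "kspan zs \<noteq> carrier M" using not indep_sub Suc.prems by auto
      then obtain z where "z \<in> carrier M" "z \<notin> kspan zs" using kspan_sub[OF indep_sub[OF zs(1)]] by auto
      then show ?case using zs by (intro exI[of _ "z # zs"]) simp
    qed
    then obtain zs where zs: "indep zs" "length zs = Suc d" by blast
    have zc: "zs ! i \<in> carrier M" if "i \<le> d" for i using indep_nth[OF zs(1), of i] zs(2) that by auto
    have "\<exists>b\<in>B. (\<forall>y\<in>set (drop (i + 2) zs). b y = \<zero>\<^bsub>M\<^esub>) \<and> b (zs ! Suc i) = zs ! i" if i: "i < d" for i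
    proof -
      have sub: "set (drop (i + 2) zs) \<subseteq> carrier M" using indep_sub[OF zs(1)] set_drop_subset by (metis subset_trans)
      have "zs ! Suc i \<notin> kspan (drop (i + 2) zs)" using indep_nth[OF zs(1), of "Suc i"] zs(2) i by simp
      then obtain b where "b \<in> B" "\<forall>y\<in>set (drop (i + 2) zs). b y = \<zero>\<^bsub>M\<^esub>" "b (zs ! Suc i) \<noteq> \<zero>\<^bsub>M\<^esub>"
        using density[OF sub zc[of "Suc i"]] i by auto
      then show ?thesis using orbit[OF sub zc[of "Suc i"] _ _ _ zc[of i]] i by auto
    qed
    then obtain b' where b': "\<And>i. i < d \<Longrightarrow> b' i \<in> B \<and> (\<forall>y\<in>set (drop (i + 2) zs). b' i y = \<zero>\<^bsub>M\<^esub>) \<and> b' i (zs ! Suc i) = zs ! i"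
      by metis
    define b where "b i = (if i < d then b' i else \<rho> \<one>\<^bsub>R\<^esub>)" for i
    have bB: "b i \<in> B" for i
      using b'[of i] B.base[OF R.one_closed] by (cases "i < d") (simp_all add: b_def)
    have kill: "b i (zs ! e) = \<zero>\<^bsub>M\<^esub>" if "i + 2 \<le> e" "e \<le> d" for i e
    proof -
      have ie: "i + 2 + (e - (i + 2)) = e" and id: "i < d" using that by auto
      have "drop (i + 2) zs ! (e - (i + 2)) = zs ! e"
        using nth_drop[of "i + 2" zs "e - (i + 2)"] that zs(2) unfolding ie by auto
      moreover have "drop (i + 2) zs ! (e - (i + 2)) \<in> set (drop (i + 2) zs)"
        using that zs(2) by (intro nth_mem) simp
      ultimately have "zs ! e \<in> set (drop (i + 2) zs)" by (simp only:)
      then have "b' i (zs ! e) = \<zero>\<^bsub>M\<^esub>" using b'[OF id] by (simp only:)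
      then show ?thesis using id by (simp only: b_def if_True)
    qed
    have shift: "b i (zs ! Suc i) = zs ! i" if "i < d" for i using b'[OF that] that by (simp add: b_def)
    \<comment> \<open>Letters act from the right end of the word. A final segment of
      \<open>[0..<d]\<close> moves the last vector down by one index per letter. At the first
      deviating letter \<open>i\<close> the current index exceeds \<open>i + 1\<close>, because the
      larger letters are used up, and the vector is killed.\<close>
    have claim: "(u = [d - length u..<d] \<and> ev b u (zs ! d) = zs ! (d - length u)) \<or>
        (u \<noteq> [d - length u..<d] \<and> ev b u (zs ! d) = \<zero>\<^bsub>M\<^esub>)" if "distinct u" "set u \<subseteq> {..<d}" for u
      using that
    proof (induction u)
      case (Cons i w)
      have lw: "length w < d" 
      proof -
        have "card (set (i # w)) \<le> card {..<d}" using Cons.prems(2) by (intro card_mono) auto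
        then show ?thesis using distinct_card[OF Cons.prems(1)] by simp
      qed
      let ?e = "d - length w"
      have iw: "i < d" "i \<notin> set w" using Cons.prems by auto
      have cons: "i # w = [d - length (i # w)..<d] \<longleftrightarrow> w = [?e..<d] \<and> Suc i = ?e"
      proof -
        have "[d - length (i # w)..<d] = (?e - 1) # [?e..<d]"
          using lw upt_conv_Cons[of "?e - 1" d] by (simp add: Suc_diff_Suc)
        then show ?thesis using lw by auto
      qed
      show ?case
      proof (cases "w = [?e..<d]")
        case True
        then have v: "ev b w (zs ! d) = zs ! ?e" using Cons by auto
        have "i < ?e" using True iw by (metis atLeastLessThan_iff not_le set_upt)
        show ?thesis
        proof (cases "Suc i = ?e")
          case s: True
          have eq: "d - length (i # w) = i" using s lw by simp
          have "ev b (i # w) (zs ! d) = zs ! i" using v shift[OF iw(1)] unfolding s[symmetric] by simp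
          then show ?thesis using cons True s eq by metis
        next
          case False
          then have "b i (zs ! ?e) = \<zero>\<^bsub>M\<^esub>" using \<open>i < ?e\<close> by (intro kill) auto
          then show ?thesis using v cons False by auto
        qed
      next
        case False
        then have "ev b w (zs ! d) = \<zero>\<^bsub>M\<^esub>" using Cons by auto
        then show ?thesis using False cons M.endo_zero[OF B_endo[OF bB]] by auto
      qed
    qed simp
    let ?P = "perms_on {..<d}"
    have len: "length u = d" if "u \<in> ?P" for u using that distinct_card[of u] unfolding perms_on_def by auto
    have id: "[0..<d] \<in> ?P" unfolding perms_on_def by auto
    have \<alpha>c: "\<alpha> u \<in> carrier R" for u using pi unfolding R.multilinear_identity_def R.central_def by auto
    have val: "\<rho> (\<alpha> u) (ev b u (zs ! d)) = (if u = [0..<d] then zs ! 0 else \<zero>\<^bsub>M\<^esub>)" if u: "u \<in> ?P" for u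
    proof (cases "u = [0..<d]")
      case True
      have "\<alpha> [0..<d] = \<one>\<^bsub>R\<^esub>" using pi unfolding R.multilinear_identity_def by simp
      moreover have "ev b u (zs ! d) = zs ! 0" using claim[of u] u True by (auto simp: perms_on_def)
      ultimately show ?thesis using True \<rho>_one zc[of 0] by simp
    next
      case False
      then have "ev b u (zs ! d) = \<zero>\<^bsub>M\<^esub>" using claim[of u] u len[OF u] by (auto simp: perms_on_def)
      then show ?thesis using False M.endo_zero[OF \<rho>_endo[OF \<alpha>c]] by simp
    qed
    have "(\<Oplus>\<^bsub>M\<^esub>u\<in>?P. \<rho> (\<alpha> u) (ev b u (zs ! d))) = (\<Oplus>\<^bsub>M\<^esub>u\<in>?P. if [0..<d] = u then zs ! 0 else \<zero>\<^bsub>M\<^esub>)"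
      using zc[of 0] by (intro M.finsum_cong') (auto simp: val)
    also have "\<dots> = zs ! 0"
      by (rule M.finsum_singleton[OF id]) (use zc[of 0] in \<open>auto simp: finite_perms_on\<close>)
    finally have "zs ! 0 = \<zero>\<^bsub>M\<^esub>" using identity_on_B[OF pi bB zc[of d]] by simp
    moreover have "zs ! 0 \<notin> kspan (drop (Suc 0) zs)" using indep_nth[OF zs(1), of 0] zs(2) by simp
    moreover have "set (drop (Suc 0) zs) \<subseteq> carrier M" using indep_sub[OF zs(1)] set_drop_subset by (metis subset_trans)
    ultimately show False using kspan_zero_in by auto
  qed
  then obtain xs where xs: "set xs \<subseteq> carrier M" "length xs \<le> d" "kspan xs = carrier M" by auto
  \<comment> \<open>Padding with zero vectors makes the length exactly \<open>d\<close>, so that the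
    later bounds depend on \<open>d\<close> alone.\<close>
  have pad: "kspan (replicate n \<zero>\<^bsub>M\<^esub> @ xs) = carrier M" for n
  proof (induction n)
    case (Suc n)
    have "z \<in> kspan (replicate (Suc n) \<zero>\<^bsub>M\<^esub> @ xs)" if z: "z \<in> carrier M" for z
      using kspan_ConsI[OF K_zero, of z "replicate n \<zero>\<^bsub>M\<^esub> @ xs" "\<zero>\<^bsub>M\<^esub>"] z Suc by simp
    moreover have "set (replicate (Suc n) \<zero>\<^bsub>M\<^esub> @ xs) \<subseteq> carrier M" using xs by auto
    ultimately show ?case using kspan_sub by blast
  qed (use xs in simp)
  have "length (replicate (d - length xs) \<zero>\<^bsub>M\<^esub> @ xs) = d" using xs(2) by simp
  moreover have "set (replicate (d - length xs) \<zero>\<^bsub>M\<^esub> @ xs) \<subseteq> carrier M" using xs(1) by auto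
  ultimately show ?thesis using pad by blast
qed

end

section \<open>Groups of linear transformations\<close>

lemma tri_map:
  assumes "tri P zs" "\<And>y f. (y, f) \<in> set zs \<Longrightarrow> \<not> P y f \<Longrightarrow> \<not> P' y (W y f)"
    "\<And>y f y'. (y, f) \<in> set zs \<Longrightarrow> y' \<in> fst ` set zs \<Longrightarrow> P y' f \<Longrightarrow> P' y' (W y f)"
  shows "tri P' (map (\<lambda>(y, f). (y, W y f)) zs)"
  using assms
proof (induction P zs rule: tri.induct)
  case (2 P y f zs)
  have "tri P' (map (\<lambda>(y, f). (y, W y f)) zs)"
    by (rule "2.IH") (use "2.prems" in auto)
  moreover have "\<not> P' y (W y f)" using "2.prems"(1,2) by simp
  moreover have "P' y (W y' f')" if "(y', f') \<in> set zs" for y' f'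
    using "2.prems"(1) "2.prems"(3)[of y' f' y] that by auto
  ultimately show ?case by auto
qed simp

lemma tri_append2:
  "tri P (as @ bs) \<longleftrightarrow> tri P as \<and> tri P bs \<and> (\<forall>(y, f) \<in> set as. \<forall>(y', f') \<in> set bs. P y f')"
  by (induction P as rule: tri.induct) auto

text \<open>The list \<open>xs\<close> spans \<open>M\<close> over \<open>K\<close> but may be
  dependent; bounds will be expressed by its length. The action \<open>\<sigma>\<close> is by
  \<open>K\<close>-linear maps and is not tied to \<open>\<rho>\<close>.\<close>

locale linear_action = linear_rep + \<Gamma>: group \<Gamma> for \<Gamma> :: "('g, 'h) monoid_scheme" +
  fixes \<sigma> :: "'g \<Rightarrow> 'c \<Rightarrow> 'c" and xs :: "'c list"
  assumes \<sigma>_endo: "g \<in> carrier \<Gamma> \<Longrightarrow> M.endo (\<sigma> g)"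
    and \<sigma>_K: "g \<in> carrier \<Gamma> \<Longrightarrow> k \<in> K \<Longrightarrow> x \<in> carrier M \<Longrightarrow> k (\<sigma> g x) = \<sigma> g (k x)"
    and \<sigma>_mult: "g \<in> carrier \<Gamma> \<Longrightarrow> h \<in> carrier \<Gamma> \<Longrightarrow> x \<in> carrier M \<Longrightarrow> \<sigma> (g \<otimes>\<^bsub>\<Gamma>\<^esub> h) x = \<sigma> g (\<sigma> h x)"
    and \<sigma>_one: "x \<in> carrier M \<Longrightarrow> \<sigma> \<one>\<^bsub>\<Gamma>\<^esub> x = x"
    and \<sigma>_faithful: "g \<in> carrier \<Gamma> \<Longrightarrow> (\<And>x. x \<in> carrier M \<Longrightarrow> \<sigma> g x = x) \<Longrightarrow> g = \<one>\<^bsub>\<Gamma>\<^esub>"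
    and xs_sub: "set xs \<subseteq> carrier M" and xs_span: "kspan xs = carrier M"
begin

lemma \<sigma>_closed [simp]: "g \<in> carrier \<Gamma> \<Longrightarrow> x \<in> carrier M \<Longrightarrow> \<sigma> g x \<in> carrier M"
  using M.endo_closed[OF \<sigma>_endo] .

definition valid :: "('g \<Rightarrow> 'c \<Rightarrow> 'c) list \<Rightarrow> bool" where
  "valid cs \<longleftrightarrow> (\<forall>c\<in>set cs. \<forall>y\<in>carrier \<Gamma>. c y \<in> K)"

text \<open>\<open>lev cs ws\<close> is the \<open>M\<close>-valued function \<open>\<Sum> c\<^sub>i(y) w\<^sub>i\<close>
  on the group with coefficient functions \<open>c\<^sub>i\<close> into \<open>K\<close>.\<close>

primrec lev :: "('g \<Rightarrow> 'c \<Rightarrow> 'c) list \<Rightarrow> 'c list \<Rightarrow> 'g \<Rightarrow> 'c" where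
  "lev [] ws y = \<zero>\<^bsub>M\<^esub>"
| "lev (c # cs) ws y = c y (hd ws) \<oplus>\<^bsub>M\<^esub> lev cs (tl ws) y"

lemma lev_closed: "valid cs \<Longrightarrow> length ws = length cs \<Longrightarrow> set ws \<subseteq> carrier M \<Longrightarrow> y \<in> carrier \<Gamma> \<Longrightarrow> lev cs ws y \<in> carrier M"
proof (induction cs arbitrary: ws)
  case (Cons c cs)
  then obtain w ws' where "ws = w # ws'" by (cases ws) auto
  then show ?case using Cons by (auto simp: valid_def)
qed simp

text \<open>Gaussian elimination: when \<open>l\<close> is the inverse of \<open>c p\<close>, the
  new coefficient functions result from solving the equation at the point \<open>p\<close> for the
  vector that belongs to \<open>c\<close> and substituting.\<close>

lemma lev_eliminate:
  assumes c: "\<And>y. y \<in> carrier \<Gamma> \<Longrightarrow> c y \<in> K" and l: "l \<in> K" and p: "p \<in> carrier \<Gamma>" and y: "y \<in> carrier \<Gamma>"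
  shows "valid cs \<Longrightarrow> length ws = length cs \<Longrightarrow> set ws \<subseteq> carrier M \<Longrightarrow>
    lev (map (\<lambda>c' y x. c' y x \<ominus>\<^bsub>M\<^esub> c y (l (c' p x))) cs) ws y = lev cs ws y \<ominus>\<^bsub>M\<^esub> c y (l (lev cs ws p))"
proof (induction cs arbitrary: ws)
  case Nil
  have "\<zero>\<^bsub>M\<^esub> \<ominus>\<^bsub>M\<^esub> \<zero>\<^bsub>M\<^esub> = \<zero>\<^bsub>M\<^esub>" by (simp add: M.minus_eq_zero_iff)
  then show ?case using M.endo_zero[OF K_endo[OF l]] M.endo_zero[OF K_endo[OF c[OF y]]] by simp
next
  case (Cons c' cs)
  then obtain w ws' where ws: "ws = w # ws'" by (cases ws) auto
  have K: "c' y \<in> K" "c' p \<in> K" "c y \<in> K" using Cons.prems(1) c y p by (auto simp: valid_def)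
  have v: "valid cs" using Cons.prems(1) by (simp add: valid_def)
  have w: "w \<in> carrier M" "set ws' \<subseteq> carrier M" "length ws' = length cs" using Cons.prems ws by auto
  have L: "lev cs ws' y \<in> carrier M" "lev cs ws' p \<in> carrier M" using lev_closed[OF v w(3,2)] y p by auto
  have "c y (l (c' p w \<oplus>\<^bsub>M\<^esub> lev cs ws' p)) = c y (l (c' p w)) \<oplus>\<^bsub>M\<^esub> c y (l (lev cs ws' p))"
    using K l w(1) L by (simp add: M.endo_add[OF K_endo])
  note split = this
  have cl: "c' y w \<in> carrier M" "c y (l (c' p w)) \<in> carrier M" "c y (l (lev cs ws' p)) \<in> carrier M"
    using K l w(1) L by auto
  have gen: "(a \<ominus>\<^bsub>M\<^esub> b) \<oplus>\<^bsub>M\<^esub> (u \<ominus>\<^bsub>M\<^esub> v) = (a \<oplus>\<^bsub>M\<^esub> u) \<ominus>\<^bsub>M\<^esub> (b \<oplus>\<^bsub>M\<^esub> v)"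
    if "a \<in> carrier M" "b \<in> carrier M" "u \<in> carrier M" "v \<in> carrier M" for a b u v
    using that by (simp add: M.minus_eq M.minus_add M.a_ac)
  show ?case
    unfolding ws list.map lev.simps list.sel Cons.IH[OF v w(3,2)] split
    by (rule gen[OF cl(1,2) L(1) cl(3)])
qed

text \<open>Each pair costs one coefficient function. If \<open>c\<close> vanishes at all points of
  the list, it is dropped. Otherwise the first pair with \<open>c\<close> nonzero at its point
  \<open>p\<close> is removed and \<open>c\<close> is eliminated at \<open>p\<close>: at earlier
  points \<open>c\<close> is zero, and later equations vanish at \<open>p\<close>, so none of the
  relevant values changes.\<close>

theorem tri_lev_bound:
  "length cs = n \<Longrightarrow> valid cs \<Longrightarrow> (\<And>y ws. (y, ws) \<in> set zs \<Longrightarrow> y \<in> carrier \<Gamma> \<and> length ws = length cs \<and> set ws \<subseteq> carrier M) \<Longrightarrow>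
    tri (\<lambda>y ws. lev cs ws y = \<zero>\<^bsub>M\<^esub>) zs \<Longrightarrow> length zs \<le> n"
proof (induction n arbitrary: cs zs)
  case 0 then show ?case by (cases zs) auto
next
  case (Suc n cs0)
  then obtain c cs where cs0: "cs0 = c # cs" by (cases cs0) auto
  have n: "length cs = n" using Suc.prems(1) cs0 by simp
  note prems = Suc.prems(2-)[unfolded cs0]
  let ?P = "\<lambda>y ws. lev (c # cs) ws y = \<zero>\<^bsub>M\<^esub>"
  have cK: "c y \<in> K" if "y \<in> carrier \<Gamma>" for y using prems(1) that by (simp add: valid_def)
  have v: "valid cs" using prems(1) by (simp add: valid_def)
  have e: "y \<in> carrier \<Gamma>" "\<exists>w ws'. ws = w # ws' \<and> w \<in> carrier M \<and> set ws' \<subseteq> carrier M \<and> length ws' = length cs"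
    if "(y, ws) \<in> set zs" for y ws
    using prems(2)[OF that] by (auto simp: length_Suc_conv)
  let ?g = "\<lambda>(y, ws). (y, tl ws)"
  show ?case
  proof (cases "\<forall>(y, ws)\<in>set zs. \<forall>x\<in>carrier M. c y x = \<zero>\<^bsub>M\<^esub>")
    case True
    have eq: "lev (c # cs) ws y' = lev cs (tl ws) y'" if z: "(y, ws) \<in> set zs" and y': "y' \<in> fst ` set zs" for y ws y'
    proof -
      obtain w ws' where ws: "ws = w # ws'" "w \<in> carrier M" "set ws' \<subseteq> carrier M" "length ws' = length cs"
        using e(2)[OF z] by auto
      obtain q where q: "(y', q) \<in> set zs" using y' by auto
      have "c y' w = \<zero>\<^bsub>M\<^esub>" using True q ws(2) by auto
      then show ?thesis using ws lev_closed[OF v ws(4,3) e(1)[OF q]] by simp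
    qed
    have "tri (\<lambda>y ws. lev cs ws y = \<zero>\<^bsub>M\<^esub>) (map ?g zs)"
      by (rule tri_map[OF prems(3)]) (use eq in force)+
    then have "length (map ?g zs) \<le> n"
    proof (rule Suc.IH[OF n v, rotated])
      fix y ws assume "(y, ws) \<in> set (map ?g zs)"
      then obtain ws' where ws': "(y, ws') \<in> set zs" "ws = tl ws'" by auto
      show "y \<in> carrier \<Gamma> \<and> length ws = length cs \<and> set ws \<subseteq> carrier M"
        using e[OF ws'(1)] ws'(2) by auto
    qed
    then show ?thesis by simp
  next
    case False
    then have "\<exists>z\<in>set zs. \<exists>x\<in>carrier M. c (fst z) x \<noteq> \<zero>\<^bsub>M\<^esub>" by fastforce
    then obtain as z bs where zs: "zs = as @ z # bs" "\<exists>x\<in>carrier M. c (fst z) x \<noteq> \<zero>\<^bsub>M\<^esub>"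
      "\<forall>z\<in>set as. \<not> (\<exists>x\<in>carrier M. c (fst z) x \<noteq> \<zero>\<^bsub>M\<^esub>)"
      using split_list_first_prop[of zs "\<lambda>z. \<exists>x\<in>carrier M. c (fst z) x \<noteq> \<zero>\<^bsub>M\<^esub>"] by blast
    obtain p ps where z: "z = (p, ps)" by (cases z)
    have p: "p \<in> carrier \<Gamma>" using e(1)[of p ps] zs(1) z by simp
    obtain x0 where x0: "x0 \<in> carrier M" "c p x0 \<noteq> \<zero>\<^bsub>M\<^esub>" using zs(2) z by auto
    obtain l where l: "l \<in> K" "\<And>x. x \<in> carrier M \<Longrightarrow> l (c p x) = x" using K_inverse[OF cK[OF p] x0] by auto
    let ?cs = "map (\<lambda>c' y x. c' y x \<ominus>\<^bsub>M\<^esub> c y (l (c' p x))) cs"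
    have v': "valid ?cs"
    proof -
      have "(\<lambda>x. c' y x \<ominus>\<^bsub>M\<^esub> c y (l (c' p x))) \<in> K" if "c' \<in> set cs" "y \<in> carrier \<Gamma>" for c' y
      proof -
        have "c' y \<in> K" "c' p \<in> K" using v that p by (auto simp: valid_def)
        then show ?thesis using K_diff[OF _ K_comp[OF cK[OF that(2)] K_comp[OF l(1)]]] by blast
      qed
      then show ?thesis unfolding valid_def by auto
    qed
    have el: "lev ?cs (tl ws) y' = lev cs (tl ws) y' \<ominus>\<^bsub>M\<^esub> c y' (l (lev cs (tl ws) p))"
      if w: "(y, ws) \<in> set zs" and y': "y' \<in> carrier \<Gamma>" for y ws y'
    proof (rule lev_eliminate[OF cK l(1) p y' v])
      show "length (tl ws) = length cs" "set (tl ws) \<subseteq> carrier M" using e(2)[OF w] by auto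
    qed
    have early: "lev (c # cs) ws y' = lev ?cs (tl ws) y'" if w: "(y, ws) \<in> set zs" and y': "(y', q) \<in> set as" for y ws y' q
    proof -
      obtain w ws' where ws: "ws = w # ws'" "w \<in> carrier M" "set ws' \<subseteq> carrier M" "length ws' = length cs"
        using e(2)[OF w] by auto
      have y'G: "y' \<in> carrier \<Gamma>" using e(1)[of y' q] y' zs(1) by simp
      have c0: "c y' x = \<zero>\<^bsub>M\<^esub>" if "x \<in> carrier M" for x using zs(3) y' that by force
      have L: "lev cs ws' y' \<in> carrier M" "l (lev cs ws' p) \<in> carrier M"
        using lev_closed[OF v ws(4,3)] y'G p l(1) by auto
      show ?thesis using el[OF w y'G] ws L c0 by (simp add: M.minus_eq)
    qed
    have late: "lev (c # cs) ws y' = lev ?cs (tl ws) y'" if w: "(y, ws) \<in> set bs" and y': "y' \<in> carrier \<Gamma>" for y ws y'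
    proof -
      have wz: "(y, ws) \<in> set zs" using w zs(1) by simp
      obtain w0 ws' where ws: "ws = w0 # ws'" "w0 \<in> carrier M" "set ws' \<subseteq> carrier M" "length ws' = length cs"
        using e(2)[OF wz] by auto
      have L: "lev cs ws' y' \<in> carrier M" "lev cs ws' p \<in> carrier M" using lev_closed[OF v ws(4,3)] y' p by auto
      have "?P p ws" using prems(3) w unfolding zs(1) z tri_append2 by auto
      then have "c p w0 \<oplus>\<^bsub>M\<^esub> lev cs ws' p = \<zero>\<^bsub>M\<^esub>" using ws by simp
      then have "lev cs ws' p = \<ominus>\<^bsub>M\<^esub> c p w0"
        using L cK[OF p] ws(2) by (intro M.minus_equality[symmetric]) (simp_all add: M.a_comm)
      then have "l (lev cs ws' p) = \<ominus>\<^bsub>M\<^esub> w0"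
        using M.endo_neg[OF K_endo[OF l(1)], of "c p w0"] l(2)[OF ws(2)] cK[OF p] ws(2) by simp
      then have "c y' (l (lev cs ws' p)) = \<ominus>\<^bsub>M\<^esub> c y' w0"
        using M.endo_neg[OF K_endo[OF cK[OF y']] ws(2)] by simp
      then show ?thesis using el[OF wz y'] ws L cK[OF y'] by (simp add: M.minus_eq M.a_comm)
    qed
    let ?P' = "\<lambda>y ws. lev ?cs ws y = \<zero>\<^bsub>M\<^esub>"
    have t: "tri ?P as" "tri ?P bs" "\<forall>(y, f) \<in> set as. \<forall>(y', f') \<in> set bs. ?P y f'"
      using prems(3) unfolding zs(1) z tri_append2 by auto
    have "tri ?P' (map ?g as)"
    proof (rule tri_map[OF t(1)])
      fix y ws assume w: "(y, ws) \<in> set as"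
      then have wz: "(y, ws) \<in> set zs" using zs(1) by simp
      show "\<not> ?P y ws \<Longrightarrow> \<not> ?P' y (tl ws)" using early[OF wz w] by (simp only: not_False_eq_True)
      fix y' assume "y' \<in> fst ` set as" and P: "?P y' ws"
      then obtain q where "(y', q) \<in> set as" by auto
      from early[OF wz this] P show "?P' y' (tl ws)" by (simp only:)
    qed
    moreover have "tri ?P' (map ?g bs)"
    proof (rule tri_map[OF t(2)])
      fix y ws assume w: "(y, ws) \<in> set bs"
      then have "(y, ws) \<in> set zs" using zs(1) by simp
      then have yG: "y \<in> carrier \<Gamma>" by (rule e(1))
      show "\<not> ?P y ws \<Longrightarrow> \<not> ?P' y (tl ws)" using late[OF w yG] by (simp only: not_False_eq_True)
      fix y' assume "y' \<in> fst ` set bs" and P: "?P y' ws"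
      then obtain q where "(y', q) \<in> set bs" by auto
      then have "(y', q) \<in> set zs" using zs(1) by simp
      from late[OF w e(1)[OF this]] P show "?P' y' (tl ws)" by (simp only:)
    qed
    moreover have "\<forall>(y, f) \<in> set (map ?g as). \<forall>(y', f') \<in> set (map ?g bs). ?P' y f'"
    proof -
      have "?P' y (tl ws)" if y: "(y, q) \<in> set as" and w: "(y', ws) \<in> set bs" for y q y' ws
      proof -
        have "?P y ws" using t(3) y w by blast
        moreover have "(y', ws) \<in> set zs" using w zs(1) by simp
        ultimately show ?thesis using early[OF _ y] by (simp only:)
      qed
      then show ?thesis by auto
    qed
    ultimately have "tri ?P' (map ?g as @ map ?g bs)" unfolding tri_append2 by blast
    then have "length (map ?g as @ map ?g bs) \<le> n"
    proof (rule Suc.IH[OF _ v', rotated 2])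
      fix y ws assume "(y, ws) \<in> set (map ?g as @ map ?g bs)"
      then obtain ws' where ws': "(y, ws') \<in> set zs" "ws = tl ws'" unfolding zs(1) by auto
      show "y \<in> carrier \<Gamma> \<and> length ws = length ?cs \<and> set ws \<subseteq> carrier M"
        using e[OF ws'(1)] ws'(2) by auto
    qed (simp add: n)
    then show ?thesis using zs(1) by simp
  qed
qed

end

section \<open>Word maps in terms of coefficient functions\<close>

context linear_action begin

text \<open>\<open>Rep cs u\<close>: the vector function \<open>u\<close> is \<open>\<Sum> c\<^sub>i(y) w\<^sub>i\<close> for some vectors \<open>w\<^sub>i\<close>.\<close>

primrec Rep :: "('g \<Rightarrow> 'c \<Rightarrow> 'c) list \<Rightarrow> ('g \<Rightarrow> 'c) \<Rightarrow> bool" where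
  "Rep [] u \<longleftrightarrow> (\<forall>y\<in>carrier \<Gamma>. u y = \<zero>\<^bsub>M\<^esub>)"
| "Rep (c # cs) u \<longleftrightarrow> (\<exists>w\<in>carrier M. \<exists>v. Rep cs v \<and> (\<forall>y\<in>carrier \<Gamma>. u y = c y w \<oplus>\<^bsub>M\<^esub> v y))"

lemma Rep_lev: "Rep cs u \<Longrightarrow> \<exists>ws. length ws = length cs \<and> set ws \<subseteq> carrier M \<and> (\<forall>y\<in>carrier \<Gamma>. u y = lev cs ws y)"
proof (induction cs arbitrary: u)
  case (Cons c cs)
  then obtain w v where w: "w \<in> carrier M" "Rep cs v" "\<forall>y\<in>carrier \<Gamma>. u y = c y w \<oplus>\<^bsub>M\<^esub> v y" by auto
  then obtain ws where "length ws = length cs \<and> set ws \<subseteq> carrier M \<and> (\<forall>y\<in>carrier \<Gamma>. v y = lev cs ws y)"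
    using Cons.IH by blast
  then show ?case using w by (intro exI[of _ "w # ws"]) simp
qed simp

lemma validD: "valid cs \<Longrightarrow> c \<in> set cs \<Longrightarrow> y \<in> carrier \<Gamma> \<Longrightarrow> c y \<in> K"
  by (auto simp: valid_def)

lemma valid_Cons: "valid (c # cs) \<longleftrightarrow> (\<forall>y\<in>carrier \<Gamma>. c y \<in> K) \<and> valid cs"
  by (auto simp: valid_def)

lemma Rep_closed: "valid cs \<Longrightarrow> Rep cs u \<Longrightarrow> y \<in> carrier \<Gamma> \<Longrightarrow> u y \<in> carrier M"
proof (induction cs arbitrary: u)
  case (Cons c cs)
  then obtain w v where w: "w \<in> carrier M" "Rep cs v" "u y = c y w \<oplus>\<^bsub>M\<^esub> v y" by auto
  have "c y \<in> K" "v y \<in> carrier M" using Cons w by (auto simp: valid_Cons)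
  then show ?case using w by simp
qed simp

lemma Rep_agree: "Rep cs u \<Longrightarrow> (\<And>y. y \<in> carrier \<Gamma> \<Longrightarrow> u y = v y) \<Longrightarrow> Rep cs v"
  by (cases cs) auto

lemma Rep_add: "valid cs \<Longrightarrow> Rep cs u \<Longrightarrow> Rep cs v \<Longrightarrow> Rep cs (\<lambda>y. u y \<oplus>\<^bsub>M\<^esub> v y)"
proof (induction cs arbitrary: u v)
  case (Cons c cs)
  then obtain w u' where u: "w \<in> carrier M" "Rep cs u'" "\<forall>y\<in>carrier \<Gamma>. u y = c y w \<oplus>\<^bsub>M\<^esub> u' y" by auto
  from Cons obtain x v' where v: "x \<in> carrier M" "Rep cs v'" "\<forall>y\<in>carrier \<Gamma>. v y = c y x \<oplus>\<^bsub>M\<^esub> v' y" by auto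
  have val: "valid cs" using Cons.prems(1) by (simp add: valid_Cons)
  have "u y \<oplus>\<^bsub>M\<^esub> v y = c y (w \<oplus>\<^bsub>M\<^esub> x) \<oplus>\<^bsub>M\<^esub> (u' y \<oplus>\<^bsub>M\<^esub> v' y)" if y: "y \<in> carrier \<Gamma>" for y
  proof -
    have k: "c y \<in> K" using Cons.prems(1) y by (simp add: valid_Cons)
    have "u' y \<in> carrier M" "v' y \<in> carrier M" using Rep_closed[OF val _ y] u(2) v(2) by auto
    then show ?thesis using u(1,3) v(1,3) y k by (simp add: M.endo_add[OF K_endo[OF k]] M.a_ac)
  qed
  then show ?case using Cons.IH[OF val u(2) v(2)] u(1) v(1)
    by (auto intro!: bexI[of _ "w \<oplus>\<^bsub>M\<^esub> x"] exI[of _ "\<lambda>y. u' y \<oplus>\<^bsub>M\<^esub> v' y"])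
qed simp

lemma Rep_zero: "valid cs \<Longrightarrow> (\<And>y. y \<in> carrier \<Gamma> \<Longrightarrow> u y = \<zero>\<^bsub>M\<^esub>) \<Longrightarrow> Rep cs u"
proof (induction cs arbitrary: u)
  case (Cons c cs)
  have "Rep cs (\<lambda>y. \<zero>\<^bsub>M\<^esub>)" using Cons.IH Cons.prems(1) by (simp add: valid_Cons)
  moreover have "u y = c y \<zero>\<^bsub>M\<^esub> \<oplus>\<^bsub>M\<^esub> \<zero>\<^bsub>M\<^esub>" if "y \<in> carrier \<Gamma>" for y
    using Cons.prems that M.endo_zero[OF K_endo[of "c y"]] by (simp add: valid_Cons)
  ultimately show ?case by (auto intro!: bexI[of _ "\<zero>\<^bsub>M\<^esub>"] exI[of _ "\<lambda>y. \<zero>\<^bsub>M\<^esub>"])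
qed simp

lemma Rep_single: "valid cs \<Longrightarrow> c \<in> set cs \<Longrightarrow> w \<in> carrier M \<Longrightarrow> Rep cs (\<lambda>y. c y w)"
proof (induction cs)
  case (Cons c' cs)
  have v: "valid cs" using Cons.prems(1) by (simp add: valid_Cons)
  have K: "c y \<in> K" "c' y \<in> K" if "y \<in> carrier \<Gamma>" for y using Cons.prems(1,2) that by (auto simp: valid_def)
  show ?case
  proof (cases "c = c'")
    case True
    have "Rep cs (\<lambda>y. \<zero>\<^bsub>M\<^esub>)" by (rule Rep_zero[OF v]) simp
    moreover have "c y w = c' y w \<oplus>\<^bsub>M\<^esub> \<zero>\<^bsub>M\<^esub>" if "y \<in> carrier \<Gamma>" for y
      using True K(2)[OF that] Cons.prems(3) by simp
    ultimately show ?thesis using Cons.prems(3) by (auto intro!: bexI[of _ w] exI[of _ "\<lambda>y. \<zero>\<^bsub>M\<^esub>"])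
  next
    case False
    then have "Rep cs (\<lambda>y. c y w)" using Cons v by simp
    moreover have "c y w = c' y \<zero>\<^bsub>M\<^esub> \<oplus>\<^bsub>M\<^esub> c y w" if "y \<in> carrier \<Gamma>" for y
      using K[OF that] Cons.prems(3) M.endo_zero[OF K_endo[OF K(2)[OF that]]] by simp
    ultimately show ?thesis by (auto intro!: bexI[of _ "\<zero>\<^bsub>M\<^esub>"] exI[of _ "\<lambda>y. c y w"])
  qed
qed simp

lemma Rep_induct:
  assumes "valid cs" "Rep cs u"
    and zero: "\<And>v. (\<And>y. y \<in> carrier \<Gamma> \<Longrightarrow> v y = \<zero>\<^bsub>M\<^esub>) \<Longrightarrow> Q v"
    and step: "\<And>c w v u. c \<in> set cs \<Longrightarrow> w \<in> carrier M \<Longrightarrow> Q v \<Longrightarrow> (\<And>y. y \<in> carrier \<Gamma> \<Longrightarrow> v y \<in> carrier M) \<Longrightarrow>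
      (\<And>y. y \<in> carrier \<Gamma> \<Longrightarrow> u y = c y w \<oplus>\<^bsub>M\<^esub> v y) \<Longrightarrow> Q u"
  shows "Q u"
proof -
  have "set ds \<subseteq> set cs \<Longrightarrow> valid ds \<Longrightarrow> Rep ds u \<Longrightarrow> Q u" for ds u
  proof (induction ds arbitrary: u)
    case Nil then show ?case using zero by simp
  next
    case (Cons c ds)
    then obtain w v where w: "w \<in> carrier M" "Rep ds v" "\<forall>y\<in>carrier \<Gamma>. u y = c y w \<oplus>\<^bsub>M\<^esub> v y" by auto
    have v: "valid ds" using Cons.prems(2) by (simp add: valid_Cons)
    have c: "c \<in> set cs" using Cons.prems(1) by simp
    have Qv: "Q v" using Cons.IH[OF _ v w(2)] Cons.prems(1) by simp
    show ?case
      by (rule step[OF c w(1) Qv]) (use Rep_closed[OF v w(2)] w(3) in blast)+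
  qed
  then show ?thesis using assms(1,2) by blast
qed

lemma Rep_mono:
  assumes "valid cs" "Rep cs u" and ds: "valid ds" "set cs \<subseteq> set ds"
  shows "Rep ds u"
  using assms(1,2)
proof (rule Rep_induct)
  show "Rep ds v" if "\<And>y. y \<in> carrier \<Gamma> \<Longrightarrow> v y = \<zero>\<^bsub>M\<^esub>" for v by (rule Rep_zero[OF ds(1) that])
  fix c w v u assume c: "c \<in> set cs" and w: "w \<in> carrier M" and v: "Rep ds v"
    and u: "\<And>y. y \<in> carrier \<Gamma> \<Longrightarrow> u y = c y w \<oplus>\<^bsub>M\<^esub> v y"
  have "c \<in> set ds" using c ds(2) by blast
  from Rep_add[OF ds(1) Rep_single[OF ds(1) this w] v] show "Rep ds u"
    by (rule Rep_agree) (simp add: u)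
qed

primrec lin :: "('c \<Rightarrow> 'c) list \<Rightarrow> 'c list \<Rightarrow> 'c" where
  "lin [] zs = \<zero>\<^bsub>M\<^esub>"
| "lin (k # ks) zs = k (hd zs) \<oplus>\<^bsub>M\<^esub> lin ks (tl zs)"

lemma lin_closed: "set ks \<subseteq> K \<Longrightarrow> length ks = length zs \<Longrightarrow> set zs \<subseteq> carrier M \<Longrightarrow> lin ks zs \<in> carrier M"
proof (induction ks arbitrary: zs)
  case (Cons k ks) then show ?case by (cases zs) auto
qed simp

lemma kspan_lin: "v \<in> kspan zs \<Longrightarrow> \<exists>ks. length ks = length zs \<and> set ks \<subseteq> K \<and> v = lin ks zs"
proof (induction zs arbitrary: v)
  case (Cons z zs)
  then obtain k v' where k: "k \<in> K" "v' \<in> kspan zs" "v = k z \<oplus>\<^bsub>M\<^esub> v'" by auto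
  then obtain ks where "length ks = length zs \<and> set ks \<subseteq> K \<and> v' = lin ks zs" using Cons.IH by blast
  then show ?case using k by (intro exI[of _ "k # ks"]) simp
qed simp

text \<open>A choice of coordinates over \<open>xs\<close>. As \<open>xs\<close> may be dependent,
  \<open>co\<close> need not be linear; what counts is that the coordinates lie in \<open>K\<close>
  and reproduce \<open>v\<close>.\<close>

definition co :: "'c \<Rightarrow> ('c \<Rightarrow> 'c) list" where
  "co v = (SOME ks. length ks = length xs \<and> set ks \<subseteq> K \<and> v = lin ks xs)"

lemma co: "v \<in> carrier M \<Longrightarrow> length (co v) = length xs" "v \<in> carrier M \<Longrightarrow> set (co v) \<subseteq> K"
  "v \<in> carrier M \<Longrightarrow> lin (co v) xs = v"
  using someI_ex[OF kspan_lin[of v xs]] xs_span unfolding co_def by auto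

text \<open>The matrix entries of \<open>y\<close> and of its inverse, and the coefficient functions needed after
  applying \<open>y\<close> or its inverse once more.\<close>

definition ents :: "('g \<Rightarrow> 'c \<Rightarrow> 'c) list" where
  "ents = map (\<lambda>(e, j, i). \<lambda>y. co (\<sigma> (if e then y else inv\<^bsub>\<Gamma>\<^esub> y) (xs ! j)) ! i)
     (List.product [True, False] (List.product [0..<length xs] [0..<length xs]))"

lemma set_ents: "set ents = {\<kappa>. \<exists>e j i. (j < length xs \<and> i < length xs) \<and> \<kappa> = (\<lambda>y. co (\<sigma> (if e then y else inv\<^bsub>\<Gamma>\<^esub> y) (xs ! j)) ! i)}"
proof -
  have eq: "set (List.product [True, False] (List.product [0..<length xs] [0..<length xs])) =
    UNIV \<times> ({..<length xs} \<times> {..<length xs})" by auto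
  show ?thesis unfolding ents_def set_map eq
    by (intro Set.set_eqI) (simp only: image_iff Bex_def mem_Collect_eq split_paired_Ex mem_Sigma_iff UNIV_I lessThan_iff prod.case simp_thms)
qed

definition nx :: "('g \<Rightarrow> 'c \<Rightarrow> 'c) list \<Rightarrow> ('g \<Rightarrow> 'c \<Rightarrow> 'c) list" where
  "nx cs = cs @ map (\<lambda>(c, \<kappa>). \<lambda>y x. c y (\<kappa> y x)) (List.product cs ents)"

text \<open>The factor counts the old coefficient functions once, and their products with the
  \<open>(length xs)^2\<close> matrix entries of \<open>y\<close> and as many of its
  inverse.\<close>

lemma length_nx: "length (nx cs) = (1 + 2 * (length xs)\<^sup>2) * length cs"
  by (simp add: nx_def ents_def length_product power2_eq_square algebra_simps)

lemma ent_K: "\<kappa> \<in> set ents \<Longrightarrow> y \<in> carrier \<Gamma> \<Longrightarrow> \<kappa> y \<in> K"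
proof -
  assume "\<kappa> \<in> set ents" and y: "y \<in> carrier \<Gamma>"
  then obtain e j i where \<kappa>: "\<kappa> = (\<lambda>y. co (\<sigma> (if e then y else inv\<^bsub>\<Gamma>\<^esub> y) (xs ! j)) ! i)" "j < length xs" "i < length xs"
    unfolding set_ents mem_Collect_eq by (elim exE conjE) (rule that, assumption+)
  have "xs ! j \<in> carrier M" using xs_sub \<kappa>(2) nth_mem by blast
  then have m: "\<sigma> (if e then y else inv\<^bsub>\<Gamma>\<^esub> y) (xs ! j) \<in> carrier M" using y by simp
  have "\<kappa> y \<in> set (co (\<sigma> (if e then y else inv\<^bsub>\<Gamma>\<^esub> y) (xs ! j)))"
    unfolding \<kappa>(1) using \<kappa>(3) co(1)[OF m] by (intro nth_mem) simp
  then show ?thesis using co(2)[OF m] by blast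
qed

lemma valid_nx: "valid cs \<Longrightarrow> valid (nx cs)"
proof -
  assume v: "valid cs"
  have "(\<lambda>x. c y (\<kappa> y x)) \<in> K" if "c \<in> set cs" "\<kappa> \<in> set ents" "y \<in> carrier \<Gamma>" for c \<kappa> y
    by (rule K_comp[OF validD[OF v that(1,3)] ent_K[OF that(2,3)]])
  then show ?thesis using v unfolding valid_def nx_def by auto
qed

text \<open>The image of \<open>xs ! j\<close> is expanded in coordinates; going back from
  \<open>drop (Suc n)\<close> to \<open>drop n\<close> adds one product of \<open>c\<close> with a
  matrix entry, applied to the vector \<open>k (xs ! n)\<close>.\<close>

lemma Rep_entry:
  assumes v: "valid cs" and c: "c \<in> set cs" and k: "k \<in> K" and j: "j < length xs"
  shows "Rep (nx cs) (\<lambda>y. c y (k (\<sigma> (if e then y else inv\<^bsub>\<Gamma>\<^esub> y) (xs ! j))))"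
proof -
  let ?e = "\<lambda>y. if e then y else inv\<^bsub>\<Gamma>\<^esub> y"
  let ?q = "\<lambda>y. co (\<sigma> (?e y) (xs ! j))"
  let ?d = "length xs"
  have xj: "xs ! j \<in> carrier M" using xs_sub j nth_mem by blast
  have m: "\<sigma> (?e y) (xs ! j) \<in> carrier M" if "y \<in> carrier \<Gamma>" for y using that xj by simp
  have lc: "lin (drop n (?q y)) (drop n xs) \<in> carrier M" if y: "y \<in> carrier \<Gamma>" for n y
    using co(1,2)[OF m[OF y]] xs_sub set_drop_subset[of n "?q y"] set_drop_subset[of n xs]
    by (intro lin_closed) auto
  have "n \<le> ?d \<Longrightarrow> Rep (nx cs) (\<lambda>y. c y (k (lin (drop n (?q y)) (drop n xs))))" for n
  proof (induction n rule: inc_induct)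
    case base
    show ?case
    proof (rule Rep_zero[OF valid_nx[OF v]])
      fix y assume y: "y \<in> carrier \<Gamma>"
      show "c y (k (lin (drop ?d (?q y)) (drop ?d xs))) = \<zero>\<^bsub>M\<^esub>"
        using co(1)[OF m[OF y]] M.endo_zero[OF K_endo[OF k]] M.endo_zero[OF K_endo[OF validD[OF v c y]]] by simp
    qed
  next
    case (step n)
    let ?\<kappa> = "\<lambda>y. ?q y ! n"
    have "?\<kappa> \<in> set ents"
      unfolding set_ents mem_Collect_eq using step(2) j
      by - (rule exI[of _ e], rule exI[of _ j], rule exI[of _ n], intro conjI refl, assumption+)
    then have "(\<lambda>y x. c y (?\<kappa> y x)) \<in> set (nx cs)"
      unfolding nx_def set_append set_map set_product using c
      by (intro UnI2 image_eqI[of _ _ "(c, ?\<kappa>)"] SigmaI) (simp_all only: prod.case)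
    moreover have xn: "xs ! n \<in> carrier M" using xs_sub step(2) nth_mem by blast
    ultimately have "Rep (nx cs) (\<lambda>y. (\<lambda>y x. c y (?\<kappa> y x)) y (k (xs ! n)))"
      using k by (intro Rep_single valid_nx[OF v]) auto
    from Rep_add[OF valid_nx[OF v] this step.IH] show ?case
    proof (rule Rep_agree)
      fix y assume y: "y \<in> carrier \<Gamma>"
      have \<kappa>K: "?\<kappa> y \<in> K" by (rule ent_K[OF \<open>?\<kappa> \<in> set ents\<close> y])
      have "drop n (?q y) = ?\<kappa> y # drop (Suc n) (?q y)" "drop n xs = xs ! n # drop (Suc n) xs"
        using step(2) co(1)[OF m[OF y]] by (simp_all add: Cons_nth_drop_Suc)
      then have "lin (drop n (?q y)) (drop n xs) = ?\<kappa> y (xs ! n) \<oplus>\<^bsub>M\<^esub> lin (drop (Suc n) (?q y)) (drop (Suc n) xs)"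
        by simp
      then show "c y (?\<kappa> y (k (xs ! n))) \<oplus>\<^bsub>M\<^esub> c y (k (lin (drop (Suc n) (?q y)) (drop (Suc n) xs)))
          = c y (k (lin (drop n (?q y)) (drop n xs)))"
        using K_swap(2)[OF k \<kappa>K xn] \<kappa>K xn lc[OF y, of "Suc n"] k validD[OF v c y]
        by (simp add: M.endo_add[OF K_endo])
    qed
  qed
  from this[of 0] show ?thesis
  proof (rule Rep_agree)
    fix y assume "y \<in> carrier \<Gamma>"
    then show "c y (k (lin (drop 0 (?q y)) (drop 0 xs))) = c y (k (\<sigma> (?e y) (xs ! j)))" using co(3)[OF m] by simp
  qed simp
qed

lemma Rep_apply_vector:
  assumes v: "valid cs" and c: "c \<in> set cs"
  shows "set zs \<subseteq> set xs \<Longrightarrow> w \<in> kspan zs \<Longrightarrow> Rep (nx cs) (\<lambda>y. c y (\<sigma> (if e then y else inv\<^bsub>\<Gamma>\<^esub> y) w))"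
proof (induction zs arbitrary: w)
  case Nil
  have "\<sigma> g \<zero>\<^bsub>M\<^esub> = \<zero>\<^bsub>M\<^esub>" if "g \<in> carrier \<Gamma>" for g using M.endo_zero[OF \<sigma>_endo[OF that]] .
  then show ?case
    using Nil.prems by (intro Rep_zero[OF valid_nx[OF v]]) (simp add: M.endo_zero[OF K_endo[OF validD[OF v c]]])
next
  case (Cons z zs)
  then obtain k w' where k: "k \<in> K" "w' \<in> kspan zs" "w = k z \<oplus>\<^bsub>M\<^esub> w'" by auto
  have zM: "z \<in> carrier M" "set zs \<subseteq> carrier M" using Cons.prems(1) xs_sub by auto
  have w'M: "w' \<in> carrier M" using kspan_sub[OF zM(2)] k(2) by blast
  obtain j where j: "j < length xs" "z = xs ! j" using Cons.prems(1) by (metis in_set_conv_nth insert_subset list.simps(15))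
  have IH: "Rep (nx cs) (\<lambda>y. c y (\<sigma> (if e then y else inv\<^bsub>\<Gamma>\<^esub> y) w'))" using Cons k(2) by simp
  from Rep_add[OF valid_nx[OF v] Rep_entry[OF v c k(1) j(1), of e] IH] show ?case
  proof (rule Rep_agree)
    fix y assume y: "y \<in> carrier \<Gamma>"
    let ?g = "if e then y else inv\<^bsub>\<Gamma>\<^esub> y"
    have g: "?g \<in> carrier \<Gamma>" using y by simp
    have "\<sigma> ?g w = k (\<sigma> ?g z) \<oplus>\<^bsub>M\<^esub> \<sigma> ?g w'"
      unfolding k(3) using M.endo_add[OF \<sigma>_endo[OF g], of "k z" w'] \<sigma>_K[OF g k(1) zM(1)] k(1) zM(1) w'M by simp
    moreover have "k (\<sigma> ?g z) \<in> carrier M" "\<sigma> ?g w' \<in> carrier M" using k(1) zM(1) w'M g by auto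
    ultimately show "c y (k (\<sigma> ?g (xs ! j))) \<oplus>\<^bsub>M\<^esub> c y (\<sigma> ?g w') = c y (\<sigma> ?g w)"
      using M.endo_add[OF K_endo[OF validD[OF v c y]]] j(2) by simp
  qed
qed

lemma Rep_apply:
  assumes v: "valid cs" and u: "Rep cs u"
  shows "Rep (nx cs) (\<lambda>y. \<sigma> (if e then y else inv\<^bsub>\<Gamma>\<^esub> y) (u y))"
  using v u
proof (rule Rep_induct)
  fix u assume "\<And>y. y \<in> carrier \<Gamma> \<Longrightarrow> u y = \<zero>\<^bsub>M\<^esub>"
  then show "Rep (nx cs) (\<lambda>y. \<sigma> (if e then y else inv\<^bsub>\<Gamma>\<^esub> y) (u y))"
    by (intro Rep_zero[OF valid_nx[OF v]]) (simp add: M.endo_zero[OF \<sigma>_endo])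
next
  fix c w v' u
  assume c: "c \<in> set cs" and w: "w \<in> carrier M" and IH: "Rep (nx cs) (\<lambda>y. \<sigma> (if e then y else inv\<^bsub>\<Gamma>\<^esub> y) (v' y))"
    and v'M: "\<And>y. y \<in> carrier \<Gamma> \<Longrightarrow> v' y \<in> carrier M" and u: "\<And>y. y \<in> carrier \<Gamma> \<Longrightarrow> u y = c y w \<oplus>\<^bsub>M\<^esub> v' y"
  have "w \<in> kspan xs" using w xs_span by simp
  from Rep_add[OF valid_nx[OF v] Rep_apply_vector[OF v c order_refl this, of e] IH]
  show "Rep (nx cs) (\<lambda>y. \<sigma> (if e then y else inv\<^bsub>\<Gamma>\<^esub> y) (u y))"
  proof (rule Rep_agree)
    fix y assume y: "y \<in> carrier \<Gamma>"
    let ?g = "if e then y else inv\<^bsub>\<Gamma>\<^esub> y"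
    have g: "?g \<in> carrier \<Gamma>" using y by simp
    have k: "c y \<in> K" using validD[OF v c y] .
    show "c y (\<sigma> ?g w) \<oplus>\<^bsub>M\<^esub> \<sigma> ?g (v' y) = \<sigma> ?g (u y)"
      unfolding u[OF y] M.endo_add[OF \<sigma>_endo[OF g] K_closed[OF k w] v'M[OF y]] \<sigma>_K[OF g k w] ..
  qed
qed

lemma Rep_const:
  assumes v: "valid cs" and u: "Rep cs u" and g: "g \<in> carrier \<Gamma>"
  shows "Rep cs (\<lambda>y. \<sigma> g (u y))"
  using v u
proof (rule Rep_induct)
  fix u assume "\<And>y. y \<in> carrier \<Gamma> \<Longrightarrow> u y = \<zero>\<^bsub>M\<^esub>"
  then show "Rep cs (\<lambda>y. \<sigma> g (u y))"
    by (intro Rep_zero[OF v]) (simp add: M.endo_zero[OF \<sigma>_endo[OF g]])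
next
  fix c w v' u
  assume c: "c \<in> set cs" and w: "w \<in> carrier M" and IH: "Rep cs (\<lambda>y. \<sigma> g (v' y))"
    and v'M: "\<And>y. y \<in> carrier \<Gamma> \<Longrightarrow> v' y \<in> carrier M" and u: "\<And>y. y \<in> carrier \<Gamma> \<Longrightarrow> u y = c y w \<oplus>\<^bsub>M\<^esub> v' y"
  from Rep_add[OF v Rep_single[OF v c \<sigma>_closed[OF g w]] IH] show "Rep cs (\<lambda>y. \<sigma> g (u y))"
  proof (rule Rep_agree)
    fix y assume y: "y \<in> carrier \<Gamma>"
    have k: "c y \<in> K" using validD[OF v c y] .
    show "c y (\<sigma> g w) \<oplus>\<^bsub>M\<^esub> \<sigma> g (v' y) = \<sigma> g (u y)"
      unfolding u[OF y] M.endo_add[OF \<sigma>_endo[OF g] K_closed[OF k w] v'M[OF y]] \<sigma>_K[OF g k w] ..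
  qed
qed

lemma valid_nx_pow: "valid cs \<Longrightarrow> valid ((nx ^^ n) cs)"
  by (induction n) (simp_all add: valid_nx)

lemma nx_pow_mono: "m \<le> n \<Longrightarrow> set ((nx ^^ m) cs) \<subseteq> set ((nx ^^ n) cs)"
  by (rule lift_Suc_mono_le[of "\<lambda>n. set ((nx ^^ n) cs)"]) (auto simp: nx_def)

lemma length_nx_pow: "length ((nx ^^ n) cs) = (1 + 2 * (length xs)\<^sup>2) ^ n * length cs"
  by (induction n) (simp_all only: funpow.simps comp_def id_def length_nx power_Suc power_0 mult.assoc mult_1)

text \<open>Each occurrence of the variable costs one application of \<open>nx\<close>. A constant
  is free: it acts \<open>K\<close>-linearly and moves only the vectors, not the coefficients.
  Products of words become compositions of operators, so the exponents add.\<close>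

lemma Rep_word:
  assumes "\<Gamma>.word_fun (carrier \<Gamma>) m f"
  shows "valid cs \<Longrightarrow> Rep cs u \<Longrightarrow> Rep ((nx ^^ m) cs) (\<lambda>y. \<sigma> (f y) (u y))"
  using assms
proof (induction arbitrary: cs u rule: \<Gamma>.word_fun.induct)
  case (const c) then show ?case using Rep_const by simp
next
  case var then show ?case using Rep_apply[of cs u True] by simp
next
  case var_inv then show ?case using Rep_apply[of cs u False] by simp
next
  case (mult m f n h)
  have "Rep ((nx ^^ m) ((nx ^^ n) cs)) (\<lambda>y. \<sigma> (f y) (\<sigma> (h y) (u y)))"
    by (rule mult.IH(1)[OF valid_nx_pow[OF mult.prems(1)] mult.IH(2)[OF mult.prems]])
  then show ?case
    unfolding funpow_add comp_def
  proof (rule Rep_agree)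
    fix y assume y: "y \<in> carrier \<Gamma>"
    show "\<sigma> (f y) (\<sigma> (h y) (u y)) = \<sigma> (f y \<otimes>\<^bsub>\<Gamma>\<^esub> h y) (u y)"
      using \<Gamma>.word_fun_closed[OF mult.hyps(1) order_refl y] \<Gamma>.word_fun_closed[OF mult.hyps(2) order_refl y]
        Rep_closed[OF mult.prems y] by (intro \<sigma>_mult[symmetric])
  qed
next
  case (weaken m f n)
  then show ?case
    using Rep_mono[OF valid_nx_pow[OF weaken.prems(1)] weaken.IH[OF weaken.prems] valid_nx_pow[OF weaken.prems(1)]
        nx_pow_mono[OF weaken.hyps(2)]] by simp
next
  case (agree m f h)
  show ?case by (rule Rep_agree[OF agree.IH[OF agree.prems]]) (simp add: agree.hyps(2))
qed

text \<open>By faithfulness, a word equation failing at its own point can be replaced by the vector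
  equation \<open>\<sigma> (f y) x = x\<close> for one vector \<open>x\<close> moved there; where
  the word equation holds, the vector equation holds too, so triangularity survives. The coefficient
  functions start as one constant function and are enlarged \<open>m\<close> times, which gives the
  bound.\<close>

theorem tri_bounded_bound: "\<Gamma>.tri_bounded (carrier \<Gamma>) m ((1 + 2 * (length xs)\<^sup>2) ^ m)"
  unfolding \<Gamma>.tri_bounded_def
proof (intro allI impI)
  fix zs :: "('g \<times> ('g \<Rightarrow> 'g)) list"
  assume zs: "(\<forall>(y, f)\<in>set zs. y \<in> carrier \<Gamma> \<and> \<Gamma>.word_fun (carrier \<Gamma>) m f) \<and> tri (\<lambda>y f. f y = \<one>\<^bsub>\<Gamma>\<^esub>) zs"
  let ?id = "[\<lambda>(y::'g) x::'c. x]"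
  let ?cs = "(nx ^^ m) ?id"
  have vid: "valid ?id" unfolding valid_def using K_id by simp
  have v: "valid ?cs" by (rule valid_nx_pow[OF vid])
  let ?ok = "\<lambda>y f ws. length ws = length ?cs \<and> set ws \<subseteq> carrier M \<and> (f y \<noteq> \<one>\<^bsub>\<Gamma>\<^esub> \<longrightarrow> lev ?cs ws y \<noteq> \<zero>\<^bsub>M\<^esub>) \<and>
      (\<forall>y'\<in>carrier \<Gamma>. f y' = \<one>\<^bsub>\<Gamma>\<^esub> \<longrightarrow> lev ?cs ws y' = \<zero>\<^bsub>M\<^esub>)"
  have ex: "\<exists>ws. ?ok y f ws" if y: "y \<in> carrier \<Gamma>" and f: "\<Gamma>.word_fun (carrier \<Gamma>) m f" for y f
  proof -
    have fc: "f y' \<in> carrier \<Gamma>" if "y' \<in> carrier \<Gamma>" for y' by (rule \<Gamma>.word_fun_closed[OF f order_refl that])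
    obtain x where x: "x \<in> carrier M" "f y \<noteq> \<one>\<^bsub>\<Gamma>\<^esub> \<longrightarrow> \<sigma> (f y) x \<noteq> x"
      using \<sigma>_faithful[OF fc[OF y]] nontrivial by blast
    have "Rep ?id (\<lambda>y. x)" using Rep_single[OF vid, of "\<lambda>y x. x" x] x(1) by simp
    then have 1: "Rep ?cs (\<lambda>y. \<sigma> (f y) x)" by (rule Rep_word[OF f vid])
    have "(\<lambda>(y::'g) x::'c. x) \<in> set ?cs" using nx_pow_mono[of 0 m ?id] by auto
    then have "Rep ?cs (\<lambda>y. \<ominus>\<^bsub>M\<^esub> x)" using Rep_single[OF v, of "\<lambda>y x. x" "\<ominus>\<^bsub>M\<^esub> x"] x(1) by simp
    then have "Rep ?cs (\<lambda>y. \<sigma> (f y) x \<oplus>\<^bsub>M\<^esub> \<ominus>\<^bsub>M\<^esub> x)" by (rule Rep_add[OF v 1])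
    from Rep_lev[OF this] obtain ws where ws: "length ws = length ?cs" "set ws \<subseteq> carrier M"
      "\<And>y. y \<in> carrier \<Gamma> \<Longrightarrow> \<sigma> (f y) x \<oplus>\<^bsub>M\<^esub> \<ominus>\<^bsub>M\<^esub> x = lev ?cs ws y" by auto
    have iff: "lev ?cs ws y' = \<zero>\<^bsub>M\<^esub> \<longleftrightarrow> \<sigma> (f y') x = x" if y': "y' \<in> carrier \<Gamma>" for y'
      using M.minus_eq_zero_iff[OF \<sigma>_closed[OF fc[OF y'] x(1)] x(1)] ws(3)[OF y'] by (simp add: M.minus_eq)
    have "lev ?cs ws y' = \<zero>\<^bsub>M\<^esub>" if "y' \<in> carrier \<Gamma>" "f y' = \<one>\<^bsub>\<Gamma>\<^esub>" for y'
      using iff[OF that(1)] that(2) \<sigma>_one[OF x(1)] by simp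
    then show ?thesis using ws(1,2) iff[OF y] x(2) by blast
  qed
  define W where "W y f = (SOME ws. ?ok y f ws)" for y f
  have W: "?ok y f (W y f)" if "(y, f) \<in> set zs" for y f
    unfolding W_def by (rule someI_ex[OF ex]) (use zs that in auto)
  have "tri (\<lambda>y ws. lev ?cs ws y = \<zero>\<^bsub>M\<^esub>) (map (\<lambda>(y, f). (y, W y f)) zs)"
  proof (rule tri_map[OF conjunct2[OF zs]])
    fix y f assume z: "(y, f) \<in> set zs"
    show "f y \<noteq> \<one>\<^bsub>\<Gamma>\<^esub> \<Longrightarrow> lev ?cs (W y f) y \<noteq> \<zero>\<^bsub>M\<^esub>" using W[OF z] by blast
    fix y' assume "y' \<in> fst ` set zs" and "f y' = \<one>\<^bsub>\<Gamma>\<^esub>"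
    moreover then have "y' \<in> carrier \<Gamma>" using zs by auto
    ultimately show "lev ?cs (W y f) y' = \<zero>\<^bsub>M\<^esub>" using W[OF z] by blast
  qed
  then have "length (map (\<lambda>(y, f). (y, W y f)) zs) \<le> length ?cs"
  proof (rule tri_lev_bound[OF refl v, rotated])
    fix y ws assume "(y, ws) \<in> set (map (\<lambda>(y, f). (y, W y f)) zs)"
    then obtain f where f: "(y, f) \<in> set zs" "ws = W y f" by auto
    then show "y \<in> carrier \<Gamma> \<and> length ws = length ?cs \<and> set ws \<subseteq> carrier M" using W[OF f(1)] zs by auto
  qed
  then show "length zs \<le> (1 + 2 * (length xs)\<^sup>2) ^ m" by (simp add: length_nx_pow)
qed

end

section \<open>Simple modules not annihilated by a non-nilpotent element\<close>

context ring begin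

definition left_ideal :: "'a set \<Rightarrow> bool" where
  "left_ideal L \<longleftrightarrow> L \<subseteq> carrier R \<and> \<zero> \<in> L \<and> (\<forall>x\<in>L. \<forall>y\<in>L. x \<oplus> y \<in> L) \<and> (\<forall>s\<in>carrier R. \<forall>x\<in>L. s \<otimes> x \<in> L)"

lemma left_idealD:
  assumes "left_ideal L"
  shows "L \<subseteq> carrier R" "\<zero> \<in> L" "x \<in> L \<Longrightarrow> y \<in> L \<Longrightarrow> x \<oplus> y \<in> L" "s \<in> carrier R \<Longrightarrow> x \<in> L \<Longrightarrow> s \<otimes> x \<in> L"
  using assms by (auto simp: left_ideal_def)

lemma left_ideal_subgroup: "left_ideal L \<Longrightarrow> abelian_subgroup L R"
proof (rule abelian_subgroupI3[OF additive_subgroup.intro abelian_group_axioms])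
  assume L: "left_ideal L"
  have "\<ominus> x \<in> L" if "x \<in> L" for x
    using left_idealD(4)[OF L, of "\<ominus> \<one>" x] left_idealD(1)[OF L] that by (auto simp: l_minus)
  then show "subgroup L (add_monoid R)"
    using left_idealD[OF L] by (intro add.subgroupI) auto
qed

text \<open>Only the additive structure is meaningful; the ring record is used because abelian
  groups are predicates on such records.\<close>

definition quotient_module :: "'a set \<Rightarrow> 'a set ring" where
  "quotient_module L = \<lparr>carrier = (\<lambda>p. L +> p) ` carrier R, monoid.mult = undefined, one = undefined, ring.zero = L, ring.add = set_add R\<rparr>"

definition coset_mult :: "'a set \<Rightarrow> 'a \<Rightarrow> 'a set \<Rightarrow> 'a set" where
  "coset_mult L s A = L +> (s \<otimes> (SOME p. p \<in> carrier R \<and> A = L +> p))"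

lemma quotient_module_simps:
  "carrier (quotient_module L) = (\<lambda>p. L +> p) ` carrier R" "\<zero>\<^bsub>quotient_module L\<^esub> = L"
  "A \<oplus>\<^bsub>quotient_module L\<^esub> B = A <+> B"
  by (simp_all add: quotient_module_def)

lemma coset_zero_iff:
  assumes L: "left_ideal L" and p: "p \<in> carrier R"
  shows "L +> p = L \<longleftrightarrow> p \<in> L"
proof -
  interpret abelian_subgroup L R by (rule left_ideal_subgroup[OF L])
  show ?thesis using a_rcos_self[OF p] a_coset_join2[OF p a_subgroup] by auto
qed

lemma coset_eq_iff:
  assumes L: "left_ideal L" and p: "p \<in> carrier R" and q: "q \<in> carrier R"
  shows "L +> p = L +> q \<longleftrightarrow> p \<ominus> q \<in> L"
proof -
  interpret abelian_subgroup L R by (rule left_ideal_subgroup[OF L])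
  have "p = (p \<ominus> q) \<oplus> q" using p q by (simp add: a_minus_def a_assoc l_neg)
  then have 1: "L +> p = (L +> (p \<ominus> q)) <+> (L +> q)" using a_rcos_sum[of "p \<ominus> q" q] p q by simp
  have 2: "L +> (p \<ominus> q) = (L +> p) <+> (L +> (\<ominus> q))" "(L +> q) <+> (L +> (\<ominus> q)) = L +> \<zero>"
    using a_rcos_sum[of p "\<ominus> q"] a_rcos_sum[of q "\<ominus> q"] p q by (simp_all add: a_minus_def r_neg)
  have 3: "L +> \<zero> = L" using coset_zero_iff[OF L, of \<zero>] left_idealD(1,2)[OF L] by blast
  have 4: "L <+> (L +> q) = L +> q" using a_rcos_sum[of \<zero> q] q 3 by simp
  show ?thesis using 1 2 3 4 coset_zero_iff[OF L, of "p \<ominus> q"] p q by auto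
qed

lemma coset_mult:
  assumes L: "left_ideal L" and s: "s \<in> carrier R" and p: "p \<in> carrier R"
  shows "coset_mult L s (L +> p) = L +> (s \<otimes> p)"
proof -
  let ?q = "SOME q. q \<in> carrier R \<and> L +> p = L +> q"
  have q: "?q \<in> carrier R \<and> L +> p = L +> ?q" by (rule someI[of _ p]) (simp add: p)
  then have "p \<ominus> ?q \<in> L" using coset_eq_iff[OF L p] by blast
  then have "s \<otimes> (p \<ominus> ?q) \<in> L" using left_idealD(4)[OF L s] by blast
  moreover have "s \<otimes> (p \<ominus> ?q) = s \<otimes> p \<ominus> s \<otimes> ?q" using s p q by (simp add: a_minus_def r_distr r_minus)
  ultimately have "L +> (s \<otimes> p) = L +> (s \<otimes> ?q)" using coset_eq_iff[OF L, of "s \<otimes> p" "s \<otimes> ?q"] s p q by simp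
  then show ?thesis unfolding coset_mult_def by simp
qed

lemma quotient_module_abelian:
  assumes L: "left_ideal L"
  shows "abelian_group (quotient_module L)"
proof -
  interpret abelian_subgroup L R by (rule left_ideal_subgroup[OF L])
  have 3: "L +> \<zero> = L" using coset_zero_iff[OF L, of \<zero>] left_idealD(1,2)[OF L] by blast
  have z: "L \<in> (\<lambda>p. L +> p) ` carrier R" using 3 left_idealD(1,2)[OF L] by (metis imageI subsetD)
  have l: "L <+> (L +> q) = L +> q" if "q \<in> carrier R" for q using a_rcos_sum[of \<zero> q] that 3 by simp
  have n: "\<exists>y\<in>(\<lambda>p. L +> p) ` carrier R. y <+> (L +> q) = L" if "q \<in> carrier R" for q
    using a_rcos_sum[of "\<ominus> q" q] that 3 by (intro bexI[of _ "L +> (\<ominus> q)"]) (auto simp: l_neg)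
  show ?thesis
    by (rule abelian_groupI) (use l n z in \<open>auto simp: quotient_module_simps a_rcos_sum a_ac\<close>)
qed

lemma coset_mult_endo:
  assumes L: "left_ideal L" and s: "s \<in> carrier R"
  shows "abelian_group.endo (quotient_module L) (coset_mult L s)"
proof -
  interpret abelian_subgroup L R by (rule left_ideal_subgroup[OF L])
  interpret M: abelian_group "quotient_module L" by (rule quotient_module_abelian[OF L])
  show ?thesis
    unfolding M.endo_def using s by (auto simp: quotient_module_simps a_rcos_sum coset_mult[OF L] r_distr)
qed

end

text \<open>Zorn's lemma is applied to sets of pairwise commuting endomorphisms commuting with
  \<open>R\<close>, without any ring structure. Closure under the ring operations follows from
  maximality, as in \<open>K_comp\<close> and \<open>K_diff\<close>. The prescribed member
  \<open>t\<close> will be the action of the polynomial variable.\<close>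

lemma (in ring_rep) maximal_commutant:
  assumes t: "M.endo t" "\<And>a. a \<in> carrier R \<Longrightarrow> M.commutes t (\<rho> a)"
  obtains K where "t \<in> K" "\<And>k. k \<in> K \<Longrightarrow> M.endo k" "\<And>k a. k \<in> K \<Longrightarrow> a \<in> carrier R \<Longrightarrow> M.commutes k (\<rho> a)"
    "\<And>k l. k \<in> K \<Longrightarrow> l \<in> K \<Longrightarrow> M.commutes k l"
    "\<And>f. M.endo f \<Longrightarrow> (\<And>a. a \<in> carrier R \<Longrightarrow> M.commutes f (\<rho> a)) \<Longrightarrow> (\<And>k. k \<in> K \<Longrightarrow> M.commutes f k) \<Longrightarrow> f \<in> K"
proof -
  let ?A = "{K. t \<in> K \<and> (\<forall>k\<in>K. M.endo k \<and> (\<forall>a\<in>carrier R. M.commutes k (\<rho> a)) \<and> (\<forall>l\<in>K. M.commutes k l))}"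
  have "\<exists>K\<in>?A. \<forall>Y\<in>?A. K \<subseteq> Y \<longrightarrow> Y = K"
  proof (rule subset_Zorn_nonempty)
    have "M.commutes t t" by (simp add: M.commutes_def)
    then have "{t} \<in> ?A" using t by simp
    then show "?A \<noteq> {}" by blast
    fix C assume C: "C \<noteq> {}" "subset.chain ?A C"
    have A: "K \<in> ?A" if "K \<in> C" for K using C(2) that by (auto simp: subset.chain_def)
    have "M.commutes k l" if k: "k \<in> K" "K \<in> C" and l: "l \<in> K'" "K' \<in> C" for k l K K'
    proof -
      have "K \<subseteq> K' \<or> K' \<subseteq> K" using C(2) k l by (auto simp: subset_chain_def)
      then show ?thesis using A[OF k(2)] A[OF l(2)] k l by blast
    qed
    moreover have "t \<in> \<Union>C" using A C(1) by blast
    moreover have "M.endo k \<and> (\<forall>a\<in>carrier R. M.commutes k (\<rho> a))" if "k \<in> K" "K \<in> C" for k K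
      using A[OF that(2)] that(1) by blast
    ultimately show "\<Union>C \<in> ?A" by blast
  qed
  then obtain K where K: "K \<in> ?A" and max: "\<forall>Y\<in>?A. K \<subseteq> Y \<longrightarrow> Y = K" by (elim bexE) (rule that)
  have kt: "t \<in> K" and ke: "\<And>k. k \<in> K \<Longrightarrow> M.endo k" and kr: "\<And>k a. k \<in> K \<Longrightarrow> a \<in> carrier R \<Longrightarrow> M.commutes k (\<rho> a)"
    and kk: "\<And>k l. k \<in> K \<Longrightarrow> l \<in> K \<Longrightarrow> M.commutes k l" using K by simp_all
  have km: "f \<in> K" if f: "M.endo f" "\<And>a. a \<in> carrier R \<Longrightarrow> M.commutes f (\<rho> a)" "\<And>k. k \<in> K \<Longrightarrow> M.commutes f k" for f
  proof -
    have sym: "M.commutes k f" if "k \<in> K" for k using f(3)[OF that] by (simp add: M.commutes_def)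
    have "M.commutes f f" by (simp add: M.commutes_def)
    then have "insert f K \<in> ?A" using kt by (simp add: f ke kr kk sym)
    from bspec[OF max this] show ?thesis by blast
  qed
  show ?thesis by (rule that[of K]) (fact kt ke kr kk km)+
qed

section \<open>Left ideals of the polynomial ring\<close>

context UP_ring begin

lemma coeff_mult_monom_one:
  assumes p: "p \<in> carrier P" and a: "a \<in> carrier R"
  shows "up_ring.coeff P (p \<otimes>\<^bsub>P\<^esub> up_ring.monom P a 1) (Suc n) = up_ring.coeff P p n \<otimes> a"
proof -
  have "up_ring.coeff P (p \<otimes>\<^bsub>P\<^esub> up_ring.monom P a 1) (Suc n) = (\<Oplus>i\<in>{..Suc n}. if n = i then up_ring.coeff P p i \<otimes> a else \<zero>)"
    using p a by (simp only: coeff_mult monom_closed coeff_monom, intro R.finsum_cong') auto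
  also have "\<dots> = up_ring.coeff P p n \<otimes> a"
    using p a by (intro R.add.finprod_singleton) auto
  finally show ?thesis .
qed

text \<open>An inverse of \<open>1 - aX\<close> would be the geometric series, which is a polynomial only if \<open>a\<close> is nilpotent.\<close>

lemma no_left_inverse:
  assumes a: "a \<in> carrier R" "\<And>m::nat. a [^] m \<noteq> \<zero>" and p: "p \<in> carrier P"
  shows "p \<otimes>\<^bsub>P\<^esub> (\<one>\<^bsub>P\<^esub> \<ominus>\<^bsub>P\<^esub> up_ring.monom P a 1) \<noteq> \<one>\<^bsub>P\<^esub>"
proof
  assume eq: "p \<otimes>\<^bsub>P\<^esub> (\<one>\<^bsub>P\<^esub> \<ominus>\<^bsub>P\<^esub> up_ring.monom P a 1) = \<one>\<^bsub>P\<^esub>"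
  have pm: "p \<otimes>\<^bsub>P\<^esub> up_ring.monom P a 1 \<in> carrier P" using p a by simp
  have "p \<otimes>\<^bsub>P\<^esub> (\<one>\<^bsub>P\<^esub> \<ominus>\<^bsub>P\<^esub> up_ring.monom P a 1) = p \<ominus>\<^bsub>P\<^esub> p \<otimes>\<^bsub>P\<^esub> up_ring.monom P a 1"
    using p a by (simp add: P.minus_eq P.r_distr P.r_minus)
  then have "p \<ominus>\<^bsub>P\<^esub> p \<otimes>\<^bsub>P\<^esub> up_ring.monom P a 1 = \<one>\<^bsub>P\<^esub>" using eq by simp
  then have "p = \<one>\<^bsub>P\<^esub> \<oplus>\<^bsub>P\<^esub> p \<otimes>\<^bsub>P\<^esub> up_ring.monom P a 1"
    using p pm by (metis P.add.inv_solve_right' P.minus_eq UP_one_closed)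
  then have c: "up_ring.coeff P p n = up_ring.coeff P \<one>\<^bsub>P\<^esub> n \<oplus> up_ring.coeff P (p \<otimes>\<^bsub>P\<^esub> up_ring.monom P a 1) n" for n
    using coeff_add[OF UP_one_closed pm, of n] by simp
  have "up_ring.coeff P (p \<otimes>\<^bsub>P\<^esub> up_ring.monom P a 1) 0 = \<zero>"
    using p a by (simp add: R.r_null)
  then have "up_ring.coeff P p n = a [^] n" for n
  proof (induction n)
    case 0 then show ?case using c[of 0] by simp
  next
    case (Suc n) then show ?case using c[of "Suc n"] coeff_mult_monom_one[OF p a(1), of n] p a(1) by simp
  qed
  then show False using deg_aboveD[of p "Suc (deg R p)"] p a(2)[of "Suc (deg R p)"] by simp
qed

lemma maximal_left_ideal_exists:
  assumes a: "a \<in> carrier R" "\<And>m::nat. a [^] m \<noteq> \<zero>"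
  obtains L where "P.left_ideal L" "\<one>\<^bsub>P\<^esub> \<notin> L" "\<one>\<^bsub>P\<^esub> \<ominus>\<^bsub>P\<^esub> up_ring.monom P a 1 \<in> L"
    "\<And>L'. P.left_ideal L' \<Longrightarrow> L \<subseteq> L' \<Longrightarrow> \<one>\<^bsub>P\<^esub> \<notin> L' \<Longrightarrow> L' = L"
proof -
  let ?u = "\<one>\<^bsub>P\<^esub> \<ominus>\<^bsub>P\<^esub> up_ring.monom P a 1"
  let ?L0 = "(\<lambda>p. p \<otimes>\<^bsub>P\<^esub> ?u) ` carrier P"
  let ?A = "{L. P.left_ideal L \<and> \<one>\<^bsub>P\<^esub> \<notin> L \<and> ?u \<in> L}"
  have u: "?u \<in> carrier P" using a by simp
  have "\<exists>L\<in>?A. \<forall>Y\<in>?A. L \<subseteq> Y \<longrightarrow> Y = L"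
  proof (rule subset_Zorn_nonempty)
    have "P.left_ideal ?L0" unfolding P.left_ideal_def
    proof (intro conjI ballI)
      show "?L0 \<subseteq> carrier P" using u by auto
      show "\<zero>\<^bsub>P\<^esub> \<in> ?L0" using u by (intro image_eqI[of _ _ "\<zero>\<^bsub>P\<^esub>"]) auto
      fix x assume "x \<in> ?L0"
      then obtain p where p: "p \<in> carrier P" "x = p \<otimes>\<^bsub>P\<^esub> ?u" by blast
      { fix y assume "y \<in> ?L0"
        then obtain q where q: "q \<in> carrier P" "y = q \<otimes>\<^bsub>P\<^esub> ?u" by blast
        show "x \<oplus>\<^bsub>P\<^esub> y \<in> ?L0"
          by (rule image_eqI[of _ _ "p \<oplus>\<^bsub>P\<^esub> q"]) (simp_all only: p q P.l_distr u P.a_closed) }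
      fix s assume s: "s \<in> carrier P"
      show "s \<otimes>\<^bsub>P\<^esub> x \<in> ?L0"
        by (rule image_eqI[of _ _ "s \<otimes>\<^bsub>P\<^esub> p"]) (simp_all only: p s P.m_assoc u P.m_closed)
    qed
    moreover have "\<one>\<^bsub>P\<^esub> \<notin> ?L0" using no_left_inverse[OF a] by force
    moreover have "?u \<in> ?L0" by (rule image_eqI[of _ _ "\<one>\<^bsub>P\<^esub>"]) (simp_all only: P.l_one u P.one_closed)
    ultimately show "?A \<noteq> {}" by blast
    fix C assume C: "C \<noteq> {}" "subset.chain ?A C"
    have A: "P.left_ideal L" "\<one>\<^bsub>P\<^esub> \<notin> L" "?u \<in> L" if "L \<in> C" for L using C(2) that by (auto simp: subset.chain_def)
    have "P.left_ideal (\<Union>C)" unfolding P.left_ideal_def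
    proof (intro conjI ballI)
      show "\<Union>C \<subseteq> carrier P" using P.left_idealD(1)[OF A(1)] by blast
      show "\<zero>\<^bsub>P\<^esub> \<in> \<Union>C" using P.left_idealD(2)[OF A(1)] C(1) by blast
      fix x assume "x \<in> \<Union>C"
      then obtain L where L: "L \<in> C" "x \<in> L" by blast
      { fix y assume "y \<in> \<Union>C"
        then obtain L' where L': "L' \<in> C" "y \<in> L'" by blast
        have "L \<subseteq> L' \<or> L' \<subseteq> L" using C(2) L L' by (auto simp: subset_chain_def)
        then show "x \<oplus>\<^bsub>P\<^esub> y \<in> \<Union>C"
        proof
          assume "L \<subseteq> L'"
          then have "x \<oplus>\<^bsub>P\<^esub> y \<in> L'" using P.left_idealD(3)[OF A(1)[OF L'(1)]] L L' by blast
          then show ?thesis using L' by blast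
        next
          assume "L' \<subseteq> L"
          then have "x \<oplus>\<^bsub>P\<^esub> y \<in> L" using P.left_idealD(3)[OF A(1)[OF L(1)]] L L' by blast
          then show ?thesis using L by blast
        qed }
      fix s assume "s \<in> carrier P"
      then have "s \<otimes>\<^bsub>P\<^esub> x \<in> L" using P.left_idealD(4)[OF A(1)[OF L(1)]] L by blast
      then show "s \<otimes>\<^bsub>P\<^esub> x \<in> \<Union>C" using L by blast
    qed
    then show "\<Union>C \<in> ?A" using A(2,3) C(1) by blast
  qed
  then obtain L where L: "L \<in> ?A" and max: "\<And>Y. Y \<in> ?A \<Longrightarrow> L \<subseteq> Y \<Longrightarrow> Y = L" by blast
  show ?thesis
  proof (rule that[of L])
    fix L' assume "P.left_ideal L'" "L \<subseteq> L'" "\<one>\<^bsub>P\<^esub> \<notin> L'"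
    then show "L' = L" using L by (intro max) auto
  qed (use L in auto)
qed

lemma monom_step:
  assumes "b \<in> carrier R"
  shows "up_ring.monom P b (Suc n) = up_ring.monom P \<one> 1 \<otimes>\<^bsub>P\<^esub> up_ring.monom P b n"
  using monom_mult[of \<one> b 1 n] assms by simp

text \<open>Stability under constants and under the variable is what stability under
  \<open>R\<close> and \<open>K\<close> supplies in \<open>simple_module_exists\<close>; every
  polynomial is a sum of monomials built from these.\<close>

lemma left_ideal_by_monoms:
  assumes L: "L \<subseteq> carrier P" "\<zero>\<^bsub>P\<^esub> \<in> L" "\<And>x y. x \<in> L \<Longrightarrow> y \<in> L \<Longrightarrow> x \<oplus>\<^bsub>P\<^esub> y \<in> L"
    and b: "\<And>b x. b \<in> carrier R \<Longrightarrow> x \<in> L \<Longrightarrow> up_ring.monom P b 0 \<otimes>\<^bsub>P\<^esub> x \<in> L"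
    and t: "\<And>x. x \<in> L \<Longrightarrow> up_ring.monom P \<one> 1 \<otimes>\<^bsub>P\<^esub> x \<in> L"
  shows "P.left_ideal L"
  unfolding P.left_ideal_def
proof (intro conjI ballI L)
  fix s x assume s: "s \<in> carrier P" and x: "x \<in> L"
  have xP: "x \<in> carrier P" using x L(1) by blast
  have m: "up_ring.monom P b n \<otimes>\<^bsub>P\<^esub> x \<in> L" if bR: "b \<in> carrier R" for b n
  proof (induction n)
    case (Suc n)
    have "up_ring.monom P b (Suc n) \<otimes>\<^bsub>P\<^esub> x = up_ring.monom P \<one> 1 \<otimes>\<^bsub>P\<^esub> (up_ring.monom P b n \<otimes>\<^bsub>P\<^esub> x)"
      unfolding monom_step[OF bR] using bR xP by (intro P.m_assoc) auto
    then show ?case using t[OF Suc] by simp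
  qed (rule b[OF bR x])
  have "(\<Oplus>\<^bsub>P\<^esub>i\<in>I. up_ring.monom P (up_ring.coeff P s i) i) \<otimes>\<^bsub>P\<^esub> x \<in> L" if "finite I" for I
    using that
  proof (induction I)
    case empty then show ?case using L(2) xP by simp
  next
    case (insert i I)
    then show ?case using s xP m[of "up_ring.coeff P s i" i] L(3) by (simp add: P.l_distr P.finsum_closed Pi_def)
  qed
  from this[of "{..deg R s}"] show "s \<otimes>\<^bsub>P\<^esub> x \<in> L" using up_repr[OF s] by simp
qed

end

text \<open>\<open>L\<close> is a maximal proper left ideal containing \<open>1 - a X\<close>. The
  variable is central in the polynomial ring, so it acts by an endomorphism commuting with
  \<open>R\<close> and can be put into \<open>K\<close>; a subset stable under addition,
  \<open>R\<close> and \<open>K\<close> then corresponds to a left ideal above \<open>L\<close>. The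
  element \<open>a\<close> sends the class of \<open>X\<close> to the class of \<open>a X\<close>,
  which is that of 1.\<close>

theorem (in ring) simple_module_exists:
  assumes a: "a \<in> carrier R" "\<And>m::nat. a [^] m \<noteq> \<zero>"
  shows "\<exists>(M :: (nat \<Rightarrow> 'a) set ring) \<rho> K. linear_rep R M \<rho> K \<and> (\<exists>x\<in>carrier M. \<rho> a x \<noteq> \<zero>\<^bsub>M\<^esub>)"
proof -
  define S where "S = UP R"
  interpret U: UP_ring R S
    by unfold_locales (rule eq_reflection[OF S_def])
  obtain L where L: "U.P.left_ideal L" and one: "\<one>\<^bsub>S\<^esub> \<notin> L" and u: "\<one>\<^bsub>S\<^esub> \<ominus>\<^bsub>S\<^esub> up_ring.monom S a 1 \<in> L"
    and max: "\<And>L'. U.P.left_ideal L' \<Longrightarrow> L \<subseteq> L' \<Longrightarrow> \<one>\<^bsub>S\<^esub> \<notin> L' \<Longrightarrow> L' = L"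
    using U.maximal_left_ideal_exists[OF a] by blast
  interpret I: abelian_subgroup L S by (rule U.P.left_ideal_subgroup[OF L])
  define M where "M = U.P.quotient_module L"
  define \<rho> where "\<rho> b = U.P.coset_mult L (up_ring.monom S b 0)" for b
  define t where "t = U.P.coset_mult L (up_ring.monom S \<one> 1)"
  let ?c = "\<lambda>p. L +>\<^bsub>S\<^esub> p"
  note Ms = U.P.quotient_module_simps[of L, folded M_def]
  have X: "up_ring.monom S \<one> 1 \<in> carrier S" by simp
  have \<rho>c: "\<rho> b (?c p) = ?c (up_ring.monom S b 0 \<otimes>\<^bsub>S\<^esub> p)" if "b \<in> carrier R" "p \<in> carrier S" for b p
    unfolding \<rho>_def using that by (intro U.P.coset_mult[OF L]) auto
  have tc: "t (?c p) = ?c (up_ring.monom S \<one> 1 \<otimes>\<^bsub>S\<^esub> p)" if "p \<in> carrier S" for p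
    unfolding t_def using that by (intro U.P.coset_mult[OF L]) auto
  interpret M: abelian_group M unfolding M_def by (rule U.P.quotient_module_abelian[OF L])
  interpret ring_rep R M \<rho>
  proof unfold_locales
    fix b assume b: "b \<in> carrier R"
    show "M.endo (\<rho> b)" unfolding \<rho>_def M_def using b by (intro U.P.coset_mult_endo[OF L]) simp
    fix c x assume c: "c \<in> carrier R" and "x \<in> carrier M"
    then obtain p where p: "p \<in> carrier S" "x = ?c p" by (auto simp: Ms)
    show "\<rho> (b \<oplus> c) x = \<rho> b x \<oplus>\<^bsub>M\<^esub> \<rho> c x"
      using b c p by (simp add: \<rho>c Ms(3) I.a_rcos_sum U.P.l_distr)
    show "\<rho> (b \<otimes> c) x = \<rho> b (\<rho> c x)"
      using b c p U.monom_mult[of b c 0 0] by (simp add: \<rho>c U.P.m_assoc)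
  next
    fix x assume "x \<in> carrier M"
    then obtain p where p: "p \<in> carrier S" "x = ?c p" by (auto simp: Ms)
    then show "\<rho> \<one> x = x" by (simp add: \<rho>c)
  qed
  have t: "M.endo t" unfolding t_def M_def by (intro U.P.coset_mult_endo[OF L]) simp
  have tcomm: "M.commutes t (\<rho> b)" if b: "b \<in> carrier R" for b
    unfolding M.commutes_def
  proof
    fix x assume "x \<in> carrier M"
    then obtain p where p: "p \<in> carrier S" "x = ?c p" by (auto simp: Ms)
    have mb: "up_ring.monom S b 0 \<in> carrier S" using b by simp
    have "up_ring.monom S \<one> 1 \<otimes>\<^bsub>S\<^esub> up_ring.monom S b 0 = up_ring.monom S b 0 \<otimes>\<^bsub>S\<^esub> up_ring.monom S \<one> 1"
      using U.monom_mult[of \<one> b 1 0] U.monom_mult[of b \<one> 0 1] b by simp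
    then have "up_ring.monom S \<one> 1 \<otimes>\<^bsub>S\<^esub> (up_ring.monom S b 0 \<otimes>\<^bsub>S\<^esub> p) = up_ring.monom S b 0 \<otimes>\<^bsub>S\<^esub> (up_ring.monom S \<one> 1 \<otimes>\<^bsub>S\<^esub> p)"
      using U.P.m_assoc[OF X mb p(1)] U.P.m_assoc[OF mb X p(1)] by simp
    then show "t (\<rho> b x) = \<rho> b (t x)"
      unfolding p(2) using p(1) b X mb by (simp only: \<rho>c tc U.P.m_closed)
  qed
  obtain K where K: "t \<in> K" "\<And>k. k \<in> K \<Longrightarrow> M.endo k" "\<And>k a. k \<in> K \<Longrightarrow> a \<in> carrier R \<Longrightarrow> M.commutes k (\<rho> a)"
    "\<And>k l. k \<in> K \<Longrightarrow> l \<in> K \<Longrightarrow> M.commutes k l"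
    "\<And>f. M.endo f \<Longrightarrow> (\<And>a. a \<in> carrier R \<Longrightarrow> M.commutes f (\<rho> a)) \<Longrightarrow> (\<And>k. k \<in> K \<Longrightarrow> M.commutes f k) \<Longrightarrow> f \<in> K"
    using maximal_commutant[OF t tcomm] by blast
  have "linear_rep R M \<rho> K"
  proof unfold_locales
    show "\<exists>x\<in>carrier M. x \<noteq> \<zero>\<^bsub>M\<^esub>"
      using U.P.coset_zero_iff[OF L U.P.one_closed] one by (auto simp: Ms)
    fix Q x assume Q: "Q \<subseteq> carrier M" "\<zero>\<^bsub>M\<^esub> \<in> Q" "\<And>x y. x \<in> Q \<Longrightarrow> y \<in> Q \<Longrightarrow> x \<oplus>\<^bsub>M\<^esub> y \<in> Q"
      "\<And>a x. a \<in> carrier R \<Longrightarrow> x \<in> Q \<Longrightarrow> \<rho> a x \<in> Q" "\<And>k x. k \<in> K \<Longrightarrow> x \<in> Q \<Longrightarrow> k x \<in> Q"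
      and x: "x \<in> Q" "x \<noteq> \<zero>\<^bsub>M\<^esub>"
    let ?L = "{p \<in> carrier S. ?c p \<in> Q}"
    have z: "?c p = L" if "p \<in> L" for p
      using that U.P.coset_zero_iff[OF L] U.P.left_idealD(1)[OF L] by blast
    have sub: "L \<subseteq> ?L" using z Q(2) U.P.left_idealD(1)[OF L] by (auto simp: Ms)
    have li: "U.P.left_ideal ?L"
    proof (rule U.left_ideal_by_monoms)
      show "\<zero>\<^bsub>S\<^esub> \<in> ?L" using sub U.P.left_idealD(2)[OF L] by blast
      fix p assume p: "p \<in> ?L"
      { fix q assume q: "q \<in> ?L"
        show "p \<oplus>\<^bsub>S\<^esub> q \<in> ?L" using p q Q(3)[of "?c p" "?c q"] by (simp add: Ms(3) I.a_rcos_sum) }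
      { fix b assume b: "b \<in> carrier R"
        show "up_ring.monom S b 0 \<otimes>\<^bsub>S\<^esub> p \<in> ?L" using p Q(4)[OF b, of "?c p"] b by (simp add: \<rho>c) }
      show "up_ring.monom S \<one> 1 \<otimes>\<^bsub>S\<^esub> p \<in> ?L" using p Q(5)[OF K(1), of "?c p"] X by (simp add: tc)
    qed auto
    obtain p where p: "p \<in> carrier S" "x = ?c p" using x(1) Q(1) by (auto simp: Ms)
    have "p \<in> ?L" "p \<notin> L" using p x z by (auto simp: Ms)
    then have "?L \<noteq> L" by blast
    then have "\<one>\<^bsub>S\<^esub> \<in> ?L" using max[OF li sub] by blast
    then have all: "?c q \<in> Q" if "q \<in> carrier S" for q using U.P.left_idealD(4)[OF li that, of "\<one>\<^bsub>S\<^esub>"] that by simp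
    show "Q = carrier M" by (rule subset_antisym[OF Q(1)]) (unfold Ms(1), rule image_subsetI, rule all)
  qed (fact K)+
  moreover have "\<rho> a (?c (up_ring.monom S \<one> 1)) \<noteq> \<zero>\<^bsub>M\<^esub>"
  proof
    have ma: "up_ring.monom S a 1 \<in> carrier S" using a by simp
    assume "\<rho> a (?c (up_ring.monom S \<one> 1)) = \<zero>\<^bsub>M\<^esub>"
    then have "?c (up_ring.monom S a 1) = L" using \<rho>c[OF a(1) X] U.monom_mult[of a \<one> 0 1] a(1) by (simp add: Ms)
    then have "up_ring.monom S a 1 \<in> L" using U.P.coset_zero_iff[OF L ma] by simp
    then have "(\<one>\<^bsub>S\<^esub> \<ominus>\<^bsub>S\<^esub> up_ring.monom S a 1) \<oplus>\<^bsub>S\<^esub> up_ring.monom S a 1 \<in> L" using U.P.left_idealD(3)[OF L u] by blast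
    moreover have "(\<one>\<^bsub>S\<^esub> \<ominus>\<^bsub>S\<^esub> up_ring.monom S a 1) \<oplus>\<^bsub>S\<^esub> up_ring.monom S a 1 = \<one>\<^bsub>S\<^esub>"
      using ma by (simp add: U.P.minus_eq U.P.a_assoc U.P.l_neg)
    ultimately show False using one by simp
  qed
  moreover have "?c (up_ring.monom S \<one> 1) \<in> carrier M" using X by (auto simp: Ms)
  ultimately show ?thesis by blast
qed

section \<open>Reduction to simple modules\<close>

context group_hom begin

lemma hom_commutator:
  "x \<in> carrier G \<Longrightarrow> y \<in> carrier G \<Longrightarrow> h (commutator G x y) = commutator H (h x) (h y)"
  by (simp add: commutator_def)

lemma hom_engel:
  assumes "a \<in> carrier G" "g \<in> carrier G"
  shows "engel G n a g \<in> carrier G \<and> h (engel G n a g) = engel H n (h a) (h g)"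
proof (induction n)
  case (Suc n)
  then have c: "engel G n a g \<in> carrier G" by simp
  have "commutator G (engel G n a g) g \<in> carrier G" using c assms by (simp add: commutator_def)
  then show ?case using Suc hom_commutator[OF c assms(2)] by simp
qed (use assms in simp)

lemma hom_delta: "range y \<subseteq> carrier G \<Longrightarrow> h (G.delta k y) = H.delta k (\<lambda>i. h (y i))"
proof (induction k arbitrary: y)
  case (Suc k)
  have r: "range (\<lambda>i. y (2 * i)) \<subseteq> carrier G" "range (\<lambda>i. y (2 * i + 1)) \<subseteq> carrier G" using Suc.prems by auto
  have d: "G.delta k z \<in> carrier G" if "range z \<subseteq> carrier G" for z
    using G.derived_values_sub[OF G.subgroup_self] that unfolding G.derived_values_def by blast
  show ?case
    unfolding G.delta.simps H.delta.simps hom_commutator[OF d[OF r(1)] d[OF r(2)]] Suc.IH[OF r(1)] Suc.IH[OF r(2)] ..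
qed simp

lemma hom_nil_in:
  assumes "h ` carrier G = carrier H"
  shows "h ` G.nil_in (carrier G) \<subseteq> H.nil_in (carrier H)"
proof
  fix u assume "u \<in> h ` G.nil_in (carrier G)"
  then obtain g where g: "g \<in> carrier G" "\<And>a. a \<in> carrier G \<Longrightarrow> \<exists>n. engel G n a g = \<one>\<^bsub>G\<^esub>" "u = h g"
    unfolding G.nil_in_def by blast
  have "\<exists>n. engel H n b u = \<one>\<^bsub>H\<^esub>" if b: "b \<in> carrier H" for b
  proof -
    obtain a where a: "a \<in> carrier G" "b = h a" using b assms by blast
    obtain n where "engel G n a g = \<one>\<^bsub>G\<^esub>" using g(2)[OF a(1)] by blast
    then have "engel H n b u = \<one>\<^bsub>H\<^esub>" using hom_engel[OF a(1) g(1), of n] a(2) g(3) by simp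
    then show ?thesis by blast
  qed
  then show "u \<in> H.nil_in (carrier H)" unfolding H.nil_in_def using g(1,3) by simp
qed

lemma hom_derived_values_generated:
  assumes onto: "h ` carrier G = carrier H" and U: "subgroup U H" "H.nil_in (carrier H) \<subseteq> U"
    and v: "v \<in> G.derived_values k (generate G (G.nil_in (carrier G)))"
  shows "h v \<in> H.derived_values k U"
proof -
  have n: "G.nil_in (carrier G) \<subseteq> carrier G" by (rule G.nil_in_sub)
  obtain y where y: "v = G.delta k y" "range y \<subseteq> generate G (G.nil_in (carrier G))"
    using v unfolding G.derived_values_def by blast
  have "h ` generate G (G.nil_in (carrier G)) = generate H (h ` G.nil_in (carrier G))" using generate_img[OF n] by simp
  also have "\<dots> \<subseteq> U" by (rule H.gen_least[OF U(1)]) (use hom_nil_in[OF onto] U(2) in blast)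
  finally have "range (\<lambda>i. h (y i)) \<subseteq> U" using y(2) by blast
  moreover have "h v = H.delta k (\<lambda>i. h (y i))"
    unfolding y(1) by (rule hom_delta) (use y(2) G.gen_carrier[OF n] in blast)
  ultimately show ?thesis unfolding H.derived_values_def by blast
qed

end

context unit_rep begin

text \<open>The image \<open>\<Gamma>\<close> of the group acts faithfully and
  \<open>K\<close>-linearly on a space spanned by \<open>d\<close> vectors. By \<open>baer\<close>
  its nil-elements lie in its radical, hence so does the image of the subgroup generated by
  nil-elements; and the radical, being locally nilpotent, satisfies the derived word whose level is
  the bound for words of length 2.\<close>

lemma nil_generated_derived_values_vanishes:
  assumes lr: "linear_rep R M \<rho> K" and pi: "R.multilinear_identity d \<alpha>"
    and v: "v \<in> G.derived_values ((1 + 2 * d\<^sup>2)\<^sup>2) (generate G (G.nil_in (carrier G)))" and x: "x \<in> carrier M"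
  shows "\<rho> (df v) x = \<zero>\<^bsub>M\<^esub>"
proof -
  interpret L: linear_rep R M \<rho> K by (rule lr)
  obtain xs where xs: "set xs \<subseteq> carrier M" "length xs = d" "L.kspan xs = carrier M"
    using L.dimension_bound[OF pi] by blast
  let ?S = "carrier M"
  \<comment> \<open>Restriction to the carrier makes the operators extensional: operators agreeing
    on \<open>M\<close> are equal, and the action of the image is faithful inside
    \<open>BijGroup\<close>.\<close>
  define h where "h g = restrict (\<rho> (\<phi> g)) ?S" for g
  have hx: "h g x = \<rho> (\<phi> g) x" if "x \<in> ?S" for g x using that by (simp add: h_def)
  have cl: "\<rho> (\<phi> g) x \<in> ?S" if "g \<in> carrier G" "x \<in> ?S" for g x using L.\<rho>_closed[OF \<phi>_closed] that by blast
  have comp: "\<rho> (\<phi> (g \<otimes>\<^bsub>G\<^esub> g')) x = \<rho> (\<phi> g) (\<rho> (\<phi> g') x)" if "g \<in> carrier G" "g' \<in> carrier G" "x \<in> ?S" for g g' x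
    using L.\<rho>_mult[OF \<phi>_closed \<phi>_closed] \<phi>_mult that by simp
  have one: "\<rho> (\<phi> \<one>\<^bsub>G\<^esub>) x = x" if "x \<in> ?S" for x using L.\<rho>_one[OF that] \<phi>_one by simp
  have hB: "h g \<in> Bij ?S" if g: "g \<in> carrier G" for g
  proof -
    have "bij_betw (h g) ?S ?S"
    proof (rule bij_betw_byWitness[where f' = "\<rho> (\<phi> (inv\<^bsub>G\<^esub> g))"])
      show "\<forall>a\<in>?S. \<rho> (\<phi> (inv\<^bsub>G\<^esub> g)) (h g a) = a" using comp[of "inv\<^bsub>G\<^esub> g" g] g one hx by simp
      show "\<forall>a\<in>?S. h g (\<rho> (\<phi> (inv\<^bsub>G\<^esub> g)) a) = a" using comp[of g "inv\<^bsub>G\<^esub> g"] g one hx cl by simp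
    qed (use cl g hx in auto)
    then show ?thesis unfolding Bij_def by (simp add: h_def)
  qed
  have hm: "h (g \<otimes>\<^bsub>G\<^esub> g') = h g \<otimes>\<^bsub>BijGroup ?S\<^esub> h g'" if "g \<in> carrier G" "g' \<in> carrier G" for g g'
  proof -
    have "h (g \<otimes>\<^bsub>G\<^esub> g') = compose ?S (h g) (h g')"
    proof
      fix x show "h (g \<otimes>\<^bsub>G\<^esub> g') x = compose ?S (h g) (h g') x"
        using that by (cases "x \<in> ?S") (simp_all add: h_def compose_def comp cl)
    qed
    then show ?thesis using hB that by (simp add: BijGroup_def)
  qed
  interpret BG: group "BijGroup ?S" by (rule group_BijGroup)
  have "h \<in> hom G (BijGroup ?S)" using hB hm by (intro homI) (simp_all add: BijGroup_def)
  then interpret h0: group_hom G "BijGroup ?S" h by unfold_locales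
  define \<Gamma> where "\<Gamma> = BijGroup ?S\<lparr>carrier := h ` carrier G\<rparr>"
  have \<Gamma>c: "carrier \<Gamma> = h ` carrier G" and \<Gamma>m: "g \<otimes>\<^bsub>\<Gamma>\<^esub> g' = g \<otimes>\<^bsub>BijGroup ?S\<^esub> g'" for g g'
    by (simp_all add: \<Gamma>_def)
  have "group \<Gamma>" unfolding \<Gamma>_def by (rule subgroup.subgroup_is_group[OF h0.img_is_subgroup BG.is_group])
  moreover have "h \<in> hom G \<Gamma>" using hm by (intro homI) (simp_all add: \<Gamma>c \<Gamma>m)
  ultimately interpret hh: group_hom G \<Gamma> h
    by (intro group_hom.intro group_hom_axioms.intro G.is_group)
  have h1: "h \<one>\<^bsub>G\<^esub> = \<one>\<^bsub>\<Gamma>\<^esub>" by (rule hh.hom_one)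
  interpret LA: linear_action R M \<rho> K \<Gamma> "\<lambda>g x. g x" xs
  proof unfold_locales
    fix u assume "u \<in> carrier \<Gamma>"
    then obtain g where g: "g \<in> carrier G" "u = h g" using \<Gamma>c by auto
    have e: "L.M.endo (\<rho> (\<phi> g))" by (rule L.\<rho>_endo[OF \<phi>_closed[OF g(1)]])
    then show "L.M.endo u" unfolding g(2) L.M.endo_def by (simp add: hx)
    { fix k x assume k: "k \<in> K" and x: "x \<in> ?S"
      have "k (\<rho> (\<phi> g) x) = \<rho> (\<phi> g) (k x)" using L.K_\<rho>[OF k \<phi>_closed[OF g(1)]] x unfolding L.M.commutes_def by blast
      then show "k (u x) = u (k x)" using hx[OF x] hx[OF L.M.endo_closed[OF L.K_endo[OF k] x]] g(2) by simp }
    { fix u' x assume "u' \<in> carrier \<Gamma>" and x: "x \<in> ?S"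
      then obtain g' where g': "g' \<in> carrier G" "u' = h g'" using \<Gamma>c by auto
      have "u \<otimes>\<^bsub>\<Gamma>\<^esub> u' = h (g \<otimes>\<^bsub>G\<^esub> g')" using hm[OF g(1) g'(1)] g(2) g'(2) by (simp add: \<Gamma>m)
      then show "(u \<otimes>\<^bsub>\<Gamma>\<^esub> u') x = u (u' x)"
        using comp[OF g(1) g'(1) x] hx[OF x] hx[OF cl[OF g'(1) x]] g(2) g'(2) by simp }
    { assume f: "\<And>x. x \<in> ?S \<Longrightarrow> u x = x"
      have "h g = h \<one>\<^bsub>G\<^esub>" unfolding h_def by (rule restrict_ext) (use f g(2) hx one in simp)
      then show "u = \<one>\<^bsub>\<Gamma>\<^esub>" using h1 g(2) by simp }
  next
    fix x assume x: "x \<in> ?S"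
    show "\<one>\<^bsub>\<Gamma>\<^esub> x = x" using hx[OF x, of "\<one>\<^bsub>G\<^esub>"] one[OF x] h1 by simp
  qed (rule xs(1), rule xs(3))
  \<comment> \<open>The value of \<open>tri_bounded_bound\<close> for \<open>m = 2\<close>. For
    words of length \<open>4 ^ ?k\<close> some bound is enough.\<close>
  let ?k = "(1 + 2 * d\<^sup>2)\<^sup>2"
  let ?U = "hh.H.HP_in (carrier \<Gamma>)"
  have tri_bounded: "hh.H.tri_bounded (carrier \<Gamma>) 2 ?k" "\<exists>n. hh.H.tri_bounded (carrier \<Gamma>) (4 ^ ?k) n"
    using LA.tri_bounded_bound[of 2] LA.tri_bounded_bound[of "4 ^ ?k"] unfolding xs(2) by blast+
  then obtain n where n: "hh.H.tri_bounded (carrier \<Gamma>) (4 ^ ?k) n" by blast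
  have nU: "hh.H.nil_in (carrier \<Gamma>) \<subseteq> ?U" by (rule hh.H.baer[OF hh.H.subgroup_self tri_bounded(1) n])
  note U = hh.H.HP_in_props[OF hh.H.subgroup_self]
  have "hh.H.derived_values ?k ?U \<subseteq> {\<one>\<^bsub>\<Gamma>\<^esub>}"
    by (rule hh.H.lnilp_derived_values_trivial[OF U(2) hh.H.tri_bounded_mono[OF tri_bounded(1) hh.H.HP_in_sub]])
  moreover have "h v \<in> hh.H.derived_values ?k ?U"
    by (rule hh.hom_derived_values_generated[OF \<Gamma>c[symmetric] hh.H.normal_inD(1)[OF U(1)] nU v])
  ultimately have "h v = h \<one>\<^bsub>G\<^esub>" using h1 by auto
  then have \<phi>v: "\<rho> (\<phi> v) x = x" using hx[OF x] one[OF x] by metis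
  have "v \<in> carrier G"
    using v G.derived_values_mono[OF G.gen_carrier[OF G.nil_in_sub]] G.derived_values_sub[OF G.subgroup_self] by blast
  then have "\<rho> (df v) x \<oplus>\<^bsub>M\<^esub> x = x" "\<rho> (df v) x \<in> carrier M"
    using \<phi>v \<phi>_df[of v] L.\<rho>_add[OF df_closed R.one_closed x] L.\<rho>_one[OF x] L.\<rho>_closed[OF df_closed x] by auto
  then show ?thesis using x by (metis L.M.add.r_cancel_one)
qed

theorem nil_elements_eq_HP:
  assumes pi: "R.multilinear_identity d \<alpha>"
  shows "nil_elements G = HP G"
proof
  show "HP G \<subseteq> nil_elements G" by (rule G.HP_subset_nil)
  let ?k = "(1 + 2 * d\<^sup>2)\<^sup>2"
  let ?X = "G.nil_in (carrier G)"
  let ?E = "generate G ?X"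
  have XG: "?X \<subseteq> carrier G" by (rule G.nil_in_sub)
  have E: "G.normal_in ?E (carrier G)"
    by (rule G.normal_in_gen_invariant[OF G.subgroup_self XG]) (rule G.gen_in, rule G.nil_in_cj[OF G.subgroup_self])
  have Es: "subgroup ?E G" by (rule G.normal_inD(1)[OF E])
  have V: "G.derived_values ?k ?E \<subseteq> ?E" by (rule G.derived_values_sub[OF Es])
  have VG: "G.derived_values ?k ?E \<subseteq> carrier G" using V G.gen_carrier[OF XG] by blast
  let ?F = "df ` G.derived_values ?k ?E"
  have Fc: "?F \<subseteq> carrier R" using VG by auto
  let ?N = "genideal R ?F"
  have N: "ideal ?N R" by (rule R.genideal_ideal[OF Fc])
  \<comment> \<open>The annihilator of each simple module is an ideal containing all the generators
    \<open>df v\<close>, so it contains \<open>?N\<close>, whereas a non-nilpotent element of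
    \<open>?N\<close> would act nontrivially on one of these modules.\<close>
  have nil: "\<exists>m::nat. a [^]\<^bsub>R\<^esub> m = \<zero>\<^bsub>R\<^esub>" if a: "a \<in> ?N" for a
  proof (rule ccontr)
    assume "\<nexists>m::nat. a [^]\<^bsub>R\<^esub> m = \<zero>\<^bsub>R\<^esub>"
    then have nn: "\<And>m::nat. a [^]\<^bsub>R\<^esub> m \<noteq> \<zero>\<^bsub>R\<^esub>" by blast
    have ac: "a \<in> carrier R" using a R.additive_subgroup_facts(1)[OF R.ideal_facts(1)[OF N]] by blast
    obtain M :: "(nat \<Rightarrow> 'c) set ring" and \<rho> K where lr: "linear_rep R M \<rho> K"
      and ne: "\<exists>x\<in>carrier M. \<rho> a x \<noteq> \<zero>\<^bsub>M\<^esub>"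
      using R.simple_module_exists[OF ac nn] by blast
    interpret L: linear_rep R M \<rho> K by (rule lr)
    let ?I = "{b \<in> carrier R. \<forall>x\<in>carrier M. \<rho> b x = \<zero>\<^bsub>M\<^esub>}"
    have "ideal ?I R"
    proof (rule R.idealI')
      show "\<zero>\<^bsub>R\<^esub> \<in> ?I" using L.\<rho>_zero by simp
      fix b c assume "b \<in> ?I" "c \<in> ?I"
      then show "b \<oplus>\<^bsub>R\<^esub> c \<in> ?I" using L.\<rho>_add by simp
    next
      fix b c assume b: "b \<in> ?I" and c: "c \<in> carrier R"
      show "c \<otimes>\<^bsub>R\<^esub> b \<in> ?I" using b c L.\<rho>_mult[OF c] L.M.endo_zero[OF L.\<rho>_endo[OF c]] by simp
      show "b \<otimes>\<^bsub>R\<^esub> c \<in> ?I" using b c L.\<rho>_mult[OF _ c] L.\<rho>_closed[OF c] by simp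
    qed auto
    moreover have "?F \<subseteq> ?I" using nil_generated_derived_values_vanishes[OF lr pi] Fc by blast
    ultimately have "?N \<subseteq> ?I" by (rule R.genideal_minimal)
    then show False using a ne by blast
  qed
  let ?H = "{x \<in> carrier G. df x \<in> ?N}"
  note Hn = G.normal_inD[OF one_plus_normal[OF N]]
  have lH: "G.lnilp ?H" by (rule one_plus_lnilp[OF N R.nil_ideal_locnil[OF pi N nil]])
  \<comment> \<open>\<open>gruenberg\<close> is applied inside \<open>?E\<close>, where the derived
    values are under control, so \<open>?H\<close> is intersected with \<open>?E\<close>. Normality
    of \<open>?E\<close> in \<open>G\<close> finally brings the radical of \<open>?E\<close> into
    that of \<open>G\<close>.\<close>
  have sHE: "subgroup (?H \<inter> ?E) G" by (rule G.subgroups_Inter_pair[OF Hn(1) Es])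
  have nHE: "G.normal_in (?H \<inter> ?E) ?E"
  proof (rule G.normal_inI[OF sHE Es])
    fix b x assume b: "b \<in> ?E" and x: "x \<in> ?H \<inter> ?E"
    have "G.cj x b \<in> ?H" using Hn(4) b x G.gen_carrier[OF XG] by blast
    moreover have "G.cj x b \<in> ?E" using G.normal_inD(4)[OF E] b x G.gen_carrier[OF XG] by blast
    ultimately show "G.cj x b \<in> ?H \<inter> ?E" by blast
  qed blast
  have VH: "G.derived_values ?k ?E \<subseteq> ?H \<inter> ?E" using V VG R.genideal_self[OF Fc] by blast
  have lHE: "G.lnilp (?H \<inter> ?E)" by (rule G.lnilp_mono[OF lH _ sHE]) blast
  show "nil_elements G \<subseteq> HP G"
  proof
    fix g assume "g \<in> nil_elements G"
    then have g: "g \<in> ?X" by (simp add: G.nil_elements_eq_nil_in)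
    then have "g \<in> G.nil_in ?E" using G.nil_in_mono[OF G.gen_carrier[OF XG]] G.gen_in[OF g] by blast
    then have "g \<in> G.HP_in ?E" by (rule G.gruenberg[OF nHE lHE VH])
    then show "g \<in> HP G" unfolding G.HP_eq_HP_in using G.HP_in_mono[OF E] by blast
  qed
qed

end

section \<open>Application to PI-groups\<close>

theorem theorem3:
  fixes G :: "('g, 'm) monoid_scheme"
  assumes "PI_group TYPE('k) TYPE('a) G"
  shows "nil_elements G = HP G"
proof -
  obtain P :: "'k ring" and A :: "('k, 'a) module" and U where G: "group G" and P: "field P"
    and pi: "PI_algebra P A" and U: "subgroup U (units_of A)" and iso: "G \<cong> (units_of A)\<lparr>carrier := U\<rparr>"
    using assms unfolding PI_group_def by blast
  from pi obtain f w where A: "assoc_algebra P A" and f: "f \<in> nc_poly P" "f w \<noteq> \<zero>\<^bsub>P\<^esub>"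
    "\<And>s. range s \<subseteq> carrier A \<Longrightarrow> nc_eval P A s f = \<zero>\<^bsub>A\<^esub>"
    unfolding PI_algebra_def by blast
  interpret A: assoc_algebra P A by (rule A)
  interpret G: group G by (rule G)
  obtain d \<alpha> where d: "A.multilinear_identity d \<alpha>" using A.multilinear_identity_exists[OF P f] by blast
  let ?U = "(units_of A)\<lparr>carrier := U\<rparr>"
  have gU: "group ?U" by (rule subgroup.subgroup_is_group[OF U A.units_group])
  have UA: "U \<subseteq> carrier A" using subgroup.subset[OF U] unfolding units_of_def Units_def by auto
  obtain \<phi> where \<phi>: "\<phi> \<in> iso G ?U" using iso unfolding is_iso_def by blast
  have hom: "\<phi> \<in> hom G ?U" and bij: "bij_betw \<phi> (carrier G) U" using \<phi> unfolding iso_def by auto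
  interpret \<phi>: group_hom G ?U \<phi> by (intro group_hom.intro group_hom_axioms.intro G gU hom)
  have one: "\<phi> \<one>\<^bsub>G\<^esub> = \<one>\<^bsub>A\<^esub>" using \<phi>.hom_one by (simp add: units_of_def)
  interpret unit_rep G A \<phi>
  proof unfold_locales
    fix x assume x: "x \<in> carrier G"
    show "\<phi> x \<in> carrier A" using bij_betwE[OF bij] x UA by blast
    show "x = \<one>\<^bsub>G\<^esub>" if "\<phi> x = \<one>\<^bsub>A\<^esub>"
      using inj_onD[OF bij_betw_imp_inj_on[OF bij] _ x G.one_closed] that one by simp
    fix y assume "y \<in> carrier G"
    then show "\<phi> (x \<otimes>\<^bsub>G\<^esub> y) = \<phi> x \<otimes>\<^bsub>A\<^esub> \<phi> y" using \<phi>.hom_mult[OF x] by (simp add: units_of_def)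
  qed (rule one)
  show ?thesis by (rule nil_elements_eq_HP[OF d])
qed

end
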